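(* Let $(M_1,\tilde g_1)$ and $(M_2,\tilde g_2)$ be pseudo-Riemannian manifolds with cometrics $g_1,g_2$, let $\Pi_i$ be a bivector field on $M_i$ ($i=1,2$), let $f$ be a positive smooth function on $M_1$ and $\mu$ a smooth function on $M_1$. If $f$ is a Casimir function (of $\Pi_1$) and $\mu$ is a nonzero essentially constant function, then the triple $(M_1\times M_2,g^f,\Pi^\mu)$ is locally symmetric if and only if $(M_1,g_1,\Pi_1)$ and $(M_2,g_2,\Pi_2)$ are locally symmetric.
   Context: For a bivector field $\Pi$ on $M$, the anchor map $\sharp_\Pi:T^*M\to TM$ is given by $\beta(\sharp_\Pi(\alpha))=\Pi(\alpha,\beta)$, and the Koszul bracket of 1-forms is $[\alpha,\beta]_\Pi=\mathcal L_{\sharp_\Pi(\alpha)}\beta-\mathcal L_{\sharp_\Pi(\beta)}\alpha-d(\Pi(\alpha,\beta))$. A function $\varphi$ is Casimir if $\sharp_\Pi(d\varphi)=0$. A function is essentially constant if it is constant on each connected component. A contravariant connection with respect to $\Pi$ is an $\mathbb R$-bilinear map $\mathcal D:\Gamma(T^*M)\times\Gamma(T^*M)\to\Gamma(T^*M)$ with $\mathcal D_{\varphi\alpha}\beta=\varphi\mathcal D_\alpha\beta$ and $\mathcal D_\alpha(\varphi\beta)=\varphi\mathcal D_\alpha\beta+\sharp_\Pi(\alpha)(\varphi)\beta$. The cometric of a pseudo-Riemannian metric $\tilde g$ is the induced metric $g$ on $T^*M$. The Levi-Civita contravariant connection of $(g,\Pi)$ is the unique contravariant connection with respect to $\Pi$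 satisfying $\sharp_\Pi(\alpha).g(\beta,\gamma)=g(\mathcal D_\alpha\beta,\gamma)+g(\beta,\mathcal D_\alpha\gamma)$ and $\mathcal D_\alpha\beta-\mathcal D_\beta\alpha=[\alpha,\beta]_\Pi$. Its curvature is $\mathcal R(\alpha,\beta)=\mathcal D_\alpha\mathcal D_\beta-\mathcal D_\beta\mathcal D_\alpha-\mathcal D_{[\alpha,\beta]_\Pi}$. The triple $(M,g,\Pi)$ is locally symmetric if $\mathcal D\mathcal R=0$, i.e. for all 1-forms $\alpha,\beta,\gamma,\delta$: $\mathcal D_\alpha(\mathcal R(\beta,\gamma)\delta)-\mathcal R(\mathcal D_\alpha\beta,\gamma)\delta-\mathcal R(\beta,\mathcal D_\alpha\gamma)\delta-\mathcal R(\beta,\gamma)\mathcal D_\alpha\delta=0$, where $\mathcal D$ is the Levi-Civita contravariant connection of $(g,\Pi)$. With $\sigma_i:M_1\times M_2\to M_i$ the projections, lifts of functions and forms are $\omega_1^h=\sigma_1^*\omega_1$, $\omega_2^v=\sigma_2^*\omega_2$. The warped bivector field $\Pi^\mu$ is determined by $\Pi^\mu(\alpha_1^h,\beta_1^h)=\Pi_1(\alpha_1,\beta_1)^h$, $\Pi^\mu(\alpha_2^v,\beta_2^v)=\mu^h\Pi_2(\alpha_2,\beta_2)^v$, $\Pi^\mu(\alpha_1^h,\beta_2^v)=0$, and the contravariant warped metric $g^f$ by $g^f(\alpha_1^h,\beta_1^h)=g_1(\alpha_1,\beta_1)^h$, $g^f(\alpha_2^v,\beta_2^v)=f^hg_2(\alpha_2,\beta_2)^v$,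 $g^f(\alpha_1^h,\alpha_2^v)=0$. *)

theory Defs
  imports "HOL-Analysis.Analysis" "HOL-Library.Function_Algebras"
begin

section \<open>Smooth manifolds\<close>

text \<open>
  On an open set \<open>S\<close>, \<open>Ck_on k f S\<close> says that \<open>f\<close> is \<open>k\<close> times continuously differentiable.
  It is used for open \<open>S\<close> only.
\<close>

primrec Ck_on :: "nat \<Rightarrow> ('e::real_normed_vector \<Rightarrow> 'f::real_normed_vector) \<Rightarrow> 'e set \<Rightarrow> bool" where
  "Ck_on 0 f S \<longleftrightarrow> continuous_on S f"
| "Ck_on (Suc k) f S \<longleftrightarrow>
     f differentiable_on S \<and> (\<forall>v. Ck_on k (\<lambda>x. frechet_derivative f (at x) v) S)"

definition smooth_on :: "('e::real_normed_vector \<Rightarrow> 'f::real_normed_vector) \<Rightarrow> 'e set \<Rightarrow> bool" where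
  "smooth_on f S \<longleftrightarrow> (\<forall>k. Ck_on k f S)"

text \<open>
  The points of a manifold are the elements of a (Hausdorff, second countable) type \<open>'a\<close>; the
  smooth structure is given by an atlas of charts with values in \<open>'e\<close>.  A chart is its domain
  together with a coordinate map, whose values outside the domain are irrelevant.
\<close>

type_synonym ('a, 'e) chart = "'a set \<times> ('a \<Rightarrow> 'e)"

definition smooth_atlas ::
  "('a::{t2_space,second_countable_topology}, 'e::euclidean_space) chart set \<Rightarrow> bool" where
  "smooth_atlas A \<longleftrightarrow>
     (\<forall>(U, \<phi>)\<in>A. open U \<and> open (\<phi> ` U) \<and> homeomorphism U (\<phi> ` U) \<phi> (inv_into U \<phi>)) \<and>
     (\<Union>(U, \<phi>)\<in>A. U) = UNIV \<and>
     (\<forall>(U, \<phi>)\<in>A. \<forall>(V, \<psi>)\<in>A. smooth_on (\<psi> \<circ> inv_into U \<phi>) (\<phi> ` (U \<inter> V)))"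

definition prod_atlas :: "('a, 'e) chart set \<Rightarrow> ('b, 'f) chart set \<Rightarrow> ('a \<times> 'b, 'e \<times> 'f) chart set" where
  "prod_atlas A B = {(U \<times> V, map_prod \<phi> \<psi>) | U \<phi> V \<psi>. (U, \<phi>) \<in> A \<and> (V, \<psi>) \<in> B}"

definition smooth_functions :: "('a, 'e::euclidean_space) chart set \<Rightarrow> ('a \<Rightarrow> real) set" where
  "smooth_functions A = {f. \<forall>(U, \<phi>)\<in>A. smooth_on (f \<circ> inv_into U \<phi>) (\<phi> ` U)}"

definition essentially_constant :: "('a::topological_space \<Rightarrow> real) \<Rightarrow> bool" where
  "essentially_constant \<phi> \<longleftrightarrow> (\<forall>x y. connected_component UNIV x y \<longrightarrow> \<phi> x = \<phi> y)"


section \<open>Tangent and cotangent vectors\<close>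

text \<open>
  A tangent vector at \<open>p\<close> is a derivation at \<open>p\<close> of the algebra of smooth functions.  So that
  equality of tangent vectors is equality in HOL, a derivation is set to \<open>0\<close> on functions that
  are not smooth, and a covector is set to \<open>0\<close> on arguments that are not tangent vectors.
\<close>

type_synonym 'a tvec = "('a \<Rightarrow> real) \<Rightarrow> real"
type_synonym 'a covec = "'a tvec \<Rightarrow> real"

definition tangent_space :: "('a, 'e::euclidean_space) chart set \<Rightarrow> 'a \<Rightarrow> 'a tvec set" where
  "tangent_space A p = {v.
     (\<forall>f\<in>smooth_functions A. \<forall>h\<in>smooth_functions A. \<forall>a b.
        v (\<lambda>x. a * f x + b * h x) = a * v f + b * v h) \<and>
     (\<forall>f\<in>smooth_functions A. \<forall>h\<in>smooth_functions A.
        v (\<lambda>x. f x * h x) = f p * v h + h p * v f) \<and>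
     (\<forall>f. f \<notin> smooth_functions A \<longrightarrow> v f = 0)}"

definition cotangent_space :: "('a, 'e::euclidean_space) chart set \<Rightarrow> 'a \<Rightarrow> 'a covec set" where
  "cotangent_space A p = {\<xi>.
     (\<forall>v\<in>tangent_space A p. \<forall>w\<in>tangent_space A p. \<forall>a b.
        \<xi> (\<lambda>f. a * v f + b * w f) = a * \<xi> v + b * \<xi> w) \<and>
     (\<forall>v. v \<notin> tangent_space A p \<longrightarrow> \<xi> v = 0)}"

text \<open>The differential of a map into the manifold with atlas \<open>B\<close>, and its transpose at \<open>p\<close>.\<close>

definition tangent_map :: "('b, 'f::euclidean_space) chart set \<Rightarrow> ('a \<Rightarrow> 'b) \<Rightarrow> 'a tvec \<Rightarrow> 'b tvec" where
  "tangent_map B F v = (\<lambda>f. if f \<in> smooth_functions B then v (f \<circ> F) else 0)"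

definition cotangent_map ::
  "('a, 'e::euclidean_space) chart set \<Rightarrow> ('b, 'f::euclidean_space) chart set \<Rightarrow>
   ('a \<Rightarrow> 'b) \<Rightarrow> 'a \<Rightarrow> 'b covec \<Rightarrow> 'a covec" where
  "cotangent_map A B F p \<xi> = (\<lambda>v. if v \<in> tangent_space A p then \<xi> (tangent_map B F v) else 0)"


section \<open>Vector fields and 1-forms\<close>

type_synonym 'a vfield = "'a \<Rightarrow> 'a tvec"
type_synonym 'a form = "'a \<Rightarrow> 'a covec"

definition vector_fields :: "('a, 'e::euclidean_space) chart set \<Rightarrow> 'a vfield set" where
  "vector_fields A = {X. (\<forall>p. X p \<in> tangent_space A p) \<and>
     (\<forall>f\<in>smooth_functions A. (\<lambda>p. X p f) \<in> smooth_functions A)}"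

definition one_forms :: "('a, 'e::euclidean_space) chart set \<Rightarrow> 'a form set" where
  "one_forms A = {\<omega>. (\<forall>p. \<omega> p \<in> cotangent_space A p) \<and>
     (\<forall>X\<in>vector_fields A. (\<lambda>p. \<omega> p (X p)) \<in> smooth_functions A)}"

text \<open>Addition, subtraction and zero of 1-forms are the pointwise operations on functions.\<close>

definition smult :: "('a \<Rightarrow> real) \<Rightarrow> 'a form \<Rightarrow> 'a form" (infixr "\<cdot>" 75) where
  "\<phi> \<cdot> \<omega> = (\<lambda>p v. \<phi> p * \<omega> p v)"

definition pullback ::
  "('a, 'e::euclidean_space) chart set \<Rightarrow> ('b, 'f::euclidean_space) chart set \<Rightarrow>
   ('a \<Rightarrow> 'b) \<Rightarrow> 'b form \<Rightarrow> 'a form" where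
  "pullback A B F \<omega> = (\<lambda>p. cotangent_map A B F p (\<omega> (F p)))"

definition exterior_d :: "('a, 'e::euclidean_space) chart set \<Rightarrow> ('a \<Rightarrow> real) \<Rightarrow> 'a form" where
  "exterior_d A f = (\<lambda>p v. if v \<in> tangent_space A p then v f else 0)"

definition lie_bracket :: "'a vfield \<Rightarrow> 'a vfield \<Rightarrow> 'a vfield" where
  "lie_bracket X Y = (\<lambda>p f. X p (\<lambda>q. Y q f) - Y p (\<lambda>q. X q f))"

text \<open>\<open>(L\<^sub>X \<beta>)(Y) = X(\<beta>(Y)) - \<beta>([X, Y])\<close>\<close>

definition lie_derivative ::
  "('a, 'e::euclidean_space) chart set \<Rightarrow> 'a vfield \<Rightarrow> 'a form \<Rightarrow> 'a form" where
  "lie_derivative A X \<beta> = (THE \<omega>. \<omega> \<in> one_forms A \<and>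
     (\<forall>Y\<in>vector_fields A. \<forall>p. \<omega> p (Y p) = X p (\<lambda>q. \<beta> q (Y q)) - \<beta> p (lie_bracket X Y p)))"


section \<open>Metrics, cometrics and bivector fields\<close>

text \<open>
  A twice contravariant tensor field is given by a bilinear form on each cotangent space; its
  values outside the cotangent spaces are irrelevant.
\<close>

type_synonym 'a metric = "'a \<Rightarrow> 'a tvec \<Rightarrow> 'a tvec \<Rightarrow> real"
type_synonym 'a contra2 = "'a \<Rightarrow> 'a covec \<Rightarrow> 'a covec \<Rightarrow> real"

definition pseudo_riemannian_metric ::
  "('a, 'e::euclidean_space) chart set \<Rightarrow> 'a metric \<Rightarrow> bool" where
  "pseudo_riemannian_metric A G \<longleftrightarrow>
     (\<forall>p. \<forall>u\<in>tangent_space A p. \<forall>v\<in>tangent_space A p.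
        G p u v = G p v u \<and>
        (\<forall>w\<in>tangent_space A p. \<forall>a b. G p (\<lambda>f. a * u f + b * v f) w = a * G p u w + b * G p v w)) \<and>
     (\<forall>p. \<forall>u\<in>tangent_space A p. (\<forall>v\<in>tangent_space A p. G p u v = 0) \<longrightarrow> u = 0) \<and>
     (\<forall>X\<in>vector_fields A. \<forall>Y\<in>vector_fields A. (\<lambda>p. G p (X p) (Y p)) \<in> smooth_functions A)"

definition raise :: "('a, 'e::euclidean_space) chart set \<Rightarrow> 'a metric \<Rightarrow> 'a \<Rightarrow> 'a covec \<Rightarrow> 'a tvec" where
  "raise A G p \<xi> = (THE v. v \<in> tangent_space A p \<and> (\<forall>w\<in>tangent_space A p. G p v w = \<xi> w))"

definition cometric :: "('a, 'e::euclidean_space) chart set \<Rightarrow> 'a metric \<Rightarrow> 'a contra2" where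
  "cometric A G = (\<lambda>p \<xi> \<eta>. G p (raise A G p \<xi>) (raise A G p \<eta>))"

definition bivector_field :: "('a, 'e::euclidean_space) chart set \<Rightarrow> 'a contra2 \<Rightarrow> bool" where
  "bivector_field A P \<longleftrightarrow>
     (\<forall>p. \<forall>\<xi>\<in>cotangent_space A p. \<forall>\<eta>\<in>cotangent_space A p.
        P p \<xi> \<eta> = - P p \<eta> \<xi> \<and>
        (\<forall>\<zeta>\<in>cotangent_space A p. \<forall>a b.
           P p (\<lambda>v. a * \<xi> v + b * \<eta> v) \<zeta> = a * P p \<xi> \<zeta> + b * P p \<eta> \<zeta>)) \<and>
     (\<forall>\<alpha>\<in>one_forms A. \<forall>\<beta>\<in>one_forms A. (\<lambda>p. P p (\<alpha> p) (\<beta> p)) \<in> smooth_functions A)"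

text \<open>\<open>\<beta>(\<sharp>(\<alpha>)) = P(\<alpha>, \<beta>)\<close>\<close>

definition anchor :: "('a, 'e::euclidean_space) chart set \<Rightarrow> 'a contra2 \<Rightarrow> 'a form \<Rightarrow> 'a vfield" where
  "anchor A P \<alpha> = (\<lambda>p. THE v. v \<in> tangent_space A p \<and>
     (\<forall>\<xi>\<in>cotangent_space A p. \<xi> v = P p (\<alpha> p) \<xi>))"

definition casimir :: "('a, 'e::euclidean_space) chart set \<Rightarrow> 'a contra2 \<Rightarrow> ('a \<Rightarrow> real) \<Rightarrow> bool" where
  "casimir A P \<phi> \<longleftrightarrow> \<phi> \<in> smooth_functions A \<and> anchor A P (exterior_d A \<phi>) = 0"

definition koszul_bracket ::
  "('a, 'e::euclidean_space) chart set \<Rightarrow> 'a contra2 \<Rightarrow> 'a form \<Rightarrow> 'a form \<Rightarrow> 'a form" where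
  "koszul_bracket A P \<alpha> \<beta> =
     lie_derivative A (anchor A P \<alpha>) \<beta> - lie_derivative A (anchor A P \<beta>) \<alpha>
       - exterior_d A (\<lambda>p. P p (\<alpha> p) (\<beta> p))"


section \<open>Contravariant connections and local symmetry\<close>

type_synonym 'a connection = "'a form \<Rightarrow> 'a form \<Rightarrow> 'a form"

definition contravariant_connection ::
  "('a, 'e::euclidean_space) chart set \<Rightarrow> 'a contra2 \<Rightarrow> 'a connection \<Rightarrow> bool" where
  "contravariant_connection A P D \<longleftrightarrow>
     (\<forall>\<alpha>\<in>one_forms A. \<forall>\<beta>\<in>one_forms A. D \<alpha> \<beta> \<in> one_forms A) \<and>
     (\<forall>\<alpha>\<in>one_forms A. \<forall>\<beta>\<in>one_forms A. \<forall>\<gamma>\<in>one_forms A. \<forall>a b::real.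
        D ((\<lambda>_. a) \<cdot> \<alpha> + (\<lambda>_. b) \<cdot> \<beta>) \<gamma> = (\<lambda>_. a) \<cdot> D \<alpha> \<gamma> + (\<lambda>_. b) \<cdot> D \<beta> \<gamma> \<and>
        D \<gamma> ((\<lambda>_. a) \<cdot> \<alpha> + (\<lambda>_. b) \<cdot> \<beta>) = (\<lambda>_. a) \<cdot> D \<gamma> \<alpha> + (\<lambda>_. b) \<cdot> D \<gamma> \<beta>) \<and>
     (\<forall>\<alpha>\<in>one_forms A. \<forall>\<beta>\<in>one_forms A. \<forall>\<phi>\<in>smooth_functions A.
        D (\<phi> \<cdot> \<alpha>) \<beta> = \<phi> \<cdot> D \<alpha> \<beta> \<and>
        D \<alpha> (\<phi> \<cdot> \<beta>) = \<phi> \<cdot> D \<alpha> \<beta> + (\<lambda>p. anchor A P \<alpha> p \<phi>) \<cdot> \<beta>)"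

definition levi_civita ::
  "('a, 'e::euclidean_space) chart set \<Rightarrow> 'a contra2 \<Rightarrow> 'a contra2 \<Rightarrow> 'a connection \<Rightarrow> bool" where
  "levi_civita A g P D \<longleftrightarrow>
     contravariant_connection A P D \<and>
     (\<forall>\<alpha>\<in>one_forms A. \<forall>\<beta>\<in>one_forms A. \<forall>\<gamma>\<in>one_forms A. \<forall>p.
        anchor A P \<alpha> p (\<lambda>q. g q (\<beta> q) (\<gamma> q)) = g p (D \<alpha> \<beta> p) (\<gamma> p) + g p (\<beta> p) (D \<alpha> \<gamma> p)) \<and>
     (\<forall>\<alpha>\<in>one_forms A. \<forall>\<beta>\<in>one_forms A. D \<alpha> \<beta> - D \<beta> \<alpha> = koszul_bracket A P \<alpha> \<beta>)"

definition curvature ::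
  "('a, 'e::euclidean_space) chart set \<Rightarrow> 'a contra2 \<Rightarrow> 'a connection \<Rightarrow>
   'a form \<Rightarrow> 'a form \<Rightarrow> 'a form \<Rightarrow> 'a form" where
  "curvature A P D \<alpha> \<beta> \<gamma> = D \<alpha> (D \<beta> \<gamma>) - D \<beta> (D \<alpha> \<gamma>) - D (koszul_bracket A P \<alpha> \<beta>) \<gamma>"

text \<open>
  The Levi-Civita contravariant connection exists and is unique as an operation on
  \<^const>\<open>one_forms\<close>; the type \<open>'a connection\<close> leaves its values on other arguments open, so it is
  introduced by an existential quantifier instead of a definite description.
\<close>

definition locally_symmetric ::
  "('a, 'e::euclidean_space) chart set \<Rightarrow> 'a contra2 \<Rightarrow> 'a contra2 \<Rightarrow> bool" where
  "locally_symmetric A g P \<longleftrightarrow>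
     (\<exists>D. levi_civita A g P D \<and>
       (let R = curvature A P D in
        \<forall>\<alpha>\<in>one_forms A. \<forall>\<beta>\<in>one_forms A. \<forall>\<gamma>\<in>one_forms A. \<forall>\<delta>\<in>one_forms A.
          D \<alpha> (R \<beta> \<gamma> \<delta>) - R (D \<alpha> \<beta>) \<gamma> \<delta> - R \<beta> (D \<alpha> \<gamma>) \<delta> - R \<beta> \<gamma> (D \<alpha> \<delta>) = 0))"


section \<open>Warped tensor fields on a product\<close>

definition hlift ::
  "('a, 'e::euclidean_space) chart set \<Rightarrow> ('b, 'f::euclidean_space) chart set \<Rightarrow>
   'a form \<Rightarrow> ('a \<times> 'b) form" where
  "hlift A B \<omega> = pullback (prod_atlas A B) A fst \<omega>"

definition vlift ::
  "('a, 'e::euclidean_space) chart set \<Rightarrow> ('b, 'f::euclidean_space) chart set \<Rightarrow>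
   'b form \<Rightarrow> ('a \<times> 'b) form" where
  "vlift A B \<omega> = pullback (prod_atlas A B) B snd \<omega>"

text \<open>
  The warped bivector field and the contravariant warped metric are both of the form
  \<open>Q\<^sub>1 + \<phi> Q\<^sub>2\<close> with \<open>\<phi>\<close> a function on the first factor.  The two components at \<open>(p, q)\<close> of a
  covector of the product are its restrictions to the slices through \<open>(p, q)\<close>.  The equations
  that determine these tensor fields on lifted 1-forms are \<open>warped_lifts\<close> below.
\<close>

definition warped ::
  "('a, 'e::euclidean_space) chart set \<Rightarrow> ('b, 'f::euclidean_space) chart set \<Rightarrow>
   ('a \<Rightarrow> real) \<Rightarrow> 'a contra2 \<Rightarrow> 'b contra2 \<Rightarrow> ('a \<times> 'b) contra2" where
  "warped A B \<phi> Q\<^sub>1 Q\<^sub>2 = (\<lambda>(p, q) \<xi> \<eta>.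
     let h = cotangent_map A (prod_atlas A B) (\<lambda>x. (x, q)) p;
         v = cotangent_map B (prod_atlas A B) (\<lambda>y. (p, y)) q
     in Q\<^sub>1 p (h \<xi>) (h \<eta>) + \<phi> p * Q\<^sub>2 q (v \<xi>) (v \<eta>))"



section \<open>Values of warped tensor fields on lifted 1-forms\<close>

lemma Ck_on_cong:
  assumes "Ck_on k f S" "open S" "\<And>x. x \<in> S \<Longrightarrow> f x = g x"
  shows "Ck_on k g S"
  using assms
proof (induction k arbitrary: f g)
  case 0
  then show ?case by (simp cong: continuous_on_cong)
next
  case (Suc k)
  have der: "(g has_derivative frechet_derivative f (at x)) (at x)" if "x \<in> S" for x
  proof -
    have "(f has_derivative frechet_derivative f (at x)) (at x)"
      using Suc.prems that by (simp add: frechet_derivative_works[symmetric] differentiable_on_eq_differentiable_at)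
    then show ?thesis
      using Suc.prems(2,3) that has_derivative_transform_within_open by blast
  qed
  have "g differentiable_on S"
    using der Suc.prems(2) by (auto simp: differentiable_on_eq_differentiable_at differentiable_def)
  moreover have "Ck_on k (\<lambda>x. frechet_derivative g (at x) v) S" for v
  proof (rule Suc.IH)
    show "Ck_on k (\<lambda>x. frechet_derivative f (at x) v) S" using Suc.prems(1) by simp
    show "open S" by fact
    show "frechet_derivative f (at x) v = frechet_derivative g (at x) v" if "x \<in> S" for x
      using frechet_derivative_at[OF der[OF that]] by simp
  qed
  ultimately show ?case by simp
qed

lemma Ck_on_compose_affine:
  assumes "Ck_on k f S" "open S" "open T" "\<And>x. x \<in> T \<Longrightarrow> F x \<in> S"
    and F: "\<And>x. (F has_derivative L) (at x)"
  shows "Ck_on k (\<lambda>x. f (F x)) T"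
  using assms(1)
proof (induction k arbitrary: f)
  case 0
  have "continuous_on T F"
    using F by (meson has_derivative_continuous continuous_at_imp_continuous_on)
  with 0 show ?case
    using assms(4) by (auto intro: continuous_on_compose2)
next
  case (Suc k)
  have der: "((\<lambda>x. f (F x)) has_derivative (\<lambda>v. frechet_derivative f (at (F x)) (L v))) (at x)"
    if "x \<in> T" for x
  proof -
    have "(f has_derivative frechet_derivative f (at (F x))) (at (F x))"
      using Suc.prems that assms
      by (simp add: frechet_derivative_works[symmetric] differentiable_on_eq_differentiable_at)
    then show ?thesis by (rule has_derivative_compose[OF F])
  qed
  have "(\<lambda>x. f (F x)) differentiable_on T"
    using der \<open>open T\<close> by (auto simp: differentiable_on_eq_differentiable_at differentiable_def)
  moreover have "Ck_on k (\<lambda>x. frechet_derivative (\<lambda>x. f (F x)) (at x) v) T" for v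
  proof (rule Ck_on_cong)
    show "Ck_on k (\<lambda>x. frechet_derivative f (at (F x)) (L v)) T"
      by (rule Suc.IH) (use Suc.prems in simp)
    show "open T" by fact
    show "frechet_derivative f (at (F x)) (L v) = frechet_derivative (\<lambda>x. f (F x)) (at x) v"
      if "x \<in> T" for x
      by (simp add: frechet_derivative_at[OF der[OF that], symmetric])
  qed
  ultimately show ?case by simp
qed

lemma smooth_on_compose_affine:
  assumes "smooth_on f S" "open S" "open T" "\<And>x. x \<in> T \<Longrightarrow> F x \<in> S"
    and "\<And>x. (F has_derivative L) (at x)"
    and "\<And>x. x \<in> T \<Longrightarrow> g x = f (F x)"
  shows "smooth_on g T"
  unfolding smooth_on_def
proof
  fix k
  have "Ck_on k (\<lambda>x. f (F x)) T"
    using assms(1) by (intro Ck_on_compose_affine[OF _ assms(2-5)]) (simp_all add: smooth_on_def)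
  then show "Ck_on k g T"
    by (rule Ck_on_cong) (use assms in auto)
qed

lemma frechet_derivativeI:
  assumes "f differentiable_on S" "open S" "x \<in> S"
  shows "(f has_derivative frechet_derivative f (at x)) (at x)"
  using assms by (simp add: frechet_derivative_works[symmetric] differentiable_on_eq_differentiable_at)

lemma Ck_on_const: "Ck_on k (\<lambda>x. c) S"
  by (induction k arbitrary: c) simp_all

lemma Ck_on_SucD: "Ck_on (Suc k) f S \<Longrightarrow> Ck_on k f S"
  by (induction k arbitrary: f) (auto simp: differentiable_imp_continuous_on)

lemma Ck_on_add:
  fixes f g :: "'e::real_normed_vector \<Rightarrow> 'f::real_normed_vector"
  assumes "Ck_on k f S" "Ck_on k g S" "open S"
  shows "Ck_on k (\<lambda>x. f x + g x) S"
  using assms(1,2)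
proof (induction k arbitrary: f g)
  case 0
  then show ?case by (simp add: continuous_on_add)
next
  case (Suc k)
  have der: "((\<lambda>x. f x + g x) has_derivative
      (\<lambda>v. frechet_derivative f (at x) v + frechet_derivative g (at x) v)) (at x)" if "x \<in> S" for x
    using Suc.prems that \<open>open S\<close> by (intro has_derivative_add frechet_derivativeI) auto
  have "Ck_on k (\<lambda>x. frechet_derivative (\<lambda>x. f x + g x) (at x) v) S" for v
  proof (rule Ck_on_cong)
    show "Ck_on k (\<lambda>x. frechet_derivative f (at x) v + frechet_derivative g (at x) v) S"
      by (rule Suc.IH) (use Suc.prems in simp_all)
  qed (simp_all add: frechet_derivative_at[OF der, symmetric] \<open>open S\<close>)
  then show ?case
    using Suc.prems by (simp add: differentiable_on_add)
qed

lemma Ck_on_mult: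
  fixes f g :: "'e::real_normed_vector \<Rightarrow> real"
  assumes "Ck_on k f S" "Ck_on k g S" "open S"
  shows "Ck_on k (\<lambda>x. f x * g x) S"
  using assms(1,2)
proof (induction k arbitrary: f g)
  case 0
  then show ?case by (simp add: continuous_on_mult)
next
  case (Suc k)
  have der: "((\<lambda>x. f x * g x) has_derivative
      (\<lambda>v. f x * frechet_derivative g (at x) v + frechet_derivative f (at x) v * g x)) (at x)"
    if "x \<in> S" for x
    using Suc.prems that \<open>open S\<close> by (intro has_derivative_mult frechet_derivativeI) auto
  have "Ck_on k (\<lambda>x. frechet_derivative (\<lambda>x. f x * g x) (at x) v) S" for v
  proof (rule Ck_on_cong)
    show "Ck_on k (\<lambda>x. f x * frechet_derivative g (at x) v + frechet_derivative f (at x) v * g x) S"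
      using Suc.prems[THEN Ck_on_SucD] Suc.prems
      by (intro Ck_on_add Suc.IH \<open>open S\<close>) simp_all
  qed (simp_all add: frechet_derivative_at[OF der, symmetric] \<open>open S\<close>)
  moreover have "(\<lambda>x. f x * g x) differentiable_on S"
    using der \<open>open S\<close> by (auto simp: differentiable_on_eq_differentiable_at differentiable_def)
  ultimately show ?case by simp
qed

lemma smooth_functions_const: "(\<lambda>x. c) \<in> smooth_functions A"
  by (auto simp: smooth_functions_def smooth_on_def o_def Ck_on_const)

lemma smooth_functions_mult:
  assumes "f \<in> smooth_functions A" "h \<in> smooth_functions A" "\<forall>(U, \<phi>)\<in>A. open (\<phi> ` U)"
  shows "(\<lambda>x. f x * h x) \<in> smooth_functions A"
  using assms by (auto simp: smooth_functions_def smooth_on_def o_def intro!: Ck_on_mult)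

lemma smooth_functions_add:
  assumes "f \<in> smooth_functions A" "h \<in> smooth_functions A" "\<forall>(U, \<phi>)\<in>A. open (\<phi> ` U)"
  shows "(\<lambda>x. f x + h x) \<in> smooth_functions A"
  using assms by (auto simp: smooth_functions_def smooth_on_def o_def intro!: Ck_on_add)

context
  fixes A :: "('a::{t2_space,second_countable_topology}, 'e::euclidean_space) chart set"
    and B :: "('b::{t2_space,second_countable_topology}, 'f::euclidean_space) chart set"
  assumes A: "smooth_atlas A" and B: "smooth_atlas B"
begin

lemma atlas_open_inj:
  shows "(U, \<phi>) \<in> A \<Longrightarrow> open (\<phi> ` U) \<and> inj_on \<phi> U"
    and "(V, \<psi>) \<in> B \<Longrightarrow> open (\<psi> ` V) \<and> inj_on \<psi> V"
proof -
  have *: "homeomorphism W (\<kappa> ` W) \<kappa> \<kappa>' \<Longrightarrow> inj_on \<kappa> W" for W \<kappa> \<kappa>'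
    by (rule inj_on_inverseI[of _ \<kappa>']) (simp add: homeomorphism_def)
  show "(U, \<phi>) \<in> A \<Longrightarrow> open (\<phi> ` U) \<and> inj_on \<phi> U"
    using A *[of U \<phi>] unfolding smooth_atlas_def by blast
  show "(V, \<psi>) \<in> B \<Longrightarrow> open (\<psi> ` V) \<and> inj_on \<psi> V"
    using B *[of V \<psi>] unfolding smooth_atlas_def by blast
qed

lemma inv_into_map_prod:
  assumes "inj_on \<phi> U" "inj_on \<psi> V" "z \<in> \<phi> ` U \<times> \<psi> ` V"
  shows "inv_into (U \<times> V) (map_prod \<phi> \<psi>) z = (inv_into U \<phi> (fst z), inv_into V \<psi> (snd z))"
proof -
  obtain x y where xy: "x \<in> U" "y \<in> V" "z = (\<phi> x, \<psi> y)"
    using assms(3) by auto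
  have "inv_into (U \<times> V) (map_prod \<phi> \<psi>) (map_prod \<phi> \<psi> (x, y)) = (x, y)"
    using assms xy by (intro inv_into_f_f map_prod_inj_on) auto
  then show ?thesis using assms xy by (simp add: inv_into_f_f)
qed

lemma smooth_functions_fst:
  assumes "h \<in> smooth_functions A"
  shows "h \<circ> fst \<in> smooth_functions (prod_atlas A B)"
  unfolding smooth_functions_def prod_atlas_def
proof clarify
  fix U \<phi> V \<psi> assume U: "(U, \<phi>) \<in> A" and V: "(V, \<psi>) \<in> B"
  note UV = atlas_open_inj(1)[OF U] atlas_open_inj(2)[OF V]
  have "smooth_on (h \<circ> inv_into U \<phi>) (\<phi> ` U)"
    using assms U V by (auto simp: smooth_functions_def)
  then have "smooth_on (h \<circ> fst \<circ> inv_into (U \<times> V) (map_prod \<phi> \<psi>)) (\<phi> ` U \<times> \<psi> ` V)"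
  proof (rule smooth_on_compose_affine[where F = fst and L = fst])
    show "(fst has_derivative fst) (at x)" for x :: "'e \<times> 'f"
      by (rule bounded_linear_imp_has_derivative[OF bounded_linear_fst])
  qed (use UV in \<open>simp_all add: inv_into_map_prod open_Times mem_Times_iff\<close>)
  then show "smooth_on (h \<circ> fst \<circ> inv_into (U \<times> V) (map_prod \<phi> \<psi>)) (map_prod \<phi> \<psi> ` (U \<times> V))"
    by (simp add: map_prod_surj_on[OF refl refl])
qed

lemma smooth_functions_snd:
  assumes "h \<in> smooth_functions B"
  shows "h \<circ> snd \<in> smooth_functions (prod_atlas A B)"
  unfolding smooth_functions_def prod_atlas_def
proof clarify
  fix U \<phi> V \<psi> assume U: "(U, \<phi>) \<in> A" and V: "(V, \<psi>) \<in> B"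
  note UV = atlas_open_inj(1)[OF U] atlas_open_inj(2)[OF V]
  have "smooth_on (h \<circ> inv_into V \<psi>) (\<psi> ` V)"
    using assms U V by (auto simp: smooth_functions_def)
  then have "smooth_on (h \<circ> snd \<circ> inv_into (U \<times> V) (map_prod \<phi> \<psi>)) (\<phi> ` U \<times> \<psi> ` V)"
  proof (rule smooth_on_compose_affine[where F = snd and L = snd])
    show "(snd has_derivative snd) (at x)" for x :: "'e \<times> 'f"
      by (rule bounded_linear_imp_has_derivative[OF bounded_linear_snd])
  qed (use UV in \<open>simp_all add: inv_into_map_prod open_Times mem_Times_iff\<close>)
  then show "smooth_on (h \<circ> snd \<circ> inv_into (U \<times> V) (map_prod \<phi> \<psi>)) (map_prod \<phi> \<psi> ` (U \<times> V))"
    by (simp add: map_prod_surj_on[OF refl refl])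
qed

lemma smooth_functions_slice1:
  assumes h: "h \<in> smooth_functions (prod_atlas A B)"
  shows "h \<circ> (\<lambda>x. (x, q)) \<in> smooth_functions A"
  unfolding smooth_functions_def
proof (clarify)
  fix U \<phi> assume U: "(U, \<phi>) \<in> A"
  have "q \<in> (\<Union>(V, \<psi>)\<in>B. V)"
    using B by (simp add: smooth_atlas_def)
  then obtain V \<psi> where V: "(V, \<psi>) \<in> B" "q \<in> V" by auto
  note UV = atlas_open_inj(1)[OF U] atlas_open_inj(2)[OF V(1)]
  have "smooth_on (h \<circ> inv_into (U \<times> V) (map_prod \<phi> \<psi>)) (map_prod \<phi> \<psi> ` (U \<times> V))"
    using h U V(1) unfolding smooth_functions_def prod_atlas_def by blast
  then have "smooth_on (h \<circ> inv_into (U \<times> V) (map_prod \<phi> \<psi>)) (\<phi> ` U \<times> \<psi> ` V)"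
    by (simp add: map_prod_surj_on[OF refl refl])
  then show "smooth_on (h \<circ> (\<lambda>x. (x, q)) \<circ> inv_into U \<phi>) (\<phi> ` U)"
  proof (rule smooth_on_compose_affine[where F = "\<lambda>x. (x, \<psi> q)" and L = "\<lambda>x. (x, 0)"])
    show "((\<lambda>x. (x, \<psi> q)) has_derivative (\<lambda>x. (x, 0))) (at x)" for x
      by (intro has_derivative_Pair has_derivative_ident has_derivative_const)
  qed (use UV V(2) in \<open>simp_all add: inv_into_map_prod open_Times\<close>)
qed

lemma smooth_functions_slice2:
  assumes h: "h \<in> smooth_functions (prod_atlas A B)"
  shows "h \<circ> (\<lambda>y. (p, y)) \<in> smooth_functions B"
  unfolding smooth_functions_def
proof (clarify)
  fix V \<psi> assume V: "(V, \<psi>) \<in> B"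
  have "p \<in> (\<Union>(U, \<phi>)\<in>A. U)"
    using A by (simp add: smooth_atlas_def)
  then obtain U \<phi> where U: "(U, \<phi>) \<in> A" "p \<in> U" by auto
  note UV = atlas_open_inj(1)[OF U(1)] atlas_open_inj(2)[OF V]
  have "smooth_on (h \<circ> inv_into (U \<times> V) (map_prod \<phi> \<psi>)) (map_prod \<phi> \<psi> ` (U \<times> V))"
    using h U(1) V unfolding smooth_functions_def prod_atlas_def by blast
  then have "smooth_on (h \<circ> inv_into (U \<times> V) (map_prod \<phi> \<psi>)) (\<phi> ` U \<times> \<psi> ` V)"
    by (simp add: map_prod_surj_on[OF refl refl])
  then show "smooth_on (h \<circ> (\<lambda>y. (p, y)) \<circ> inv_into V \<psi>) (\<psi> ` V)"
  proof (rule smooth_on_compose_affine[where F = "\<lambda>y. (\<phi> p, y)" and L = "\<lambda>y. (0, y)"])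
    show "((\<lambda>y. (\<phi> p, y)) has_derivative (\<lambda>y. (0, y))) (at y)" for y
      by (intro has_derivative_Pair has_derivative_ident has_derivative_const)
  qed (use UV U(2) in \<open>simp_all add: inv_into_map_prod open_Times\<close>)
qed

lemma prod_atlas_open: "\<forall>(W, \<kappa>)\<in>prod_atlas A B. open (\<kappa> ` W)"
  unfolding prod_atlas_def
  by clarify (simp add: map_prod_surj_on[OF refl refl] open_Times atlas_open_inj)

lemmas prod_smooth_functions =
  smooth_functions_add[OF _ _ prod_atlas_open]
  smooth_functions_mult[OF smooth_functions_const _ prod_atlas_open]
  smooth_functions_mult[OF _ _ prod_atlas_open]

lemma tangent_map_slice1:
  assumes "v \<in> tangent_space A p"
  shows "tangent_map (prod_atlas A B) (\<lambda>x. (x, q)) v \<in> tangent_space (prod_atlas A B) (p, q)"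
proof -
  have 1: "v (\<lambda>x. a * f x + b * h x) = a * v f + b * v h"
    if "f \<in> smooth_functions A" "h \<in> smooth_functions A" for f h a b
    using assms that unfolding tangent_space_def by blast
  have 2: "v (\<lambda>x. f x * h x) = f p * v h + h p * v f"
    if "f \<in> smooth_functions A" "h \<in> smooth_functions A" for f h
    using assms that unfolding tangent_space_def by blast
  note sl = smooth_functions_slice1[unfolded o_def]
  show ?thesis
    by (simp add: tangent_space_def tangent_map_def prod_smooth_functions o_def 1[OF sl sl] 2[OF sl sl])
qed

lemma tangent_map_slice2:
  assumes "w \<in> tangent_space B q"
  shows "tangent_map (prod_atlas A B) (\<lambda>y. (p, y)) w \<in> tangent_space (prod_atlas A B) (p, q)"
proof -
  have 1: "w (\<lambda>y. a * f y + b * h y) = a * w f + b * w h"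
    if "f \<in> smooth_functions B" "h \<in> smooth_functions B" for f h a b
    using assms that unfolding tangent_space_def by blast
  have 2: "w (\<lambda>y. f y * h y) = f q * w h + h q * w f"
    if "f \<in> smooth_functions B" "h \<in> smooth_functions B" for f h
    using assms that unfolding tangent_space_def by blast
  note sl = smooth_functions_slice2[unfolded o_def]
  show ?thesis
    by (simp add: tangent_space_def tangent_map_def prod_smooth_functions o_def 1[OF sl sl] 2[OF sl sl])
qed

end

lemma tangent_space_const:
  assumes "v \<in> tangent_space A p"
  shows "v (\<lambda>x. c) = 0"
proof -
  have 1: "v (\<lambda>x. a * f x + b * h x) = a * v f + b * v h"
    if "f \<in> smooth_functions A" "h \<in> smooth_functions A" for f h a b
    using assms that unfolding tangent_space_def by blast
  have 2: "v (\<lambda>x. f x * h x) = f p * v h + h p * v f"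
    if "f \<in> smooth_functions A" "h \<in> smooth_functions A" for f h
    using assms that unfolding tangent_space_def by blast
  note one = smooth_functions_const[of 1 A]
  show ?thesis
    using 1[OF one one, of c 0] 2[OF one one] by simp
qed

lemma tangent_space_nonsmooth: "v \<in> tangent_space A p \<Longrightarrow> f \<notin> smooth_functions A \<Longrightarrow> v f = 0"
  by (simp add: tangent_space_def)

lemma cotangent_space_zero:
  assumes "\<xi> \<in> cotangent_space A p"
  shows "\<xi> 0 = 0"
proof (cases "0 \<in> tangent_space A p")
  case True
  then have "\<xi> (\<lambda>f. 0 * 0 f + 0 * 0 f) = 0 * \<xi> 0 + 0 * \<xi> 0"
    using assms unfolding cotangent_space_def by blast
  then show ?thesis by (simp add: zero_fun_def)
next
  case False
  then show ?thesis using assms by (simp add: cotangent_space_def)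
qed

context
  fixes A :: "('a::{t2_space,second_countable_topology}, 'e::euclidean_space) chart set"
    and B :: "('b::{t2_space,second_countable_topology}, 'f::euclidean_space) chart set"
  assumes A: "smooth_atlas A" and B: "smooth_atlas B"
begin

lemma tangent_map_proj_slice1:
  assumes "v \<in> tangent_space A p"
  shows "tangent_map A fst (tangent_map (prod_atlas A B) (\<lambda>x. (x, q)) v) = v"
    and "tangent_map B snd (tangent_map (prod_atlas A B) (\<lambda>x. (x, q)) v) = 0"
  using smooth_functions_fst[OF A B] smooth_functions_snd[OF A B]
  by (auto simp: tangent_map_def fun_eq_iff o_def tangent_space_const[OF assms]
      tangent_space_nonsmooth[OF assms])

lemma tangent_map_proj_slice2:
  assumes "w \<in> tangent_space B q"
  shows "tangent_map A fst (tangent_map (prod_atlas A B) (\<lambda>y. (p, y)) w) = 0"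
    and "tangent_map B snd (tangent_map (prod_atlas A B) (\<lambda>y. (p, y)) w) = w"
  using smooth_functions_fst[OF A B] smooth_functions_snd[OF A B]
  by (auto simp: tangent_map_def fun_eq_iff o_def tangent_space_const[OF assms]
      tangent_space_nonsmooth[OF assms])

lemma restrict_lift:
  fixes p :: 'a and q :: 'b
  assumes \<alpha>: "\<alpha> \<in> one_forms A" and \<beta>: "\<beta> \<in> one_forms B"
  defines "h \<equiv> cotangent_map A (prod_atlas A B) (\<lambda>x. (x, q)) p"
    and "v \<equiv> cotangent_map B (prod_atlas A B) (\<lambda>y. (p, y)) q"
  shows "h (hlift A B \<alpha> (p, q)) = \<alpha> p" "v (hlift A B \<alpha> (p, q)) = 0"
    and "h (vlift A B \<beta> (p, q)) = 0" "v (vlift A B \<beta> (p, q)) = \<beta> q"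
proof -
  have *: "\<alpha> p \<in> cotangent_space A p" "\<beta> q \<in> cotangent_space B q"
    using \<alpha> \<beta> by (auto simp: one_forms_def)
  have "\<And>w. w \<notin> tangent_space A p \<Longrightarrow> \<alpha> p w = 0" "\<And>w. w \<notin> tangent_space B q \<Longrightarrow> \<beta> q w = 0"
    using * by (simp_all add: cotangent_space_def)
  with *[THEN cotangent_space_zero] show "h (hlift A B \<alpha> (p, q)) = \<alpha> p" "v (hlift A B \<alpha> (p, q)) = 0"
    and "h (vlift A B \<beta> (p, q)) = 0" "v (vlift A B \<beta> (p, q)) = \<beta> q"
    by (auto simp: h_def v_def hlift_def vlift_def pullback_def cotangent_map_def fun_eq_iff
        tangent_map_proj_slice1 tangent_map_proj_slice2 tangent_map_slice1[OF A B] tangent_map_slice2[OF A B])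
qed

theorem warped_lifts:
  assumes "\<alpha>\<^sub>1 \<in> one_forms A" "\<beta>\<^sub>1 \<in> one_forms A" "\<alpha>\<^sub>2 \<in> one_forms B" "\<beta>\<^sub>2 \<in> one_forms B"
    and "\<And>\<xi>. \<xi> \<in> cotangent_space A p \<Longrightarrow> Q\<^sub>1 p \<xi> 0 = 0 \<and> Q\<^sub>1 p 0 \<xi> = 0"
    and "\<And>\<xi>. \<xi> \<in> cotangent_space B q \<Longrightarrow> Q\<^sub>2 q \<xi> 0 = 0 \<and> Q\<^sub>2 q 0 \<xi> = 0"
  shows "warped A B \<phi> Q\<^sub>1 Q\<^sub>2 (p, q) (hlift A B \<alpha>\<^sub>1 (p, q)) (hlift A B \<beta>\<^sub>1 (p, q)) =
           Q\<^sub>1 p (\<alpha>\<^sub>1 p) (\<beta>\<^sub>1 p)"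
    and "warped A B \<phi> Q\<^sub>1 Q\<^sub>2 (p, q) (vlift A B \<alpha>\<^sub>2 (p, q)) (vlift A B \<beta>\<^sub>2 (p, q)) =
           \<phi> p * Q\<^sub>2 q (\<alpha>\<^sub>2 q) (\<beta>\<^sub>2 q)"
    and "warped A B \<phi> Q\<^sub>1 Q\<^sub>2 (p, q) (hlift A B \<alpha>\<^sub>1 (p, q)) (vlift A B \<beta>\<^sub>2 (p, q)) = 0"
    and "warped A B \<phi> Q\<^sub>1 Q\<^sub>2 (p, q) (vlift A B \<alpha>\<^sub>2 (p, q)) (hlift A B \<beta>\<^sub>1 (p, q)) = 0"
proof -
  have "\<omega> p \<in> cotangent_space A p" if "\<omega> \<in> one_forms A" for \<omega>
    using that by (auto simp: one_forms_def)
  moreover have "\<omega> q \<in> cotangent_space B q" if "\<omega> \<in> one_forms B" for \<omega>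
    using that by (auto simp: one_forms_def)
  moreover have "0 \<in> cotangent_space A p" "0 \<in> cotangent_space B q"
    by (simp_all add: cotangent_space_def)
  ultimately show
    "warped A B \<phi> Q\<^sub>1 Q\<^sub>2 (p, q) (hlift A B \<alpha>\<^sub>1 (p, q)) (hlift A B \<beta>\<^sub>1 (p, q)) =
       Q\<^sub>1 p (\<alpha>\<^sub>1 p) (\<beta>\<^sub>1 p)"
    "warped A B \<phi> Q\<^sub>1 Q\<^sub>2 (p, q) (vlift A B \<alpha>\<^sub>2 (p, q)) (vlift A B \<beta>\<^sub>2 (p, q)) =
       \<phi> p * Q\<^sub>2 q (\<alpha>\<^sub>2 q) (\<beta>\<^sub>2 q)"
    "warped A B \<phi> Q\<^sub>1 Q\<^sub>2 (p, q) (hlift A B \<alpha>\<^sub>1 (p, q)) (vlift A B \<beta>\<^sub>2 (p, q)) = 0"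
    "warped A B \<phi> Q\<^sub>1 Q\<^sub>2 (p, q) (vlift A B \<alpha>\<^sub>2 (p, q)) (hlift A B \<beta>\<^sub>1 (p, q)) = 0"
    using assms by (simp_all add: warped_def Let_def restrict_lift)
qed

end

end

theory Submission
  imports Defs
begin

text \<open>
  Let \<open>D\<^sub>1\<close>, \<open>D\<^sub>2\<close> and \<open>D\<close> be the Levi-Civita contravariant connections of the factors and of the
  product.  As \<open>f\<close> is Casimir and \<open>\<mu>\<close> is locally constant, the Koszul formula gives
  \<open>D\<^bsub>\<alpha>\<^esub> \<beta> = (D\<^sub>1 \<alpha>\<^sub>1 \<beta>\<^sub>1)\<^sup>h + \<mu> (D\<^sub>2 \<alpha>\<^sub>2 \<beta>\<^sub>2)\<^sup>v\<close> for \<open>\<alpha> = \<alpha>\<^sub>1\<^sup>h + \<alpha>\<^sub>2\<^sup>v\<close> and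
  \<open>\<beta> = \<beta>\<^sub>1\<^sup>h + \<beta>\<^sub>2\<^sup>v\<close>, so on such lifts \<open>DR\<close> is
  \<open>(D\<^sub>1R\<^sub>1)\<^sup>h + \<mu>\<^sup>3 (D\<^sub>2R\<^sub>2)\<^sup>v\<close>.  If \<open>DR = 0\<close>, this yields \<open>D\<^sub>1R\<^sub>1 = 0\<close> and, at a point with
  \<open>\<mu> \<noteq> 0\<close>, \<open>D\<^sub>2R\<^sub>2 = 0\<close>.  The converse needs \<open>DR\<close> to be tensorial, as a 1-form of the product is a
  sum of lifts at each single point only.  The bivector fields are not assumed to be Poisson, but
  \<open>DR\<close> fails to be linear over functions exactly by the term
  \<open>([\<sharp>\<beta>, \<sharp>\<gamma>] - \<sharp>[\<beta>, \<gamma>])(\<phi>) D\<^bsub>\<alpha>\<^esub> \<delta>\<close>, so \<open>D\<^sub>1R\<^sub>1 = 0\<close> and \<open>D\<^sub>2R\<^sub>2 = 0\<close> imply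
  \<open>[\<sharp>\<beta>, \<sharp>\<gamma>] = \<sharp>[\<beta>, \<gamma>]\<close> on the factors, and then on the product.
\<close>

section \<open>Smooth functions on open subsets of Euclidean space\<close>

text \<open>Tangent vectors are derivations of the algebra of global smooth functions, so locality,
  the spanning of tangent spaces by partial derivatives and the extension of vectors and covectors
  to global fields rest on cut-off functions and Hadamard's lemma. \<open>locally_symmetric\<close>
  asserts that a Levi-Civita connection exists, so in each direction the connections on the side of
  the conclusion have to be constructed; this is possible because the Koszul formula is linear over
  functions in its last argument. The Casimir hypothesis makes \<open>f\<close> a constant for every
  anchored derivative, so \<open>f\<close> factors out of the vertical part of the Koszul formula
  and matches the factor \<open>f\<close> in the warped metric. That DR = 0 forces the defect J =
  [\<sharp>\<beta>, \<sharp>\<gamma>] - \<sharp>[\<beta>, \<gamma>] to vanish is a pointwise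
  argument: the failure of linearity in the first slot gives J(f) D\<alpha>\<delta> = 0, so where
  J(f) is nonzero every D\<alpha>\<delta> vanishes; the Leibniz rule for the form h dh, evaluated on
  \<sharp>\<alpha>, then leaves the square of \<sharp>\<alpha>(h) equal to 0, so the anchor vanishes
  at that point and J(f) with it.\<close>

lemma Ck_on_subset: "Ck_on k f S \<Longrightarrow> T \<subseteq> S \<Longrightarrow> Ck_on k f T"
  by (induction k arbitrary: f) (auto intro: continuous_on_subset differentiable_on_subset)

text \<open>The recursion of \<open>Ck_on\<close> differentiates with the unrestricted filter
  \<open>at x\<close>, so the derivative is the same function whichever neighbourhood is considered,
  and the neighbourhood given for the function also serves for its derivative.\<close>

lemma Ck_on_local:
  assumes "open S" "\<And>x. x \<in> S \<Longrightarrow> \<exists>T. open T \<and> x \<in> T \<and> Ck_on k f T"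
  shows "Ck_on k f S"
  using assms(2)
proof (induction k arbitrary: f)
  case 0
  have "continuous (at x) f" if "x \<in> S" for x
    using 0[OF that] by (auto simp: continuous_on_eq_continuous_at)
  then show ?case by (simp add: continuous_at_imp_continuous_on)
next
  case (Suc k)
  have "f differentiable (at x)" if "x \<in> S" for x
    using Suc.prems[OF that] by (auto simp: differentiable_on_eq_differentiable_at)
  then have "f differentiable_on S"
    using assms(1) by (simp add: differentiable_on_eq_differentiable_at)
  moreover have "Ck_on k (\<lambda>x. frechet_derivative f (at x) v) S" for v
  proof (rule Suc.IH)
    fix x assume "x \<in> S"
    from Suc.prems[OF this] show "\<exists>T. open T \<and> x \<in> T \<and> Ck_on k (\<lambda>x. frechet_derivative f (at x) v) T"
      by auto
  qed
  ultimately show ?case by simp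
qed

lemma Ck_on_sum:
  fixes f :: "'i \<Rightarrow> 'e::real_normed_vector \<Rightarrow> 'f::real_normed_vector"
  assumes "open S" "\<And>i. i \<in> I \<Longrightarrow> Ck_on k (f i) S"
  shows "Ck_on k (\<lambda>x. \<Sum>i\<in>I. f i x) S"
  using assms(2)
proof (induction I rule: infinite_finite_induct)
  case (insert i I)
  then show ?case by (simp add: Ck_on_add \<open>open S\<close>)
qed (simp_all add: Ck_on_const)

lemma Ck_on_bounded_linear:
  assumes "bounded_linear L"
  shows "Ck_on k L S"
proof (cases k)
  case 0
  then show ?thesis using assms by (simp add: linear_continuous_on)
next
  case (Suc j)
  have "frechet_derivative L (at x) = L" for x
    using frechet_derivative_at[OF bounded_linear_imp_has_derivative[OF assms]] by simp
  then show ?thesis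
    using assms Suc by (simp add: Ck_on_const bounded_linear_imp_differentiable_on)
qed

lemma Ck_on_linear_compose:
  assumes L: "bounded_linear L" and "Ck_on k f S" "open S"
  shows "Ck_on k (\<lambda>x. L (f x)) S"
  using assms(2)
proof (induction k arbitrary: f)
  case 0
  then show ?case by (simp add: bounded_linear.continuous_on[OF L])
next
  case (Suc k)
  have der: "((\<lambda>x. L (f x)) has_derivative (\<lambda>v. L (frechet_derivative f (at x) v))) (at x)" if "x \<in> S" for x
    using Suc.prems that \<open>open S\<close> by (intro bounded_linear.has_derivative[OF L] frechet_derivativeI) auto
  have "Ck_on k (\<lambda>x. frechet_derivative (\<lambda>x. L (f x)) (at x) v) S" for v
  proof (rule Ck_on_cong)
    show "Ck_on k (\<lambda>x. L (frechet_derivative f (at x) v)) S"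
      by (rule Suc.IH) (use Suc.prems in simp)
  qed (simp_all add: frechet_derivative_at[OF der, symmetric] \<open>open S\<close>)
  moreover have "(\<lambda>x. L (f x)) differentiable_on S"
    using der \<open>open S\<close> by (auto simp: differentiable_on_eq_differentiable_at differentiable_def)
  ultimately show ?case by simp
qed

lemma Ck_on_Pair:
  assumes "Ck_on k f S" "Ck_on k g S" "open S"
  shows "Ck_on k (\<lambda>x. (f x, g x)) S"
  using assms(1,2)
proof (induction k arbitrary: f g)
  case 0
  then show ?case by (simp add: continuous_on_Pair)
next
  case (Suc k)
  have der: "((\<lambda>x. (f x, g x)) has_derivative
      (\<lambda>v. (frechet_derivative f (at x) v, frechet_derivative g (at x) v))) (at x)" if "x \<in> S" for x
    using Suc.prems that \<open>open S\<close> by (intro has_derivative_Pair frechet_derivativeI) auto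
  have "Ck_on k (\<lambda>x. frechet_derivative (\<lambda>x. (f x, g x)) (at x) v) S" for v
  proof (rule Ck_on_cong)
    show "Ck_on k (\<lambda>x. (frechet_derivative f (at x) v, frechet_derivative g (at x) v)) S"
      by (rule Suc.IH) (use Suc.prems in simp_all)
  qed (simp_all add: frechet_derivative_at[OF der, symmetric] \<open>open S\<close>)
  moreover have "(\<lambda>x. (f x, g x)) differentiable_on S"
    using der \<open>open S\<close> by (auto simp: differentiable_on_eq_differentiable_at differentiable_def)
  ultimately show ?case by simp
qed

lemma linear_sum_Basis:
  fixes L :: "'f::euclidean_space \<Rightarrow> real"
  assumes "linear L"
  shows "L w = (\<Sum>b\<in>Basis. L b * (w \<bullet> b))"
proof -
  have "L w = L (\<Sum>b\<in>Basis. (w \<bullet> b) *\<^sub>R b)" by (simp add: euclidean_representation)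
  also have "\<dots> = (\<Sum>b\<in>Basis. L b * (w \<bullet> b))"
    using assms by (simp add: linear_sum linear_scale mult.commute)
  finally show ?thesis .
qed

text \<open>The chain rule yields the derivative of \<open>f\<close> applied to a vector depending
  on x, which is not a product of functions. Expanding that vector in the basis turns it into a sum
  of products of real functions, to which \<open>Ck_on_mult\<close> and the induction hypothesis for
  the partial derivatives of \<open>f\<close> apply.\<close>

lemma Ck_on_compose:
  fixes f :: "'f::euclidean_space \<Rightarrow> real" and g :: "'e::real_normed_vector \<Rightarrow> 'f"
  assumes "Ck_on k f S" "Ck_on k g T" "open S" "open T" "\<And>x. x \<in> T \<Longrightarrow> g x \<in> S"
  shows "Ck_on k (\<lambda>x. f (g x)) T"
  using assms(1,2)
proof (induction k arbitrary: f)
  case 0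
  then show ?case
    using assms(5) by (auto intro: continuous_on_compose2)
next
  case (Suc k)
  have Df: "(f has_derivative frechet_derivative f (at (g x))) (at (g x))" if "x \<in> T" for x
    using Suc.prems(1) by (intro frechet_derivativeI[OF _ assms(3) assms(5)[OF that]]) simp
  have Dg: "(g has_derivative frechet_derivative g (at x)) (at x)" if "x \<in> T" for x
    using Suc.prems(2) by (intro frechet_derivativeI[OF _ assms(4) that]) simp
  have der: "((\<lambda>x. f (g x)) has_derivative
      (\<lambda>v. frechet_derivative f (at (g x)) (frechet_derivative g (at x) v))) (at x)" if "x \<in> T" for x
    by (rule has_derivative_compose[OF Dg[OF that] Df[OF that]])
  have exp: "frechet_derivative (\<lambda>x. f (g x)) (at x) v =
      (\<Sum>b\<in>Basis. frechet_derivative f (at (g x)) b * (frechet_derivative g (at x) v \<bullet> b))"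
    if "x \<in> T" for x v
    unfolding frechet_derivative_at[OF der[OF that], symmetric]
    by (rule linear_sum_Basis[OF has_derivative_linear[OF Df[OF that]]])
  have "Ck_on k (\<lambda>x. frechet_derivative (\<lambda>x. f (g x)) (at x) v) T" for v
  proof (rule Ck_on_cong)
    have g: "Ck_on k g T" by (rule Ck_on_SucD) fact
    have 1: "Ck_on k (\<lambda>x. frechet_derivative f (at (g x)) b) T" for b
      using Suc.prems by (intro Suc.IH[OF _ g]) simp
    have 2: "Ck_on k (\<lambda>x. frechet_derivative g (at x) v \<bullet> b) T" for b
      using Suc.prems by (intro Ck_on_linear_compose[OF bounded_linear_inner_left _ assms(4)]) simp
    show "Ck_on k (\<lambda>x. \<Sum>b\<in>Basis. frechet_derivative f (at (g x)) b * (frechet_derivative g (at x) v \<bullet> b)) T"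
      by (intro Ck_on_sum Ck_on_mult 1 2 assms(4))
  qed (simp_all add: exp \<open>open T\<close>)
  moreover have "(\<lambda>x. f (g x)) differentiable_on T"
    using der \<open>open T\<close> by (auto simp: differentiable_on_eq_differentiable_at differentiable_def)
  ultimately show ?case by simp
qed

section \<open>The closure properties for smooth maps\<close>

lemma smooth_on_cong:
  "smooth_on f S \<Longrightarrow> open S \<Longrightarrow> (\<And>x. x \<in> S \<Longrightarrow> f x = g x) \<Longrightarrow> smooth_on g S"
  unfolding smooth_on_def using Ck_on_cong by blast

lemma smooth_on_subset: "smooth_on f S \<Longrightarrow> T \<subseteq> S \<Longrightarrow> smooth_on f T"
  unfolding smooth_on_def using Ck_on_subset by blast

lemma smooth_on_local:
  assumes "open S" "\<And>x. x \<in> S \<Longrightarrow> \<exists>T. open T \<and> x \<in> T \<and> smooth_on f T"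
  shows "smooth_on f S"
  using assms unfolding smooth_on_def by (metis Ck_on_local)

lemma smooth_on_const [simp]: "smooth_on (\<lambda>x. c) S"
  by (simp add: smooth_on_def Ck_on_const)

lemma smooth_on_add:
  fixes f g :: "'e::real_normed_vector \<Rightarrow> 'f::real_normed_vector"
  shows "smooth_on f S \<Longrightarrow> smooth_on g S \<Longrightarrow> open S \<Longrightarrow> smooth_on (\<lambda>x. f x + g x) S"
  by (simp add: smooth_on_def Ck_on_add)

lemma smooth_on_mult:
  fixes f g :: "'e::real_normed_vector \<Rightarrow> real"
  shows "smooth_on f S \<Longrightarrow> smooth_on g S \<Longrightarrow> open S \<Longrightarrow> smooth_on (\<lambda>x. f x * g x) S"
  by (simp add: smooth_on_def Ck_on_mult)

lemma smooth_on_diff: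
  fixes f g :: "'e::real_normed_vector \<Rightarrow> real"
  assumes "smooth_on f S" "smooth_on g S" "open S"
  shows "smooth_on (\<lambda>x. f x - g x) S"
  using smooth_on_add[OF assms(1) smooth_on_mult[OF smooth_on_const assms(2,3), of "-1"] assms(3)] by simp

lemma smooth_on_sum:
  fixes f :: "'i \<Rightarrow> 'e::real_normed_vector \<Rightarrow> 'f::real_normed_vector"
  shows "open S \<Longrightarrow> (\<And>i. i \<in> I \<Longrightarrow> smooth_on (f i) S) \<Longrightarrow> smooth_on (\<lambda>x. \<Sum>i\<in>I. f i x) S"
  by (simp add: smooth_on_def Ck_on_sum)

lemma smooth_on_Pair: "smooth_on f S \<Longrightarrow> smooth_on g S \<Longrightarrow> open S \<Longrightarrow> smooth_on (\<lambda>x. (f x, g x)) S"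
  by (simp add: smooth_on_def Ck_on_Pair)

lemma smooth_on_bounded_linear: "bounded_linear L \<Longrightarrow> smooth_on L S"
  by (simp add: smooth_on_def Ck_on_bounded_linear)

lemma smooth_on_compose:
  fixes f :: "'f::euclidean_space \<Rightarrow> real" and g :: "'e::real_normed_vector \<Rightarrow> 'f"
  assumes "smooth_on f S" "smooth_on g T" "open S" "open T" "\<And>x. x \<in> T \<Longrightarrow> g x \<in> S"
  shows "smooth_on (\<lambda>x. f (g x)) T"
  using assms Ck_on_compose unfolding smooth_on_def by blast

lemma smooth_on_frechet: "smooth_on f S \<Longrightarrow> smooth_on (\<lambda>x. frechet_derivative f (at x) v) S"
  unfolding smooth_on_def by (metis Ck_on.simps(2))

lemma smooth_on_has_derivative:
  "smooth_on f S \<Longrightarrow> open S \<Longrightarrow> x \<in> S \<Longrightarrow> (f has_derivative frechet_derivative f (at x)) (at x)"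
  unfolding smooth_on_def by (metis Ck_on.simps(2) frechet_derivativeI)


subsection \<open>Bump functions\<close>

text \<open>Member 0 is the classical flat function exp(-1/t). The powers of 1/t are added so that
  the derivative of a member is a linear combination of members, which makes smoothness an induction
  over the whole family.\<close>

definition bump_kernel :: "nat \<Rightarrow> real \<Rightarrow> real" where
  "bump_kernel n t = (if t > 0 then (1 / t) ^ n * exp (- 1 / t) else 0)"

lemma bump_kernel_pos: "t > 0 \<Longrightarrow> bump_kernel n t > 0"
  and bump_kernel_nonpos: "t \<le> 0 \<Longrightarrow> bump_kernel n t = 0"
  by (simp_all add: bump_kernel_def)

text \<open>With s = 1/t the limit from the right is the decay of s^n / exp(s) at infinity; on the
  left the kernel is constantly 0.\<close>

lemma bump_kernel_tendsto: "((\<lambda>t. bump_kernel n t) \<longlongrightarrow> 0) (at 0)"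
proof -
  have "((\<lambda>t. inverse t ^ n / exp (inverse t)) \<longlongrightarrow> (0::real)) (at_right 0)"
    by (rule filterlim_compose[OF tendsto_power_div_exp_0 filterlim_inverse_at_top_right])
  then have "((\<lambda>t. bump_kernel n t) \<longlongrightarrow> 0) (at_right 0)"
  proof (rule Lim_transform_eventually)
    show "\<forall>\<^sub>F t in at_right 0. inverse t ^ n / exp (inverse t) = bump_kernel n t"
      using eventually_at_right_less[of "0::real"]
      by eventually_elim (simp add: bump_kernel_def exp_minus divide_simps)
  qed
  moreover have "((\<lambda>t. bump_kernel n t) \<longlongrightarrow> 0) (at_left 0)"
  proof (rule Lim_transform_eventually[OF tendsto_const])
    show "\<forall>\<^sub>F t in at_left 0. 0 = bump_kernel n t"
      by (auto simp: eventually_at_filter bump_kernel_def)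
  qed
  ultimately show ?thesis by (simp add: filterlim_at_split)
qed

lemma bump_kernel_deriv:
  "(bump_kernel n has_real_derivative (bump_kernel (n + 2) t - real n * bump_kernel (n + 1) t)) (at t)"
proof (cases t "0::real" rule: linorder_cases)
  case less
  have "((\<lambda>_. 0) has_real_derivative 0) (at t)" by simp
  then have "(bump_kernel n has_real_derivative 0) (at t)"
    by (rule has_field_derivative_transform_within_open[of _ _ _ "{..<0}"])
       (use less in \<open>auto simp: bump_kernel_def\<close>)
  then show ?thesis using less by (simp add: bump_kernel_def)
next
  case equal
  \<comment> \<open>At 0 the difference quotient of member \<open>n\<close> is exactly member
    \<open>n + 1\<close>, so differentiability there is the limit just proved.\<close>
  have "(\<lambda>h. (bump_kernel n (0 + h) - bump_kernel n 0) / h) = bump_kernel (n + 1)"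
    by (auto simp: bump_kernel_def fun_eq_iff)
  then show ?thesis
    using equal bump_kernel_tendsto[of "n + 1"] by (simp add: DERIV_def bump_kernel_nonpos)
next
  case greater
  have "((\<lambda>t. (1 / t) ^ n * exp (- 1 / t)) has_real_derivative
      (bump_kernel (n + 2) t - real n * bump_kernel (n + 1) t)) (at t)"
    using greater
    by (auto intro!: derivative_eq_intros simp: bump_kernel_def field_simps power2_eq_square)
       (cases n; simp add: field_simps)
  then show ?thesis
    by (rule has_field_derivative_transform_within_open[of _ _ _ "{0<..}"])
       (use greater in \<open>auto simp: bump_kernel_def\<close>)
qed

lemma Ck_on_bump_kernel: "Ck_on k (bump_kernel n) UNIV"
proof (induction k arbitrary: n)
  case 0
  show ?case
    using DERIV_isCont[OF bump_kernel_deriv] by (simp add: continuous_at_imp_continuous_on)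
next
  case (Suc k)
  have der: "(bump_kernel n has_derivative
      (\<lambda>v. (bump_kernel (n + 2) t + - real n * bump_kernel (n + 1) t) * v)) (at t)" for t
    using bump_kernel_deriv[of n t] by (simp add: has_field_derivative_def)
  have "Ck_on k (\<lambda>x. frechet_derivative (bump_kernel n) (at x) v) UNIV" for v
    unfolding frechet_derivative_at[OF der, symmetric]
    by (intro Ck_on_mult Ck_on_add Suc.IH Ck_on_const open_UNIV)
  then show ?case
    using der by (auto simp: differentiable_on_def differentiable_def)
qed

lemma smooth_on_bump_kernel: "smooth_on (bump_kernel n) UNIV"
  by (simp add: smooth_on_def Ck_on_bump_kernel)

text \<open>Let k be kernel 0. The function k(s) is positive on the ball, 0 outside, and has the
  value \<open>m\<close> at the centre. Hence w = m/2 - k(s) is negative near the centre and equal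
  to m/2 outside the ball, so k(w) is 0 near the centre and the constant c = k(m/2) outside. The
  bump is 1 - k(w)/c. Writing \<open>s\<close> as a sum of squares of coordinates, not with the
  norm, makes its smoothness evident.\<close>

lemma euclidean_bump:
  fixes x0 :: "'e::euclidean_space"
  assumes "\<epsilon> > 0"
  obtains b :: "'e \<Rightarrow> real" and \<delta> where "smooth_on b UNIV" "\<And>x. x \<notin> ball x0 \<epsilon> \<Longrightarrow> b x = 0"
    "\<delta> > 0" "\<And>x. x \<in> ball x0 \<delta> \<Longrightarrow> b x = 1"
proof -
  define s where "s x = \<epsilon>\<^sup>2 - (\<Sum>c\<in>Basis. ((x - x0) \<bullet> c) * ((x - x0) \<bullet> c))" for x
  have s: "s x = \<epsilon>\<^sup>2 - (dist x0 x)\<^sup>2" for x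
  proof -
    have "(\<Sum>c\<in>Basis. ((x - x0) \<bullet> c) * ((x - x0) \<bullet> c)) = (x - x0) \<bullet> (x - x0)"
      by (rule euclidean_inner[symmetric])
    then show ?thesis by (simp add: s_def dist_norm norm_minus_commute[of x0] power2_norm_eq_inner)
  qed
  define m where "m = bump_kernel 0 (\<epsilon>\<^sup>2)"
  have m: "m > 0" using assms by (simp add: m_def bump_kernel_pos)
  define w where "w x = m / 2 - bump_kernel 0 (s x)" for x
  define c where "c = bump_kernel 0 (m / 2)"
  have c: "c > 0" using m by (simp add: c_def bump_kernel_pos)
  have sm_s: "smooth_on s UNIV"
    unfolding s_def inner_diff_left
    by (intro smooth_on_diff smooth_on_const smooth_on_sum smooth_on_mult open_UNIV
        smooth_on_bounded_linear bounded_linear_inner_left)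
  have sm_k: "smooth_on (\<lambda>x. bump_kernel 0 (h x)) UNIV" if "smooth_on h UNIV" for h :: "'e \<Rightarrow> real"
    by (rule smooth_on_compose[OF smooth_on_bump_kernel that]) auto
  have sm_w: "smooth_on w UNIV"
    unfolding w_def by (intro smooth_on_diff smooth_on_const sm_k sm_s open_UNIV)
  have cont: "continuous_on UNIV w"
    using sm_w unfolding smooth_on_def by (metis Ck_on.simps(1))
  have "open {x. w x < 0}"
    using open_Collect_less[OF cont continuous_on_const] by simp
  moreover have "w x0 < 0" using m by (simp add: w_def s m_def)
  ultimately obtain \<delta> where \<delta>: "\<delta> > 0" "ball x0 \<delta> \<subseteq> {x. w x < 0}"
    by (auto simp: open_contains_ball)
  show ?thesis
  proof
    show "smooth_on (\<lambda>x. 1 - (1 / c) * bump_kernel 0 (w x)) UNIV"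
      by (intro smooth_on_diff smooth_on_const smooth_on_mult sm_k sm_w open_UNIV)
    show "1 - (1 / c) * bump_kernel 0 (w x) = 0" if "x \<notin> ball x0 \<epsilon>" for x
    proof -
      have "\<epsilon>\<^sup>2 \<le> (dist x0 x)\<^sup>2"
        using that assms by (intro power_mono) auto
      then show ?thesis using c by (simp add: w_def s bump_kernel_nonpos c_def)
    qed
    show "1 - (1 / c) * bump_kernel 0 (w x) = 1" if "x \<in> ball x0 \<delta>" for x
    proof -
      have "w x < 0" using that \<delta>(2) by auto
      then show ?thesis by (simp add: bump_kernel_nonpos)
    qed
  qed fact
qed


subsection \<open>Hadamard's lemma\<close>

text \<open>Each differentiation under the integral sign produces a factor t from the inner
  function. The arbitrary continuous weight \<open>w\<close> absorbs it: the partial derivatives are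
  integrals of the same kind, with weight t w(t) and a partial derivative of
  \<open>H\<close>.\<close>

lemma Ck_on_param_integral:
  fixes H :: "'e::euclidean_space \<Rightarrow> real" and w :: "real \<Rightarrow> real"
  assumes "Ck_on k H (ball x0 r)" "continuous_on {0..1} w"
  shows "Ck_on k (\<lambda>x. integral {0..1} (\<lambda>t. w t * H (x0 + t *\<^sub>R (x - x0)))) (ball x0 r)"
  using assms
proof (induction k arbitrary: H w)
  have seg: "x0 + t *\<^sub>R (x - x0) \<in> ball x0 r" if "x \<in> ball x0 r" "t \<in> {0..1}" for x t
  proof -
    have "norm (t *\<^sub>R (x - x0)) \<le> 1 * norm (x - x0)"
      using that(2) by (simp add: mult_left_le_one_le)
    then show ?thesis using that(1) by (simp add: dist_norm norm_minus_commute)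
  qed
  have cont: "continuous_on (ball x0 r \<times> {0..1}) (\<lambda>(x, t). w t * H (x0 + t *\<^sub>R (x - x0)))"
    if "continuous_on (ball x0 r) H" "continuous_on {0..1} w" for H :: "'e \<Rightarrow> real" and w :: "real \<Rightarrow> real"
    unfolding split_beta
    by (intro continuous_intros continuous_on_compose2[OF that(1)] continuous_on_compose2[OF that(2)])
       (use seg in auto)
  {
    case 0
    then show ?case
      using integral_continuous_on_param[of "ball x0 r" 0 1 "\<lambda>x t. w t * H (x0 + t *\<^sub>R (x - x0))"] cont
      by simp
  next
    case (Suc k)
    define dH where "dH b x = frechet_derivative H (at x) b" for b x
    \<comment> \<open>The x-derivative of the integrand as a bounded linear functional, since
      \<open>leibniz_rule\<close> integrates derivatives with values in the space of such
      functionals.\<close>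
    define fx where "fx x t = (\<Sum>b\<in>Basis. ((t * w t) * dH b (x0 + t *\<^sub>R (x - x0))) *\<^sub>R blinfun_inner_right b)" for x t
    let ?F = "\<lambda>x. integral {0..1} (\<lambda>t. w t * H (x0 + t *\<^sub>R (x - x0)))"
    have ctw: "continuous_on {0..1} (\<lambda>t. t * w t)"
      using Suc.prems(2) by (intro continuous_intros)
    have CH: "Ck_on k (dH b) (ball x0 r)" for b
      using Suc.prems(1) by (simp add: dH_def[abs_def])
    have cH: "continuous_on (ball x0 r) (dH b)" for b
      using CH[of b] by (cases k) (auto simp: differentiable_imp_continuous_on)
    have cH0: "continuous_on (ball x0 r) H"
      using Suc.prems(1) by (auto simp: differentiable_imp_continuous_on)
    have ci: "continuous_on {0..1} (\<lambda>t. u t * G (x0 + t *\<^sub>R (x - x0)))"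
      if "continuous_on (ball x0 r) G" "continuous_on {0..1} u" "x \<in> ball x0 r"
      for G :: "'e \<Rightarrow> real" and u x
      by (rule continuous_on_compose2[OF cont[OF that(1,2)], of _ "\<lambda>t. (x, t)", unfolded split_conv])
         (use that(3) in \<open>auto intro!: continuous_intros\<close>)
    have der: "(?F has_derivative integral {0..1} (fx x)) (at x)" if x: "x \<in> ball x0 r" for x
    proof -
      have "((\<lambda>x. integral (cbox 0 1) (\<lambda>t. w t * H (x0 + t *\<^sub>R (x - x0)))) has_derivative
          integral (cbox 0 1) (fx x)) (at x within ball x0 r)"
      proof (rule leibniz_rule)
        fix y t assume y: "y \<in> ball x0 r" and t: "t \<in> cbox (0::real) 1"
        have "(H has_derivative frechet_derivative H (at (x0 + t *\<^sub>R (y - x0)))) (at (x0 + t *\<^sub>R (y - x0)))"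
          using Suc.prems(1) seg y t by (intro frechet_derivativeI) auto
        note D = this
        have "((\<lambda>y. x0 + t *\<^sub>R (y - x0)) has_derivative (\<lambda>v. t *\<^sub>R v)) (at y)"
          by (auto intro!: derivative_eq_intros)
        from has_derivative_mult_right[OF has_derivative_compose[OF this D]]
        have "((\<lambda>y. w t * H (x0 + t *\<^sub>R (y - x0))) has_derivative
          (\<lambda>v. w t * frechet_derivative H (at (x0 + t *\<^sub>R (y - x0))) (t *\<^sub>R v))) (at y within ball x0 r)"
          by (rule has_derivative_at_withinI)
        moreover have "(\<lambda>v. w t * frechet_derivative H (at (x0 + t *\<^sub>R (y - x0))) (t *\<^sub>R v)) = blinfun_apply (fx y t)"
        proof
          fix v
          show "w t * frechet_derivative H (at (x0 + t *\<^sub>R (y - x0))) (t *\<^sub>R v) = blinfun_apply (fx y t) v"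
            unfolding linear_sum_Basis[OF has_derivative_linear[OF D], of "t *\<^sub>R v"] fx_def dH_def
            by (simp add: blinfun.sum_left blinfun.scaleR_left sum_distrib_left algebra_simps inner_commute)
        qed
        ultimately show "((\<lambda>y. w t * H (x0 + t *\<^sub>R (y - x0))) has_derivative blinfun_apply (fx y t)) (at y within ball x0 r)"
          by simp
      next
        fix y assume y: "y \<in> ball x0 r"
        show "(\<lambda>t. w t * H (x0 + t *\<^sub>R (y - x0))) integrable_on cbox 0 1"
          using integrable_continuous_interval ci[OF cH0 Suc.prems(2) y] by simp
      next
        show "continuous_on (ball x0 r \<times> cbox 0 1) (\<lambda>(x, t). fx x t)"
          unfolding fx_def split_beta
          by (intro continuous_on_sum continuous_on_scaleR continuous_on_const)
             (use cont[OF cH ctw] in \<open>simp add: split_beta\<close>)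
      qed (use x in auto)
      then show ?thesis using x by (simp add: at_within_open[OF x])
    qed
    have bl: "integral {0..1} (fx x) v = (\<Sum>b\<in>Basis. integral {0..1} (\<lambda>t. (t * w t) * dH b (x0 + t *\<^sub>R (x - x0))) * (b \<bullet> v))"
      if x: "x \<in> ball x0 r" for x v
    proof -
      have i: "(\<lambda>t. (t * w t) * dH b (x0 + t *\<^sub>R (x - x0))) integrable_on {0..1}" for b
        by (rule integrable_continuous_interval) (rule ci[OF cH ctw x])
      have i2: "fx x integrable_on {0..1}"
        unfolding fx_def by (intro integrable_sum integrable_on_scaleR_left i finite_Basis)
      have "integral {0..1} (fx x) v = integral {0..1} (\<lambda>t. fx x t v)"
        by (rule blinfun_apply_integral[OF i2])
      also have "\<dots> = integral {0..1} (\<lambda>t. \<Sum>b\<in>Basis. (t * w t) * dH b (x0 + t *\<^sub>R (x - x0)) * (b \<bullet> v))"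
        by (simp add: fx_def blinfun.sum_left blinfun.scaleR_left)
      also have "\<dots> = (\<Sum>b\<in>Basis. integral {0..1} (\<lambda>t. (t * w t) * dH b (x0 + t *\<^sub>R (x - x0)) * (b \<bullet> v)))"
        by (intro integral_sum finite_Basis integrable_on_mult_left i)
      finally show ?thesis by simp
    qed
    have "?F differentiable_on ball x0 r"
      unfolding differentiable_on_eq_differentiable_at[OF open_ball] differentiable_def
      by (intro ballI exI) (rule der)
    moreover have "Ck_on k (\<lambda>x. frechet_derivative ?F (at x) v) (ball x0 r)" for v
    proof (rule Ck_on_cong)
      show "Ck_on k (\<lambda>x. \<Sum>b\<in>Basis. integral {0..1} (\<lambda>t. (t * w t) * dH b (x0 + t *\<^sub>R (x - x0))) * (b \<bullet> v)) (ball x0 r)"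
        by (intro Ck_on_sum Ck_on_mult Suc.IH CH ctw Ck_on_const open_ball)
      show "(\<Sum>b\<in>Basis. integral {0..1} (\<lambda>t. (t * w t) * dH b (x0 + t *\<^sub>R (x - x0))) * (b \<bullet> v)) = frechet_derivative ?F (at x) v"
        if "x \<in> ball x0 r" for x
        using frechet_derivative_at[OF der[OF that]] bl[OF that] by metis
    qed simp
    ultimately show ?case by simp
  }
qed

text \<open>The fundamental theorem of calculus along the segment from \<open>x0\<close> to x writes
  f(x) - f(x0) as the integral of the directional derivative; splitting the direction x - x0 in the
  basis gives the coefficients as averages of the partial derivatives over the segment.\<close>

lemma hadamard:
  fixes f :: "'e::euclidean_space \<Rightarrow> real"
  assumes f: "smooth_on f (ball x0 r)" and r: "r > 0"
  obtains g where "\<And>b. b \<in> Basis \<Longrightarrow> smooth_on (g b) (ball x0 r)"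
    "\<And>x. x \<in> ball x0 r \<Longrightarrow> f x = f x0 + (\<Sum>b\<in>Basis. ((x - x0) \<bullet> b) * g b x)"
    "\<And>b. b \<in> Basis \<Longrightarrow> g b x0 = frechet_derivative f (at x0) b"
proof -
  define dH where "dH b x = frechet_derivative f (at x) b" for b x
  \<comment> \<open>The factor \<open>1\<close> is the constant weight that makes this an instance
    of \<open>Ck_on_param_integral\<close>.\<close>
  define g where "g b x = integral {0..1} (\<lambda>t. 1 * dH b (x0 + t *\<^sub>R (x - x0)))" for b x
  have sd: "smooth_on (dH b) (ball x0 r)" for b
    using smooth_on_frechet[OF f] by (simp add: dH_def[abs_def])
  show ?thesis
  proof
    show "smooth_on (g b) (ball x0 r)" for b
      using sd unfolding g_def smooth_on_def
      by (intro allI Ck_on_param_integral) auto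
    show "g b x0 = frechet_derivative f (at x0) b" for b
      by (simp add: g_def dH_def)
    show "f x = f x0 + (\<Sum>b\<in>Basis. ((x - x0) \<bullet> b) * g b x)" if x: "x \<in> ball x0 r" for x
    proof -
      have seg: "x0 + t *\<^sub>R (x - x0) \<in> ball x0 r" if "t \<in> {0..1}" for t
      proof -
        have "norm (t *\<^sub>R (x - x0)) \<le> 1 * norm (x - x0)"
          using that by (simp add: mult_left_le_one_le)
        then show ?thesis using x by (simp add: dist_norm norm_minus_commute)
      qed
      have cd: "continuous_on (ball x0 r) (dH b)" for b
        using sd[of b] unfolding smooth_on_def by (metis Ck_on.simps(1))
      have c: "continuous_on {0..1} (\<lambda>t. dH b (x0 + t *\<^sub>R (x - x0)))" for b
        by (rule continuous_on_compose2[OF cd]) (use seg in \<open>auto intro!: continuous_intros\<close>)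
      have i: "(\<lambda>t. dH b (x0 + t *\<^sub>R (x - x0))) integrable_on {0..1}" for b
        by (rule integrable_continuous_interval[OF c])
      have "((\<lambda>t. \<Sum>b\<in>Basis. ((x - x0) \<bullet> b) * dH b (x0 + t *\<^sub>R (x - x0))) has_integral
          f (x0 + 1 *\<^sub>R (x - x0)) - f (x0 + 0 *\<^sub>R (x - x0))) {0..1}"
      proof (rule fundamental_theorem_of_calculus)
        fix t :: real assume t: "t \<in> {0..1}"
        note D = smooth_on_has_derivative[OF f open_ball seg[OF t]]
        have "((\<lambda>t. x0 + t *\<^sub>R (x - x0)) has_derivative (\<lambda>s. s *\<^sub>R (x - x0))) (at t)"
          by (auto intro!: derivative_eq_intros)
        from has_derivative_compose[OF this D]
        have "((\<lambda>t. f (x0 + t *\<^sub>R (x - x0))) has_derivative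
          (\<lambda>s. frechet_derivative f (at (x0 + t *\<^sub>R (x - x0))) (s *\<^sub>R (x - x0)))) (at t)" .
        moreover have "frechet_derivative f (at (x0 + t *\<^sub>R (x - x0))) (s *\<^sub>R (x - x0)) =
           s *\<^sub>R (\<Sum>b\<in>Basis. ((x - x0) \<bullet> b) * dH b (x0 + t *\<^sub>R (x - x0)))" for s
          unfolding linear_sum_Basis[OF has_derivative_linear[OF D], of "s *\<^sub>R (x - x0)"] dH_def
          by (simp add: sum_distrib_left algebra_simps)
        ultimately show "((\<lambda>t. f (x0 + t *\<^sub>R (x - x0))) has_vector_derivative
          (\<Sum>b\<in>Basis. ((x - x0) \<bullet> b) * dH b (x0 + t *\<^sub>R (x - x0)))) (at t within {0..1})"
          unfolding has_vector_derivative_def by (auto intro: has_derivative_at_withinI)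
      qed simp
      then have "f x - f x0 = integral {0..1} (\<lambda>t. \<Sum>b\<in>Basis. ((x - x0) \<bullet> b) * dH b (x0 + t *\<^sub>R (x - x0)))"
        by (simp add: integral_unique)
      also have "\<dots> = (\<Sum>b\<in>Basis. integral {0..1} (\<lambda>t. ((x - x0) \<bullet> b) * dH b (x0 + t *\<^sub>R (x - x0))))"
        by (rule integral_sum) (auto intro: integrable_on_mult_right i)
      also have "\<dots> = (\<Sum>b\<in>Basis. ((x - x0) \<bullet> b) * g b x)"
        by (simp add: g_def)
      finally show ?thesis by simp
    qed
  qed
qed


subsection \<open>Inverse matrices\<close>

text \<open>Because \<open>g\<close> vanishes at x, the term with the derivative of \<open>f\<close>
  in the product rule has factor 0, and continuity of \<open>f\<close> at x is enough. This
  differentiates the entries of an inverse matrix at a stage where only their continuity is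
  known.\<close>

lemma has_derivative_mult_vanishing:
  fixes f g :: "'e::real_normed_vector \<Rightarrow> real"
  assumes f: "continuous (at x) f" and g: "(g has_derivative g') (at x)" and "g x = 0"
  shows "((\<lambda>y. f y * g y) has_derivative (\<lambda>v. f x * g' v)) (at x)"
proof -
  have bl: "bounded_linear g'" using g by (rule has_derivative_bounded_linear)
  then obtain K where K: "K > 0" "\<And>v. \<bar>g' v\<bar> \<le> norm v * K"
    using bounded_linear.pos_bounded[OF bl] by auto
  have lim: "((\<lambda>y. norm (g y - g x - g' (y - x)) / norm (y - x)) \<longlongrightarrow> 0) (at x)"
    using g by (simp add: has_derivative_iff_norm)
  have fl: "((\<lambda>y. f y - f x) \<longlongrightarrow> 0) (at x)" using f by (simp add: isCont_def LIM_zero)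
  have "((\<lambda>y. norm (f y * g y - f x * g x - f x * g' (y - x)) / norm (y - x)) \<longlongrightarrow> 0) (at x)"
  proof (rule Lim_null_comparison)
    show "\<forall>\<^sub>F y in at x. norm (norm (f y * g y - f x * g x - f x * g' (y - x)) / norm (y - x)) \<le>
      \<bar>f y\<bar> * (norm (g y - g x - g' (y - x)) / norm (y - x)) + \<bar>f y - f x\<bar> * K"
    proof (rule eventually_at_filter[THEN iffD2], rule always_eventually, intro allI impI)
      fix y assume "y \<noteq> x"
      then have n: "norm (y - x) > 0" by simp
      \<comment> \<open>The error splits into \<open>f y\<close> times the remainder of
        \<open>g\<close>, and a term that is small because \<open>f\<close> is continuous and the
        derivative of \<open>g\<close> is bounded.\<close>
      have "\<bar>f y * g y - f x * g' (y - x)\<bar> = \<bar>f y * (g y - g' (y - x)) + (f y - f x) * g' (y - x)\<bar>"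
        by (simp add: algebra_simps)
      also have "\<dots> \<le> \<bar>f y\<bar> * \<bar>g y - g' (y - x)\<bar> + \<bar>f y - f x\<bar> * (norm (y - x) * K)"
        by (rule order_trans[OF abs_triangle_ineq]) (auto simp: abs_mult intro!: add_mono mult_left_mono K)
      finally have "\<bar>f y * g y - f x * g' (y - x)\<bar> / norm (y - x) \<le>
          (\<bar>f y\<bar> * \<bar>g y - g' (y - x)\<bar> + \<bar>f y - f x\<bar> * (norm (y - x) * K)) / norm (y - x)"
        using n by (simp add: divide_right_mono)
      then show "norm (norm (f y * g y - f x * g x - f x * g' (y - x)) / norm (y - x)) \<le>
        \<bar>f y\<bar> * (norm (g y - g x - g' (y - x)) / norm (y - x)) + \<bar>f y - f x\<bar> * K"
        using n by (simp add: \<open>g x = 0\<close> add_divide_distrib)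
    qed
    have "((\<lambda>y. \<bar>f y\<bar> * (norm (g y - g x - g' (y - x)) / norm (y - x)) + \<bar>f y - f x\<bar> * K) \<longlongrightarrow>
        \<bar>f x\<bar> * 0 + \<bar>0\<bar> * K) (at x)"
      using f by (intro tendsto_add tendsto_mult tendsto_rabs lim fl tendsto_const) (simp add: isCont_def)
    then show "((\<lambda>y. \<bar>f y\<bar> * (norm (g y - g x - g' (y - x)) / norm (y - x)) + \<bar>f y - f x\<bar> * K) \<longlongrightarrow> 0) (at x)"
      by simp
  qed
  then show ?thesis
    using bl by (auto simp: has_derivative_iff_norm intro: bounded_linear_const_mult)
qed

text \<open>No determinants are used. With n = inverse of m, the identity n(x) - n(x0) = - n(x)
  (m(x) - m(x0)) n(x0) gives a bound on n near x0, then continuity, then the derivative - n m' n. As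
  this derivative is polynomial in the entries of n and m', differentiability of all orders follows
  by induction.\<close>

lemma smooth_on_inverse_matrix:
  fixes m n :: "'i \<Rightarrow> 'i \<Rightarrow> 'e::real_normed_vector \<Rightarrow> real"
  assumes I: "finite I" and S: "open S"
    and m: "\<And>i j. i \<in> I \<Longrightarrow> j \<in> I \<Longrightarrow> smooth_on (m i j) S"
    and nm: "\<And>x i j. x \<in> S \<Longrightarrow> i \<in> I \<Longrightarrow> j \<in> I \<Longrightarrow> (\<Sum>l\<in>I. n i l x * m l j x) = (if i = j then 1 else 0)"
    and mn: "\<And>x i j. x \<in> S \<Longrightarrow> i \<in> I \<Longrightarrow> j \<in> I \<Longrightarrow> (\<Sum>l\<in>I. m i l x * n l j x) = (if i = j then 1 else 0)"
    and ij: "i \<in> I" "j \<in> I"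
  shows "smooth_on (n i j) S"
proof -
  have key: "n i j x = n i j x0 - (\<Sum>k\<in>I. \<Sum>l\<in>I. n l j x0 * (n i k x * (m k l x - m k l x0)))"
    if "x \<in> S" "x0 \<in> S" "i \<in> I" "j \<in> I" for i j x x0
  proof -
    have "(\<Sum>k\<in>I. \<Sum>l\<in>I. n l j x0 * (n i k x * m k l x)) = (\<Sum>l\<in>I. (\<Sum>k\<in>I. n i k x * m k l x) * n l j x0)"
      by (subst sum.swap) (simp add: sum_distrib_left sum_distrib_right mult_ac)
    also have "\<dots> = n i j x0"
      using that I by (simp add: nm if_distrib[where f = "\<lambda>c. c * _"] cong: if_cong)
    finally have 1: "(\<Sum>k\<in>I. \<Sum>l\<in>I. n l j x0 * (n i k x * m k l x)) = n i j x0" .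
    have "(\<Sum>k\<in>I. \<Sum>l\<in>I. n l j x0 * (n i k x * m k l x0)) = (\<Sum>k\<in>I. n i k x * (\<Sum>l\<in>I. m k l x0 * n l j x0))"
      by (simp add: sum_distrib_left sum_distrib_right mult_ac)
    also have "\<dots> = n i j x"
      using that I by (simp add: mn if_distrib cong: if_cong)
    finally have 2: "(\<Sum>k\<in>I. \<Sum>l\<in>I. n l j x0 * (n i k x * m k l x0)) = n i j x" .
    show ?thesis
      by (simp add: right_diff_distrib sum_subtractf 1 2)
  qed
  define A where "A x = (\<Sum>i\<in>I. \<Sum>j\<in>I. \<bar>n i j x\<bar>)" for x
  have nA: "\<bar>n i j x\<bar> \<le> A x" if "i \<in> I" "j \<in> I" for i j x
  proof -
    have "\<bar>n i j x\<bar> \<le> (\<Sum>j\<in>I. \<bar>n i j x\<bar>)" using that I by (intro member_le_sum) auto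
    also have "\<dots> \<le> A x" unfolding A_def using that I
      by (intro member_le_sum[of i I "\<lambda>i. \<Sum>j\<in>I. \<bar>n i j x\<bar>"]) (auto intro: sum_nonneg)
    finally show ?thesis .
  qed
  have A0: "A x \<ge> 0" for x by (simp add: A_def sum_nonneg)
  define e where "e x0 x = (\<Sum>k\<in>I. \<Sum>l\<in>I. \<bar>m k l x - m k l x0\<bar>)" for x0 x
  have bound: "\<bar>n i j x - n i j x0\<bar> \<le> A x0 * A x * e x0 x"
    if "x \<in> S" "x0 \<in> S" "i \<in> I" "j \<in> I" for i j x x0
  proof -
    have "\<bar>n i j x - n i j x0\<bar> = \<bar>\<Sum>k\<in>I. \<Sum>l\<in>I. n l j x0 * (n i k x * (m k l x - m k l x0))\<bar>"
      using key[OF that] by simp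
    also have "\<dots> \<le> (\<Sum>k\<in>I. \<Sum>l\<in>I. \<bar>n l j x0 * (n i k x * (m k l x - m k l x0))\<bar>)"
      by (rule order_trans[OF sum_abs]) (intro sum_mono sum_abs)
    also have "\<dots> \<le> (\<Sum>k\<in>I. \<Sum>l\<in>I. A x0 * (A x * \<bar>m k l x - m k l x0\<bar>))"
      using that by (intro sum_mono) (auto simp: abs_mult intro!: mult_mono nA A0)
    also have "\<dots> = A x0 * A x * e x0 x"
      by (simp add: e_def sum_distrib_left mult_ac)
    finally show ?thesis .
  qed
  have cont: "continuous (at x0) (n i j)" if x0: "x0 \<in> S" and ij: "i \<in> I" "j \<in> I" for i j x0
  proof -
    have mc: "continuous (at x0) (m k l)" if "k \<in> I" "l \<in> I" for k l
      using m[OF that] S x0 unfolding smooth_on_def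
      by (metis Ck_on.simps(1) continuous_on_eq_continuous_at)
    have e0: "(e x0 \<longlongrightarrow> 0) (at x0)"
    proof -
      have "((\<lambda>x. \<bar>m k l x - m k l x0\<bar>) \<longlongrightarrow> 0) (at x0)" if "k \<in> I" "l \<in> I" for k l
        using mc[OF that] by (simp add: isCont_def LIM_zero tendsto_rabs_zero)
      then show ?thesis unfolding e_def by (intro tendsto_null_sum)
    qed
    \<comment> \<open>Summing the entrywise bound over all pairs of indices gives A(x) \<le> A(x0) +
      A(x) N A(x0) e(x). Once N A(x0) e(x) is below 1/2, the last term is absorbed on the left and
      A(x) \<le> 2 A(x0), which makes the bound on n(x) - n(x0) independent of A(x).\<close>
    define N where "N = real (card I) * real (card I)"
    have "((\<lambda>x. N * A x0 * e x0 x) \<longlongrightarrow> N * A x0 * 0) (at x0)"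
      by (intro tendsto_mult tendsto_const e0)
    then have ev: "\<forall>\<^sub>F x in at x0. N * A x0 * e x0 x < 1 / 2"
      by (intro order_tendstoD) auto
    have evS: "\<forall>\<^sub>F x in at x0. x \<in> S"
      using S x0 by (auto simp: eventually_at_topological)
    have "((\<lambda>x. n i j x - n i j x0) \<longlongrightarrow> 0) (at x0)"
    proof (rule Lim_null_comparison)
      show "\<forall>\<^sub>F x in at x0. norm (n i j x - n i j x0) \<le> A x0 * (2 * A x0) * e x0 x"
        using ev evS
      proof eventually_elim
        case (elim x)
        have en: "e x0 x \<ge> 0" by (simp add: e_def sum_nonneg)
        have "\<bar>n i j x\<bar> \<le> \<bar>n i j x0\<bar> + A x0 * A x * e x0 x" if "i \<in> I" "j \<in> I" for i j
          using bound[OF elim(2) x0 that] by linarith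
        then have "(\<Sum>i\<in>I. \<Sum>j\<in>I. \<bar>n i j x\<bar>) \<le> (\<Sum>i\<in>I. \<Sum>j\<in>I. \<bar>n i j x0\<bar> + A x0 * A x * e x0 x)"
          by (intro sum_mono)
        then have "A x \<le> (\<Sum>i\<in>I. \<Sum>j\<in>I. \<bar>n i j x0\<bar> + A x0 * A x * e x0 x)"
          by (simp only: A_def[of x, symmetric])
        also have "\<dots> = A x0 + A x * (N * A x0 * e x0 x)"
          by (simp add: sum.distrib A_def[of x0] N_def)
        also have "\<dots> \<le> A x0 + A x * (1 / 2)"
          using elim(1) A0[of x] by (intro add_left_mono mult_left_mono) auto
        finally have "A x \<le> 2 * A x0" by simp
        then have "A x0 * A x * e x0 x \<le> A x0 * (2 * A x0) * e x0 x"
          using A0 en by (intro mult_right_mono mult_left_mono) auto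
        with bound[OF elim(2) x0 ij] show ?case by simp
      qed
      have "((\<lambda>x. A x0 * (2 * A x0) * e x0 x) \<longlongrightarrow> A x0 * (2 * A x0) * 0) (at x0)"
        by (intro tendsto_mult tendsto_const e0)
      then show "((\<lambda>x. A x0 * (2 * A x0) * e x0 x) \<longlongrightarrow> 0) (at x0)" by simp
    qed
    then show ?thesis by (simp add: isCont_def LIM_zero_iff)
  qed
  let ?D = "\<lambda>i j x0 v. \<Sum>k\<in>I. \<Sum>l\<in>I. - n l j x0 * (n i k x0 * frechet_derivative (m k l) (at x0) v)"
  have der: "(n i j has_derivative ?D i j x0) (at x0)" if x0: "x0 \<in> S" and ij: "i \<in> I" "j \<in> I" for i j x0
  proof -
    \<comment> \<open>The right side of \<open>key\<close> is differentiated: the increments of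
      \<open>m\<close> vanish at \<open>x0\<close> and are multiplied by the continuous entries of
      \<open>n\<close>, the situation of \<open>has_derivative_mult_vanishing\<close>.\<close>
    have "((\<lambda>x. n i j x0 + (\<Sum>k\<in>I. \<Sum>l\<in>I. - n l j x0 * (n i k x * (m k l x - m k l x0))))
        has_derivative (\<lambda>v. 0 + ?D i j x0 v)) (at x0)"
    proof (intro has_derivative_add has_derivative_const has_derivative_sum has_derivative_mult_right
        has_derivative_mult_vanishing cont x0 ij)
      fix k l assume kl: "k \<in> I" "l \<in> I"
      show "((\<lambda>x. m k l x - m k l x0) has_derivative frechet_derivative (m k l) (at x0)) (at x0)"
        using has_derivative_diff[OF smooth_on_has_derivative[OF m[OF kl] S x0] has_derivative_const] by simp
    qed simp_all
    then have "((\<lambda>x. n i j x0 + (\<Sum>k\<in>I. \<Sum>l\<in>I. - n l j x0 * (n i k x * (m k l x - m k l x0))))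
        has_derivative ?D i j x0) (at x0)" by simp
    then show ?thesis
      by (rule has_derivative_transform_within_open[OF _ S x0])
         (use key[OF _ x0 ij] in \<open>simp add: sum_negf\<close>)
  qed
  have "Ck_on k (n i j) S" if "i \<in> I" "j \<in> I" for k i j
    using that
  proof (induction k arbitrary: i j)
    case 0
    then show ?case using cont by (simp add: continuous_at_imp_continuous_on)
  next
    case (Suc k)
    have "Ck_on k (\<lambda>x. frechet_derivative (n i j) (at x) v) S" for v
    proof (rule Ck_on_cong)
      have "Ck_on k (\<lambda>x. frechet_derivative (m a b) (at x) v) S" if "a \<in> I" "b \<in> I" for a b
        using smooth_on_frechet[OF m[OF that]] by (simp add: smooth_on_def)
      then have "Ck_on k (\<lambda>x. \<Sum>a\<in>I. \<Sum>b\<in>I. (-1) * n b j x * (n i a x * frechet_derivative (m a b) (at x) v)) S"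
        using Suc by (intro Ck_on_sum Ck_on_mult Ck_on_const S) auto
      then show "Ck_on k (\<lambda>x. ?D i j x v) S" by (simp only: mult_minus1)
      show "?D i j x v = frechet_derivative (n i j) (at x) v" if "x \<in> S" for x
        by (rule fun_cong[OF frechet_derivative_at[OF der[OF that Suc.prems]]])
    qed fact
    moreover have "n i j differentiable_on S"
      using der S Suc.prems by (auto simp: differentiable_on_eq_differentiable_at differentiable_def)
    ultimately show ?case by simp
  qed
  then show ?thesis using ij by (simp add: smooth_on_def)
qed

section \<open>Smooth functions and frames on a manifold\<close>

locale manifold =
  fixes A :: "('a::{t2_space,second_countable_topology}, 'e::euclidean_space) chart set"
  assumes atlas: "smooth_atlas A"
begin

lemma chart:
  assumes "(U, \<phi>) \<in> A"
  shows "open U" "open (\<phi> ` U)" "homeomorphism U (\<phi> ` U) \<phi> (inv_into U \<phi>)"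
  using atlas assms unfolding smooth_atlas_def by blast+

lemma chart_inv: "(U, \<phi>) \<in> A \<Longrightarrow> x \<in> U \<Longrightarrow> inv_into U \<phi> (\<phi> x) = x"
  using chart(3) by (fastforce simp: homeomorphism_def)

lemma chart_at:
  obtains U \<phi> where "(U, \<phi>) \<in> A" "p \<in> U"
proof -
  have "p \<in> (\<Union>(U, \<phi>)\<in>A. U)" using atlas by (simp add: smooth_atlas_def)
  then show ?thesis using that by auto
qed

lemma chart_open_image:
  assumes "(U, \<phi>) \<in> A" "open W" "W \<subseteq> U"
  shows "open (\<phi> ` W)"
proof -
  have "openin (top_of_set U) W"
    using assms chart(1) by (simp add: openin_open_eq)
  then have "openin (top_of_set (\<phi> ` U)) (\<phi> ` W)"
    by (rule homeomorphism_imp_open_map[OF chart(3)[OF assms(1)]])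
  then show ?thesis
    using chart(2)[OF assms(1)] by (simp add: openin_open_eq)
qed

lemma chart_open_preimage:
  assumes "(U, \<phi>) \<in> A" "open S"
  shows "open {x \<in> U. \<phi> x \<in> S}"
proof -
  have "continuous_on U \<phi>" using chart(3)[OF assms(1)] by (simp add: homeomorphism_def)
  from continuous_open_preimage[OF this chart(1)[OF assms(1)] assms(2)]
  have "open (U \<inter> \<phi> -` S)" .
  moreover have "U \<inter> \<phi> -` S = {x \<in> U. \<phi> x \<in> S}" by auto
  ultimately show ?thesis by simp
qed

lemma chart_ball:
  assumes "(U, \<phi>) \<in> A" "p \<in> W" "open W" "W \<subseteq> U"
  obtains r where "r > 0" "cball (\<phi> p) r \<subseteq> \<phi> ` W"
  using chart_open_image[OF assms(1,3,4)] assms(2) by (metis imageI open_contains_cball)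

lemma smooth_functions_open: "\<forall>(U, \<phi>)\<in>A. open (\<phi> ` U)"
  using chart(2) by auto

lemma smooth_chart: "f \<in> smooth_functions A \<Longrightarrow> (U, \<phi>) \<in> A \<Longrightarrow> smooth_on (f \<circ> inv_into U \<phi>) (\<phi> ` U)"
  unfolding smooth_functions_def by auto

text \<open>Transition maps are smooth, so smoothness near a point in one chart passes to every
  other chart around that point.\<close>

lemma smooth_functionsI:
  assumes "\<And>p. \<exists>U \<phi> W. (U, \<phi>) \<in> A \<and> open W \<and> p \<in> W \<and> W \<subseteq> U \<and> smooth_on (f \<circ> inv_into U \<phi>) (\<phi> ` W)"
  shows "f \<in> smooth_functions A"
  unfolding smooth_functions_def
proof clarify
  fix V \<psi> assume V: "(V, \<psi>) \<in> A"
  show "smooth_on (f \<circ> inv_into V \<psi>) (\<psi> ` V)"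
  proof (rule smooth_on_local[OF chart(2)[OF V]])
    fix y assume "y \<in> \<psi> ` V"
    then obtain p where p: "p \<in> V" "y = \<psi> p" by auto
    obtain U \<phi> W where W: "(U, \<phi>) \<in> A" "open W" "p \<in> W" "W \<subseteq> U" "smooth_on (f \<circ> inv_into U \<phi>) (\<phi> ` W)"
      using assms[of p] by blast
    have oT: "open (\<psi> ` (V \<inter> W))"
      using chart_open_image[OF V] chart(1)[OF V] W(2) by (simp add: open_Int)
    have "smooth_on (\<phi> \<circ> inv_into V \<psi>) (\<psi> ` (V \<inter> U))"
      using atlas V W(1) unfolding smooth_atlas_def by blast
    then have sm: "smooth_on (\<phi> \<circ> inv_into V \<psi>) (\<psi> ` (V \<inter> W))"
      by (rule smooth_on_subset) (use W(4) in auto)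
    have "smooth_on (\<lambda>x. (f \<circ> inv_into U \<phi>) ((\<phi> \<circ> inv_into V \<psi>) x)) (\<psi> ` (V \<inter> W))"
      by (rule smooth_on_compose[OF W(5) sm chart_open_image[OF W(1,2,4)] oT])
         (auto simp: chart_inv[OF V])
    then have "smooth_on (f \<circ> inv_into V \<psi>) (\<psi> ` (V \<inter> W))"
      by (rule smooth_on_cong[OF _ oT])
         (use W(4) chart_inv[OF V] chart_inv[OF W(1)] in auto)
    then show "\<exists>T. open T \<and> y \<in> T \<and> smooth_on (f \<circ> inv_into V \<psi>) T"
      using oT p W(3) by blast
  qed
qed

lemma smooth_functions_local:
  assumes "\<And>p. \<exists>h W. h \<in> smooth_functions A \<and> open W \<and> p \<in> W \<and> (\<forall>x\<in>W. f x = h x)"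
  shows "f \<in> smooth_functions A"
proof (rule smooth_functionsI)
  fix p
  obtain h W where h: "h \<in> smooth_functions A" "open W" "p \<in> W" "\<forall>x\<in>W. f x = h x"
    using assms[of p] by blast
  obtain U \<phi> where U: "(U, \<phi>) \<in> A" "p \<in> U" by (rule chart_at)
  have o: "open (W \<inter> U)" using h(2) chart(1)[OF U(1)] by auto
  have "smooth_on (h \<circ> inv_into U \<phi>) (\<phi> ` (W \<inter> U))"
    by (rule smooth_on_subset[OF smooth_chart[OF h(1) U(1)]]) auto
  then have "smooth_on (f \<circ> inv_into U \<phi>) (\<phi> ` (W \<inter> U))"
    by (rule smooth_on_cong[OF _ chart_open_image[OF U(1) o]])
       (use chart_inv[OF U(1)] h(4) in auto)
  then show "\<exists>U \<phi> W. (U, \<phi>) \<in> A \<and> open W \<and> p \<in> W \<and> W \<subseteq> U \<and> smooth_on (f \<circ> inv_into U \<phi>) (\<phi> ` W)"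
    using U h(3) o by (metis Int_iff inf_le2)
qed

lemma smooth_add: "f \<in> smooth_functions A \<Longrightarrow> h \<in> smooth_functions A \<Longrightarrow> (\<lambda>x. f x + h x) \<in> smooth_functions A"
  and smooth_mult: "f \<in> smooth_functions A \<Longrightarrow> h \<in> smooth_functions A \<Longrightarrow> (\<lambda>x. f x * h x) \<in> smooth_functions A"
  by (rule smooth_functions_add smooth_functions_mult; (assumption | rule smooth_functions_open))+

lemma smooth_const: "(\<lambda>x. c) \<in> smooth_functions A"
  by (rule smooth_functions_const)

lemma smooth_minus: "f \<in> smooth_functions A \<Longrightarrow> (\<lambda>x. - f x) \<in> smooth_functions A"
  using smooth_mult[OF smooth_const, of f "-1"] by simp

lemma smooth_diff: "f \<in> smooth_functions A \<Longrightarrow> h \<in> smooth_functions A \<Longrightarrow> (\<lambda>x. f x - h x) \<in> smooth_functions A"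
  using smooth_add[OF _ smooth_minus, of f h] by simp

lemma smooth_sum:
  "(\<And>i. i \<in> I \<Longrightarrow> f i \<in> smooth_functions A) \<Longrightarrow> (\<lambda>x. \<Sum>i\<in>I. f i x) \<in> smooth_functions A"
  by (induction I rule: infinite_finite_induct) (simp_all add: smooth_const smooth_add)

text \<open>The reciprocal is the inverse of a matrix of size one, so
  \<open>smooth_on_inverse_matrix\<close> applies with a singleton index set.\<close>

lemma smooth_divide:
  assumes f: "f \<in> smooth_functions A" and h: "h \<in> smooth_functions A" and "\<And>x. h x \<noteq> 0"
  shows "(\<lambda>x. f x / h x) \<in> smooth_functions A"
proof -
  have "smooth_on ((\<lambda>x. 1 / h x) \<circ> inv_into U \<phi>) (\<phi> ` U)" if U: "(U, \<phi>) \<in> A" for U \<phi>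
    using smooth_on_inverse_matrix[of "{()}" "\<phi> ` U" "\<lambda>_ _. h \<circ> inv_into U \<phi>"
        "\<lambda>_ _. (\<lambda>x. 1 / h x) \<circ> inv_into U \<phi>"] chart(2)[OF U] smooth_chart[OF h U] assms(3) by simp
  then have "(\<lambda>x. 1 / h x) \<in> smooth_functions A"
    unfolding smooth_functions_def by blast
  from smooth_mult[OF f this] show ?thesis by simp
qed

text \<open>A Euclidean bump is transported by a chart and extended by 0. The set \<open>C\<close>
  is the preimage of a closed ball; it is compact, hence closed in a Hausdorff space, so every point
  outside the chart has a neighbourhood, the complement of \<open>C\<close>, on which the extension
  is identically 0.\<close>

lemma bump:
  assumes W: "open W" and pW: "p \<in> W"
  obtains \<kappa> N C where "\<kappa> \<in> smooth_functions A" "open N" "p \<in> N" "N \<subseteq> C" "closed C" "C \<subseteq> W"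
    "\<And>x. x \<in> N \<Longrightarrow> \<kappa> x = 1" "\<And>x. x \<notin> C \<Longrightarrow> \<kappa> x = 0"
proof -
  obtain U \<phi> where U: "(U, \<phi>) \<in> A" "p \<in> U" by (rule chart_at)
  note inv = chart_inv[OF U(1)]
  have o: "open (W \<inter> U)" using W chart(1)[OF U(1)] by auto
  obtain r where r: "r > 0" "cball (\<phi> p) r \<subseteq> \<phi> ` (W \<inter> U)"
    using chart_ball[OF U(1) _ o] U(2) pW by auto
  obtain b :: "'e \<Rightarrow> real" and \<delta> where b: "smooth_on b UNIV" "\<And>x. x \<notin> ball (\<phi> p) r \<Longrightarrow> b x = 0"
    "\<delta> > 0" "\<And>x. x \<in> ball (\<phi> p) \<delta> \<Longrightarrow> b x = 1"
    using euclidean_bump[OF r(1)] by metis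
  define C where "C = inv_into U \<phi> ` cball (\<phi> p) r"
  have "continuous_on (\<phi> ` U) (inv_into U \<phi>)"
    using chart(3)[OF U(1)] by (simp add: homeomorphism_def)
  then have "continuous_on (cball (\<phi> p) r) (inv_into U \<phi>)"
    by (rule continuous_on_subset) (use r(2) in auto)
  then have "compact C" unfolding C_def by (rule compact_continuous_image) simp
  then have clC: "closed C" by (rule compact_imp_closed)
  have CW: "C \<subseteq> W \<inter> U"
    using r(2) inv by (fastforce simp: C_def)
  define N where "N = {x \<in> U. \<phi> x \<in> ball (\<phi> p) (min \<delta> r)}"
  have oN: "open N" unfolding N_def by (rule chart_open_preimage[OF U(1) open_ball])
  have inC: "x \<in> C" if "x \<in> U" "\<phi> x \<in> ball (\<phi> p) r" for x
    unfolding C_def using that inv[OF that(1)] by (intro image_eqI[of _ _ "\<phi> x"]) auto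
  define \<kappa> where "\<kappa> x = (if x \<in> U then b (\<phi> x) else 0)" for x
  have \<kappa>0: "\<kappa> x = 0" if "x \<notin> C" for x
    using that inC[of x] b(2)[of "\<phi> x"] by (auto simp: \<kappa>_def)
  have "\<kappa> \<in> smooth_functions A"
  proof (rule smooth_functionsI)
    fix q
    obtain V \<psi> where V: "(V, \<psi>) \<in> A" "q \<in> V" by (rule chart_at)
    show "\<exists>U \<phi> W. (U, \<phi>) \<in> A \<and> open W \<and> q \<in> W \<and> W \<subseteq> U \<and> smooth_on (\<kappa> \<circ> inv_into U \<phi>) (\<phi> ` W)"
    proof (cases "q \<in> U")
      case True
      have "smooth_on (\<kappa> \<circ> inv_into U \<phi>) (\<phi> ` U)"
        by (rule smooth_on_cong[OF smooth_on_subset[OF b(1)] chart(2)[OF U(1)]])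
           (auto simp: \<kappa>_def inv)
      then show ?thesis using True U(1) chart(1)[OF U(1)] by blast
    next
      case False
      have oV: "open (V - C)" using chart(1)[OF V(1)] clC by (rule open_Diff)
      have "smooth_on (\<kappa> \<circ> inv_into V \<psi>) (\<psi> ` (V - C))"
        by (rule smooth_on_cong[OF smooth_on_const chart_open_image[OF V(1) oV]])
           (use chart_inv[OF V(1)] \<kappa>0 in auto)
      then show ?thesis using False V CW oV by blast
    qed
  qed
  then show ?thesis
  proof (rule that)
    show "N \<subseteq> C" using inC by (auto simp: N_def)
    show "\<kappa> x = 1" if "x \<in> N" for x using that b(4) by (auto simp: N_def \<kappa>_def)
  qed (use oN U(2) b(3) r(1) clC CW \<kappa>0 in \<open>auto simp: N_def\<close>)
qed

text \<open>Tangent vectors act on global functions only. Multiplying a function given in a chart by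
  a cut-off function produces a global one with the same germ at p.\<close>

lemma smooth_extend:
  assumes U: "(U, \<phi>) \<in> A" and W: "open W" "p \<in> W" "W \<subseteq> U" and u: "smooth_on u (\<phi> ` W)"
  obtains h N where "h \<in> smooth_functions A" "open N" "p \<in> N" "N \<subseteq> W" "\<And>x. x \<in> N \<Longrightarrow> h x = u (\<phi> x)"
proof -
  note inv = chart_inv[OF U(1)]
  obtain \<kappa> N C where \<kappa>: "\<kappa> \<in> smooth_functions A" "open N" "p \<in> N" "N \<subseteq> C" "closed C" "C \<subseteq> W"
    "\<And>x. x \<in> N \<Longrightarrow> \<kappa> x = 1" "\<And>x. x \<notin> C \<Longrightarrow> \<kappa> x = 0"
    using bump[OF W(1,2)] by metis
  define h where "h x = (if x \<in> W then \<kappa> x * u (\<phi> x) else 0)" for x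
  have "h \<in> smooth_functions A"
  proof (rule smooth_functionsI)
    fix q
    obtain V \<psi> where V: "(V, \<psi>) \<in> A" "q \<in> V" by (rule chart_at)
    show "\<exists>U \<phi> W. (U, \<phi>) \<in> A \<and> open W \<and> q \<in> W \<and> W \<subseteq> U \<and> smooth_on (h \<circ> inv_into U \<phi>) (\<phi> ` W)"
    proof (cases "q \<in> W")
      case True
      have o: "open (\<phi> ` W)" by (rule chart_open_image[OF U W(1,3)])
      have "smooth_on (\<kappa> \<circ> inv_into U \<phi>) (\<phi> ` W)"
        by (rule smooth_on_subset[OF smooth_chart[OF \<kappa>(1) U]]) (use W(3) in auto)
      from smooth_on_mult[OF this u o]
      have "smooth_on (h \<circ> inv_into U \<phi>) (\<phi> ` W)"
        by (rule smooth_on_cong[OF _ o]) (use W(3) inv in \<open>auto simp: h_def subset_iff\<close>)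
      then show ?thesis using True U W by blast
    next
      case False
      have oV: "open (V - C)" using chart(1)[OF V(1)] \<kappa>(5) by (rule open_Diff)
      have "smooth_on (h \<circ> inv_into V \<psi>) (\<psi> ` (V - C))"
        by (rule smooth_on_cong[OF smooth_on_const chart_open_image[OF V(1) oV]])
           (use chart_inv[OF V(1)] \<kappa>(8) in \<open>auto simp: h_def\<close>)
      then show ?thesis using False V \<kappa>(6) oV by blast
    qed
  qed
  then show ?thesis
    by (rule that[of h N]) (use \<kappa> in \<open>auto simp: h_def\<close>)
qed


subsection \<open>Tangent vectors\<close>

lemma tangent_linear:
  "v \<in> tangent_space A p \<Longrightarrow> f \<in> smooth_functions A \<Longrightarrow> h \<in> smooth_functions A \<Longrightarrow>
    v (\<lambda>x. a * f x + b * h x) = a * v f + b * v h"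
  unfolding tangent_space_def by blast

lemma tangent_mult:
  "v \<in> tangent_space A p \<Longrightarrow> f \<in> smooth_functions A \<Longrightarrow> h \<in> smooth_functions A \<Longrightarrow>
    v (\<lambda>x. f x * h x) = f p * v h + h p * v f"
  unfolding tangent_space_def by blast

lemma tangent_add:
  "v \<in> tangent_space A p \<Longrightarrow> f \<in> smooth_functions A \<Longrightarrow> h \<in> smooth_functions A \<Longrightarrow>
    v (\<lambda>x. f x + h x) = v f + v h"
  using tangent_linear[of v p f h 1 1] by simp

lemma tangent_diff:
  "v \<in> tangent_space A p \<Longrightarrow> f \<in> smooth_functions A \<Longrightarrow> h \<in> smooth_functions A \<Longrightarrow>
    v (\<lambda>x. f x - h x) = v f - v h"
  using tangent_linear[of v p f h 1 "-1"] by simp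

lemma tangent_minus:
  "v \<in> tangent_space A p \<Longrightarrow> f \<in> smooth_functions A \<Longrightarrow> v (\<lambda>x. - f x) = - v f"
  using tangent_linear[of v p f f "-1" 0] by simp

lemma tangent_cmult:
  "v \<in> tangent_space A p \<Longrightarrow> f \<in> smooth_functions A \<Longrightarrow> v (\<lambda>x. c * f x) = c * v f"
  using tangent_linear[of v p f f c 0] by simp

lemma tangent_sum:
  assumes v: "v \<in> tangent_space A p" and "\<And>i. i \<in> I \<Longrightarrow> f i \<in> smooth_functions A"
  shows "v (\<lambda>x. \<Sum>i\<in>I. f i x) = (\<Sum>i\<in>I. v (f i))"
  using assms(2)
  by (induction I rule: infinite_finite_induct)
     (simp_all add: tangent_space_const[OF v] tangent_add[OF v] smooth_sum)

lemma tangent_spaceI: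
  assumes "\<And>f h a b. f \<in> smooth_functions A \<Longrightarrow> h \<in> smooth_functions A \<Longrightarrow>
      v (\<lambda>x. a * f x + b * h x) = a * v f + b * v h"
    and "\<And>f h. f \<in> smooth_functions A \<Longrightarrow> h \<in> smooth_functions A \<Longrightarrow>
      v (\<lambda>x. f x * h x) = f p * v h + h p * v f"
    and "\<And>f. f \<notin> smooth_functions A \<Longrightarrow> v f = 0"
  shows "v \<in> tangent_space A p"
  using assms unfolding tangent_space_def by blast

lemma tangent_space_combine:
  assumes u: "u \<in> tangent_space A p" and v: "v \<in> tangent_space A p"
  shows "(\<lambda>f. a * u f + b * v f) \<in> tangent_space A p"
  by (rule tangent_spaceI)
     (simp_all add: tangent_linear[OF u] tangent_linear[OF v] tangent_mult[OF u] tangent_mult[OF v]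
       tangent_space_nonsmooth[OF u] tangent_space_nonsmooth[OF v] algebra_simps)

lemma tangent_space_0: "(\<lambda>f. 0) \<in> tangent_space A p"
  by (rule tangent_spaceI) simp_all

lemma tangent_space_sum:
  "(\<And>i. i \<in> I \<Longrightarrow> v i \<in> tangent_space A p) \<Longrightarrow> (\<lambda>f. \<Sum>i\<in>I. c i * v i f) \<in> tangent_space A p"
proof (induction I rule: infinite_finite_induct)
  case (insert i I)
  then have "(\<lambda>f. c i * v i f + 1 * (\<Sum>i\<in>I. c i * v i f)) \<in> tangent_space A p"
    by (intro tangent_space_combine) auto
  then show ?case using insert by simp
qed (simp_all add: tangent_space_0)

text \<open>For a cut-off function \<kappa> supported where f = h, the product \<kappa> (f - h) is
  0. The Leibniz rule at p, where \<kappa> = 1 and f - h = 0, then leaves v(f - h) = 0.\<close>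

lemma tangent_local:
  assumes v: "v \<in> tangent_space A p" and f: "f \<in> smooth_functions A" and h: "h \<in> smooth_functions A"
    and N: "open N" "p \<in> N" and eq: "\<And>x. x \<in> N \<Longrightarrow> f x = h x"
  shows "v f = v h"
proof -
  obtain \<kappa> M C where \<kappa>: "\<kappa> \<in> smooth_functions A" "open M" "p \<in> M" "M \<subseteq> C" "closed C" "C \<subseteq> N"
    "\<And>x. x \<in> M \<Longrightarrow> \<kappa> x = 1" "\<And>x. x \<notin> C \<Longrightarrow> \<kappa> x = 0"
    using bump[OF N] by metis
  have "(\<lambda>x. \<kappa> x * (f x - h x)) = (\<lambda>x. 0)"
    using eq \<kappa>(6,8) by (fastforce simp: fun_eq_iff)
  then have "\<kappa> p * v (\<lambda>x. f x - h x) + (f p - h p) * v \<kappa> = 0"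
    using tangent_mult[OF v \<kappa>(1) smooth_diff[OF f h]] tangent_space_const[OF v, of 0] by simp
  then show ?thesis using \<kappa>(3,7) eq N(2) by (simp add: tangent_diff[OF v f h])
qed

text \<open>By Hadamard's lemma F agrees near p with F(p) plus the sum of (x_b - x_b(p)) G_b, where
  the G_b are globalised coefficients. The first factors vanish at p, so the Leibniz rule retains
  only G_b(p) v(x_b), and G_b(p) is the partial derivative of F. Thus a derivation is determined by
  its values on the coordinates.\<close>

lemma tangent_hadamard:
  assumes U: "(U, \<phi>) \<in> A" and N: "open N" "p \<in> N" "N \<subseteq> U"
    and x: "\<And>b. b \<in> Basis \<Longrightarrow> x b \<in> smooth_functions A"
    and eq: "\<And>b y. b \<in> Basis \<Longrightarrow> y \<in> N \<Longrightarrow> x b y = \<phi> y \<bullet> b"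
    and v: "v \<in> tangent_space A p" and F: "F \<in> smooth_functions A"
  shows "v F = (\<Sum>b\<in>Basis. frechet_derivative (F \<circ> inv_into U \<phi>) (at (\<phi> p)) b * v (x b))"
proof -
  note inv = chart_inv[OF U(1)]
  obtain r where r: "r > 0" "cball (\<phi> p) r \<subseteq> \<phi> ` N"
    using chart_ball[OF U N(2,1,3)] by blast
  define W where "W = N \<inter> {y \<in> U. \<phi> y \<in> ball (\<phi> p) r}"
  have W: "open W" "p \<in> W" "W \<subseteq> U"
    using N r(1) chart_open_preimage[OF U open_ball] by (auto simp: W_def)
  have Wr: "\<phi> ` W \<subseteq> ball (\<phi> p) r" by (auto simp: W_def)
  have smF: "smooth_on (F \<circ> inv_into U \<phi>) (ball (\<phi> p) r)"
    by (rule smooth_on_subset[OF smooth_chart[OF F U]]) (use r(2) image_mono[OF N(3), of \<phi>] ball_subset_cball[of "\<phi> p" r] in blast)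
  obtain g where g: "\<And>b. b \<in> Basis \<Longrightarrow> smooth_on (g b) (ball (\<phi> p) r)"
    "\<And>y. y \<in> ball (\<phi> p) r \<Longrightarrow> (F \<circ> inv_into U \<phi>) y = (F \<circ> inv_into U \<phi>) (\<phi> p) + (\<Sum>b\<in>Basis. ((y - \<phi> p) \<bullet> b) * g b y)"
    "\<And>b. b \<in> Basis \<Longrightarrow> g b (\<phi> p) = frechet_derivative (F \<circ> inv_into U \<phi>) (at (\<phi> p)) b"
    by (rule hadamard[OF smF r(1)]) (rule that)
  have "\<exists>hM. fst hM \<in> smooth_functions A \<and> open (snd hM) \<and> p \<in> snd hM \<and> snd hM \<subseteq> W \<and>
      (\<forall>y\<in>snd hM. fst hM y = g b (\<phi> y))" if b: "b \<in> Basis" for b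
  proof -
    obtain h M where "h \<in> smooth_functions A" "open M" "p \<in> M" "M \<subseteq> W" "\<And>y. y \<in> M \<Longrightarrow> h y = g b (\<phi> y)"
      using smooth_extend[OF U W smooth_on_subset[OF g(1)[OF b] Wr]] by blast
    then show ?thesis by (intro exI[of _ "(h, M)"]) simp
  qed
  then have "\<forall>b\<in>Basis. \<exists>hM. fst hM \<in> smooth_functions A \<and> open (snd hM) \<and> p \<in> snd hM \<and> snd hM \<subseteq> W \<and>
      (\<forall>y\<in>snd hM. fst hM y = g b (\<phi> y))" by blast
  from bchoice[OF this] obtain GM where GM: "\<forall>b\<in>Basis. fst (GM b) \<in> smooth_functions A \<and>
      open (snd (GM b)) \<and> p \<in> snd (GM b) \<and> snd (GM b) \<subseteq> W \<and> (\<forall>y\<in>snd (GM b). fst (GM b) y = g b (\<phi> y))"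
    by blast
  define G M where "G b = fst (GM b)" and "M b = snd (GM b)" for b
  have G: "\<And>b. b \<in> Basis \<Longrightarrow> G b \<in> smooth_functions A"
    and M: "\<And>b. b \<in> Basis \<Longrightarrow> open (M b) \<and> p \<in> M b \<and> M b \<subseteq> W \<and> (\<forall>y\<in>M b. G b y = g b (\<phi> y))"
    using GM by (simp_all add: G_def M_def)
  define K where "K = W \<inter> (\<Inter>b\<in>Basis. M b)"
  have K: "open K" "p \<in> K"
    unfolding K_def using M W by (intro open_Int open_INT ballI; simp) (use M W in blast)
  let ?H = "\<lambda>y. F p + (\<Sum>b\<in>Basis. (x b y - x b p) * G b y)"
  have sm: "(\<lambda>y. \<Sum>b\<in>Basis. (x b y - x b p) * G b y) \<in> smooth_functions A"
    by (intro smooth_sum smooth_mult smooth_diff x G smooth_const)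
  have "v F = v ?H"
  proof (rule tangent_local[OF v F _ K])
    show "?H \<in> smooth_functions A" by (intro smooth_add smooth_const sm)
    fix y assume y: "y \<in> K"
    then have "y \<in> N" "y \<in> U" "\<phi> y \<in> ball (\<phi> p) r" by (auto simp: K_def W_def)
    have "F y = F p + (\<Sum>b\<in>Basis. ((\<phi> y - \<phi> p) \<bullet> b) * g b (\<phi> y))"
      using g(2)[OF \<open>\<phi> y \<in> _\<close>] inv[OF \<open>y \<in> U\<close>] inv[of p] W(2,3) by auto
    also have "\<dots> = ?H y"
      using y M eq[OF _ \<open>y \<in> N\<close>] eq[OF _ N(2)] by (simp add: K_def inner_diff_left)
    finally show "F y = ?H y" .
  qed
  also have "\<dots> = v (\<lambda>y. \<Sum>b\<in>Basis. (x b y - x b p) * G b y)"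
    by (simp add: tangent_add[OF v smooth_const sm] tangent_space_const[OF v])
  also have "\<dots> = (\<Sum>b\<in>Basis. v (\<lambda>y. (x b y - x b p) * G b y))"
    by (intro tangent_sum[OF v] smooth_mult smooth_diff x G smooth_const)
  also have "\<dots> = (\<Sum>b\<in>Basis. frechet_derivative (F \<circ> inv_into U \<phi>) (at (\<phi> p)) b * v (x b))"
  proof (rule sum.cong[OF refl])
    fix b :: 'e assume b: "b \<in> Basis"
    have "G b p = frechet_derivative (F \<circ> inv_into U \<phi>) (at (\<phi> p)) b"
      using M[OF b] g(3)[OF b] by auto
    then show "v (\<lambda>y. (x b y - x b p) * G b y) = frechet_derivative (F \<circ> inv_into U \<phi>) (at (\<phi> p)) b * v (x b)"
      by (simp add: tangent_mult[OF v smooth_diff[OF x[OF b] smooth_const] G[OF b]]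
          tangent_diff[OF v x[OF b] smooth_const] tangent_space_const[OF v])
  qed
  finally show ?thesis .
qed

section \<open>Vector fields and coordinate frames\<close>

lemma vector_fieldD:
  "X \<in> vector_fields A \<Longrightarrow> X p \<in> tangent_space A p"
  "X \<in> vector_fields A \<Longrightarrow> f \<in> smooth_functions A \<Longrightarrow> (\<lambda>p. X p f) \<in> smooth_functions A"
  by (auto simp: vector_fields_def)

end

definition frame_on ::
  "('a, 'e::euclidean_space) chart set \<Rightarrow> 'i set \<Rightarrow> ('i \<Rightarrow> 'a::topological_space \<Rightarrow> real) \<Rightarrow> ('i \<Rightarrow> 'a vfield) \<Rightarrow> 'a set \<Rightarrow> bool" where
  "frame_on A I x X W \<longleftrightarrow> finite I \<and> open W \<and> (\<forall>i\<in>I. x i \<in> smooth_functions A \<and> X i \<in> vector_fields A) \<and>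
     (\<forall>r\<in>W. (\<forall>v\<in>tangent_space A r. \<forall>F. v F = (\<Sum>i\<in>I. v (x i) * X i r F)) \<and>
        (\<forall>i\<in>I. \<forall>j\<in>I. X i r (x j) = (if i = j then 1 else 0)))"

context manifold
begin

lemma coordinate_frame:
  assumes U: "(U, \<phi>) \<in> A" and N: "open N" "p \<in> N" "N \<subseteq> U"
    and x: "\<And>b. b \<in> Basis \<Longrightarrow> x b \<in> smooth_functions A"
    and eq: "\<And>b y. b \<in> Basis \<Longrightarrow> y \<in> N \<Longrightarrow> x b y = \<phi> y \<bullet> b"
  obtains X W where "frame_on A Basis x X W" "p \<in> W" "W \<subseteq> N"
proof -
  note inv = chart_inv[OF U(1)]
  obtain \<kappa> M C where \<kappa>: "\<kappa> \<in> smooth_functions A" "open M" "p \<in> M" "M \<subseteq> C" "closed C" "C \<subseteq> N"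
    "\<And>x. x \<in> M \<Longrightarrow> \<kappa> x = 1" "\<And>x. x \<notin> C \<Longrightarrow> \<kappa> x = 0"
    using bump[OF N(1,2)] by metis
  define d where "d F y = frechet_derivative (F \<circ> inv_into U \<phi>) (at y)" for F :: "'a \<Rightarrow> real" and y
  have der: "((F \<circ> inv_into U \<phi>) has_derivative d F (\<phi> r)) (at (\<phi> r))"
    if "F \<in> smooth_functions A" "r \<in> U" for F r
    unfolding d_def using that
    by (intro smooth_on_has_derivative[OF smooth_chart[OF _ U] chart(2)[OF U]]) auto
  \<comment> \<open>The partial derivative is multiplied by the cut-off function to make it a global
    field; on \<open>M\<close>, where \<kappa> = 1, it is the coordinate field itself. The value 0
    on non-smooth functions is the convention of \<open>tangent_space\<close>.\<close>
  define X where "X b r F = (if r \<in> U \<and> F \<in> smooth_functions A then \<kappa> r * d F (\<phi> r) b else 0)"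
    for b :: 'e and r and F :: "'a \<Rightarrow> real"
  have dlin: "d (\<lambda>x. a * f x + b * h x) (\<phi> r) = (\<lambda>w. a * d f (\<phi> r) w + b * d h (\<phi> r) w)"
    if "f \<in> smooth_functions A" "h \<in> smooth_functions A" "r \<in> U" for f h a b r
  proof -
    have "((\<lambda>y. a * (f \<circ> inv_into U \<phi>) y + b * (h \<circ> inv_into U \<phi>) y) has_derivative
        (\<lambda>w. a * d f (\<phi> r) w + b * d h (\<phi> r) w)) (at (\<phi> r))"
      by (intro has_derivative_add has_derivative_mult_right der that)
    from frechet_derivative_at[OF this] show ?thesis by (simp add: d_def o_def)
  qed
  have dmul: "d (\<lambda>x. f x * h x) (\<phi> r) = (\<lambda>w. f r * d h (\<phi> r) w + d f (\<phi> r) w * h r)"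
    if "f \<in> smooth_functions A" "h \<in> smooth_functions A" "r \<in> U" for f h r
  proof -
    have "((\<lambda>y. (f \<circ> inv_into U \<phi>) y * (h \<circ> inv_into U \<phi>) y) has_derivative
        (\<lambda>w. (f \<circ> inv_into U \<phi>) (\<phi> r) * d h (\<phi> r) w + d f (\<phi> r) w * (h \<circ> inv_into U \<phi>) (\<phi> r))) (at (\<phi> r))"
      by (intro has_derivative_mult der that)
    from frechet_derivative_at[OF this] show ?thesis using inv[OF that(3)] by (simp add: d_def o_def)
  qed
  have XT: "X b r \<in> tangent_space A r" for b r
    by (rule tangent_spaceI)
       (auto simp: X_def dlin dmul smooth_add smooth_mult smooth_const algebra_simps)
  have XV: "X b \<in> vector_fields A" for b
    unfolding vector_fields_def
  proof (intro CollectI conjI ballI allI)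
    fix F assume F: "F \<in> smooth_functions A"
    show "(\<lambda>p. X b p F) \<in> smooth_functions A"
    proof (rule smooth_functionsI)
      fix q
      obtain V \<psi> where V: "(V, \<psi>) \<in> A" "q \<in> V" by (rule chart_at)
      show "\<exists>U \<phi> W. (U, \<phi>) \<in> A \<and> open W \<and> q \<in> W \<and> W \<subseteq> U \<and> smooth_on ((\<lambda>p. X b p F) \<circ> inv_into U \<phi>) (\<phi> ` W)"
      proof (cases "q \<in> U")
        case True
        have "smooth_on (\<lambda>y. (\<kappa> \<circ> inv_into U \<phi>) y * d F y b) (\<phi> ` U)"
          unfolding d_def
          by (intro smooth_on_mult smooth_on_frechet smooth_chart \<kappa> U F chart(2)[OF U])
        then have "smooth_on ((\<lambda>p. X b p F) \<circ> inv_into U \<phi>) (\<phi> ` U)"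
          by (rule smooth_on_cong[OF _ chart(2)[OF U]]) (auto simp: X_def inv F)
        then show ?thesis using True U chart(1)[OF U] by blast
      next
        case False
        have oV: "open (V - C)" using chart(1)[OF V(1)] \<kappa>(5) by (rule open_Diff)
        have "smooth_on ((\<lambda>p. X b p F) \<circ> inv_into V \<psi>) (\<psi> ` (V - C))"
          by (rule smooth_on_cong[OF smooth_on_const chart_open_image[OF V(1) oV]])
             (use chart_inv[OF V(1)] \<kappa>(8) in \<open>auto simp: X_def\<close>)
        then show ?thesis using False V \<kappa>(6) N(3) oV by blast
      qed
    qed
  qed (rule XT)
  have MN: "M \<subseteq> N" "M \<subseteq> U" using \<kappa>(4,6) N(3) by auto
  have "frame_on A Basis x X M"
    unfolding frame_on_def
  proof (intro conjI ballI allI)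
    fix r v F assume r: "r \<in> M" and v: "v \<in> tangent_space A r"
    show "v F = (\<Sum>i\<in>Basis. v (x i) * X i r F)"
    proof (cases "F \<in> smooth_functions A")
      case True
      have rN: "r \<in> N" "r \<in> U" using r MN by auto
      have "v F = (\<Sum>b\<in>Basis. frechet_derivative (F \<circ> inv_into U \<phi>) (at (\<phi> r)) b * v (x b))"
        by (rule tangent_hadamard[OF U N(1) rN(1) N(3) x eq v True])
      then show ?thesis using True rN \<kappa>(7)[OF r] by (simp add: X_def d_def mult.commute)
    next
      case False
      then show ?thesis using tangent_space_nonsmooth[OF v] by (simp add: X_def)
    qed
  next
    fix r and i j :: 'e assume r: "r \<in> M" and ij: "i \<in> Basis" "j \<in> Basis"
    have rN: "r \<in> N" "r \<in> U" using r MN by auto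
    have "((\<lambda>y. y \<bullet> j) has_derivative (\<lambda>w. w \<bullet> j)) (at (\<phi> r))"
      by (intro derivative_intros)
    then have "((x j \<circ> inv_into U \<phi>) has_derivative (\<lambda>w. w \<bullet> j)) (at (\<phi> r))"
      by (rule has_derivative_transform_within_open[OF _ chart_open_image[OF U N(1,3)]])
         (use rN N(3) inv eq[OF ij(2)] in auto)
    from frechet_derivative_at[OF this] have "d (x j) (\<phi> r) = (\<lambda>w. w \<bullet> j)"
      unfolding d_def by (rule sym)
    then show "X i r (x j) = (if i = j then 1 else 0)"
      using rN x[OF ij(2)] \<kappa>(7)[OF r] ij by (simp add: X_def inner_Basis)
  qed (use x XV \<kappa>(2) in auto)
  then show ?thesis using that \<kappa>(3) MN by blast
qed

lemma coordinates_at: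
  assumes U: "(U, \<phi>) \<in> A" "p \<in> U"
  obtains x N where "open N" "p \<in> N" "N \<subseteq> U" "\<And>b. b \<in> Basis \<Longrightarrow> x b \<in> smooth_functions A"
    "\<And>b y. b \<in> Basis \<Longrightarrow> y \<in> N \<Longrightarrow> x b y = \<phi> y \<bullet> b"
proof -
  have "\<exists>h M. h \<in> smooth_functions A \<and> open M \<and> p \<in> M \<and> M \<subseteq> U \<and> (\<forall>y\<in>M. h y = \<phi> y \<bullet> b)" for b
  proof -
    obtain h M where "h \<in> smooth_functions A" "open M" "p \<in> M" "M \<subseteq> U" "\<And>y. y \<in> M \<Longrightarrow> h y = \<phi> y \<bullet> b"
      using smooth_extend[OF U(1) chart(1)[OF U(1)] U(2) order_refl
          smooth_on_bounded_linear[OF bounded_linear_inner_left[of b]]] by blast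
    then show ?thesis by blast
  qed
  then obtain x M where x: "\<And>b. x b \<in> smooth_functions A"
    and M: "\<And>b. open (M b) \<and> p \<in> M b \<and> M b \<subseteq> U \<and> (\<forall>y\<in>M b. x b y = \<phi> y \<bullet> b)"
    by metis
  show ?thesis
    by (rule that[of "U \<inter> (\<Inter>b\<in>Basis. M b)" x]) (use M x U chart(1)[OF U(1)] in \<open>auto intro!: open_Int open_INT\<close>)
qed

lemma frame_at:
  obtains x X W where "frame_on A (Basis :: 'e set) x X W" "p \<in> W"
proof -
  obtain U \<phi> where U: "(U, \<phi>) \<in> A" "p \<in> U" by (rule chart_at)
  obtain x N where N: "open N" "p \<in> N" "N \<subseteq> U" "\<And>b. b \<in> Basis \<Longrightarrow> x b \<in> smooth_functions A"
    "\<And>b y. b \<in> Basis \<Longrightarrow> y \<in> N \<Longrightarrow> x b y = \<phi> y \<bullet> b"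
    using coordinates_at[OF U] by metis
  show ?thesis
    by (rule coordinate_frame[OF U(1) N]) (auto intro: that)
qed

end

section \<open>Tensor calculus\<close>

lemma sum_form_apply: "(\<Sum>i\<in>I. f i) p v = (\<Sum>i\<in>I. (f i :: 'a form) p v)"
  by (induction I rule: infinite_finite_induct) (simp_all add: zero_fun_def plus_fun_def)

lemma exterior_d_apply: "v \<in> tangent_space A p \<Longrightarrow> exterior_d A F p v = v F"
  by (simp add: exterior_d_def)

context manifold
begin

lemma frame_onD:
  assumes "frame_on A I x X W"
  shows "finite I" "open W" "i \<in> I \<Longrightarrow> x i \<in> smooth_functions A" "i \<in> I \<Longrightarrow> X i \<in> vector_fields A"
    "r \<in> W \<Longrightarrow> v \<in> tangent_space A r \<Longrightarrow> v F = (\<Sum>i\<in>I. v (x i) * X i r F)"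
    "r \<in> W \<Longrightarrow> i \<in> I \<Longrightarrow> j \<in> I \<Longrightarrow> X i r (x j) = (if i = j then 1 else 0)"
proof -
  show "finite I" using assms unfolding frame_on_def by (elim conjE)
  show "open W" using assms unfolding frame_on_def by (elim conjE)
  have I: "\<forall>i\<in>I. x i \<in> smooth_functions A \<and> X i \<in> vector_fields A"
    using assms unfolding frame_on_def by (elim conjE)
  show "x i \<in> smooth_functions A" if "i \<in> I" by (rule conjunct1[OF bspec[OF I that]])
  show "X i \<in> vector_fields A" if "i \<in> I" by (rule conjunct2[OF bspec[OF I that]])
  have W: "\<forall>r\<in>W. (\<forall>v\<in>tangent_space A r. \<forall>F. v F = (\<Sum>i\<in>I. v (x i) * X i r F)) \<and>
        (\<forall>i\<in>I. \<forall>j\<in>I. X i r (x j) = (if i = j then 1 else 0))"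
    using assms unfolding frame_on_def by (elim conjE)
  show "v F = (\<Sum>i\<in>I. v (x i) * X i r F)" if "r \<in> W" "v \<in> tangent_space A r"
    by (rule spec[OF bspec[OF conjunct1[OF bspec[OF W that(1)]] that(2)]])
  show "X i r (x j) = (if i = j then 1 else 0)" if "r \<in> W" "i \<in> I" "j \<in> I"
    by (rule bspec[OF bspec[OF conjunct2[OF bspec[OF W that(1)]] that(2)] that(3)])
qed

section \<open>Vector fields and 1-forms as modules over the smooth functions\<close>

lemma vector_fieldI:
  "(\<And>p. X p \<in> tangent_space A p) \<Longrightarrow> (\<And>f. f \<in> smooth_functions A \<Longrightarrow> (\<lambda>p. X p f) \<in> smooth_functions A)
    \<Longrightarrow> X \<in> vector_fields A"
  by (simp add: vector_fields_def)

lemma vf_combine: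
  assumes "X \<in> vector_fields A" "Y \<in> vector_fields A" "f \<in> smooth_functions A" "h \<in> smooth_functions A"
  shows "(\<lambda>p F. f p * X p F + h p * Y p F) \<in> vector_fields A"
  by (intro vector_fieldI tangent_space_combine smooth_add smooth_mult vector_fieldD(1)[OF assms(1)]
      vector_fieldD(1)[OF assms(2)] vector_fieldD(2)[OF assms(1)] vector_fieldD(2)[OF assms(2)] assms(3,4))

lemma vf_smult:
  assumes "X \<in> vector_fields A" "f \<in> smooth_functions A"
  shows "(\<lambda>p F. f p * X p F) \<in> vector_fields A"
  using vf_combine[OF assms(1,1,2) smooth_const[of 0]] by simp

lemma vf_sum:
  assumes "\<And>i. i \<in> I \<Longrightarrow> X i \<in> vector_fields A" "\<And>i. i \<in> I \<Longrightarrow> f i \<in> smooth_functions A"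
  shows "(\<lambda>p F. \<Sum>i\<in>I. f i p * X i p F) \<in> vector_fields A"
  by (intro vector_fieldI tangent_space_sum smooth_sum smooth_mult vector_fieldD(1)[OF assms(1)]
      vector_fieldD(2)[OF assms(1)] assms(2))

text \<open>The extension has constant coefficients v(x_i) with respect to a frame at p.\<close>

lemma vf_extend:
  assumes "v \<in> tangent_space A p"
  obtains X where "X \<in> vector_fields A" "X p = v"
proof -
  obtain x X W where F: "frame_on A (Basis :: 'e set) x X W" "p \<in> W" by (rule frame_at)
  show ?thesis
    by (rule that[of "\<lambda>q F. \<Sum>i\<in>Basis. (\<lambda>_. v (x i)) q * X i q F"])
       (auto intro!: vf_sum smooth_const frame_onD(4)[OF F(1)] ext frame_onD(5)[OF F(1,2) assms, symmetric])
qed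

lemma cotangent_linear:
  "\<xi> \<in> cotangent_space A p \<Longrightarrow> v \<in> tangent_space A p \<Longrightarrow> w \<in> tangent_space A p \<Longrightarrow>
    \<xi> (\<lambda>f. a * v f + b * w f) = a * \<xi> v + b * \<xi> w"
  unfolding cotangent_space_def by blast

lemma cotangent_outside: "\<xi> \<in> cotangent_space A p \<Longrightarrow> v \<notin> tangent_space A p \<Longrightarrow> \<xi> v = 0"
  unfolding cotangent_space_def by blast

lemma cotangent_cmult:
  "\<xi> \<in> cotangent_space A p \<Longrightarrow> v \<in> tangent_space A p \<Longrightarrow> \<xi> (\<lambda>f. a * v f) = a * \<xi> v"
  using cotangent_linear[of \<xi> p v v a 0] by simp

lemma cotangent_sum:
  assumes \<xi>: "\<xi> \<in> cotangent_space A p" and "\<And>i. i \<in> I \<Longrightarrow> v i \<in> tangent_space A p"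
  shows "\<xi> (\<lambda>f. \<Sum>i\<in>I. c i * v i f) = (\<Sum>i\<in>I. c i * \<xi> (v i))"
  using assms(2)
proof (induction I rule: infinite_finite_induct)
  case (insert i I)
  have "\<xi> (\<lambda>f. c i * v i f + 1 * (\<Sum>i\<in>I. c i * v i f)) = c i * \<xi> (v i) + 1 * \<xi> (\<lambda>f. \<Sum>i\<in>I. c i * v i f)"
    using insert.prems by (intro cotangent_linear[OF \<xi>] tangent_space_sum) auto
  then show ?case using insert by simp
qed (use cotangent_space_zero[OF \<xi>] in \<open>simp_all add: zero_fun_def\<close>)

lemma cotangent_eqI:
  assumes "\<xi> \<in> cotangent_space A p" "\<eta> \<in> cotangent_space A p" "\<And>v. v \<in> tangent_space A p \<Longrightarrow> \<xi> v = \<eta> v"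
  shows "\<xi> = \<eta>"
proof
  fix v show "\<xi> v = \<eta> v"
    by (cases "v \<in> tangent_space A p") (simp_all add: assms(3) cotangent_outside[OF assms(1)] cotangent_outside[OF assms(2)])
qed

lemma cotangent_spaceI:
  assumes "\<And>v w a b. v \<in> tangent_space A p \<Longrightarrow> w \<in> tangent_space A p \<Longrightarrow>
      \<xi> (\<lambda>f. a * v f + b * w f) = a * \<xi> v + b * \<xi> w"
    and "\<And>v. v \<notin> tangent_space A p \<Longrightarrow> \<xi> v = 0"
  shows "\<xi> \<in> cotangent_space A p"
  using assms unfolding cotangent_space_def by blast

lemma cotangent_combine:
  assumes "\<xi> \<in> cotangent_space A p" "\<eta> \<in> cotangent_space A p"
  shows "(\<lambda>v. a * \<xi> v + b * \<eta> v) \<in> cotangent_space A p"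
  by (rule cotangent_spaceI)
     (simp_all add: cotangent_linear[OF assms(1)] cotangent_linear[OF assms(2)]
       cotangent_outside[OF assms(1)] cotangent_outside[OF assms(2)] algebra_simps)

lemma exterior_d_cotangent: "exterior_d A F p \<in> cotangent_space A p"
  by (rule cotangent_spaceI) (simp_all add: exterior_d_def tangent_space_combine)

lemma one_formD:
  "\<omega> \<in> one_forms A \<Longrightarrow> \<omega> p \<in> cotangent_space A p"
  "\<omega> \<in> one_forms A \<Longrightarrow> X \<in> vector_fields A \<Longrightarrow> (\<lambda>p. \<omega> p (X p)) \<in> smooth_functions A"
  by (auto simp: one_forms_def)

lemma one_formI:
  "(\<And>p. \<omega> p \<in> cotangent_space A p) \<Longrightarrow> (\<And>X. X \<in> vector_fields A \<Longrightarrow> (\<lambda>p. \<omega> p (X p)) \<in> smooth_functions A)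
    \<Longrightarrow> \<omega> \<in> one_forms A"
  by (simp add: one_forms_def)

lemma exterior_d_form: "F \<in> smooth_functions A \<Longrightarrow> exterior_d A F \<in> one_forms A"
  by (intro one_formI exterior_d_cotangent) (simp add: exterior_d_apply vector_fieldD(1) vector_fieldD(2)[of _ F])

lemma form_combine:
  assumes "\<omega> \<in> one_forms A" "\<eta> \<in> one_forms A" "f \<in> smooth_functions A" "h \<in> smooth_functions A"
  shows "f \<cdot> \<omega> + h \<cdot> \<eta> \<in> one_forms A"
proof -
  have "(\<lambda>p v. f p * \<omega> p v + h p * \<eta> p v) \<in> one_forms A"
    by (intro one_formI cotangent_combine smooth_add smooth_mult one_formD(1)[OF assms(1)]
        one_formD(1)[OF assms(2)] one_formD(2)[OF assms(1)] one_formD(2)[OF assms(2)] assms(3,4))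
  then show ?thesis by (simp add: smult_def plus_fun_def)
qed

lemma smult_const_1: "(\<lambda>_. 1) \<cdot> \<omega> = \<omega>"
  and smult_const_0: "(\<lambda>_. 0) \<cdot> \<omega> = 0"
  and smult_const_minus_1: "(\<lambda>_. - 1) \<cdot> \<omega> = - \<omega>"
  by (simp_all add: smult_def fun_eq_iff)

lemma form_add: "\<omega> \<in> one_forms A \<Longrightarrow> \<eta> \<in> one_forms A \<Longrightarrow> \<omega> + \<eta> \<in> one_forms A"
  using form_combine[OF _ _ smooth_const[of 1] smooth_const[of 1]] by (simp add: smult_const_1)

lemma form_diff: "\<omega> \<in> one_forms A \<Longrightarrow> \<eta> \<in> one_forms A \<Longrightarrow> \<omega> - \<eta> \<in> one_forms A"
  using form_combine[OF _ _ smooth_const[of 1] smooth_const[of "-1"]]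
  by (simp add: smult_const_1 smult_const_minus_1)

lemma form_smult: "\<omega> \<in> one_forms A \<Longrightarrow> f \<in> smooth_functions A \<Longrightarrow> f \<cdot> \<omega> \<in> one_forms A"
  using form_combine[OF _ _ _ smooth_const[of 0], of \<omega> \<omega> f] by (simp add: smult_const_0)

lemma form_uminus: "\<omega> \<in> one_forms A \<Longrightarrow> - \<omega> \<in> one_forms A"
  using form_smult[OF _ smooth_const[of "-1"]] by (simp add: smult_const_minus_1)

lemma form_zero: "0 \<in> one_forms A"
  by (intro one_formI cotangent_spaceI) (simp_all add: smooth_const)

lemma form_sum: "(\<And>i. i \<in> I \<Longrightarrow> \<omega> i \<in> one_forms A) \<Longrightarrow> (\<Sum>i\<in>I. \<omega> i) \<in> one_forms A"
  by (induction I rule: infinite_finite_induct) (simp_all add: form_zero form_add)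

lemma form_eqI:
  assumes "\<omega> \<in> one_forms A" "\<eta> \<in> one_forms A"
    and "\<And>p Y. Y \<in> vector_fields A \<Longrightarrow> \<omega> p (Y p) = \<eta> p (Y p)"
  shows "\<omega> = \<eta>"
proof
  fix p show "\<omega> p = \<eta> p"
  proof (rule cotangent_eqI[OF one_formD(1)[OF assms(1)] one_formD(1)[OF assms(2)]])
    fix v assume "v \<in> tangent_space A p"
    then obtain Y where "Y \<in> vector_fields A" "Y p = v" by (rule vf_extend)
    then show "\<omega> p v = \<eta> p v" using assms(3)[of Y p] by simp
  qed
qed

lemma form_local:
  assumes "\<And>p. \<omega> p \<in> cotangent_space A p"
    and "\<And>p. \<exists>\<eta> W. \<eta> \<in> one_forms A \<and> open W \<and> p \<in> W \<and> (\<forall>r\<in>W. \<omega> r = \<eta> r)"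
  shows "\<omega> \<in> one_forms A"
proof (rule one_formI[OF assms(1) smooth_functions_local])
  fix X p assume X: "X \<in> vector_fields A"
  obtain \<eta> W where "\<eta> \<in> one_forms A" "open W" "p \<in> W" "\<forall>r\<in>W. \<omega> r = \<eta> r"
    using assms(2)[of p] by blast
  then show "\<exists>h W. h \<in> smooth_functions A \<and> open W \<and> p \<in> W \<and> (\<forall>x\<in>W. \<omega> x (X x) = h x)"
    using one_formD(2)[OF _ X, of \<eta>] by (intro exI[of _ "\<lambda>p. \<eta> p (X p)"] exI[of _ W]) auto
qed

section \<open>Frame expansions and the tensor characterisation of operators linear over
  functions\<close>

lemma cotangent_frame:
  assumes "frame_on A I x X W" "r \<in> W" "\<xi> \<in> cotangent_space A r"
  shows "v \<in> tangent_space A r \<Longrightarrow> \<xi> v = (\<Sum>i\<in>I. v (x i) * \<xi> (X i r))"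
    and "\<xi> = (\<lambda>v. \<Sum>i\<in>I. \<xi> (X i r) * exterior_d A (x i) r v)"
proof -
  have 1: "\<xi> v = (\<Sum>i\<in>I. v (x i) * \<xi> (X i r))" if v: "v \<in> tangent_space A r" for v
  proof -
    have "v = (\<lambda>F. \<Sum>i\<in>I. v (x i) * X i r F)"
      by (rule ext) (rule frame_onD(5)[OF assms(1,2) v])
    then have "\<xi> v = \<xi> (\<lambda>F. \<Sum>i\<in>I. v (x i) * X i r F)" by (rule arg_cong)
    also have "\<dots> = (\<Sum>i\<in>I. v (x i) * \<xi> (X i r))"
      by (rule cotangent_sum[OF assms(3) vector_fieldD(1)[OF frame_onD(4)[OF assms(1)]]])
    finally show ?thesis .
  qed
  then show "v \<in> tangent_space A r \<Longrightarrow> \<xi> v = (\<Sum>i\<in>I. v (x i) * \<xi> (X i r))" .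
  show "\<xi> = (\<lambda>v. \<Sum>i\<in>I. \<xi> (X i r) * exterior_d A (x i) r v)"
  proof
    fix v show "\<xi> v = (\<Sum>i\<in>I. \<xi> (X i r) * exterior_d A (x i) r v)"
    proof (cases "v \<in> tangent_space A r")
      case True
      show ?thesis by (subst 1[OF True]) (simp add: exterior_d_apply[OF True] mult.commute)
    next
      case False
      then show ?thesis by (simp add: cotangent_outside[OF assms(3)] exterior_d_def)
    qed
  qed
qed

text \<open>The combination of the coordinate functions with the components of the covector as
  coefficients has the right differential. Statements that depend on a 1-form through its value at p
  thus need to be checked on differentials only.\<close>

lemma cotangent_exact:
  assumes "\<xi> \<in> cotangent_space A p"
  obtains h where "h \<in> smooth_functions A" "exterior_d A h p = \<xi>"
proof -
  obtain x X W where F: "frame_on A (Basis :: 'e set) x X W" "p \<in> W" by (rule frame_at)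
  note x = frame_onD(3)[OF F(1)]
  define h where "h q = (\<Sum>i\<in>Basis. \<xi> (X i p) * x i q)" for q
  have h: "h \<in> smooth_functions A"
    unfolding h_def by (intro smooth_sum smooth_mult smooth_const x)
  have "exterior_d A h p = \<xi>"
  proof (rule cotangent_eqI[OF exterior_d_cotangent assms])
    fix v assume v: "v \<in> tangent_space A p"
    have "v h = (\<Sum>i\<in>Basis. v (\<lambda>q. \<xi> (X i p) * x i q))"
      unfolding h_def by (intro tangent_sum[OF v] smooth_mult smooth_const x)
    also have "\<dots> = (\<Sum>i\<in>Basis. \<xi> (X i p) * v (x i))"
      by (intro sum.cong refl tangent_cmult[OF v] x)
    also have "\<dots> = \<xi> v"
      by (subst cotangent_frame(1)[OF F assms v]) (simp only: mult.commute)
    finally show "exterior_d A h p v = \<xi> v" by (simp add: exterior_d_apply[OF v])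
  qed
  with h show ?thesis by (rule that)
qed

text \<open>By additivity it is enough that T kills a form \<theta> vanishing at p. There
  T(\<theta>) = T(\<kappa> \<theta>) for a cut-off function with \<kappa>(p) = 1, and \<kappa>
  \<theta> is a combination of the differentials of coordinates whose coefficients \<kappa>
  \<theta>(X_i) vanish at p.\<close>

lemma form_tensor_cong:
  assumes add: "\<And>\<omega> \<eta>. \<omega> \<in> one_forms A \<Longrightarrow> \<eta> \<in> one_forms A \<Longrightarrow> T (\<omega> + \<eta>) = T \<omega> + T \<eta>"
    and smult: "\<And>\<omega> f. \<omega> \<in> one_forms A \<Longrightarrow> f \<in> smooth_functions A \<Longrightarrow> T (f \<cdot> \<omega>) = f p * (T \<omega> :: real)"
    and \<omega>: "\<omega> \<in> one_forms A" and \<eta>: "\<eta> \<in> one_forms A" and "\<omega> p = \<eta> p"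
  shows "T \<omega> = T \<eta>"
proof -
  have T0: "T 0 = 0" using smult[OF form_zero smooth_const[of 0]] by (simp add: smult_const_0)
  have sum: "T (\<Sum>i\<in>I. \<omega> i) = (\<Sum>i\<in>I. T (\<omega> i))" if "\<And>i. i \<in> I \<Longrightarrow> \<omega> i \<in> one_forms A"
    for I and \<omega> :: "'e \<Rightarrow> 'a form"
    using that by (induction I rule: infinite_finite_induct) (simp_all add: T0 add form_sum)
  have zero: "T \<theta> = 0" if \<theta>: "\<theta> \<in> one_forms A" "\<theta> p = 0" for \<theta>
  proof -
    obtain x X W where F: "frame_on A (Basis :: 'e set) x X W" "p \<in> W" by (rule frame_at)
    obtain \<kappa> N C where \<kappa>: "\<kappa> \<in> smooth_functions A" "open N" "p \<in> N" "N \<subseteq> C" "closed C" "C \<subseteq> W"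
      "\<And>x. x \<in> N \<Longrightarrow> \<kappa> x = 1" "\<And>x. x \<notin> C \<Longrightarrow> \<kappa> x = 0"
      by (rule bump[OF frame_onD(2)[OF F(1)] F(2)]) (rule that)
    let ?a = "\<lambda>i q. \<kappa> q * \<theta> q (X i q)"
    have a: "?a i \<in> smooth_functions A" if "i \<in> Basis" for i
      by (intro smooth_mult \<kappa> one_formD(2)[OF \<theta>(1)] frame_onD(4)[OF F(1) that])
    have dx: "exterior_d A (x i) \<in> one_forms A" if "i \<in> Basis" for i
      by (rule exterior_d_form[OF frame_onD(3)[OF F(1) that]])
    \<comment> \<open>An identity of global forms: inside \<open>W\<close> it is the frame
      expansion, outside both sides vanish with \<kappa>.\<close>
    have "\<kappa> \<cdot> \<theta> = (\<Sum>i\<in>Basis. ?a i \<cdot> exterior_d A (x i))"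
    proof (intro ext)
      fix q v
      show "(\<kappa> \<cdot> \<theta>) q v = (\<Sum>i\<in>Basis. ?a i \<cdot> exterior_d A (x i)) q v"
      proof (cases "q \<in> W")
        case True
        have "\<theta> q v = (\<Sum>i\<in>Basis. \<theta> q (X i q) * exterior_d A (x i) q v)"
          by (rule fun_cong[OF cotangent_frame(2)[OF F(1) True one_formD(1)[OF \<theta>(1)]]])
        then have "\<kappa> q * \<theta> q v = (\<Sum>i\<in>Basis. \<kappa> q * (\<theta> q (X i q) * exterior_d A (x i) q v))"
          by (simp only: sum_distrib_left)
        then show ?thesis by (simp only: sum_form_apply smult_def mult.assoc)
      next
        case False
        then have "\<kappa> q = 0" using \<kappa>(6,8) by blast
        then show ?thesis by (simp add: sum_form_apply smult_def)
      qed
    qed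
    then have "T (\<kappa> \<cdot> \<theta>) = (\<Sum>i\<in>Basis. T (?a i \<cdot> exterior_d A (x i)))"
      using sum[of Basis "\<lambda>i. ?a i \<cdot> exterior_d A (x i)"] form_smult dx a by simp
    also have "\<dots> = (\<Sum>i\<in>Basis. ?a i p * T (exterior_d A (x i)))"
      by (intro sum.cong refl smult dx a)
    also have "\<dots> = 0" by (simp add: \<theta>(2))
    finally show ?thesis using smult[OF \<theta>(1) \<kappa>(1)] \<kappa>(3,7) by simp
  qed
  have "T \<omega> = T (\<eta> + (\<omega> - \<eta>))" by simp
  also have "\<dots> = T \<eta> + T (\<omega> - \<eta>)" by (rule add[OF \<eta> form_diff[OF \<omega> \<eta>]])
  also have "T (\<omega> - \<eta>) = 0" using assms(5) by (intro zero form_diff[OF \<omega> \<eta>]) simp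
  finally show ?thesis by simp
qed

text \<open>The field is V(F) = T(dF): linearity over functions turns the product rule for d into
  the derivation property. For general forms, \<omega> is replaced at each point by a differential
  with the same value there.\<close>

lemma form_tensor_vf:
  assumes add: "\<And>\<omega> \<eta> p. \<omega> \<in> one_forms A \<Longrightarrow> \<eta> \<in> one_forms A \<Longrightarrow> T (\<omega> + \<eta>) p = T \<omega> p + T \<eta> p"
    and smult: "\<And>\<omega> f p. \<omega> \<in> one_forms A \<Longrightarrow> f \<in> smooth_functions A \<Longrightarrow> T (f \<cdot> \<omega>) p = f p * T \<omega> p"
    and smooth: "\<And>\<omega>. \<omega> \<in> one_forms A \<Longrightarrow> T \<omega> \<in> smooth_functions A"
  obtains V where "V \<in> vector_fields A" "\<And>\<omega> p. \<omega> \<in> one_forms A \<Longrightarrow> T \<omega> p = \<omega> p (V p)"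
proof -
  define V where "V p F = (if F \<in> smooth_functions A then T (exterior_d A F) p else 0)" for p and F :: "'a \<Rightarrow> real"
  have cong: "T \<omega> p = T \<eta> p" if "\<omega> \<in> one_forms A" "\<eta> \<in> one_forms A" "\<omega> p = \<eta> p" for \<omega> \<eta> p
    using form_tensor_cong[of "\<lambda>\<omega>. T \<omega> p" p \<omega> \<eta>] add smult that by blast
  have comb: "T (a \<cdot> \<omega> + b \<cdot> \<eta>) p = a p * T \<omega> p + b p * T \<eta> p"
    if "\<omega> \<in> one_forms A" "\<eta> \<in> one_forms A" "a \<in> smooth_functions A" "b \<in> smooth_functions A" for \<omega> \<eta> p a b
    using that by (simp add: add smult form_smult)
  have VT: "V p \<in> tangent_space A p" for p
  proof (rule tangent_spaceI)
    fix f h a b assume fh: "f \<in> smooth_functions A" "h \<in> smooth_functions A"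
    have "exterior_d A (\<lambda>x. a * f x + b * h x) = (\<lambda>_. a) \<cdot> exterior_d A f + (\<lambda>_. b) \<cdot> exterior_d A h"
      by (auto simp: exterior_d_def smult_def fun_eq_iff tangent_linear fh)
    then show "V p (\<lambda>x. a * f x + b * h x) = a * V p f + b * V p h"
      using fh by (simp add: V_def comb exterior_d_form smooth_const smooth_add smooth_mult)
  next
    fix f h assume fh: "f \<in> smooth_functions A" "h \<in> smooth_functions A"
    have "exterior_d A (\<lambda>x. f x * h x) = f \<cdot> exterior_d A h + h \<cdot> exterior_d A f"
      by (auto simp: exterior_d_def smult_def fun_eq_iff tangent_mult fh)
    then show "V p (\<lambda>x. f x * h x) = f p * V p h + h p * V p f"
      using fh by (simp add: V_def comb exterior_d_form smooth_mult)
  qed (simp add: V_def)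
  have "V \<in> vector_fields A"
  proof (rule vector_fieldI[OF VT])
    fix f assume "f \<in> smooth_functions A"
    then show "(\<lambda>p. V p f) \<in> smooth_functions A"
      using smooth[OF exterior_d_form, of f] by (simp add: V_def)
  qed
  moreover have "T \<omega> p = \<omega> p (V p)" if \<omega>: "\<omega> \<in> one_forms A" for \<omega> p
  proof -
    obtain h where h: "h \<in> smooth_functions A" "exterior_d A h p = \<omega> p"
      by (rule cotangent_exact[OF one_formD(1)[OF \<omega>]]) (rule that)
    have "T \<omega> p = T (exterior_d A h) p"
      by (rule cong[OF \<omega> exterior_d_form[OF h(1)]]) (simp add: h(2))
    also have "\<dots> = V p h" by (simp add: V_def h(1))
    also have "\<dots> = \<omega> p (V p)" by (simp add: h(2)[symmetric] exterior_d_apply VT)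
    finally show ?thesis .
  qed
  ultimately show ?thesis by (rule that)
qed

text \<open>Dual to \<open>form_tensor_vf\<close>. The value of the covector on a tangent vector v
  is T applied to a chosen field through v; the choice is irrelevant because T of a field vanishing
  at p is 0 at p, by the same cut-off argument as for forms.\<close>

lemma vf_tensor_form:
  assumes add: "\<And>X Y p. X \<in> vector_fields A \<Longrightarrow> Y \<in> vector_fields A \<Longrightarrow>
      T (\<lambda>p F. X p F + Y p F) p = T X p + T Y p"
    and smult: "\<And>X f p. X \<in> vector_fields A \<Longrightarrow> f \<in> smooth_functions A \<Longrightarrow> T (\<lambda>p F. f p * X p F) p = f p * T X p"
    and smooth: "\<And>X. X \<in> vector_fields A \<Longrightarrow> T X \<in> smooth_functions A"
  obtains \<omega> where "\<omega> \<in> one_forms A" "\<And>X p. X \<in> vector_fields A \<Longrightarrow> \<omega> p (X p) = T X p"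
proof -
  have vf0: "(\<lambda>p F. 0) \<in> vector_fields A" by (intro vector_fieldI tangent_space_0 smooth_const)
  have T0: "T (\<lambda>p F. 0) p = 0" for p
    using smult[OF vf0 smooth_const[of 0], of p] by simp
  have sum: "T (\<lambda>p F. \<Sum>i\<in>I. f i p * X i p F) p = (\<Sum>i\<in>I. f i p * T (X i) p)"
    if "\<And>i. i \<in> I \<Longrightarrow> X i \<in> vector_fields A" "\<And>i. i \<in> I \<Longrightarrow> f i \<in> smooth_functions A"
    for I :: "'e set" and f X p
    using that
  proof (induction I rule: infinite_finite_induct)
    case (insert i I)
    have "T (\<lambda>p F. f i p * X i p F + (\<Sum>i\<in>I. f i p * X i p F)) p =
        T (\<lambda>p F. f i p * X i p F) p + T (\<lambda>p F. \<Sum>i\<in>I. f i p * X i p F) p"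
      using insert.prems by (intro add vf_smult vf_sum) auto
    then show ?case using insert by (simp add: smult)
  qed (simp_all add: T0)
  have zero: "T Z p = 0" if Z: "Z \<in> vector_fields A" "Z p = (\<lambda>F. 0)" for Z p
  proof -
    obtain x X W where F: "frame_on A (Basis :: 'e set) x X W" "p \<in> W" by (rule frame_at)
    obtain \<kappa> N C where \<kappa>: "\<kappa> \<in> smooth_functions A" "open N" "p \<in> N" "N \<subseteq> C" "closed C" "C \<subseteq> W"
      "\<And>x. x \<in> N \<Longrightarrow> \<kappa> x = 1" "\<And>x. x \<notin> C \<Longrightarrow> \<kappa> x = 0"
      by (rule bump[OF frame_onD(2)[OF F(1)] F(2)]) (rule that)
    let ?a = "\<lambda>i q. \<kappa> q * Z q (x i)"
    have "(\<lambda>q F. \<kappa> q * Z q F) = (\<lambda>q F. \<Sum>i\<in>Basis. ?a i q * X i q F)"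
    proof (intro ext)
      fix q f
      show "\<kappa> q * Z q f = (\<Sum>i\<in>Basis. ?a i q * X i q f)"
      proof (cases "q \<in> W")
        case True
        then show ?thesis
          by (subst frame_onD(5)[OF F(1) True vector_fieldD(1)[OF Z(1)], of f])
             (simp only: sum_distrib_left mult.assoc)
      next
        case False
        then have "\<kappa> q = 0" using \<kappa>(6,8) by blast
        then show ?thesis by simp
      qed
    qed
    then have "T (\<lambda>q F. \<kappa> q * Z q F) p = (\<Sum>i\<in>Basis. ?a i p * T (X i) p)"
      using sum[of Basis X ?a p] frame_onD(3,4)[OF F(1)] by (simp add: smooth_mult \<kappa> vector_fieldD(2)[OF Z(1)])
    also have "\<dots> = 0" by (simp add: Z(2))
    finally show ?thesis using smult[OF Z(1) \<kappa>(1)] \<kappa>(3,7) by simp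
  qed
  have cong: "T X p = T Y p" if X: "X \<in> vector_fields A" and Y: "Y \<in> vector_fields A" and "X p = Y p" for X Y p
  proof -
    let ?Z = "\<lambda>p F. 1 * X p F + (-1) * Y p F"
    have Z: "?Z \<in> vector_fields A" by (intro vf_combine[of X Y "\<lambda>_. 1" "\<lambda>_. -1"] X Y smooth_const)
    have "T (\<lambda>p F. Y p F + ?Z p F) p = T Y p + T ?Z p" by (rule add[OF Y Z])
    moreover have "T ?Z p = 0" by (rule zero[OF Z]) (simp add: that)
    ultimately show ?thesis by simp
  qed
  define e where "e v p = (SOME X. X \<in> vector_fields A \<and> X p = v)" for v p
  have e: "e v p \<in> vector_fields A \<and> e v p p = v" if "v \<in> tangent_space A p" for v p
  proof -
    have "\<exists>X. X \<in> vector_fields A \<and> X p = v" using vf_extend[OF that] by blast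
    then show ?thesis unfolding e_def by (rule someI_ex)
  qed
  define \<omega> where "\<omega> p v = (if v \<in> tangent_space A p then T (e v p) p else 0)" for p v
  have \<omega>: "\<omega> p (X p) = T X p" if "X \<in> vector_fields A" for X p
    using that vector_fieldD(1)[OF that] e[of "X p" p] cong[of "e (X p) p" X p] by (simp add: \<omega>_def)
  have "\<omega> \<in> one_forms A"
  proof (rule one_formI[OF cotangent_spaceI])
    fix p v w a b assume v: "v \<in> tangent_space A p" and w: "w \<in> tangent_space A p"
    obtain X where X: "X \<in> vector_fields A" "X p = v" using v by (rule vf_extend)
    obtain Y where Y: "Y \<in> vector_fields A" "Y p = w" using w by (rule vf_extend)
    note ab = vf_combine[OF X(1) Y(1) smooth_const[of a] smooth_const[of b]]
    have "\<omega> p (\<lambda>f. a * v f + b * w f) = T (\<lambda>p F. a * X p F + b * Y p F) p"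
      using \<omega>[OF ab, of p] by (simp add: X(2) Y(2))
    also have "\<dots> = T (\<lambda>p F. a * X p F) p + T (\<lambda>p F. b * Y p F) p"
      by (intro add vf_smult[of _ "\<lambda>_. a"] vf_smult[of _ "\<lambda>_. b"] X Y smooth_const)
    also have "\<dots> = a * T X p + b * T Y p"
      using smult[OF X(1) smooth_const[of a]] smult[OF Y(1) smooth_const[of b]] by simp
    also have "\<dots> = a * \<omega> p v + b * \<omega> p w"
      using \<omega>[OF X(1), of p] \<omega>[OF Y(1), of p] by (simp add: X Y)
    finally show "\<omega> p (\<lambda>f. a * v f + b * w f) = a * \<omega> p v + b * \<omega> p w" .
  next
    fix X assume "X \<in> vector_fields A"
    then show "(\<lambda>p. \<omega> p (X p)) \<in> smooth_functions A" by (simp add: \<omega> smooth)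
  qed (simp add: \<omega>_def)
  then show ?thesis using that \<omega> by blast
qed

end

text \<open>The part common to cometrics and bivector fields, without any symmetry, so that the
  warped construction can be treated once for both.\<close>

definition tensor2 :: "('a, 'e::euclidean_space) chart set \<Rightarrow> 'a contra2 \<Rightarrow> bool" where
  "tensor2 A Q \<longleftrightarrow>
     (\<forall>p. \<forall>\<xi>\<in>cotangent_space A p. \<forall>\<eta>\<in>cotangent_space A p. \<forall>\<zeta>\<in>cotangent_space A p. \<forall>a b.
        Q p (\<lambda>v. a * \<xi> v + b * \<eta> v) \<zeta> = a * Q p \<xi> \<zeta> + b * Q p \<eta> \<zeta> \<and>
        Q p \<zeta> (\<lambda>v. a * \<xi> v + b * \<eta> v) = a * Q p \<zeta> \<xi> + b * Q p \<zeta> \<eta>) \<and>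
     (\<forall>\<alpha>\<in>one_forms A. \<forall>\<beta>\<in>one_forms A. (\<lambda>p. Q p (\<alpha> p) (\<beta> p)) \<in> smooth_functions A)"

context manifold
begin

lemma tensor2D:
  assumes "tensor2 A Q"
  shows "\<xi> \<in> cotangent_space A p \<Longrightarrow> \<eta> \<in> cotangent_space A p \<Longrightarrow> \<zeta> \<in> cotangent_space A p \<Longrightarrow>
      Q p (\<lambda>v. a * \<xi> v + b * \<eta> v) \<zeta> = a * Q p \<xi> \<zeta> + b * Q p \<eta> \<zeta>"
    "\<xi> \<in> cotangent_space A p \<Longrightarrow> \<eta> \<in> cotangent_space A p \<Longrightarrow> \<zeta> \<in> cotangent_space A p \<Longrightarrow>
      Q p \<zeta> (\<lambda>v. a * \<xi> v + b * \<eta> v) = a * Q p \<zeta> \<xi> + b * Q p \<zeta> \<eta>"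
    "\<alpha> \<in> one_forms A \<Longrightarrow> \<beta> \<in> one_forms A \<Longrightarrow> (\<lambda>p. Q p (\<alpha> p) (\<beta> p)) \<in> smooth_functions A"
  using assms unfolding tensor2_def by blast+

lemma tensor2_forms:
  assumes Q: "tensor2 A Q" and "\<alpha> \<in> one_forms A" "\<beta> \<in> one_forms A" "\<gamma> \<in> cotangent_space A p"
  shows "Q p ((f \<cdot> \<alpha> + h \<cdot> \<beta>) p) \<gamma> = f p * Q p (\<alpha> p) \<gamma> + h p * Q p (\<beta> p) \<gamma>"
    and "Q p \<gamma> ((f \<cdot> \<alpha> + h \<cdot> \<beta>) p) = f p * Q p \<gamma> (\<alpha> p) + h p * Q p \<gamma> (\<beta> p)"
  using tensor2D(1,2)[OF Q one_formD(1)[OF assms(2)] one_formD(1)[OF assms(3)] assms(4), of "f p" "h p"]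
  by (simp_all add: smult_def plus_fun_def)

lemma tensor2_zero:
  assumes "tensor2 A Q" "\<xi> \<in> cotangent_space A p"
  shows "Q p \<xi> 0 = 0" "Q p 0 \<xi> = 0"
  using tensor2D(1,2)[OF assms(1) assms(2,2,2), of 0 0] by (simp_all add: zero_fun_def)

lemma bivector_tensor2:
  assumes P: "bivector_field A P"
  shows "tensor2 A P"
proof -
  have 1: "P p \<xi> \<eta> = - P p \<eta> \<xi>" if "\<xi> \<in> cotangent_space A p" "\<eta> \<in> cotangent_space A p" for p \<xi> \<eta>
    using P that unfolding bivector_field_def by blast
  have 2: "P p (\<lambda>v. a * \<xi> v + b * \<eta> v) \<zeta> = a * P p \<xi> \<zeta> + b * P p \<eta> \<zeta>"
    if "\<xi> \<in> cotangent_space A p" "\<eta> \<in> cotangent_space A p" "\<zeta> \<in> cotangent_space A p" for p \<xi> \<eta> \<zeta> a b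
    using P that unfolding bivector_field_def by blast
  have 3: "P p \<zeta> (\<lambda>v. a * \<xi> v + b * \<eta> v) = a * P p \<zeta> \<xi> + b * P p \<zeta> \<eta>"
    if "\<xi> \<in> cotangent_space A p" "\<eta> \<in> cotangent_space A p" "\<zeta> \<in> cotangent_space A p" for p \<xi> \<eta> \<zeta> a b
    using 1[OF that(3) cotangent_combine[OF that(1,2)]] 1[OF that(3,1)] 1[OF that(3,2)] 2[OF that] by simp
  have 4: "(\<lambda>p. P p (\<alpha> p) (\<beta> p)) \<in> smooth_functions A" if "\<alpha> \<in> one_forms A" "\<beta> \<in> one_forms A" for \<alpha> \<beta>
    using P that unfolding bivector_field_def by blast
  show ?thesis
    unfolding tensor2_def using 2 3 4 by blast
qed

section \<open>Lie brackets and Lie derivatives\<close>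

lemma lie_bracket_vf:
  assumes X: "X \<in> vector_fields A" and Y: "Y \<in> vector_fields A"
  shows "lie_bracket X Y \<in> vector_fields A"
proof (rule vector_fieldI)
  fix p
  note XT = vector_fieldD(1)[OF X] and YT = vector_fieldD(1)[OF Y]
    and Xs = vector_fieldD(2)[OF X] and Ys = vector_fieldD(2)[OF Y]
  show "lie_bracket X Y p \<in> tangent_space A p"
  proof (rule tangent_spaceI)
    fix f h a b assume fh: "f \<in> smooth_functions A" "h \<in> smooth_functions A"
    show "lie_bracket X Y p (\<lambda>x. a * f x + b * h x) = a * lie_bracket X Y p f + b * lie_bracket X Y p h"
      by (simp add: lie_bracket_def tangent_linear[OF XT] tangent_linear[OF YT] fh Xs Ys algebra_simps)
  next
    fix f h assume fh: "f \<in> smooth_functions A" "h \<in> smooth_functions A"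
    show "lie_bracket X Y p (\<lambda>x. f x * h x) = f p * lie_bracket X Y p h + h p * lie_bracket X Y p f"
      by (simp add: lie_bracket_def tangent_mult[OF XT] tangent_mult[OF YT] tangent_add[OF XT]
          tangent_add[OF YT] smooth_mult fh Xs Ys algebra_simps)
  next
    fix f assume "f \<notin> smooth_functions A"
    then show "lie_bracket X Y p f = 0"
      by (simp add: lie_bracket_def tangent_space_nonsmooth[OF XT] tangent_space_nonsmooth[OF YT]
          tangent_space_const[OF XT] tangent_space_const[OF YT])
  qed
next
  fix f assume "f \<in> smooth_functions A"
  then show "(\<lambda>p. lie_bracket X Y p f) \<in> smooth_functions A"
    unfolding lie_bracket_def
    by (intro smooth_diff vector_fieldD(2)[OF X] vector_fieldD(2)[OF Y])
qed

text \<open>The factors \<open>1 *\<close> give the right side the shape of a two-term linear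
  combination, to which \<open>cotangent_linear\<close> can be applied.\<close>

lemma lie_bracket_combine:
  assumes X: "X \<in> vector_fields A" and Y: "Y \<in> vector_fields A" and Z: "Z \<in> vector_fields A"
    and f: "f \<in> smooth_functions A" and h: "h \<in> smooth_functions A"
  shows "lie_bracket X (\<lambda>p F. f p * Y p F + h p * Z p F) p =
      (\<lambda>F. 1 * (f p * lie_bracket X Y p F + h p * lie_bracket X Z p F) + 1 * (X p f * Y p F + X p h * Z p F))"
proof
  fix F
  note XT = vector_fieldD(1)[OF X] and YT = vector_fieldD(1)[OF Y] and ZT = vector_fieldD(1)[OF Z]
    and Xs = vector_fieldD(2)[OF X] and Ys = vector_fieldD(2)[OF Y] and Zs = vector_fieldD(2)[OF Z]
  show "lie_bracket X (\<lambda>p F. f p * Y p F + h p * Z p F) p F =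
      1 * (f p * lie_bracket X Y p F + h p * lie_bracket X Z p F) + 1 * (X p f * Y p F + X p h * Z p F)"
  proof (cases "F \<in> smooth_functions A")
    case True
    then show ?thesis
      by (simp add: lie_bracket_def tangent_add[OF XT] tangent_mult[OF XT] smooth_mult f h Xs Ys Zs algebra_simps)
  next
    case False
    then show ?thesis
      by (simp add: lie_bracket_def tangent_space_nonsmooth[OF XT] tangent_space_nonsmooth[OF YT]
          tangent_space_nonsmooth[OF ZT] tangent_space_const[OF XT] tangent_space_const[OF YT] tangent_space_const[OF ZT])
  qed
qed

lemma lie_bracket_commute: "lie_bracket Y X p = (\<lambda>F. (-1) * lie_bracket X Y p F)"
  by (simp add: lie_bracket_def)

lemma cotangent_lie_bracket:
  assumes \<xi>: "\<xi> \<in> cotangent_space A p"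
    and X: "X \<in> vector_fields A" and Y: "Y \<in> vector_fields A" and Z: "Z \<in> vector_fields A"
    and f: "f \<in> smooth_functions A" and h: "h \<in> smooth_functions A"
  shows "\<xi> (lie_bracket X (\<lambda>p F. f p * Y p F + h p * Z p F) p) =
      f p * \<xi> (lie_bracket X Y p) + h p * \<xi> (lie_bracket X Z p) + X p f * \<xi> (Y p) + X p h * \<xi> (Z p)"
proof -
  note T = vector_fieldD(1)[OF lie_bracket_vf[OF X Y], of p] vector_fieldD(1)[OF lie_bracket_vf[OF X Z], of p]
    vector_fieldD(1)[OF Y, of p] vector_fieldD(1)[OF Z, of p]
  show ?thesis
    unfolding lie_bracket_combine[OF X Y Z f h]
    by (subst cotangent_linear[OF \<xi>]; (intro tangent_space_combine T)?) (simp add: cotangent_linear[OF \<xi>] T)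
qed

lemma cotangent_lie_bracket_skew:
  assumes "\<xi> \<in> cotangent_space A p" "X \<in> vector_fields A" "Y \<in> vector_fields A"
  shows "\<xi> (lie_bracket Y X p) = - \<xi> (lie_bracket X Y p)"
  unfolding lie_bracket_commute[of Y X]
  by (subst cotangent_cmult[OF assms(1) vector_fieldD(1)[OF lie_bracket_vf[OF assms(2,3)]]]) simp

text \<open>The expression X(\<beta>(Y)) - \<beta>([X, Y]) is linear over functions in Y, since both
  terms produce X(f) \<beta>(Y) when Y is replaced by f Y. It is therefore a 1-form, and a unique
  one, so the definite description denotes it.\<close>

lemma lie_derivative:
  assumes X: "X \<in> vector_fields A" and \<beta>: "\<beta> \<in> one_forms A"
  shows "lie_derivative A X \<beta> \<in> one_forms A"
    and "Y \<in> vector_fields A \<Longrightarrow>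
      lie_derivative A X \<beta> p (Y p) = X p (\<lambda>q. \<beta> q (Y q)) - \<beta> p (lie_bracket X Y p)"
proof -
  note XT = vector_fieldD(1)[OF X]
  let ?T = "\<lambda>Y p. X p (\<lambda>q. \<beta> q (Y q)) - \<beta> p (lie_bracket X Y p)"
  have \<beta>s: "(\<lambda>q. \<beta> q (Y q)) \<in> smooth_functions A" if "Y \<in> vector_fields A" for Y
    by (rule one_formD(2)[OF \<beta> that])
  have comb: "?T (\<lambda>p F. f p * Y p F + h p * Z p F) p = f p * ?T Y p + h p * ?T Z p"
    if Y: "Y \<in> vector_fields A" and Z: "Z \<in> vector_fields A"
      and f: "f \<in> smooth_functions A" and h: "h \<in> smooth_functions A" for Y Z f h p
    by (simp add: cotangent_lie_bracket[OF one_formD(1)[OF \<beta>] X Y Z f h]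
        cotangent_linear[OF one_formD(1)[OF \<beta>]] vector_fieldD(1)[OF Y] vector_fieldD(1)[OF Z]
        tangent_add[OF XT] tangent_mult[OF XT] smooth_mult f h \<beta>s[OF Y] \<beta>s[OF Z] algebra_simps)
  obtain \<omega> where \<omega>: "\<omega> \<in> one_forms A" "\<And>Y p. Y \<in> vector_fields A \<Longrightarrow> \<omega> p (Y p) = ?T Y p"
  proof (rule vf_tensor_form[of ?T])
    show "?T (\<lambda>p F. Y p F + Z p F) p = ?T Y p + ?T Z p"
      if "Y \<in> vector_fields A" "Z \<in> vector_fields A" for Y Z p
      using comb[OF that smooth_const[of 1] smooth_const[of 1], of p] by simp
    show "?T (\<lambda>p F. f p * Y p F) p = f p * ?T Y p"
      if "Y \<in> vector_fields A" "f \<in> smooth_functions A" for Y f p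
      using comb[OF that(1,1,2) smooth_const[of 0], of p] by simp
    show "?T Y \<in> smooth_functions A" if "Y \<in> vector_fields A" for Y
      by (intro smooth_diff vector_fieldD(2)[OF X] \<beta>s that one_formD(2)[OF \<beta>] lie_bracket_vf X)
  qed blast
  have "lie_derivative A X \<beta> = \<omega>"
    unfolding lie_derivative_def
  proof (rule the_equality)
    show "\<omega> \<in> one_forms A \<and> (\<forall>Y\<in>vector_fields A. \<forall>p. \<omega> p (Y p) = ?T Y p)" using \<omega> by blast
    show "\<theta> = \<omega>" if "\<theta> \<in> one_forms A \<and> (\<forall>Y\<in>vector_fields A. \<forall>p. \<theta> p (Y p) = ?T Y p)" for \<theta>
      by (rule form_eqI) (use that \<omega> in auto)
  qed
  with \<omega> show "lie_derivative A X \<beta> \<in> one_forms A"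
    "Y \<in> vector_fields A \<Longrightarrow> lie_derivative A X \<beta> p (Y p) = X p (\<lambda>q. \<beta> q (Y q)) - \<beta> p (lie_bracket X Y p)"
    by auto
qed

lemma tangent_eqI:
  assumes "v \<in> tangent_space A p" "w \<in> tangent_space A p"
    and "\<And>F. F \<in> smooth_functions A \<Longrightarrow> v F = w F"
  shows "v = w"
proof
  fix F show "v F = w F"
    by (cases "F \<in> smooth_functions A")
       (simp_all add: assms(3) tangent_space_nonsmooth[OF assms(1)] tangent_space_nonsmooth[OF assms(2)])
qed

end

section \<open>Bivector fields and the Koszul bracket\<close>

locale bivector_manifold = manifold A
  for A :: "('a::{t2_space,second_countable_topology}, 'e::euclidean_space) chart set" +
  fixes P :: "'a contra2"
  assumes bivector: "bivector_field A P"
begin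

lemma skew: "\<xi> \<in> cotangent_space A p \<Longrightarrow> \<eta> \<in> cotangent_space A p \<Longrightarrow> P p \<eta> \<xi> = - P p \<xi> \<eta>"
  using bivector unfolding bivector_field_def by blast

lemmas P_tensor = bivector_tensor2[OF bivector]

abbreviation "sh \<equiv> anchor A P"

text \<open>For fixed \<alpha> the map sending \<omega> to P(\<alpha>, \<omega>) is linear over
  functions, hence given by a vector field. Differentials separate tangent vectors, so the definite
  description in \<open>anchor\<close> denotes the value of this field.\<close>

lemma anchor_vf_cotangent:
  assumes \<alpha>: "\<alpha> \<in> one_forms A"
  shows "sh \<alpha> \<in> vector_fields A" and "\<xi> \<in> cotangent_space A p \<Longrightarrow> \<xi> (sh \<alpha> p) = P p (\<alpha> p) \<xi>"
proof -
  note \<alpha>T = one_formD(1)[OF \<alpha>]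
  obtain V where V: "V \<in> vector_fields A" "\<And>\<omega> p. \<omega> \<in> one_forms A \<Longrightarrow> P p (\<alpha> p) (\<omega> p) = \<omega> p (V p)"
  proof (rule form_tensor_vf[of "\<lambda>\<omega> p. P p (\<alpha> p) (\<omega> p)"])
    show "P p (\<alpha> p) ((\<omega> + \<eta>) p) = P p (\<alpha> p) (\<omega> p) + P p (\<alpha> p) (\<eta> p)"
      if "\<omega> \<in> one_forms A" "\<eta> \<in> one_forms A" for \<omega> \<eta> p
      using tensor2_forms(2)[OF P_tensor that \<alpha>T, of p "\<lambda>_. 1" "\<lambda>_. 1"] by (simp add: smult_const_1)
    show "P p (\<alpha> p) ((f \<cdot> \<omega>) p) = f p * P p (\<alpha> p) (\<omega> p)" if "\<omega> \<in> one_forms A" for \<omega> f p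
      using tensor2_forms(2)[OF P_tensor that that \<alpha>T, of p f "\<lambda>_. 0"] by (simp add: smult_const_0)
  qed (auto intro: tensor2D(3)[OF P_tensor \<alpha>])
  have Vc: "\<xi> (V p) = P p (\<alpha> p) \<xi>" if \<xi>: "\<xi> \<in> cotangent_space A p" for \<xi> p
  proof -
    obtain h where "h \<in> smooth_functions A" "exterior_d A h p = \<xi>"
      by (rule cotangent_exact[OF \<xi>]) (rule that)
    then show ?thesis using V(2)[OF exterior_d_form, of h p] by simp
  qed
  have "sh \<alpha> p = V p" for p
    unfolding anchor_def
  proof (rule the_equality)
    show "V p \<in> tangent_space A p \<and> (\<forall>\<xi>\<in>cotangent_space A p. \<xi> (V p) = P p (\<alpha> p) \<xi>)"
      using vector_fieldD(1)[OF V(1)] Vc by blast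
    fix v assume v: "v \<in> tangent_space A p \<and> (\<forall>\<xi>\<in>cotangent_space A p. \<xi> v = P p (\<alpha> p) \<xi>)"
    show "v = V p"
    proof (rule tangent_eqI[OF conjunct1[OF v] vector_fieldD(1)[OF V(1)]])
      fix F assume "F \<in> smooth_functions A"
      have "exterior_d A F p v = exterior_d A F p (V p)"
        using v Vc exterior_d_cotangent[of F p] by simp
      then show "v F = V p F"
        using v vector_fieldD(1)[OF V(1), of p] by (simp add: exterior_d_apply)
    qed
  qed
  then have "sh \<alpha> = V" by (rule ext)
  then show "sh \<alpha> \<in> vector_fields A" "\<xi> \<in> cotangent_space A p \<Longrightarrow> \<xi> (sh \<alpha> p) = P p (\<alpha> p) \<xi>"
    using V(1) Vc by auto
qed

lemmas anchor_vf = anchor_vf_cotangent(1)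
lemmas anchor_tangent = vector_fieldD(1)[OF anchor_vf]
lemmas anchor_smooth = vector_fieldD(2)[OF anchor_vf]

lemma anchor_form: "\<alpha> \<in> one_forms A \<Longrightarrow> \<beta> \<in> one_forms A \<Longrightarrow> \<beta> p (sh \<alpha> p) = P p (\<alpha> p) (\<beta> p)"
  by (rule anchor_vf_cotangent(2)[OF _ one_formD(1)])

lemma anchor_apply: "\<alpha> \<in> one_forms A \<Longrightarrow> sh \<alpha> p F = P p (\<alpha> p) (exterior_d A F p)"
  using anchor_vf_cotangent(2)[OF _ exterior_d_cotangent, of \<alpha> F p] by (simp add: exterior_d_apply anchor_tangent)

lemma anchor_combine:
  assumes "\<alpha> \<in> one_forms A" "\<beta> \<in> one_forms A" "f \<in> smooth_functions A" "h \<in> smooth_functions A"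
  shows "sh (f \<cdot> \<alpha> + h \<cdot> \<beta>) = (\<lambda>p F. f p * sh \<alpha> p F + h p * sh \<beta> p F)"
  by (intro ext)
     (simp add: anchor_apply assms form_combine tensor2_forms(1)[OF P_tensor assms(1,2) exterior_d_cotangent] del: plus_fun_apply uminus_apply minus_apply)

lemma anchor_smult: "\<alpha> \<in> one_forms A \<Longrightarrow> f \<in> smooth_functions A \<Longrightarrow> sh (f \<cdot> \<alpha>) p F = f p * sh \<alpha> p F"
  using anchor_combine[of \<alpha> \<alpha> f "\<lambda>_. 0"] by (simp add: smult_const_0 smooth_const)

lemma anchor_add: "\<alpha> \<in> one_forms A \<Longrightarrow> \<beta> \<in> one_forms A \<Longrightarrow> sh (\<alpha> + \<beta>) p F = sh \<alpha> p F + sh \<beta> p F"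
  using anchor_combine[of \<alpha> \<beta> "\<lambda>_. 1" "\<lambda>_. 1"] by (simp add: smult_const_1 smooth_const)

abbreviation "kos \<equiv> koszul_bracket A P"

lemma koszul_form: "\<alpha> \<in> one_forms A \<Longrightarrow> \<beta> \<in> one_forms A \<Longrightarrow> kos \<alpha> \<beta> \<in> one_forms A"
  unfolding koszul_bracket_def
  by (intro form_diff lie_derivative(1) anchor_vf exterior_d_form tensor2D(3)[OF P_tensor])

lemma koszul_apply:
  assumes \<alpha>: "\<alpha> \<in> one_forms A" and \<beta>: "\<beta> \<in> one_forms A" and Y: "Y \<in> vector_fields A"
  shows "kos \<alpha> \<beta> p (Y p) = sh \<alpha> p (\<lambda>q. \<beta> q (Y q)) - \<beta> p (lie_bracket (sh \<alpha>) Y p)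
    - sh \<beta> p (\<lambda>q. \<alpha> q (Y q)) + \<alpha> p (lie_bracket (sh \<beta>) Y p) - Y p (\<lambda>q. P q (\<alpha> q) (\<beta> q))"
  by (simp add: koszul_bracket_def lie_derivative(2)[OF anchor_vf[OF \<alpha>] \<beta> Y]
      lie_derivative(2)[OF anchor_vf[OF \<beta>] \<alpha> Y] exterior_d_apply vector_fieldD(1)[OF Y])

lemma koszul_skew:
  assumes \<alpha>: "\<alpha> \<in> one_forms A" and \<beta>: "\<beta> \<in> one_forms A"
  shows "kos \<beta> \<alpha> = - kos \<alpha> \<beta>"
proof (rule form_eqI[OF koszul_form[OF \<beta> \<alpha>] form_uminus[OF koszul_form[OF \<alpha> \<beta>]]])
  fix p Y assume Y: "Y \<in> vector_fields A"
  have "(\<lambda>q. P q (\<beta> q) (\<alpha> q)) = (\<lambda>q. - P q (\<alpha> q) (\<beta> q))"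
    by (intro ext skew one_formD(1) \<alpha> \<beta>)
  then show "kos \<beta> \<alpha> p (Y p) = (- kos \<alpha> \<beta>) p (Y p)"
    by (simp add: koszul_apply[OF \<alpha> \<beta> Y] koszul_apply[OF \<beta> \<alpha> Y]
        tangent_minus[OF vector_fieldD(1)[OF Y] tensor2D(3)[OF P_tensor \<alpha> \<beta>]])
qed

text \<open>Besides the visible terms, the bracket [\<sharp>(f \<beta>), Y] and the differential of
  P(\<alpha>, f \<beta>) both contribute a derivative Y(f); the two cancel because
  \<alpha>(\<sharp>\<beta>) = - P(\<alpha>, \<beta>). With two coefficients in one statement, the
  values 1 and 0 give additivity and the Leibniz rule as special cases.\<close>

lemma koszul_combine:
  assumes \<alpha>: "\<alpha> \<in> one_forms A" and \<beta>: "\<beta> \<in> one_forms A" and \<gamma>: "\<gamma> \<in> one_forms A"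
    and f: "f \<in> smooth_functions A" and h: "h \<in> smooth_functions A"
  shows "kos \<alpha> (f \<cdot> \<beta> + h \<cdot> \<gamma>) =
    (f \<cdot> kos \<alpha> \<beta> + h \<cdot> kos \<alpha> \<gamma>) + ((\<lambda>p. sh \<alpha> p f) \<cdot> \<beta> + (\<lambda>p. sh \<alpha> p h) \<cdot> \<gamma>)"
proof -
  let ?\<beta> = "f \<cdot> \<beta> + h \<cdot> \<gamma>"
  have \<beta>': "?\<beta> \<in> one_forms A" by (rule form_combine[OF \<beta> \<gamma> f h])
  have sm: "(\<lambda>q. \<omega> q (Y q)) \<in> smooth_functions A" if "\<omega> \<in> one_forms A" "Y \<in> vector_fields A" for \<omega> Y
    by (rule one_formD(2)[OF that])
  show ?thesis
  proof (rule form_eqI)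
    show "kos \<alpha> ?\<beta> \<in> one_forms A" by (rule koszul_form[OF \<alpha> \<beta>'])
    show "(f \<cdot> kos \<alpha> \<beta> + h \<cdot> kos \<alpha> \<gamma>) + ((\<lambda>p. sh \<alpha> p f) \<cdot> \<beta> + (\<lambda>p. sh \<alpha> p h) \<cdot> \<gamma>) \<in> one_forms A"
      by (intro form_add[OF form_combine form_combine] koszul_form anchor_smooth \<alpha> \<beta> \<gamma> f h)
    fix p Y assume Y: "Y \<in> vector_fields A"
    note YT = vector_fieldD(1)[OF Y] and aT = anchor_tangent[OF \<alpha>] and bT = anchor_tangent[OF \<beta>]
      and cT = anchor_tangent[OF \<gamma>]
    have 1: "sh \<alpha> p (\<lambda>q. ?\<beta> q (Y q)) = f p * sh \<alpha> p (\<lambda>q. \<beta> q (Y q)) + sh \<alpha> p f * \<beta> p (Y p)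
        + (h p * sh \<alpha> p (\<lambda>q. \<gamma> q (Y q)) + sh \<alpha> p h * \<gamma> p (Y p))"
      by (simp add: smult_def plus_fun_def tangent_add[OF aT] tangent_mult[OF aT] smooth_mult sm \<beta> \<gamma> Y f h)
    have 2: "Y p (\<lambda>q. P q (\<alpha> q) (?\<beta> q)) = f p * Y p (\<lambda>q. P q (\<alpha> q) (\<beta> q)) + Y p f * P p (\<alpha> p) (\<beta> p)
        + (h p * Y p (\<lambda>q. P q (\<alpha> q) (\<gamma> q)) + Y p h * P p (\<alpha> p) (\<gamma> p))"
      by (simp add: tensor2_forms(2)[OF P_tensor \<beta> \<gamma> one_formD(1)[OF \<alpha>]]
          tangent_add[OF YT] tangent_mult[OF YT] smooth_mult tensor2D(3)[OF P_tensor] \<alpha> \<beta> \<gamma> f h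
          del: plus_fun_apply)
    have 3: "\<alpha> p (lie_bracket (sh ?\<beta>) Y p) = f p * \<alpha> p (lie_bracket (sh \<beta>) Y p) - Y p f * \<alpha> p (sh \<beta> p)
        + (h p * \<alpha> p (lie_bracket (sh \<gamma>) Y p) - Y p h * \<alpha> p (sh \<gamma> p))"
      unfolding anchor_combine[OF \<beta> \<gamma> f h]
      by (subst cotangent_lie_bracket_skew[OF one_formD(1)[OF \<alpha>] Y vf_combine[OF anchor_vf[OF \<beta>] anchor_vf[OF \<gamma>] f h]])
         (simp add: cotangent_lie_bracket[OF one_formD(1)[OF \<alpha>] Y anchor_vf[OF \<beta>] anchor_vf[OF \<gamma>] f h]
          cotangent_lie_bracket_skew[OF one_formD(1)[OF \<alpha>] Y anchor_vf[OF \<beta>]]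
          cotangent_lie_bracket_skew[OF one_formD(1)[OF \<alpha>] Y anchor_vf[OF \<gamma>]])
    have 4: "?\<beta> p v = f p * \<beta> p v + h p * \<gamma> p v" for v by (simp add: smult_def)
    have 5: "sh ?\<beta> p F = f p * sh \<beta> p F + h p * sh \<gamma> p F" for F by (simp add: anchor_combine[OF \<beta> \<gamma> f h])
    have 6: "\<alpha> p (sh \<beta> p) = - P p (\<alpha> p) (\<beta> p)" "\<alpha> p (sh \<gamma> p) = - P p (\<alpha> p) (\<gamma> p)"
      using anchor_form[OF \<beta> \<alpha>] anchor_form[OF \<gamma> \<alpha>] skew[OF one_formD(1)[OF \<alpha>] one_formD(1)[OF \<beta>]]
        skew[OF one_formD(1)[OF \<alpha>] one_formD(1)[OF \<gamma>]] by simp_all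
    show "kos \<alpha> ?\<beta> p (Y p) =
      ((f \<cdot> kos \<alpha> \<beta> + h \<cdot> kos \<alpha> \<gamma>) + ((\<lambda>p. sh \<alpha> p f) \<cdot> \<beta> + (\<lambda>p. sh \<alpha> p h) \<cdot> \<gamma>)) p (Y p)"
      unfolding koszul_apply[OF \<alpha> \<beta>' Y] 1 2 3 4 5 6
      by (simp add: smult_def koszul_apply[OF \<alpha> \<beta> Y] koszul_apply[OF \<alpha> \<gamma> Y] algebra_simps)
  qed
qed

lemma koszul_combine_left:
  assumes \<alpha>: "\<alpha> \<in> one_forms A" and \<beta>: "\<beta> \<in> one_forms A" and \<gamma>: "\<gamma> \<in> one_forms A"
    and f: "f \<in> smooth_functions A" and h: "h \<in> smooth_functions A"
  shows "kos (f \<cdot> \<beta> + h \<cdot> \<gamma>) \<alpha> =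
    (f \<cdot> kos \<beta> \<alpha> + h \<cdot> kos \<gamma> \<alpha>) + ((\<lambda>p. - sh \<alpha> p f) \<cdot> \<beta> + (\<lambda>p. - sh \<alpha> p h) \<cdot> \<gamma>)"
  unfolding koszul_skew[OF \<alpha> form_combine[OF \<beta> \<gamma> f h]] koszul_combine[OF assms]
    koszul_skew[OF \<alpha> \<beta>] koszul_skew[OF \<alpha> \<gamma>]
  by (simp add: smult_def fun_eq_iff)

end


section \<open>The Levi-Civita contravariant connection\<close>

text \<open>Nondegeneracy is expressed as surjectivity on global objects: every vector field is
  represented by a 1-form. This is the form in which it is used to construct the connection;
  injectivity follows from it by symmetry.\<close>

definition cometric_tensor :: "('a, 'e::euclidean_space) chart set \<Rightarrow> 'a contra2 \<Rightarrow> bool" where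
  "cometric_tensor A g \<longleftrightarrow> tensor2 A g \<and>
     (\<forall>p. \<forall>\<xi>\<in>cotangent_space A p. \<forall>\<eta>\<in>cotangent_space A p. g p \<xi> \<eta> = g p \<eta> \<xi>) \<and>
     (\<forall>V\<in>vector_fields A. \<exists>\<omega>\<in>one_forms A. \<forall>p. \<forall>\<xi>\<in>cotangent_space A p. g p (\<omega> p) \<xi> = \<xi> (V p))"

locale metric_manifold = bivector_manifold A P
  for A :: "('a::{t2_space,second_countable_topology}, 'e::euclidean_space) chart set" and P +
  fixes g :: "'a contra2"
  assumes cometric: "cometric_tensor A g"
begin

lemma g_tensor: "tensor2 A g"
  using cometric by (simp add: cometric_tensor_def)

lemma g_sym: "\<xi> \<in> cotangent_space A p \<Longrightarrow> \<eta> \<in> cotangent_space A p \<Longrightarrow> g p \<xi> \<eta> = g p \<eta> \<xi>"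
  using cometric unfolding cometric_tensor_def by blast

lemma flat:
  assumes "V \<in> vector_fields A"
  obtains \<omega> where "\<omega> \<in> one_forms A" "\<And>p \<xi>. \<xi> \<in> cotangent_space A p \<Longrightarrow> g p (\<omega> p) \<xi> = \<xi> (V p)"
  using cometric assms unfolding cometric_tensor_def by blast

text \<open>The test forms are those representing vector fields: pairing with them under g evaluates
  a covector on an arbitrary tangent vector.\<close>

lemma nondegenerate:
  assumes \<xi>: "\<xi> \<in> cotangent_space A p" and \<eta>: "\<eta> \<in> cotangent_space A p"
    and eq: "\<And>\<gamma>. \<gamma> \<in> one_forms A \<Longrightarrow> g p \<xi> (\<gamma> p) = g p \<eta> (\<gamma> p)"
  shows "\<xi> = \<eta>"
proof (rule cotangent_eqI[OF \<xi> \<eta>])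
  fix v assume "v \<in> tangent_space A p"
  then obtain V where V: "V \<in> vector_fields A" "V p = v" by (rule vf_extend)
  obtain \<omega> where \<omega>: "\<omega> \<in> one_forms A" "\<And>p \<xi>. \<xi> \<in> cotangent_space A p \<Longrightarrow> g p (\<omega> p) \<xi> = \<xi> (V p)"
    by (rule flat[OF V(1)]) (rule that)
  have "g p (\<omega> p) \<xi> = g p (\<omega> p) \<eta>"
    using eq[OF \<omega>(1)] g_sym[OF one_formD(1)[OF \<omega>(1)] \<xi>] g_sym[OF one_formD(1)[OF \<omega>(1)] \<eta>] by simp
  then show "\<xi> v = \<eta> v" by (simp add: \<omega>(2)[OF \<xi>] \<omega>(2)[OF \<eta>] V(2))
qed

lemma form_nondegenerate:
  assumes "\<omega> \<in> one_forms A" "\<eta> \<in> one_forms A"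
    and "\<And>\<gamma> p. \<gamma> \<in> one_forms A \<Longrightarrow> g p (\<omega> p) (\<gamma> p) = g p (\<eta> p) (\<gamma> p)"
  shows "\<omega> = \<eta>"
  by (rule ext, rule nondegenerate[OF one_formD(1)[OF assms(1)] one_formD(1)[OF assms(2)] assms(3)])

text \<open>Twice \<open>g(D\<^sub>\<alpha>\<beta>, \<gamma>)\<close>, by the Koszul formula.\<close>

definition koszul_formula :: "'a form \<Rightarrow> 'a form \<Rightarrow> 'a form \<Rightarrow> 'a \<Rightarrow> real" where
  "koszul_formula \<alpha> \<beta> \<gamma> p =
     sh \<alpha> p (\<lambda>q. g q (\<beta> q) (\<gamma> q)) + sh \<beta> p (\<lambda>q. g q (\<alpha> q) (\<gamma> q)) - sh \<gamma> p (\<lambda>q. g q (\<alpha> q) (\<beta> q))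
     + g p (kos \<alpha> \<beta> p) (\<gamma> p) + g p (kos \<gamma> \<alpha> p) (\<beta> p) + g p (kos \<gamma> \<beta> p) (\<alpha> p)"

lemma g_smooth: "\<alpha> \<in> one_forms A \<Longrightarrow> \<beta> \<in> one_forms A \<Longrightarrow> (\<lambda>p. g p (\<alpha> p) (\<beta> p)) \<in> smooth_functions A"
  by (rule tensor2D(3)[OF g_tensor])

lemma g_add:
  assumes "\<xi> \<in> one_forms A" "\<eta> \<in> one_forms A" "\<zeta> \<in> one_forms A"
  shows "g p ((\<xi> + \<eta>) p) (\<zeta> p) = g p (\<xi> p) (\<zeta> p) + g p (\<eta> p) (\<zeta> p)"
  using tensor2_forms(1)[OF g_tensor assms(1,2) one_formD(1)[OF assms(3)], of p "\<lambda>_. 1" "\<lambda>_. 1"]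
  by (simp add: smult_const_1)

lemma g_minus:
  assumes "\<xi> \<in> one_forms A" "\<zeta> \<in> one_forms A"
  shows "g p ((- \<xi>) p) (\<zeta> p) = - g p (\<xi> p) (\<zeta> p)"
  using tensor2_forms(1)[OF g_tensor assms(1,1) one_formD(1)[OF assms(2)], of p "\<lambda>_. -1" "\<lambda>_. 0"]
  by (simp add: smult_const_minus_1 smult_const_0)

lemma g_commute: "\<xi> \<in> one_forms A \<Longrightarrow> \<eta> \<in> one_forms A \<Longrightarrow> g p (\<xi> p) (\<eta> p) = g p (\<eta> p) (\<xi> p)"
  by (intro g_sym one_formD(1))

lemma anchor_g_combine:
  assumes "\<alpha> \<in> one_forms A" "\<beta> \<in> one_forms A" "\<gamma> \<in> one_forms A" "\<delta> \<in> one_forms A"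
    and "f \<in> smooth_functions A" "h \<in> smooth_functions A"
  shows "sh \<delta> p (\<lambda>q. g q ((f \<cdot> \<alpha> + h \<cdot> \<beta>) q) (\<gamma> q)) =
      f p * sh \<delta> p (\<lambda>q. g q (\<alpha> q) (\<gamma> q)) + sh \<delta> p f * g p (\<alpha> p) (\<gamma> p)
      + (h p * sh \<delta> p (\<lambda>q. g q (\<beta> q) (\<gamma> q)) + sh \<delta> p h * g p (\<beta> p) (\<gamma> p))"
    and "sh \<delta> p (\<lambda>q. g q (\<gamma> q) ((f \<cdot> \<alpha> + h \<cdot> \<beta>) q)) =
      f p * sh \<delta> p (\<lambda>q. g q (\<gamma> q) (\<alpha> q)) + sh \<delta> p f * g p (\<gamma> p) (\<alpha> p)
      + (h p * sh \<delta> p (\<lambda>q. g q (\<gamma> q) (\<beta> q)) + sh \<delta> p h * g p (\<gamma> p) (\<beta> p))"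
  by (simp_all add: tensor2_forms[OF g_tensor assms(1,2) one_formD(1)[OF assms(3)]]
      tangent_add[OF anchor_tangent[OF assms(4)]] tangent_mult[OF anchor_tangent[OF assms(4)]]
      smooth_mult g_smooth assms del: plus_fun_apply)

lemma g_koszul_combine:
  assumes \<alpha>: "\<alpha> \<in> one_forms A" and \<beta>: "\<beta> \<in> one_forms A" and \<gamma>: "\<gamma> \<in> one_forms A" and \<delta>: "\<delta> \<in> one_forms A"
    and f: "f \<in> smooth_functions A" and h: "h \<in> smooth_functions A"
  shows "g p (kos \<alpha> (f \<cdot> \<beta> + h \<cdot> \<gamma>) p) (\<delta> p) =
      f p * g p (kos \<alpha> \<beta> p) (\<delta> p) + h p * g p (kos \<alpha> \<gamma> p) (\<delta> p)
      + (sh \<alpha> p f * g p (\<beta> p) (\<delta> p) + sh \<alpha> p h * g p (\<gamma> p) (\<delta> p))"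
    and "g p (kos (f \<cdot> \<beta> + h \<cdot> \<gamma>) \<alpha> p) (\<delta> p) =
      f p * g p (kos \<beta> \<alpha> p) (\<delta> p) + h p * g p (kos \<gamma> \<alpha> p) (\<delta> p)
      - (sh \<alpha> p f * g p (\<beta> p) (\<delta> p) + sh \<alpha> p h * g p (\<gamma> p) (\<delta> p))"
proof -
  note \<delta>T = one_formD(1)[OF \<delta>]
  note sm = anchor_smooth[OF \<alpha> f] anchor_smooth[OF \<alpha> h]
  note k = koszul_form[OF \<alpha> \<beta>] koszul_form[OF \<alpha> \<gamma>] koszul_form[OF \<beta> \<alpha>] koszul_form[OF \<gamma> \<alpha>]
  show "g p (kos \<alpha> (f \<cdot> \<beta> + h \<cdot> \<gamma>) p) (\<delta> p) =
      f p * g p (kos \<alpha> \<beta> p) (\<delta> p) + h p * g p (kos \<alpha> \<gamma> p) (\<delta> p)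
      + (sh \<alpha> p f * g p (\<beta> p) (\<delta> p) + sh \<alpha> p h * g p (\<gamma> p) (\<delta> p))"
    unfolding koszul_combine[OF \<alpha> \<beta> \<gamma> f h]
    by (subst g_add[OF form_combine[OF k(1,2) f h] form_combine[OF \<beta> \<gamma> sm] \<delta>])
       (simp only: tensor2_forms(1)[OF g_tensor k(1,2) \<delta>T] tensor2_forms(1)[OF g_tensor \<beta> \<gamma> \<delta>T])
  show "g p (kos (f \<cdot> \<beta> + h \<cdot> \<gamma>) \<alpha> p) (\<delta> p) =
      f p * g p (kos \<beta> \<alpha> p) (\<delta> p) + h p * g p (kos \<gamma> \<alpha> p) (\<delta> p)
      - (sh \<alpha> p f * g p (\<beta> p) (\<delta> p) + sh \<alpha> p h * g p (\<gamma> p) (\<delta> p))"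
    unfolding koszul_combine_left[OF \<alpha> \<beta> \<gamma> f h]
    by (subst g_add[OF form_combine[OF k(3,4) f h] form_combine[OF \<beta> \<gamma> smooth_minus[OF sm(1)] smooth_minus[OF sm(2)]] \<delta>])
       (simp add: tensor2_forms(1)[OF g_tensor k(3,4) \<delta>T] tensor2_forms(1)[OF g_tensor \<beta> \<gamma> \<delta>T] del: plus_fun_apply)
qed

text \<open>Linearity in the last argument makes the formula define a 1-form; the other two parts
  become the axioms of a contravariant connection. In the middle argument the term with
  \<sharp>\<gamma>(f) arises twice, from the derivative of g and from the bracket, whereas the two
  terms with \<sharp>\<delta>(f) cancel.\<close>

lemma koszul_formula_combine:
  assumes \<alpha>: "\<alpha> \<in> one_forms A" and \<beta>: "\<beta> \<in> one_forms A" and \<gamma>: "\<gamma> \<in> one_forms A" and \<delta>: "\<delta> \<in> one_forms A"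
    and f: "f \<in> smooth_functions A" and h: "h \<in> smooth_functions A"
  shows "koszul_formula \<gamma> \<delta> (f \<cdot> \<alpha> + h \<cdot> \<beta>) p = f p * koszul_formula \<gamma> \<delta> \<alpha> p + h p * koszul_formula \<gamma> \<delta> \<beta> p"
    and "koszul_formula (f \<cdot> \<alpha> + h \<cdot> \<beta>) \<gamma> \<delta> p = f p * koszul_formula \<alpha> \<gamma> \<delta> p + h p * koszul_formula \<beta> \<gamma> \<delta> p"
    and "koszul_formula \<gamma> (f \<cdot> \<alpha> + h \<cdot> \<beta>) \<delta> p = f p * koszul_formula \<gamma> \<alpha> \<delta> p + h p * koszul_formula \<gamma> \<beta> \<delta> p
      + 2 * (sh \<gamma> p f * g p (\<alpha> p) (\<delta> p) + sh \<gamma> p h * g p (\<beta> p) (\<delta> p))"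
proof -
  note A = \<alpha> \<beta> \<gamma> \<delta>
  have gc: "g p (\<delta> p) (\<alpha> p) = g p (\<alpha> p) (\<delta> p)" "g p (\<gamma> p) (\<alpha> p) = g p (\<alpha> p) (\<gamma> p)"
    "g p (\<delta> p) (\<beta> p) = g p (\<beta> p) (\<delta> p)" "g p (\<gamma> p) (\<beta> p) = g p (\<beta> p) (\<gamma> p)"
    by (intro g_commute A)+
  note simps = g_koszul_combine[OF _ \<alpha> \<beta> _ f h]
    tensor2_forms[OF g_tensor \<alpha> \<beta> one_formD(1)] koszul_form
    anchor_combine[OF \<alpha> \<beta> f h] A gc
  show "koszul_formula \<gamma> \<delta> (f \<cdot> \<alpha> + h \<cdot> \<beta>) p = f p * koszul_formula \<gamma> \<delta> \<alpha> p + h p * koszul_formula \<gamma> \<delta> \<beta> p"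
    unfolding koszul_formula_def
    by (simp only: anchor_g_combine[OF \<alpha> \<beta> _ _ f h] A) (simp add: simps algebra_simps del: plus_fun_apply)
  show "koszul_formula (f \<cdot> \<alpha> + h \<cdot> \<beta>) \<gamma> \<delta> p = f p * koszul_formula \<alpha> \<gamma> \<delta> p + h p * koszul_formula \<beta> \<gamma> \<delta> p"
    unfolding koszul_formula_def
    by (simp only: anchor_g_combine[OF \<alpha> \<beta> _ _ f h] A) (simp add: simps algebra_simps del: plus_fun_apply)
  show "koszul_formula \<gamma> (f \<cdot> \<alpha> + h \<cdot> \<beta>) \<delta> p = f p * koszul_formula \<gamma> \<alpha> \<delta> p + h p * koszul_formula \<gamma> \<beta> \<delta> p
      + 2 * (sh \<gamma> p f * g p (\<alpha> p) (\<delta> p) + sh \<gamma> p h * g p (\<beta> p) (\<delta> p))"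
    unfolding koszul_formula_def
    by (simp only: anchor_g_combine[OF \<alpha> \<beta> _ _ f h] A) (simp add: simps algebra_simps del: plus_fun_apply)
qed

text \<open>As a function of \<gamma> the formula is linear over functions, hence evaluation of
  \<gamma> on a vector field; the 1-form representing that field under g, halved, is the form
  sought.\<close>

lemma koszul_formula_form:
  assumes \<alpha>: "\<alpha> \<in> one_forms A" and \<beta>: "\<beta> \<in> one_forms A"
  obtains \<omega> where "\<omega> \<in> one_forms A" "\<And>\<gamma> p. \<gamma> \<in> one_forms A \<Longrightarrow> 2 * g p (\<omega> p) (\<gamma> p) = koszul_formula \<alpha> \<beta> \<gamma> p"
proof -
  obtain V where V: "V \<in> vector_fields A" "\<And>\<gamma> p. \<gamma> \<in> one_forms A \<Longrightarrow> koszul_formula \<alpha> \<beta> \<gamma> p = \<gamma> p (V p)"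
  proof (rule form_tensor_vf[of "koszul_formula \<alpha> \<beta>"])
    show "koszul_formula \<alpha> \<beta> (\<gamma> + \<delta>) p = koszul_formula \<alpha> \<beta> \<gamma> p + koszul_formula \<alpha> \<beta> \<delta> p"
      if "\<gamma> \<in> one_forms A" "\<delta> \<in> one_forms A" for \<gamma> \<delta> p
      using koszul_formula_combine(1)[OF that \<alpha> \<beta> smooth_const[of 1] smooth_const[of 1]]
      by (simp add: smult_const_1)
    show "koszul_formula \<alpha> \<beta> (f \<cdot> \<gamma>) p = f p * koszul_formula \<alpha> \<beta> \<gamma> p"
      if "\<gamma> \<in> one_forms A" "f \<in> smooth_functions A" for \<gamma> f p
      using koszul_formula_combine(1)[OF that(1,1) \<alpha> \<beta> that(2) smooth_const[of 0]]
      by (simp add: smult_const_0)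
    show "koszul_formula \<alpha> \<beta> \<gamma> \<in> smooth_functions A" if \<gamma>: "\<gamma> \<in> one_forms A" for \<gamma>
      unfolding koszul_formula_def[abs_def]
      by (intro smooth_add smooth_diff anchor_smooth[OF \<alpha>] anchor_smooth[OF \<beta>] anchor_smooth[OF \<gamma>]
          g_smooth koszul_form \<alpha> \<beta> \<gamma>)
  qed blast
  obtain \<omega> where \<omega>: "\<omega> \<in> one_forms A" "\<And>p \<xi>. \<xi> \<in> cotangent_space A p \<Longrightarrow> g p (\<omega> p) \<xi> = \<xi> (V p)"
    by (rule flat[OF V(1)]) (rule that)
  show ?thesis
  proof (rule that)
    show "(\<lambda>_. 1 / 2) \<cdot> \<omega> \<in> one_forms A" by (rule form_smult[OF \<omega>(1) smooth_const])
    fix \<gamma> p assume \<gamma>: "\<gamma> \<in> one_forms A"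
    have "g p (((\<lambda>_. 1 / 2) \<cdot> \<omega>) p) (\<gamma> p) = 1 / 2 * g p (\<omega> p) (\<gamma> p)"
      using tensor2_forms(1)[OF g_tensor \<omega>(1) \<omega>(1) one_formD(1)[OF \<gamma>], of p "\<lambda>_. 1 / 2" "\<lambda>_. 0"]
      by (simp add: smult_const_0)
    then show "2 * g p (((\<lambda>_. 1 / 2) \<cdot> \<omega>) p) (\<gamma> p) = koszul_formula \<alpha> \<beta> \<gamma> p"
      by (simp add: \<omega>(2)[OF one_formD(1)[OF \<gamma>]] V(2)[OF \<gamma>])
  qed
qed

text \<open>The connection is chosen form by form from the Koszul formula, and every axiom is
  checked by pairing with test forms. Adding the formulas with \<beta> and \<gamma> exchanged leaves
  2 \<sharp>\<alpha>(g(\<beta>, \<gamma>)), the metric condition; subtracting those with \<alpha>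
  and \<beta> exchanged leaves 2 g([\<alpha>, \<beta>], \<gamma>), the torsion condition.\<close>

lemma levi_civita_exists:
  obtains D where "levi_civita A g P D"
proof -
  define D where "D \<alpha> \<beta> = (SOME \<omega>. \<omega> \<in> one_forms A \<and>
    (\<forall>\<gamma>\<in>one_forms A. \<forall>p. 2 * g p (\<omega> p) (\<gamma> p) = koszul_formula \<alpha> \<beta> \<gamma> p))" for \<alpha> \<beta>
  have "D \<alpha> \<beta> \<in> one_forms A \<and> (\<forall>\<gamma>\<in>one_forms A. \<forall>p. 2 * g p (D \<alpha> \<beta> p) (\<gamma> p) = koszul_formula \<alpha> \<beta> \<gamma> p)"
    if "\<alpha> \<in> one_forms A" "\<beta> \<in> one_forms A" for \<alpha> \<beta>
  proof -
    have "\<exists>\<omega>. \<omega> \<in> one_forms A \<and> (\<forall>\<gamma>\<in>one_forms A. \<forall>p. 2 * g p (\<omega> p) (\<gamma> p) = koszul_formula \<alpha> \<beta> \<gamma> p)"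
      by (rule koszul_formula_form[OF that]) blast
    then show ?thesis unfolding D_def by (rule someI_ex)
  qed
  then have D: "D \<alpha> \<beta> \<in> one_forms A"
    and K: "\<gamma> \<in> one_forms A \<Longrightarrow> koszul_formula \<alpha> \<beta> \<gamma> p = 2 * g p (D \<alpha> \<beta> p) (\<gamma> p)"
    if "\<alpha> \<in> one_forms A" "\<beta> \<in> one_forms A" for \<alpha> \<beta> \<gamma> p
    using that by auto
  have left: "D (f \<cdot> \<alpha> + h \<cdot> \<beta>) \<gamma> = f \<cdot> D \<alpha> \<gamma> + h \<cdot> D \<beta> \<gamma>"
    if A: "\<alpha> \<in> one_forms A" "\<beta> \<in> one_forms A" "\<gamma> \<in> one_forms A" and f: "f \<in> smooth_functions A" "h \<in> smooth_functions A"
    for \<alpha> \<beta> \<gamma> f h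
  proof (rule form_nondegenerate[OF D[OF form_combine[OF A(1,2) f] A(3)] form_combine[OF D[OF A(1,3)] D[OF A(2,3)] f]])
    fix \<delta> p assume \<delta>: "\<delta> \<in> one_forms A"
    show "g p (D (f \<cdot> \<alpha> + h \<cdot> \<beta>) \<gamma> p) (\<delta> p) = g p ((f \<cdot> D \<alpha> \<gamma> + h \<cdot> D \<beta> \<gamma>) p) (\<delta> p)"
      using koszul_formula_combine(2)[OF A \<delta> f, of p]
      by (simp add: K A \<delta> form_combine f tensor2_forms(1)[OF g_tensor D[OF A(1,3)] D[OF A(2,3)] one_formD(1)[OF \<delta>]] del: plus_fun_apply)
  qed
  have right: "D \<gamma> (f \<cdot> \<alpha> + h \<cdot> \<beta>) = (f \<cdot> D \<gamma> \<alpha> + h \<cdot> D \<gamma> \<beta>) + ((\<lambda>p. sh \<gamma> p f) \<cdot> \<alpha> + (\<lambda>p. sh \<gamma> p h) \<cdot> \<beta>)"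
    if A: "\<alpha> \<in> one_forms A" "\<beta> \<in> one_forms A" "\<gamma> \<in> one_forms A" and f: "f \<in> smooth_functions A" "h \<in> smooth_functions A"
    for \<alpha> \<beta> \<gamma> f h
  proof -
    note sm = anchor_smooth[OF A(3) f(1)] anchor_smooth[OF A(3) f(2)]
    note c = form_combine[OF D[OF A(3,1)] D[OF A(3,2)] f] form_combine[OF A(1,2) sm]
    show ?thesis
    proof (rule form_nondegenerate[OF D[OF A(3) form_combine[OF A(1,2) f]] form_add[OF c]])
      fix \<delta> p assume \<delta>: "\<delta> \<in> one_forms A"
      have "2 * g p (D \<gamma> (f \<cdot> \<alpha> + h \<cdot> \<beta>) p) (\<delta> p) = 2 * (f p * g p (D \<gamma> \<alpha> p) (\<delta> p) + h p * g p (D \<gamma> \<beta> p) (\<delta> p)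
          + (sh \<gamma> p f * g p (\<alpha> p) (\<delta> p) + sh \<gamma> p h * g p (\<beta> p) (\<delta> p)))"
        using koszul_formula_combine(3)[OF A \<delta> f, of p] by (simp add: K A \<delta> form_combine f del: plus_fun_apply)
      then show "g p (D \<gamma> (f \<cdot> \<alpha> + h \<cdot> \<beta>) p) (\<delta> p) =
          g p (((f \<cdot> D \<gamma> \<alpha> + h \<cdot> D \<gamma> \<beta>) + ((\<lambda>p. sh \<gamma> p f) \<cdot> \<alpha> + (\<lambda>p. sh \<gamma> p h) \<cdot> \<beta>)) p) (\<delta> p)"
        by (simp only: g_add[OF c \<delta>] tensor2_forms(1)[OF g_tensor D[OF A(3,1)] D[OF A(3,2)] one_formD(1)[OF \<delta>]]
            tensor2_forms(1)[OF g_tensor A(1,2) one_formD(1)[OF \<delta>]]) simp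
    qed
  qed
  have zero: "sh \<gamma> p (\<lambda>_. c) = 0" if "\<gamma> \<in> one_forms A" for \<gamma> p c
    by (rule tangent_space_const[OF anchor_tangent[OF that]])
  have lin: "D ((\<lambda>_. a) \<cdot> \<alpha> + (\<lambda>_. b) \<cdot> \<beta>) \<gamma> = (\<lambda>_. a) \<cdot> D \<alpha> \<gamma> + (\<lambda>_. b) \<cdot> D \<beta> \<gamma> \<and>
        D \<gamma> ((\<lambda>_. a) \<cdot> \<alpha> + (\<lambda>_. b) \<cdot> \<beta>) = (\<lambda>_. a) \<cdot> D \<gamma> \<alpha> + (\<lambda>_. b) \<cdot> D \<gamma> \<beta>"
    if A: "\<alpha> \<in> one_forms A" "\<beta> \<in> one_forms A" "\<gamma> \<in> one_forms A" for \<alpha> \<beta> \<gamma> a b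
    using left[OF A smooth_const smooth_const] right[OF A smooth_const smooth_const]
    by (simp add: zero[OF A(3)] smult_const_0)
  have leib: "D (\<phi> \<cdot> \<alpha>) \<beta> = \<phi> \<cdot> D \<alpha> \<beta> \<and> D \<alpha> (\<phi> \<cdot> \<beta>) = \<phi> \<cdot> D \<alpha> \<beta> + (\<lambda>p. sh \<alpha> p \<phi>) \<cdot> \<beta>"
    if A: "\<alpha> \<in> one_forms A" "\<beta> \<in> one_forms A" and \<phi>: "\<phi> \<in> smooth_functions A" for \<alpha> \<beta> \<phi>
    using left[OF A(1,1,2) \<phi> smooth_const[of 0]] right[OF A(2,2,1) \<phi> smooth_const[of 0]]
    by (simp add: zero[OF A(1)] smult_const_0)
  have metric: "sh \<alpha> p (\<lambda>q. g q (\<beta> q) (\<gamma> q)) = g p (D \<alpha> \<beta> p) (\<gamma> p) + g p (\<beta> p) (D \<alpha> \<gamma> p)"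
    if A: "\<alpha> \<in> one_forms A" "\<beta> \<in> one_forms A" "\<gamma> \<in> one_forms A" for \<alpha> \<beta> \<gamma> p
  proof -
    have "(\<lambda>q. g q (\<gamma> q) (\<beta> q)) = (\<lambda>q. g q (\<beta> q) (\<gamma> q))" by (intro ext g_commute A)
    then have "koszul_formula \<alpha> \<beta> \<gamma> p + koszul_formula \<alpha> \<gamma> \<beta> p = 2 * sh \<alpha> p (\<lambda>q. g q (\<beta> q) (\<gamma> q))"
      by (simp add: koszul_formula_def koszul_skew[OF A(1,2)] koszul_skew[OF A(1,3)] koszul_skew[OF A(2,3)]
          g_minus koszul_form A del: uminus_apply)
    moreover have "g p (\<beta> p) (D \<alpha> \<gamma> p) = g p (D \<alpha> \<gamma> p) (\<beta> p)" by (intro g_commute A D)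
    ultimately show ?thesis by (simp add: K A)
  qed
  have torsion: "D \<alpha> \<beta> - D \<beta> \<alpha> = kos \<alpha> \<beta>" if A: "\<alpha> \<in> one_forms A" "\<beta> \<in> one_forms A" for \<alpha> \<beta>
  proof (rule form_nondegenerate[OF form_diff[OF D[OF A] D[OF A(2,1)]] koszul_form[OF A]])
    fix \<gamma> p assume \<gamma>: "\<gamma> \<in> one_forms A"
    have "(\<lambda>q. g q (\<beta> q) (\<alpha> q)) = (\<lambda>q. g q (\<alpha> q) (\<beta> q))" by (intro ext g_commute A)
    then have "koszul_formula \<alpha> \<beta> \<gamma> p - koszul_formula \<beta> \<alpha> \<gamma> p = 2 * g p (kos \<alpha> \<beta> p) (\<gamma> p)"
      by (simp add: koszul_formula_def koszul_skew[OF A] g_minus koszul_form A \<gamma> del: uminus_apply)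
    moreover have "g p ((D \<alpha> \<beta> - D \<beta> \<alpha>) p) (\<gamma> p) = g p (D \<alpha> \<beta> p) (\<gamma> p) - g p (D \<beta> \<alpha> p) (\<gamma> p)"
      using g_add[OF D[OF A] form_uminus[OF D[OF A(2,1)]] \<gamma>, of p] g_minus[OF D[OF A(2,1)] \<gamma>, of p] by simp
    ultimately show "g p ((D \<alpha> \<beta> - D \<beta> \<alpha>) p) (\<gamma> p) = g p (kos \<alpha> \<beta> p) (\<gamma> p)"
      by (simp add: K A \<gamma>)
  qed
  have "levi_civita A g P D"
    unfolding levi_civita_def contravariant_connection_def
    by (intro conjI ballI allI; (rule D conjunct1[OF lin] conjunct2[OF lin] conjunct1[OF leib]
          conjunct2[OF leib] metric torsion; assumption))
  then show ?thesis by (rule that)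
qed

lemma levi_civitaD:
  assumes "levi_civita A g P D"
  shows "\<alpha> \<in> one_forms A \<Longrightarrow> \<beta> \<in> one_forms A \<Longrightarrow> D \<alpha> \<beta> \<in> one_forms A"
    and "\<alpha> \<in> one_forms A \<Longrightarrow> \<beta> \<in> one_forms A \<Longrightarrow> \<gamma> \<in> one_forms A \<Longrightarrow>
      sh \<alpha> p (\<lambda>q. g q (\<beta> q) (\<gamma> q)) = g p (D \<alpha> \<beta> p) (\<gamma> p) + g p (\<beta> p) (D \<alpha> \<gamma> p)"
    and "\<alpha> \<in> one_forms A \<Longrightarrow> \<beta> \<in> one_forms A \<Longrightarrow> kos \<alpha> \<beta> = D \<alpha> \<beta> - D \<beta> \<alpha>"
    and "\<alpha> \<in> one_forms A \<Longrightarrow> \<beta> \<in> one_forms A \<Longrightarrow> \<phi> \<in> smooth_functions A \<Longrightarrow> D (\<phi> \<cdot> \<alpha>) \<beta> = \<phi> \<cdot> D \<alpha> \<beta>"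
    and "\<alpha> \<in> one_forms A \<Longrightarrow> \<beta> \<in> one_forms A \<Longrightarrow> \<phi> \<in> smooth_functions A \<Longrightarrow>
      D \<alpha> (\<phi> \<cdot> \<beta>) = \<phi> \<cdot> D \<alpha> \<beta> + (\<lambda>p. sh \<alpha> p \<phi>) \<cdot> \<beta>"
    and "\<alpha> \<in> one_forms A \<Longrightarrow> \<beta> \<in> one_forms A \<Longrightarrow> \<gamma> \<in> one_forms A \<Longrightarrow> D (\<alpha> + \<beta>) \<gamma> = D \<alpha> \<gamma> + D \<beta> \<gamma>"
    and "\<alpha> \<in> one_forms A \<Longrightarrow> \<beta> \<in> one_forms A \<Longrightarrow> \<gamma> \<in> one_forms A \<Longrightarrow> D \<gamma> (\<alpha> + \<beta>) = D \<gamma> \<alpha> + D \<gamma> \<beta>"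
proof -
  note D = assms[unfolded levi_civita_def contravariant_connection_def]
  note 1 = D[THEN conjunct1, THEN conjunct1] and 4 = D[THEN conjunct1, THEN conjunct2, THEN conjunct1]
    and 5 = D[THEN conjunct1, THEN conjunct2, THEN conjunct2]
    and 2 = D[THEN conjunct2, THEN conjunct1] and 3 = D[THEN conjunct2, THEN conjunct2]
  show "\<alpha> \<in> one_forms A \<Longrightarrow> \<beta> \<in> one_forms A \<Longrightarrow> D \<alpha> \<beta> \<in> one_forms A"
    and "\<alpha> \<in> one_forms A \<Longrightarrow> \<beta> \<in> one_forms A \<Longrightarrow> \<gamma> \<in> one_forms A \<Longrightarrow>
      sh \<alpha> p (\<lambda>q. g q (\<beta> q) (\<gamma> q)) = g p (D \<alpha> \<beta> p) (\<gamma> p) + g p (\<beta> p) (D \<alpha> \<gamma> p)"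
    and "\<alpha> \<in> one_forms A \<Longrightarrow> \<beta> \<in> one_forms A \<Longrightarrow> kos \<alpha> \<beta> = D \<alpha> \<beta> - D \<beta> \<alpha>"
    and "\<alpha> \<in> one_forms A \<Longrightarrow> \<beta> \<in> one_forms A \<Longrightarrow> \<phi> \<in> smooth_functions A \<Longrightarrow> D (\<phi> \<cdot> \<alpha>) \<beta> = \<phi> \<cdot> D \<alpha> \<beta>"
    and "\<alpha> \<in> one_forms A \<Longrightarrow> \<beta> \<in> one_forms A \<Longrightarrow> \<phi> \<in> smooth_functions A \<Longrightarrow>
      D \<alpha> (\<phi> \<cdot> \<beta>) = \<phi> \<cdot> D \<alpha> \<beta> + (\<lambda>p. sh \<alpha> p \<phi>) \<cdot> \<beta>"
    using 1 2 3 5 by auto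
  show "D (\<alpha> + \<beta>) \<gamma> = D \<alpha> \<gamma> + D \<beta> \<gamma>" "D \<gamma> (\<alpha> + \<beta>) = D \<gamma> \<alpha> + D \<gamma> \<beta>"
    if A: "\<alpha> \<in> one_forms A" "\<beta> \<in> one_forms A" "\<gamma> \<in> one_forms A"
    using bspec[OF bspec[OF bspec[OF 4 A(1)] A(2)] A(3), THEN spec, THEN spec, of 1 1]
    by (simp_all add: smult_const_1)
qed

text \<open>Derivatives of g are replaced by the metric condition and brackets by the torsion
  condition; all terms but two copies of g(D\<alpha>\<beta>, \<gamma>) cancel. With nondegeneracy
  this fixes D on 1-forms, which is how the connection of the product is computed.\<close>

lemma levi_civita_koszul:
  assumes D: "levi_civita A g P D" and A: "\<alpha> \<in> one_forms A" "\<beta> \<in> one_forms A" "\<gamma> \<in> one_forms A"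
  shows "2 * g p (D \<alpha> \<beta> p) (\<gamma> p) = koszul_formula \<alpha> \<beta> \<gamma> p"
proof -
  note DF = levi_civitaD(1)[OF D]
  have sub: "g p ((\<xi> - \<eta>) p) (\<zeta> p) = g p (\<xi> p) (\<zeta> p) - g p (\<eta> p) (\<zeta> p)"
    if "\<xi> \<in> one_forms A" "\<eta> \<in> one_forms A" "\<zeta> \<in> one_forms A" for \<xi> \<eta> \<zeta>
    using g_add[OF that(1) form_uminus[OF that(2)] that(3), of p] g_minus[OF that(2,3), of p] by simp
  have c: "g p (\<beta> p) (D \<alpha> \<gamma> p) = g p (D \<alpha> \<gamma> p) (\<beta> p)" "g p (\<alpha> p) (D \<gamma> \<beta> p) = g p (D \<gamma> \<beta> p) (\<alpha> p)"
     "g p (\<alpha> p) (D \<beta> \<gamma> p) = g p (D \<beta> \<gamma> p) (\<alpha> p)"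
    by (intro g_commute A DF)+
  show ?thesis
    unfolding koszul_formula_def levi_civitaD(2)[OF D A] levi_civitaD(2)[OF D A(2,1,3)] levi_civitaD(2)[OF D A(3,1,2)]
      levi_civitaD(3)[OF D A(1,2)] levi_civitaD(3)[OF D A(3,1)] levi_civitaD(3)[OF D A(3,2)]
    by (simp add: sub DF A c del: minus_apply)
qed

end

section \<open>Cometrics\<close>

context manifold
begin

text \<open>Two facts need finite dimension: every covector is represented by a tangent vector, by
  injectivity of a linear endomorphism of the model space, and the cometric is smooth, because in a
  frame its coefficients form the inverse of the matrix of \<open>G\<close>.\<close>

lemma cometric_tensor_cometric:
  assumes M: "pseudo_riemannian_metric A G"
  shows "cometric_tensor A (cometric A G)"
proof -
  have sym: "G p u v = G p v u" if "u \<in> tangent_space A p" "v \<in> tangent_space A p" for p u v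
    using M that unfolding pseudo_riemannian_metric_def by blast
  have lin: "G p (\<lambda>f. a * u f + b * v f) w = a * G p u w + b * G p v w"
    if "u \<in> tangent_space A p" "v \<in> tangent_space A p" "w \<in> tangent_space A p" for p u v w a b
    using M that unfolding pseudo_riemannian_metric_def by blast
  have nondeg: "u = 0" if "u \<in> tangent_space A p" "\<And>v. v \<in> tangent_space A p \<Longrightarrow> G p u v = 0" for p u
    using M that unfolding pseudo_riemannian_metric_def by blast
  have Gs: "(\<lambda>p. G p (X p) (Y p)) \<in> smooth_functions A"
    if "X \<in> vector_fields A" "Y \<in> vector_fields A" for X Y
    using M that unfolding pseudo_riemannian_metric_def by blast
  \<comment> \<open>The lowering map, extended by 0 outside the tangent space as
    \<open>cotangent_space\<close> demands.\<close>
  define fl where "fl p v = (\<lambda>w. if w \<in> tangent_space A p then G p v w else 0)" for p v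
  have fl: "fl p v \<in> cotangent_space A p" if v: "v \<in> tangent_space A p" for p v
  proof (rule cotangent_spaceI)
    fix u w a b assume "u \<in> tangent_space A p" "w \<in> tangent_space A p"
    then show "fl p v (\<lambda>f. a * u f + b * w f) = a * fl p v u + b * fl p v w"
      using lin[of u p w v a b] sym[OF v] tangent_space_combine[of u p w a b] v by (simp add: fl_def)
  qed (simp add: fl_def)
  have fl_inj: "u = v" if u: "u \<in> tangent_space A p" and v: "v \<in> tangent_space A p"
    and eq: "\<And>w. w \<in> tangent_space A p \<Longrightarrow> G p u w = G p v w" for p u v
  proof -
    have "G p (\<lambda>f. 1 * u f + (-1) * v f) w = 0" if w: "w \<in> tangent_space A p" for w
      using lin[OF u v w, of 1 "-1"] eq[OF w] by simp
    then have "(\<lambda>f. 1 * u f + (-1) * v f) = 0"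
      by (rule nondeg[OF tangent_space_combine[OF u v]])
    then show ?thesis by (simp add: fun_eq_iff)
  qed
  have ex: "\<exists>v. v \<in> tangent_space A p \<and> (\<forall>w\<in>tangent_space A p. G p v w = \<xi> w)"
    if \<xi>: "\<xi> \<in> cotangent_space A p" for p \<xi>
  proof -
    obtain x X W where F: "frame_on A (Basis :: 'e set) x X W" "p \<in> W" by (rule frame_at)
    have XT: "X b p \<in> tangent_space A p" if "b \<in> Basis" for b
      by (rule vector_fieldD(1)[OF frame_onD(4)[OF F(1) that]])
    define v where "v c = (\<lambda>f. \<Sum>a\<in>Basis. (c \<bullet> a) * X a p f)" for c :: 'e
    have v: "v c \<in> tangent_space A p" for c
      unfolding v_def by (rule tangent_space_sum[OF XT])
    have vx: "v c (x a) = c \<bullet> a" if "a \<in> Basis" for c a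
    proof -
      have "v c (x a) = (\<Sum>b\<in>Basis. (c \<bullet> b) * (if b = a then 1 else 0))"
        unfolding v_def by (intro sum.cong refl) (simp add: frame_onD(6)[OF F _ that])
      then show ?thesis using that by (simp add: if_distrib cong: if_cong)
    qed
    \<comment> \<open>Lowering an index, written in the frame at p as an endomorphism of the model
      space. Nondegeneracy of \<open>G\<close> makes it injective, hence surjective, and a preimage
      of the components of the covector gives the representing vector.\<close>
    define L where "L c = (\<Sum>b\<in>Basis. G p (v c) (X b p) *\<^sub>R b)" for c
    have vlin: "v (r *\<^sub>R c + s *\<^sub>R d) = (\<lambda>f. r * v c f + s * v d f)" for r s c d
      by (simp add: v_def inner_add_left sum_distrib_left sum.distrib algebra_simps)
    have Glin: "G p (v (r *\<^sub>R c + s *\<^sub>R d)) (X b p) = r * G p (v c) (X b p) + s * G p (v d) (X b p)"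
      if "b \<in> Basis" for r s c d b
      unfolding vlin by (rule lin[OF v v XT[OF that]])
    have "linear L"
    proof (rule linearI)
      show "L (c + d) = L c + L d" for c d
        unfolding L_def sum.distrib[symmetric]
        by (intro sum.cong refl) (use Glin[of _ 1 c 1 d] in \<open>simp add: scaleR_add_left\<close>)
      show "L (r *\<^sub>R c) = r *\<^sub>R L c" for r c
        unfolding L_def scaleR_sum_right
        by (intro sum.cong refl) (use Glin[of _ r c 0 c] in simp)
    qed
    have all: "G p (v c) w = \<eta> w" if eq: "\<And>b. b \<in> Basis \<Longrightarrow> G p (v c) (X b p) = \<eta> (X b p)"
      and \<eta>: "\<eta> \<in> cotangent_space A p" and w: "w \<in> tangent_space A p" for c w \<eta>
    proof -
      have "G p (v c) w = fl p (v c) w" using w by (simp add: fl_def)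
      also have "\<dots> = (\<Sum>b\<in>Basis. w (x b) * fl p (v c) (X b p))"
        by (rule cotangent_frame(1)[OF F fl[OF v] w])
      also have "\<dots> = (\<Sum>b\<in>Basis. w (x b) * \<eta> (X b p))"
        by (intro sum.cong refl) (simp add: fl_def XT eq)
      also have "\<dots> = \<eta> w" by (rule cotangent_frame(1)[OF F \<eta> w, symmetric])
      finally show ?thesis .
    qed
    have Lb: "L c \<bullet> b = G p (v c) (X b p)" if "b \<in> Basis" for c b
      unfolding L_def by (rule inner_sum_left_Basis[OF that])
    have "inj L"
    proof (rule linear_injective_0[OF \<open>linear L\<close>, THEN iffD2], intro allI impI)
      fix c assume "L c = 0"
      then have "G p (v c) (X b p) = (\<lambda>_. 0) (X b p)" if "b \<in> Basis" for b
        using Lb[OF that, of c] by simp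
      moreover have "(\<lambda>_. 0) \<in> cotangent_space A p" by (rule cotangent_spaceI) simp_all
      ultimately have "G p (v c) w = 0" if "w \<in> tangent_space A p" for w
        using all[of c "\<lambda>_. 0" w] that by blast
      then have v0: "v c = 0" by (rule nondeg[OF v])
      have "c \<bullet> a = 0" if "a \<in> Basis" for a unfolding vx[OF that, of c, symmetric] v0 by simp
      then show "c = 0" by (rule euclidean_all_zero_iff[THEN iffD1, OF ballI])
    qed
    then have "surj L" by (rule linear_inj_imp_surj[OF \<open>linear L\<close>])
    then obtain c where c: "L c = (\<Sum>b\<in>Basis. \<xi> (X b p) *\<^sub>R b)" by (metis surjD)
    have "G p (v c) (X b p) = \<xi> (X b p)" if "b \<in> Basis" for b
      using Lb[OF that, of c] unfolding c inner_sum_left_Basis[OF that] by simp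
    then show ?thesis using all[OF _ \<xi>, of c] v by blast
  qed
  have raise: "raise A G p \<xi> \<in> tangent_space A p"
    and raise_eq: "w \<in> tangent_space A p \<Longrightarrow> G p (raise A G p \<xi>) w = \<xi> w"
    and raise_unique: "v \<in> tangent_space A p \<Longrightarrow> (\<And>w. w \<in> tangent_space A p \<Longrightarrow> G p v w = \<xi> w) \<Longrightarrow> raise A G p \<xi> = v"
    if \<xi>: "\<xi> \<in> cotangent_space A p" for p \<xi> w v
  proof -
    let ?Q = "\<lambda>v. v \<in> tangent_space A p \<and> (\<forall>w\<in>tangent_space A p. G p v w = \<xi> w)"
    obtain u where u: "?Q u" using ex[OF \<xi>] by blast
    have un: "v = u" if "?Q v" for v
      using that u by (intro fl_inj[of v p u]) auto
    have Q: "?Q (raise A G p \<xi>)"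
      unfolding raise_def by (rule theI[of ?Q, OF u un])
    show "raise A G p \<xi> = v" if "v \<in> tangent_space A p" "\<And>w. w \<in> tangent_space A p \<Longrightarrow> G p v w = \<xi> w"
      using un[OF Q] un[of v] that by simp
    from Q show "raise A G p \<xi> \<in> tangent_space A p"
      and "w \<in> tangent_space A p \<Longrightarrow> G p (raise A G p \<xi>) w = \<xi> w"
      by auto
  qed
  have com: "cometric A G p \<xi> \<eta> = \<xi> (raise A G p \<eta>)"
    if "\<xi> \<in> cotangent_space A p" "\<eta> \<in> cotangent_space A p" for p \<xi> \<eta>
    unfolding cometric_def by (rule raise_eq[OF that(1) raise[OF that(2)]])
  have com_sym: "cometric A G p \<xi> \<eta> = cometric A G p \<eta> \<xi>"
    if "\<xi> \<in> cotangent_space A p" "\<eta> \<in> cotangent_space A p" for p \<xi> \<eta>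
    unfolding cometric_def by (rule sym[OF raise[OF that(1)] raise[OF that(2)]])
  have smooth: "(\<lambda>p. cometric A G p (\<alpha> p) (\<beta> p)) \<in> smooth_functions A"
    if \<alpha>: "\<alpha> \<in> one_forms A" and \<beta>: "\<beta> \<in> one_forms A" for \<alpha> \<beta>
  proof (rule smooth_functionsI)
    fix p0
    obtain x X W where F: "frame_on A (Basis :: 'e set) x X W" "p0 \<in> W" by (rule frame_at)
    obtain U \<phi> where U: "(U, \<phi>) \<in> A" "p0 \<in> U" by (rule chart_at)
    have o: "open (W \<inter> U)" using frame_onD(2)[OF F(1)] chart(1)[OF U(1)] by (rule open_Int)
    have oi: "open (\<phi> ` (W \<inter> U))" by (rule chart_open_image[OF U(1) o]) simp
    have inv: "inv_into U \<phi> y \<in> W" if "y \<in> \<phi> ` (W \<inter> U)" for y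
      using that chart_inv[OF U(1)] by auto
    have sm: "smooth_on (h \<circ> inv_into U \<phi>) (\<phi> ` (W \<inter> U))" if "h \<in> smooth_functions A" for h
      by (rule smooth_on_subset[OF smooth_chart[OF that U(1)]]) auto
    define R where "R i p = raise A G p (exterior_d A (x i) p)" for i p
    have R: "R i p \<in> tangent_space A p" for i p
      unfolding R_def by (rule raise[OF exterior_d_cotangent])
    define m where "m i j p = G p (X i p) (X j p)" for i j p
    \<comment> \<open>The coefficients of the cometric on the differentials of the coordinates. They
      are shown to be inverse to \<open>m\<close>, so their smoothness follows from that of
      \<open>m\<close>.\<close>
    define n where "n i j p = R i p (x j)" for i j p
    have XV: "X i \<in> vector_fields A" if "i \<in> Basis" for i by (rule frame_onD(4)[OF F(1) that])
    have XT: "X i p \<in> tangent_space A p" if "i \<in> Basis" for i p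
      by (rule vector_fieldD(1)[OF XV[OF that]])
    have n_sym: "n i j p = n j i p" for i j p
    proof -
      have "n i j p = cometric A G p (exterior_d A (x j) p) (exterior_d A (x i) p)" for i j
        unfolding com[OF exterior_d_cotangent exterior_d_cotangent] R_def[symmetric] n_def
        by (rule exterior_d_apply[OF R, symmetric])
      then show ?thesis using com_sym[OF exterior_d_cotangent exterior_d_cotangent] by simp
    qed
    have m_sym: "m i j p = m j i p" if "i \<in> Basis" "j \<in> Basis" for i j p
      unfolding m_def by (rule sym[OF XT[OF that(1)] XT[OF that(2)]])
    have nm: "(\<Sum>l\<in>Basis. n i l p * m l j p) = (if i = j then 1 else 0)"
      if p: "p \<in> W" and ij: "i \<in> Basis" "j \<in> Basis" for i j p
    proof -
      have "(\<Sum>l\<in>Basis. n i l p * m l j p) = (\<Sum>l\<in>Basis. R i p (x l) * fl p (X j p) (X l p))"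
        by (intro sum.cong refl) (simp add: n_def m_def fl_def XT ij sym[OF XT XT])
      also have "\<dots> = fl p (X j p) (R i p)"
        by (rule cotangent_frame(1)[OF F(1) p fl[OF XT[OF ij(2)]] R, symmetric])
      also have "\<dots> = G p (R i p) (X j p)"
        by (simp add: fl_def R sym[OF XT[OF ij(2)] R])
      also have "\<dots> = X j p (x i)"
        unfolding R_def by (simp add: raise_eq[OF exterior_d_cotangent XT[OF ij(2)]] exterior_d_apply XT ij)
      finally show ?thesis by (simp add: frame_onD(6)[OF F(1) p ij(2,1)] eq_commute)
    qed
    have mn: "(\<Sum>l\<in>Basis. m i l p * n l j p) = (if i = j then 1 else 0)"
      if p: "p \<in> W" and ij: "i \<in> Basis" "j \<in> Basis" for i j p
    proof -
      have "(\<Sum>l\<in>Basis. m i l p * n l j p) = (\<Sum>l\<in>Basis. n j l p * m l i p)"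
        by (intro sum.cong refl) (simp add: n_sym[of _ j] m_sym[OF ij(1)])
      then show ?thesis by (simp add: nm[OF p ij(2,1)] eq_commute)
    qed
    have ns: "smooth_on (n i j \<circ> inv_into U \<phi>) (\<phi> ` (W \<inter> U))" if "i \<in> Basis" "j \<in> Basis" for i j
    proof (rule smooth_on_inverse_matrix[of Basis _ "\<lambda>i j. m i j \<circ> inv_into U \<phi>"])
      show "smooth_on (m i j \<circ> inv_into U \<phi>) (\<phi> ` (W \<inter> U))" if "i \<in> Basis" "j \<in> Basis" for i j
        unfolding m_def by (rule sm[OF Gs[OF XV[OF that(1)] XV[OF that(2)]]])
    qed (use oi nm mn inv that in auto)
    have eq: "cometric A G p (\<alpha> p) (\<beta> p) = (\<Sum>i\<in>Basis. \<Sum>j\<in>Basis. n i j p * (\<beta> p (X j p) * \<alpha> p (X i p)))"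
      if p: "p \<in> W" for p
    proof -
      note \<alpha>T = one_formD(1)[OF \<alpha>] and \<beta>T = one_formD(1)[OF \<beta>]
      have "raise A G p (\<beta> p) (x i) = (\<Sum>j\<in>Basis. n i j p * \<beta> p (X j p))" for i
      proof -
        have "raise A G p (\<beta> p) (x i) = cometric A G p (exterior_d A (x i) p) (\<beta> p)"
          by (simp add: com[OF exterior_d_cotangent \<beta>T] exterior_d_apply[OF raise[OF \<beta>T]])
        also have "\<dots> = \<beta> p (R i p)"
          by (simp add: com_sym[OF exterior_d_cotangent \<beta>T] com[OF \<beta>T exterior_d_cotangent] R_def)
        also have "\<dots> = (\<Sum>j\<in>Basis. n i j p * \<beta> p (X j p))"
          unfolding n_def by (rule cotangent_frame(1)[OF F(1) p \<beta>T R])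
        finally show ?thesis .
      qed
      moreover have "cometric A G p (\<alpha> p) (\<beta> p) = (\<Sum>i\<in>Basis. raise A G p (\<beta> p) (x i) * \<alpha> p (X i p))"
        unfolding com[OF \<alpha>T \<beta>T] by (rule cotangent_frame(1)[OF F(1) p \<alpha>T raise[OF \<beta>T]])
      ultimately show ?thesis by (simp add: sum_distrib_right mult.assoc)
    qed
    have "smooth_on (\<lambda>y. \<Sum>i\<in>Basis. \<Sum>j\<in>Basis. (n i j \<circ> inv_into U \<phi>) y *
        ((\<lambda>p. \<beta> p (X j p) * \<alpha> p (X i p)) \<circ> inv_into U \<phi>) y) (\<phi> ` (W \<inter> U))"
      by (intro smooth_on_sum smooth_on_mult ns oi sm smooth_mult one_formD(2)[OF \<alpha>] one_formD(2)[OF \<beta>] XV)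
    then have "smooth_on ((\<lambda>p. cometric A G p (\<alpha> p) (\<beta> p)) \<circ> inv_into U \<phi>) (\<phi> ` (W \<inter> U))"
      by (rule smooth_on_cong[OF _ oi]) (simp add: eq[OF inv])
    then show "\<exists>U \<phi> W. (U, \<phi>) \<in> A \<and> open W \<and> p0 \<in> W \<and> W \<subseteq> U \<and>
        smooth_on ((\<lambda>p. cometric A G p (\<alpha> p) (\<beta> p)) \<circ> inv_into U \<phi>) (\<phi> ` W)"
      using U F(2) o by (intro exI[of _ U] exI[of _ \<phi>] exI[of _ "W \<inter> U"]) auto
  qed
  have bil: "cometric A G p (\<lambda>v. a * \<xi> v + b * \<eta> v) \<zeta> = a * cometric A G p \<xi> \<zeta> + b * cometric A G p \<eta> \<zeta>"
    "cometric A G p \<zeta> (\<lambda>v. a * \<xi> v + b * \<eta> v) = a * cometric A G p \<zeta> \<xi> + b * cometric A G p \<zeta> \<eta>"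
    if c: "\<xi> \<in> cotangent_space A p" "\<eta> \<in> cotangent_space A p" "\<zeta> \<in> cotangent_space A p" for p \<xi> \<eta> \<zeta> a b
    by (simp_all add: com cotangent_combine c com_sym[OF c(3) cotangent_combine[OF c(1,2)]]
        com_sym[OF c(3,1)] com_sym[OF c(3,2)])
  have tensor: "tensor2 A (cometric A G)"
    unfolding tensor2_def
    by (intro conjI ballI allI; (rule smooth bil; assumption))
  have flat: "\<exists>\<omega>\<in>one_forms A. \<forall>p. \<forall>\<xi>\<in>cotangent_space A p. cometric A G p (\<omega> p) \<xi> = \<xi> (V p)"
    if V: "V \<in> vector_fields A" for V
  proof (rule bexI[of _ "\<lambda>p. fl p (V p)"], intro allI ballI)
    note VT = vector_fieldD(1)[OF V]
    fix p \<xi> assume \<xi>: "\<xi> \<in> cotangent_space A p"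
    have "raise A G p (fl p (V p)) = V p"
      by (rule raise_unique[OF fl[OF VT] VT]) (simp add: fl_def)
    then show "cometric A G p (fl p (V p)) \<xi> = \<xi> (V p)"
      by (simp add: com_sym[OF fl[OF VT] \<xi>] com[OF \<xi> fl[OF VT]])
  next
    show "(\<lambda>p. fl p (V p)) \<in> one_forms A"
      by (rule one_formI[OF fl[OF vector_fieldD(1)[OF V]]])
         (simp add: fl_def vector_fieldD(1) Gs[OF V])
  qed
  show ?thesis
    unfolding cometric_tensor_def using tensor com_sym flat by blast
qed

end


section \<open>The curvature and its covariant derivative\<close>

locale levi_civita_manifold = metric_manifold A P g
  for A :: "('a::{t2_space,second_countable_topology}, 'e::euclidean_space) chart set" and P g +
  fixes D :: "'a connection"
  assumes levi_civita: "levi_civita A g P D"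
begin

abbreviation "R \<equiv> curvature A P D"

definition DR :: "'a form \<Rightarrow> 'a form \<Rightarrow> 'a form \<Rightarrow> 'a form \<Rightarrow> 'a form" where
  "DR \<alpha> \<beta> \<gamma> \<delta> = D \<alpha> (R \<beta> \<gamma> \<delta>) - R (D \<alpha> \<beta>) \<gamma> \<delta> - R \<beta> (D \<alpha> \<gamma>) \<delta> - R \<beta> \<gamma> (D \<alpha> \<delta>)"

text \<open>The vector field \<open>[\<sharp>\<beta>, \<sharp>\<gamma>] - \<sharp>[\<beta>, \<gamma>]\<close>, which vanishes if and only if \<open>P\<close> is a Poisson tensor.\<close>

definition jacobi_defect :: "'a form \<Rightarrow> 'a form \<Rightarrow> ('a \<Rightarrow> real) \<Rightarrow> 'a \<Rightarrow> real" where
  "jacobi_defect \<beta> \<gamma> \<phi> p = sh \<beta> p (\<lambda>q. sh \<gamma> q \<phi>) - sh \<gamma> p (\<lambda>q. sh \<beta> q \<phi>) - sh (kos \<beta> \<gamma>) p \<phi>"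

lemmas D_form = levi_civitaD(1)[OF levi_civita]
  and D_smult_left = levi_civitaD(4)[OF levi_civita]
  and D_smult_right = levi_civitaD(5)[OF levi_civita]
  and D_add_left = levi_civitaD(6)[OF levi_civita]
  and D_add_right = levi_civitaD(7)[OF levi_civita]

lemma koszul_add:
  assumes "\<alpha> \<in> one_forms A" "\<beta> \<in> one_forms A" "\<gamma> \<in> one_forms A"
  shows "kos \<alpha> (\<beta> + \<gamma>) = kos \<alpha> \<beta> + kos \<alpha> \<gamma>" "kos (\<beta> + \<gamma>) \<alpha> = kos \<beta> \<alpha> + kos \<gamma> \<alpha>"
  using koszul_combine[OF assms smooth_const[of 1] smooth_const[of 1]]
    koszul_combine_left[OF assms smooth_const[of 1] smooth_const[of 1]]
  by (simp_all add: smult_const_1 smult_const_0 tangent_space_const[OF anchor_tangent[OF assms(1)]])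

lemma koszul_smult:
  assumes "\<alpha> \<in> one_forms A" "\<beta> \<in> one_forms A" "f \<in> smooth_functions A"
  shows "kos \<alpha> (f \<cdot> \<beta>) = f \<cdot> kos \<alpha> \<beta> + (\<lambda>p. sh \<alpha> p f) \<cdot> \<beta>"
    "kos (f \<cdot> \<beta>) \<alpha> = f \<cdot> kos \<beta> \<alpha> + (\<lambda>p. - sh \<alpha> p f) \<cdot> \<beta>"
  using koszul_combine[OF assms(1,2,2,3) smooth_const[of 0]]
    koszul_combine_left[OF assms(1,2,2,3) smooth_const[of 0]]
  by (simp_all add: smult_const_1 smult_const_0 tangent_space_const[OF anchor_tangent[OF assms(1)]])

lemma R_form: "\<alpha> \<in> one_forms A \<Longrightarrow> \<beta> \<in> one_forms A \<Longrightarrow> \<gamma> \<in> one_forms A \<Longrightarrow> R \<alpha> \<beta> \<gamma> \<in> one_forms A"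
  unfolding curvature_def by (intro form_diff D_form koszul_form)

lemma R_add:
  assumes "\<alpha> \<in> one_forms A" "\<alpha>' \<in> one_forms A" "\<beta> \<in> one_forms A" "\<gamma> \<in> one_forms A"
  shows "R (\<alpha> + \<alpha>') \<beta> \<gamma> = R \<alpha> \<beta> \<gamma> + R \<alpha>' \<beta> \<gamma>" "R \<beta> (\<alpha> + \<alpha>') \<gamma> = R \<beta> \<alpha> \<gamma> + R \<beta> \<alpha>' \<gamma>"
    "R \<beta> \<gamma> (\<alpha> + \<alpha>') = R \<beta> \<gamma> \<alpha> + R \<beta> \<gamma> \<alpha>'"
  by (simp_all add: curvature_def D_add_left D_add_right koszul_add koszul_form D_form assms)

text \<open>In the first two slots the derivatives of f produced by D and by the Koszul bracket
  cancel. In the third slot the mixed first-order terms cancel by antisymmetry, and what acts on f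
  is [\<sharp>\<alpha>, \<sharp>\<beta>] from the iterated derivatives minus
  \<sharp>[\<alpha>, \<beta>] from the bracket term.\<close>

lemma R_smult:
  assumes "\<alpha> \<in> one_forms A" "\<beta> \<in> one_forms A" "\<gamma> \<in> one_forms A" and f: "f \<in> smooth_functions A"
  shows "R (f \<cdot> \<alpha>) \<beta> \<gamma> = f \<cdot> R \<alpha> \<beta> \<gamma>" "R \<alpha> (f \<cdot> \<beta>) \<gamma> = f \<cdot> R \<alpha> \<beta> \<gamma>"
    "R \<alpha> \<beta> (f \<cdot> \<gamma>) = f \<cdot> R \<alpha> \<beta> \<gamma> + jacobi_defect \<alpha> \<beta> f \<cdot> \<gamma>"
  by (rule ext, rule ext,
      simp add: curvature_def D_smult_left D_smult_right D_add_left D_add_right koszul_smult koszul_form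
        D_form form_smult form_add anchor_smooth smooth_minus assms,
      simp add: smult_def jacobi_defect_def algebra_simps)+

lemma DR_form:
  "\<alpha> \<in> one_forms A \<Longrightarrow> \<beta> \<in> one_forms A \<Longrightarrow> \<gamma> \<in> one_forms A \<Longrightarrow> \<delta> \<in> one_forms A \<Longrightarrow> DR \<alpha> \<beta> \<gamma> \<delta> \<in> one_forms A"
  unfolding DR_def by (intro form_diff D_form R_form)

lemma DR_add:
  assumes "\<alpha> \<in> one_forms A" "\<alpha>' \<in> one_forms A" "\<beta> \<in> one_forms A" "\<gamma> \<in> one_forms A" "\<delta> \<in> one_forms A"
  shows "DR (\<alpha> + \<alpha>') \<beta> \<gamma> \<delta> = DR \<alpha> \<beta> \<gamma> \<delta> + DR \<alpha>' \<beta> \<gamma> \<delta>"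
    "DR \<beta> (\<alpha> + \<alpha>') \<gamma> \<delta> = DR \<beta> \<alpha> \<gamma> \<delta> + DR \<beta> \<alpha>' \<gamma> \<delta>"
    "DR \<beta> \<gamma> (\<alpha> + \<alpha>') \<delta> = DR \<beta> \<gamma> \<alpha> \<delta> + DR \<beta> \<gamma> \<alpha>' \<delta>"
    "DR \<beta> \<gamma> \<delta> (\<alpha> + \<alpha>') = DR \<beta> \<gamma> \<delta> \<alpha> + DR \<beta> \<gamma> \<delta> \<alpha>'"
  by (simp_all add: DR_def D_add_left D_add_right R_add R_form D_form assms)

text \<open>Only the last term of \<open>DR\<close> violates linearity here: it contains the
  curvature applied to f D\<alpha>\<delta>, a multiple in the third slot. This isolates the defect
  multiplied by a single covariant derivative.\<close>

lemma DR_smult_left: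
  assumes "\<alpha> \<in> one_forms A" "\<beta> \<in> one_forms A" "\<gamma> \<in> one_forms A" "\<delta> \<in> one_forms A" "f \<in> smooth_functions A"
  shows "DR (f \<cdot> \<alpha>) \<beta> \<gamma> \<delta> = f \<cdot> DR \<alpha> \<beta> \<gamma> \<delta> - jacobi_defect \<beta> \<gamma> f \<cdot> D \<alpha> \<delta>"
  by (rule ext, rule ext, simp add: DR_def D_smult_left R_smult R_form D_form assms,
      simp add: smult_def algebra_simps)

lemma DR_smult:
  assumes "\<alpha> \<in> one_forms A" "\<beta> \<in> one_forms A" "\<gamma> \<in> one_forms A" "\<delta> \<in> one_forms A" and f: "f \<in> smooth_functions A"
    and J: "\<And>\<beta> \<gamma> f. \<beta> \<in> one_forms A \<Longrightarrow> \<gamma> \<in> one_forms A \<Longrightarrow> f \<in> smooth_functions A \<Longrightarrow> jacobi_defect \<beta> \<gamma> f = (\<lambda>p. 0)"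
  shows "DR (f \<cdot> \<alpha>) \<beta> \<gamma> \<delta> = f \<cdot> DR \<alpha> \<beta> \<gamma> \<delta>" "DR \<alpha> (f \<cdot> \<beta>) \<gamma> \<delta> = f \<cdot> DR \<alpha> \<beta> \<gamma> \<delta>"
    "DR \<alpha> \<beta> (f \<cdot> \<gamma>) \<delta> = f \<cdot> DR \<alpha> \<beta> \<gamma> \<delta>" "DR \<alpha> \<beta> \<gamma> (f \<cdot> \<delta>) = f \<cdot> DR \<alpha> \<beta> \<gamma> \<delta>"
  by (rule ext, rule ext,
      simp add: DR_def D_smult_left D_smult_right R_smult R_add R_form D_form form_smult form_add
        anchor_smooth smult_const_0 J assms,
      simp add: smult_def algebra_simps)+

text \<open>The defect is linear over functions in both forms, as the derivatives of the coefficient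
  produced by the commutator and by the Koszul bracket cancel. On the product it can therefore be
  evaluated with lifts having the same values at the point.\<close>

lemma jacobi_defect_cong:
  assumes F: "\<beta> \<in> one_forms A" "\<beta>' \<in> one_forms A" "\<gamma> \<in> one_forms A" "\<gamma>' \<in> one_forms A" and h: "h \<in> smooth_functions A"
    and eq: "\<beta> p = \<beta>' p" "\<gamma> p = \<gamma>' p"
  shows "jacobi_defect \<beta> \<gamma> h p = jacobi_defect \<beta>' \<gamma>' h p"
proof -
  have left: "jacobi_defect (\<alpha> + \<alpha>') \<delta> h p = jacobi_defect \<alpha> \<delta> h p + jacobi_defect \<alpha>' \<delta> h p"
    "jacobi_defect \<delta> (\<alpha> + \<alpha>') h p = jacobi_defect \<delta> \<alpha> h p + jacobi_defect \<delta> \<alpha>' h p"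
    if "\<alpha> \<in> one_forms A" "\<alpha>' \<in> one_forms A" "\<delta> \<in> one_forms A" for \<alpha> \<alpha>' \<delta>
    by (simp_all add: jacobi_defect_def anchor_add koszul_add koszul_form that
        tangent_add[OF anchor_tangent[OF that(3)]] anchor_smooth h)
  have smult: "jacobi_defect (f \<cdot> \<alpha>) \<delta> h p = f p * jacobi_defect \<alpha> \<delta> h p"
    "jacobi_defect \<delta> (f \<cdot> \<alpha>) h p = f p * jacobi_defect \<delta> \<alpha> h p"
    if "\<alpha> \<in> one_forms A" "\<delta> \<in> one_forms A" "f \<in> smooth_functions A" for \<alpha> \<delta> f
    by (simp_all add: jacobi_defect_def anchor_add anchor_smult koszul_smult koszul_form form_smult anchor_smooth
        smooth_minus that tangent_mult[OF anchor_tangent[OF that(2)]] h algebra_simps)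
  have "jacobi_defect \<beta> \<gamma> h p = jacobi_defect \<beta>' \<gamma> h p"
    by (rule form_tensor_cong[OF left(1)[OF _ _ F(3)] smult(1)[OF _ F(3)] F(1,2) eq(1)])
  also have "\<dots> = jacobi_defect \<beta>' \<gamma>' h p"
    by (rule form_tensor_cong[OF left(2)[OF _ _ F(2)] smult(2)[OF _ F(2)] F(3,4) eq(2)])
  finally show ?thesis .
qed

text \<open>By \<open>DR_smult_left\<close> the defect times every D\<alpha>\<delta> is 0, so at a
  point where the defect is nonzero all covariant derivatives vanish. Then the anchor vanishes there
  too, and each of the three terms of the defect is an anchored derivative at that point.\<close>

lemma locally_symmetric_jacobi:
  assumes sym: "\<And>\<alpha> \<beta> \<gamma> \<delta>. \<alpha> \<in> one_forms A \<Longrightarrow> \<beta> \<in> one_forms A \<Longrightarrow> \<gamma> \<in> one_forms A \<Longrightarrow> \<delta> \<in> one_forms A \<Longrightarrow> DR \<alpha> \<beta> \<gamma> \<delta> = 0"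
    and \<beta>: "\<beta> \<in> one_forms A" and \<gamma>: "\<gamma> \<in> one_forms A" and f: "f \<in> smooth_functions A"
  shows "jacobi_defect \<beta> \<gamma> f = (\<lambda>p. 0)"
proof (rule ext, rule ccontr)
  fix p assume J: "jacobi_defect \<beta> \<gamma> f p \<noteq> 0"
  have 1: "jacobi_defect \<beta> \<gamma> f \<cdot> D \<alpha> \<delta> = 0" if "\<alpha> \<in> one_forms A" "\<delta> \<in> one_forms A" for \<alpha> \<delta>
    using DR_smult_left[OF that(1) \<beta> \<gamma> that(2) f] sym[OF that(1) \<beta> \<gamma> that(2)]
      sym[OF form_smult[OF that(1) f] \<beta> \<gamma> that(2)]
    by (simp add: smult_def fun_eq_iff)
  have Dz: "D \<alpha> \<delta> p v = 0" if "\<alpha> \<in> one_forms A" "\<delta> \<in> one_forms A" for \<alpha> \<delta> v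
    using fun_cong[OF fun_cong[OF 1[OF that]], of p v] J by (simp add: smult_def)
  have sh0: "sh \<alpha> p h = 0" if \<alpha>: "\<alpha> \<in> one_forms A" and h: "h \<in> smooth_functions A" for \<alpha> h
  proof -
    note dh = exterior_d_form[OF h]
    \<comment> \<open>The Leibniz rule for the 1-form h dh, evaluated on \<sharp>\<alpha>. As the
      covariant derivatives vanish at p, only the square of \<sharp>\<alpha>(h) remains.\<close>
    have "h p * D \<alpha> (exterior_d A h) p (sh \<alpha> p) + sh \<alpha> p h * exterior_d A h p (sh \<alpha> p) = 0"
      using Dz[OF \<alpha> form_smult[OF dh h], of "sh \<alpha> p"] D_smult_right[OF \<alpha> dh h] by (simp add: smult_def)
    then show ?thesis by (simp add: Dz[OF \<alpha> dh] exterior_d_apply[OF anchor_tangent[OF \<alpha>]])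
  qed
  have "jacobi_defect \<beta> \<gamma> f p = 0"
    unfolding jacobi_defect_def by (simp add: sh0 \<beta> \<gamma> f koszul_form anchor_smooth)
  with J show False by simp
qed

text \<open>With zero defect \<open>DR\<close> is linear over functions in every slot, so
  \<open>form_tensor_cong\<close> exchanges the four arguments one at a time.\<close>

lemma DR_cong:
  assumes J: "\<And>\<beta> \<gamma> f. \<beta> \<in> one_forms A \<Longrightarrow> \<gamma> \<in> one_forms A \<Longrightarrow> f \<in> smooth_functions A \<Longrightarrow> jacobi_defect \<beta> \<gamma> f = (\<lambda>p. 0)"
    and F: "\<alpha> \<in> one_forms A" "\<beta> \<in> one_forms A" "\<gamma> \<in> one_forms A" "\<delta> \<in> one_forms A"
    and F': "\<alpha>' \<in> one_forms A" "\<beta>' \<in> one_forms A" "\<gamma>' \<in> one_forms A" "\<delta>' \<in> one_forms A"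
    and eq: "\<alpha> p = \<alpha>' p" "\<beta> p = \<beta>' p" "\<gamma> p = \<gamma>' p" "\<delta> p = \<delta>' p"
  shows "DR \<alpha> \<beta> \<gamma> \<delta> p v = DR \<alpha>' \<beta>' \<gamma>' \<delta>' p v"
proof -
  have sm: "(f \<cdot> \<omega>) p v = f p * \<omega> p v" for f \<omega> by (simp add: smult_def)
  have "DR \<alpha> \<beta> \<gamma> \<delta> p v = DR \<alpha>' \<beta> \<gamma> \<delta> p v"
    by (rule form_tensor_cong[OF _ _ F(1) F'(1) eq(1)])
       (subst DR_add(1)[OF _ _ F(2,3,4)], assumption+, simp, subst DR_smult(1)[OF _ F(2,3,4) _ J], assumption+, simp only: sm)
  also have "\<dots> = DR \<alpha>' \<beta>' \<gamma> \<delta> p v"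
    by (rule form_tensor_cong[OF _ _ F(2) F'(2) eq(2)])
       (subst DR_add(2)[OF _ _ F'(1) F(3,4)], assumption+, simp, subst DR_smult(2)[OF F'(1) _ F(3,4) _ J], assumption+, simp only: sm)
  also have "\<dots> = DR \<alpha>' \<beta>' \<gamma>' \<delta> p v"
    by (rule form_tensor_cong[OF _ _ F(3) F'(3) eq(3)])
       (subst DR_add(3)[OF _ _ F'(1,2) F(4)], assumption+, simp, subst DR_smult(3)[OF F'(1,2) _ F(4) _ J], assumption+, simp only: sm)
  also have "\<dots> = DR \<alpha>' \<beta>' \<gamma>' \<delta>' p v"
    by (rule form_tensor_cong[OF _ _ F(4) F'(4) eq(4)])
       (subst DR_add(4)[OF _ _ F'(1,2,3)], assumption+, simp, subst DR_smult(4)[OF F'(1,2,3) _ _ J], assumption+, simp only: sm)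
  finally show ?thesis .
qed

lemma locally_symmetricI:
  assumes "\<And>\<alpha> \<beta> \<gamma> \<delta>. \<alpha> \<in> one_forms A \<Longrightarrow> \<beta> \<in> one_forms A \<Longrightarrow> \<gamma> \<in> one_forms A \<Longrightarrow> \<delta> \<in> one_forms A \<Longrightarrow> DR \<alpha> \<beta> \<gamma> \<delta> = 0"
  shows "locally_symmetric A g P"
  unfolding locally_symmetric_def Let_def
  by (intro exI[of _ D] conjI ballI levi_civita, fold DR_def, rule assms)

end

lemma (in metric_manifold) locally_symmetricE:
  assumes "locally_symmetric A g P"
  obtains D where "levi_civita_manifold A P g D"
    "\<And>\<alpha> \<beta> \<gamma> \<delta>. \<alpha> \<in> one_forms A \<Longrightarrow> \<beta> \<in> one_forms A \<Longrightarrow> \<gamma> \<in> one_forms A \<Longrightarrow> \<delta> \<in> one_forms A \<Longrightarrow>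
      levi_civita_manifold.DR A P D \<alpha> \<beta> \<gamma> \<delta> = 0"
proof -
  obtain D where D: "levi_civita A g P D"
    and R: "\<forall>\<alpha>\<in>one_forms A. \<forall>\<beta>\<in>one_forms A. \<forall>\<gamma>\<in>one_forms A. \<forall>\<delta>\<in>one_forms A.
          D \<alpha> (curvature A P D \<beta> \<gamma> \<delta>) - curvature A P D (D \<alpha> \<beta>) \<gamma> \<delta> - curvature A P D \<beta> (D \<alpha> \<gamma>) \<delta>
            - curvature A P D \<beta> \<gamma> (D \<alpha> \<delta>) = 0"
    using assms unfolding locally_symmetric_def Let_def by blast
  interpret levi_civita_manifold A P g D by unfold_locales (rule D)
  show ?thesis
    by (rule that[OF levi_civita_manifold_axioms]) (use R in \<open>simp add: DR_def\<close>)
qed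

section \<open>Product manifolds\<close>

context manifold
begin

text \<open>It separates the covectors from the tensor: on the product, coefficients of arbitrary
  1-forms are multiplied by components of the tensor that live on a factor, and smoothness can be
  read off each.\<close>

lemma tensor2_expand:
  assumes Q: "tensor2 A Q" and F: "frame_on A I x X W" and r: "r \<in> W"
    and \<xi>: "\<xi> \<in> cotangent_space A r" and \<eta>: "\<eta> \<in> cotangent_space A r"
  shows "Q r \<xi> \<eta> = (\<Sum>i\<in>I. \<Sum>j\<in>I. \<xi> (X i r) * (\<eta> (X j r) * Q r (exterior_d A (x i) r) (exterior_d A (x j) r)))"
proof -
  note d = exterior_d_cotangent
  have c0: "(\<lambda>v. 0) \<in> cotangent_space A r" by (rule cotangent_spaceI) simp_all
  have cs: "(\<lambda>v. \<Sum>i\<in>J. c i * exterior_d A (x i) r v) \<in> cotangent_space A r" for c J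
  proof (induction J rule: infinite_finite_induct)
    case (insert i J)
    show ?case using cotangent_combine[OF d insert.IH, of "c i" "x i" 1] insert by simp
  qed (simp_all add: c0)
  have z: "Q r (\<lambda>v. 0) \<zeta> = 0" "Q r \<zeta> (\<lambda>v. 0) = 0" if "\<zeta> \<in> cotangent_space A r" for \<zeta>
    using tensor2_zero[OF Q that] by (simp_all add: zero_fun_def)
  have left: "Q r (\<lambda>v. \<Sum>i\<in>J. c i * exterior_d A (x i) r v) \<zeta> = (\<Sum>i\<in>J. c i * Q r (exterior_d A (x i) r) \<zeta>)"
    if \<zeta>: "\<zeta> \<in> cotangent_space A r" for c \<zeta> J
  proof (induction J rule: infinite_finite_induct)
    case (insert i J)
    show ?case using tensor2D(1)[OF Q d cs \<zeta>, of "c i" "x i" 1 c J] insert by simp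
  qed (simp_all add: z[OF \<zeta>])
  have right: "Q r \<zeta> (\<lambda>v. \<Sum>i\<in>J. c i * exterior_d A (x i) r v) = (\<Sum>i\<in>J. c i * Q r \<zeta> (exterior_d A (x i) r))"
    if \<zeta>: "\<zeta> \<in> cotangent_space A r" for c \<zeta> J
  proof (induction J rule: infinite_finite_induct)
    case (insert i J)
    show ?case using tensor2D(2)[OF Q d cs \<zeta>, of "c i" "x i" 1 c J] insert by simp
  qed (simp_all add: z[OF \<zeta>])
  have "Q r \<xi> \<eta> = Q r (\<lambda>v. \<Sum>i\<in>I. \<xi> (X i r) * exterior_d A (x i) r v) \<eta>"
    by (rule arg_cong[where f = "\<lambda>\<zeta>. Q r \<zeta> \<eta>", OF cotangent_frame(2)[OF F r \<xi>]])
  also have "\<dots> = (\<Sum>i\<in>I. \<xi> (X i r) * Q r (exterior_d A (x i) r) \<eta>)" by (rule left[OF \<eta>])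
  also have "\<dots> = (\<Sum>i\<in>I. \<xi> (X i r) * (\<Sum>j\<in>I. \<eta> (X j r) * Q r (exterior_d A (x i) r) (exterior_d A (x j) r)))"
  proof (intro sum.cong refl arg_cong2[where f = "(*)"])
    fix i
    have "Q r (exterior_d A (x i) r) \<eta> = Q r (exterior_d A (x i) r) (\<lambda>v. \<Sum>j\<in>I. \<eta> (X j r) * exterior_d A (x j) r v)"
      by (rule arg_cong[where f = "\<lambda>\<zeta>. Q r _ \<zeta>", OF cotangent_frame(2)[OF F r \<eta>]])
    then show "Q r (exterior_d A (x i) r) \<eta> = (\<Sum>j\<in>I. \<eta> (X j r) * Q r (exterior_d A (x i) r) (exterior_d A (x j) r))"
      by (simp only: right[OF d])
  qed
  finally show ?thesis by (simp only: sum_distrib_left)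
qed

text \<open>Nondegeneracy only needs to be checked locally, as the 1-forms representing a vector field are unique.\<close>

lemma cometric_tensorI:
  assumes T: "tensor2 A g"
    and sym: "\<And>p \<xi> \<eta>. \<xi> \<in> cotangent_space A p \<Longrightarrow> \<eta> \<in> cotangent_space A p \<Longrightarrow> g p \<xi> \<eta> = g p \<eta> \<xi>"
    and loc: "\<And>V p. V \<in> vector_fields A \<Longrightarrow> \<exists>\<omega> W. \<omega> \<in> one_forms A \<and> open W \<and> p \<in> W \<and>
        (\<forall>r\<in>W. \<forall>\<xi>\<in>cotangent_space A r. g r (\<omega> r) \<xi> = \<xi> (V r))"
  shows "cometric_tensor A g"
proof -
  have nondeg: "\<xi> = \<eta>" if \<xi>: "\<xi> \<in> cotangent_space A p" and \<eta>: "\<eta> \<in> cotangent_space A p"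
    and eq: "\<And>\<zeta>. \<zeta> \<in> cotangent_space A p \<Longrightarrow> g p \<xi> \<zeta> = g p \<eta> \<zeta>" for p \<xi> \<eta>
  proof (rule cotangent_eqI[OF \<xi> \<eta>])
    fix v assume "v \<in> tangent_space A p"
    then obtain V where V: "V \<in> vector_fields A" "V p = v" by (rule vf_extend)
    obtain \<omega> W where \<omega>: "\<omega> \<in> one_forms A" "p \<in> W" "\<forall>r\<in>W. \<forall>\<xi>\<in>cotangent_space A r. g r (\<omega> r) \<xi> = \<xi> (V r)"
      using loc[OF V(1), of p] by blast
    have "g p (\<omega> p) \<xi> = g p (\<omega> p) \<eta>"
      using eq[OF one_formD(1)[OF \<omega>(1)]] sym[OF \<xi> one_formD(1)[OF \<omega>(1)]] sym[OF \<eta> one_formD(1)[OF \<omega>(1)]] by simp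
    then show "\<xi> v = \<eta> v" using \<omega>(2,3) \<xi> \<eta> V(2) by auto
  qed
  have "\<exists>\<omega>\<in>one_forms A. \<forall>p. \<forall>\<xi>\<in>cotangent_space A p. g p (\<omega> p) \<xi> = \<xi> (V p)" if V: "V \<in> vector_fields A" for V
  proof -
    from loc[OF V] have "\<forall>p. \<exists>\<omega> W. \<omega> \<in> one_forms A \<and> open W \<and> p \<in> W \<and>
        (\<forall>r\<in>W. \<forall>\<xi>\<in>cotangent_space A r. g r (\<omega> r) \<xi> = \<xi> (V r))" by blast
    from choice[OF this] obtain e where "\<forall>p. \<exists>W. e p \<in> one_forms A \<and> open W \<and> p \<in> W \<and>
        (\<forall>r\<in>W. \<forall>\<xi>\<in>cotangent_space A r. g r (e p r) \<xi> = \<xi> (V r))" by blast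
    from choice[OF this] obtain W where e: "\<And>p. e p \<in> one_forms A" "\<And>p. open (W p)" "\<And>p. p \<in> W p"
      "\<And>p r \<xi>. r \<in> W p \<Longrightarrow> \<xi> \<in> cotangent_space A r \<Longrightarrow> g r (e p r) \<xi> = \<xi> (V r)" by blast
    define \<omega> where "\<omega> p = e p p" for p
    have eq: "\<omega> r = e p r" if "r \<in> W p" for p r
      unfolding \<omega>_def
      by (rule nondeg[OF one_formD(1)[OF e(1)] one_formD(1)[OF e(1)]]) (simp add: e(4)[OF e(3)] e(4)[OF that])
    have "\<omega> \<in> one_forms A"
    proof (rule form_local)
      show "\<omega> p \<in> cotangent_space A p" for p unfolding \<omega>_def by (rule one_formD(1)[OF e(1)])
      show "\<exists>\<eta> W. \<eta> \<in> one_forms A \<and> open W \<and> p \<in> W \<and> (\<forall>r\<in>W. \<omega> r = \<eta> r)" for p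
        using e(1-3)[of p] eq by blast
    qed
    moreover have "g p (\<omega> p) \<xi> = \<xi> (V p)" if "\<xi> \<in> cotangent_space A p" for p \<xi>
      unfolding \<omega>_def by (rule e(4)[OF e(3) that])
    ultimately show ?thesis by blast
  qed
  then show ?thesis unfolding cometric_tensor_def using T sym by blast
qed

end

section \<open>The atlas of a product manifold\<close>

lemma smooth_atlas_prod:
  fixes A :: "('a::{t2_space,second_countable_topology}, 'e::euclidean_space) chart set"
    and B :: "('b::{t2_space,second_countable_topology}, 'f::euclidean_space) chart set"
  assumes A: "smooth_atlas A" and B: "smooth_atlas B"
  shows "smooth_atlas (prod_atlas A B)"
proof -
  interpret M1: manifold A by unfold_locales (rule A)
  interpret M2: manifold B by unfold_locales (rule B)
  note inj = atlas_open_inj[OF A B]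
  note inv = inv_into_map_prod[OF A B]
  show ?thesis
    unfolding smooth_atlas_def
  proof (intro conjI)
    show "\<forall>(W, \<kappa>)\<in>prod_atlas A B. open W \<and> open (\<kappa> ` W) \<and> homeomorphism W (\<kappa> ` W) \<kappa> (inv_into W \<kappa>)"
      unfolding prod_atlas_def
    proof clarify
      fix U \<phi> V \<psi> assume U: "(U, \<phi>) \<in> A" and V: "(V, \<psi>) \<in> B"
      have im: "map_prod \<phi> \<psi> ` (U \<times> V) = \<phi> ` U \<times> \<psi> ` V" by (rule map_prod_surj_on[OF refl refl])
      have ij: "inj_on \<phi> U" "inj_on \<psi> V" using inj U V by auto
      have cU: "continuous_on U \<phi>" "continuous_on (\<phi> ` U) (inv_into U \<phi>)"
        using M1.chart(3)[OF U] by (simp_all add: homeomorphism_def)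
      have cV: "continuous_on V \<psi>" "continuous_on (\<psi> ` V) (inv_into V \<psi>)"
        using M2.chart(3)[OF V] by (simp_all add: homeomorphism_def)
      have "homeomorphism (U \<times> V) (\<phi> ` U \<times> \<psi> ` V) (map_prod \<phi> \<psi>) (inv_into (U \<times> V) (map_prod \<phi> \<psi>))"
      proof (rule homeomorphismI)
        show "continuous_on (U \<times> V) (map_prod \<phi> \<psi>)"
          unfolding map_prod_def split_beta
          by (intro continuous_on_Pair continuous_on_compose2[OF cU(1)] continuous_on_compose2[OF cV(1)] continuous_intros) auto
        have "continuous_on (\<phi> ` U \<times> \<psi> ` V) (\<lambda>z. (inv_into U \<phi> (fst z), inv_into V \<psi> (snd z)))"
          by (intro continuous_on_Pair continuous_on_compose2[OF cU(2)] continuous_on_compose2[OF cV(2)] continuous_intros) auto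
        then show "continuous_on (\<phi> ` U \<times> \<psi> ` V) (inv_into (U \<times> V) (map_prod \<phi> \<psi>))"
          by (rule continuous_on_cong[THEN iffD1, OF refl, rotated]) (simp add: inv[OF ij])
      qed (use ij in \<open>auto simp: inv[OF ij]\<close>)
      then show "open (U \<times> V) \<and> open (map_prod \<phi> \<psi> ` (U \<times> V)) \<and>
          homeomorphism (U \<times> V) (map_prod \<phi> \<psi> ` (U \<times> V)) (map_prod \<phi> \<psi>) (inv_into (U \<times> V) (map_prod \<phi> \<psi>))"
        by (simp add: im open_Times M1.chart[OF U] M2.chart[OF V])
    qed
    show "(\<Union>(W, \<kappa>)\<in>prod_atlas A B. W) = UNIV"
    proof (intro equalityI subsetI)
      fix z :: "'a \<times> 'b"
      obtain U \<phi> where U: "(U, \<phi>) \<in> A" "fst z \<in> U" by (rule M1.chart_at)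
      obtain V \<psi> where V: "(V, \<psi>) \<in> B" "snd z \<in> V" by (rule M2.chart_at)
      have "(U \<times> V, map_prod \<phi> \<psi>) \<in> prod_atlas A B"
        using U V by (auto simp: prod_atlas_def)
      then show "z \<in> (\<Union>(W, \<kappa>)\<in>prod_atlas A B. W)"
        using UN_I[of _ "prod_atlas A B" z "\<lambda>(W, \<kappa>). W"] U(2) V(2) by (fastforce simp: mem_Times_iff)
    qed simp
    show "\<forall>(W, \<kappa>)\<in>prod_atlas A B. \<forall>(W', \<kappa>')\<in>prod_atlas A B. smooth_on (\<kappa>' \<circ> inv_into W \<kappa>) (\<kappa> ` (W \<inter> W'))"
      unfolding prod_atlas_def
    proof clarify
      fix U \<phi> V \<psi> U' \<phi>' V' \<psi>'
      assume U: "(U, \<phi>) \<in> A" and V: "(V, \<psi>) \<in> B" and U': "(U', \<phi>') \<in> A" and V': "(V', \<psi>') \<in> B"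
      have ij: "inj_on \<phi> U" "inj_on \<psi> V" using inj U V by auto
      have im: "map_prod \<phi> \<psi> ` (U \<times> V \<inter> U' \<times> V') = \<phi> ` (U \<inter> U') \<times> \<psi> ` (V \<inter> V')"
        unfolding Times_Int_Times by (rule map_prod_surj_on[OF refl refl])
      have o1: "open (\<phi> ` (U \<inter> U'))"
        using M1.chart(1)[OF U] M1.chart(1)[OF U'] by (intro M1.chart_open_image[OF U]) auto
      have o2: "open (\<psi> ` (V \<inter> V'))"
        using M2.chart(1)[OF V] M2.chart(1)[OF V'] by (intro M2.chart_open_image[OF V]) auto
      have s1: "smooth_on (\<phi>' \<circ> inv_into U \<phi>) (\<phi> ` (U \<inter> U'))"
        using A U U' unfolding smooth_atlas_def by blast
      have s2: "smooth_on (\<psi>' \<circ> inv_into V \<psi>) (\<psi> ` (V \<inter> V'))"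
        using B V V' unfolding smooth_atlas_def by blast
      have "smooth_on (\<lambda>z. ((\<phi>' \<circ> inv_into U \<phi>) (fst z), (\<psi>' \<circ> inv_into V \<psi>) (snd z)))
          (\<phi> ` (U \<inter> U') \<times> \<psi> ` (V \<inter> V'))"
      proof (rule smooth_on_Pair)
        show "smooth_on (\<lambda>z. (\<phi>' \<circ> inv_into U \<phi>) (fst z)) (\<phi> ` (U \<inter> U') \<times> \<psi> ` (V \<inter> V'))"
          by (rule smooth_on_compose_affine[OF s1 o1 open_Times[OF o1 o2]
                _ bounded_linear_imp_has_derivative[OF bounded_linear_fst]]) auto
        show "smooth_on (\<lambda>z. (\<psi>' \<circ> inv_into V \<psi>) (snd z)) (\<phi> ` (U \<inter> U') \<times> \<psi> ` (V \<inter> V'))"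
          by (rule smooth_on_compose_affine[OF s2 o2 open_Times[OF o1 o2]
                _ bounded_linear_imp_has_derivative[OF bounded_linear_snd]]) auto
      qed (rule open_Times[OF o1 o2])
      then have "smooth_on (map_prod \<phi>' \<psi>' \<circ> inv_into (U \<times> V) (map_prod \<phi> \<psi>)) (\<phi> ` (U \<inter> U') \<times> \<psi> ` (V \<inter> V'))"
        by (rule smooth_on_cong[OF _ open_Times[OF o1 o2]]) (auto simp: inv[OF ij])
      then show "smooth_on (map_prod \<phi>' \<psi>' \<circ> inv_into (U \<times> V) (map_prod \<phi> \<psi>)) (map_prod \<phi> \<psi> ` (U \<times> V \<inter> U' \<times> V'))"
        by (simp only: im)
    qed
  qed
qed

locale product_manifold = M1: manifold A + M2: manifold B
  for A :: "('a::{t2_space,second_countable_topology}, 'e::euclidean_space) chart set"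
    and B :: "('b::{t2_space,second_countable_topology}, 'f::euclidean_space) chart set"
begin

abbreviation "C \<equiv> prod_atlas A B"

sublocale M: manifold C
  by unfold_locales (rule smooth_atlas_prod[OF M1.atlas M2.atlas])

lemma smooth_fst: "h \<in> smooth_functions A \<Longrightarrow> (\<lambda>z. h (fst z)) \<in> smooth_functions C"
  using smooth_functions_fst[OF M1.atlas M2.atlas, of h] by (simp add: o_def)

lemma smooth_snd: "h \<in> smooth_functions B \<Longrightarrow> (\<lambda>z. h (snd z)) \<in> smooth_functions C"
  using smooth_functions_snd[OF M1.atlas M2.atlas, of h] by (simp add: o_def)

section \<open>Slice inclusions, projections and the splitting of tangent spaces\<close>

abbreviation "incl1 q \<equiv> tangent_map C (\<lambda>x. (x, q))"
abbreviation "incl2 p \<equiv> tangent_map C (\<lambda>y. (p, y))"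
abbreviation "proj1 \<equiv> tangent_map A fst"
abbreviation "proj2 \<equiv> tangent_map B snd"

lemmas incl1_tangent = tangent_map_slice1[OF M1.atlas M2.atlas]
  and incl2_tangent = tangent_map_slice2[OF M1.atlas M2.atlas]

lemma incl1_apply:
  assumes v: "v \<in> tangent_space A p"
  shows "h \<in> smooth_functions A \<Longrightarrow> incl1 q v (\<lambda>z. h (fst z)) = v h"
    and "k \<in> smooth_functions B \<Longrightarrow> incl1 q v (\<lambda>z. k (snd z)) = 0"
  by (simp_all add: tangent_map_def smooth_fst smooth_snd o_def tangent_space_const[OF v])

lemma incl2_apply:
  assumes w: "w \<in> tangent_space B q"
  shows "h \<in> smooth_functions A \<Longrightarrow> incl2 p w (\<lambda>z. h (fst z)) = 0"
    and "k \<in> smooth_functions B \<Longrightarrow> incl2 p w (\<lambda>z. k (snd z)) = w k"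
  by (simp_all add: tangent_map_def smooth_fst smooth_snd o_def tangent_space_const[OF w])

lemma proj1_apply: "h \<in> smooth_functions A \<Longrightarrow> proj1 u h = u (\<lambda>z. h (fst z))"
  and proj2_apply: "k \<in> smooth_functions B \<Longrightarrow> proj2 u k = u (\<lambda>z. k (snd z))"
  by (simp_all add: tangent_map_def o_def)

lemma proj1_tangent:
  assumes u: "u \<in> tangent_space C z"
  shows "proj1 u \<in> tangent_space A (fst z)"
proof (rule M1.tangent_spaceI)
  fix f h a b assume fh: "f \<in> smooth_functions A" "h \<in> smooth_functions A"
  then show "proj1 u (\<lambda>x. a * f x + b * h x) = a * proj1 u f + b * proj1 u h"
    using M.tangent_linear[OF u smooth_fst smooth_fst]
    by (simp add: proj1_apply M1.smooth_add M1.smooth_mult M1.smooth_const)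
next
  fix f h assume fh: "f \<in> smooth_functions A" "h \<in> smooth_functions A"
  then show "proj1 u (\<lambda>x. f x * h x) = f (fst z) * proj1 u h + h (fst z) * proj1 u f"
    using M.tangent_mult[OF u smooth_fst smooth_fst]
    by (simp add: proj1_apply M1.smooth_mult)
qed (simp add: tangent_map_def)

lemma proj2_tangent:
  assumes u: "u \<in> tangent_space C z"
  shows "proj2 u \<in> tangent_space B (snd z)"
proof (rule M2.tangent_spaceI)
  fix f h a b assume fh: "f \<in> smooth_functions B" "h \<in> smooth_functions B"
  then show "proj2 u (\<lambda>x. a * f x + b * h x) = a * proj2 u f + b * proj2 u h"
    using M.tangent_linear[OF u smooth_snd smooth_snd]
    by (simp add: proj2_apply M2.smooth_add M2.smooth_mult M2.smooth_const)
next
  fix f h assume fh: "f \<in> smooth_functions B" "h \<in> smooth_functions B"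
  then show "proj2 u (\<lambda>x. f x * h x) = f (snd z) * proj2 u h + h (snd z) * proj2 u f"
    using M.tangent_mult[OF u smooth_snd smooth_snd]
    by (simp add: proj2_apply M2.smooth_mult)
qed (simp add: tangent_map_def)

text \<open>The point of the third property is that the coordinates of the frame are lifted from a
  factor, so tangent vectors and fields on the product can be tested on lifted functions
  alone.\<close>

lemma product_frame_at:
  fixes z :: "'a \<times> 'b"
  obtains x X W where "frame_on C (Basis :: ('e \<times> 'f) set) x X W" "z \<in> W"
    "\<And>b. b \<in> Basis \<Longrightarrow> (\<exists>h\<in>smooth_functions A. x b = (\<lambda>z. h (fst z))) \<or> (\<exists>h\<in>smooth_functions B. x b = (\<lambda>z. h (snd z)))"
proof -
  obtain U \<phi> where U: "(U, \<phi>) \<in> A" "fst z \<in> U" by (rule M1.chart_at)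
  obtain V \<psi> where V: "(V, \<psi>) \<in> B" "snd z \<in> V" by (rule M2.chart_at)
  obtain x N where x: "open N" "fst z \<in> N" "N \<subseteq> U" "\<And>b. b \<in> Basis \<Longrightarrow> x b \<in> smooth_functions A"
    "\<And>b y. b \<in> Basis \<Longrightarrow> y \<in> N \<Longrightarrow> x b y = \<phi> y \<bullet> b"
    by (rule M1.coordinates_at[OF U]) (rule that)
  obtain y M where y: "open M" "snd z \<in> M" "M \<subseteq> V" "\<And>b. b \<in> Basis \<Longrightarrow> y b \<in> smooth_functions B"
    "\<And>b q. b \<in> Basis \<Longrightarrow> q \<in> M \<Longrightarrow> y b q = \<psi> q \<bullet> b"
    by (rule M2.coordinates_at[OF V]) (rule that)
  \<comment> \<open>Basis vectors of the product space are of the form (b, 0) or (0, b); a zero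
    second component selects a coordinate of the first factor.\<close>
  define w where "w b = (if snd b = 0 then (\<lambda>z. x (fst b) (fst z)) else (\<lambda>z. y (snd b) (snd z)))" for b :: "'e \<times> 'f"
  have cases: "b \<in> Basis \<Longrightarrow> (snd b = 0 \<and> fst b \<in> Basis) \<or> (snd b \<noteq> 0 \<and> fst b = 0 \<and> snd b \<in> Basis)" for b :: "'e \<times> 'f"
    by (auto simp: Basis_prod_def)
  have lift: "(\<exists>h\<in>smooth_functions A. w b = (\<lambda>z. h (fst z))) \<or> (\<exists>h\<in>smooth_functions B. w b = (\<lambda>z. h (snd z)))"
    if "b \<in> Basis" for b
    using cases[OF that] x(4) y(4) by (auto simp: w_def)
  have sm: "w b \<in> smooth_functions C" if "b \<in> Basis" for b
    using lift[OF that] by (auto intro: smooth_fst smooth_snd)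
  have eq: "w b r = map_prod \<phi> \<psi> r \<bullet> b" if "b \<in> Basis" "r \<in> N \<times> M" for b r
    using cases[OF that(1)] that(2) x(5) y(5) by (auto simp: w_def inner_prod_def)
  have UV: "(U \<times> V, map_prod \<phi> \<psi>) \<in> C"
    using U V by (auto simp: prod_atlas_def)
  have N: "open (N \<times> M)" "z \<in> N \<times> M" "N \<times> M \<subseteq> U \<times> V"
    using x(1-3) y(1-3) by (auto simp: open_Times mem_Times_iff)
  show ?thesis
  proof (rule M.coordinate_frame[OF UV N sm eq])
    fix X W assume "frame_on C Basis w X W" "z \<in> W"
    then show thesis using lift by (rule that)
  qed
qed

text \<open>A tangent vector is determined by its values on the coordinates of a frame, and those of
  \<open>product_frame_at\<close> are all lifts.\<close>

lemma product_tangent_eqI: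
  assumes u: "u \<in> tangent_space C z" and v: "v \<in> tangent_space C z"
    and 1: "\<And>h. h \<in> smooth_functions A \<Longrightarrow> u (\<lambda>z. h (fst z)) = v (\<lambda>z. h (fst z))"
    and 2: "\<And>h. h \<in> smooth_functions B \<Longrightarrow> u (\<lambda>z. h (snd z)) = v (\<lambda>z. h (snd z))"
  shows "u = v"
proof
  fix F
  obtain x X W where X: "frame_on C (Basis :: ('e \<times> 'f) set) x X W" "z \<in> W"
    "\<And>b. b \<in> Basis \<Longrightarrow> (\<exists>h\<in>smooth_functions A. x b = (\<lambda>z. h (fst z))) \<or> (\<exists>h\<in>smooth_functions B. x b = (\<lambda>z. h (snd z)))"
    by (rule product_frame_at[of z]) (rule that)
  have "u F = (\<Sum>b\<in>Basis. u (x b) * X b z F)" by (rule M.frame_onD(5)[OF X(1,2) u])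
  also have "\<dots> = (\<Sum>b\<in>Basis. v (x b) * X b z F)"
    by (intro sum.cong refl arg_cong2[where f = "(*)"]) (use X(3) 1 2 in fastforce)
  also have "\<dots> = v F" by (rule M.frame_onD(5)[OF X(1,2) v, symmetric])
  finally show "u F = v F" .
qed

lemma product_vfI:
  assumes V: "\<And>z. V z \<in> tangent_space C z"
    and 1: "\<And>h. h \<in> smooth_functions A \<Longrightarrow> (\<lambda>z. V z (\<lambda>z. h (fst z))) \<in> smooth_functions C"
    and 2: "\<And>h. h \<in> smooth_functions B \<Longrightarrow> (\<lambda>z. V z (\<lambda>z. h (snd z))) \<in> smooth_functions C"
  shows "V \<in> vector_fields C"
proof (rule M.vector_fieldI[OF V])
  fix F assume F: "F \<in> smooth_functions C"
  show "(\<lambda>z. V z F) \<in> smooth_functions C"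
  proof (rule M.smooth_functions_local)
    fix z
    obtain x X W where X: "frame_on C (Basis :: ('e \<times> 'f) set) x X W" "z \<in> W"
      "\<And>b. b \<in> Basis \<Longrightarrow> (\<exists>h\<in>smooth_functions A. x b = (\<lambda>z. h (fst z))) \<or> (\<exists>h\<in>smooth_functions B. x b = (\<lambda>z. h (snd z)))"
      by (rule product_frame_at[of z]) (rule that)
    have sm: "(\<lambda>z. V z (x b)) \<in> smooth_functions C" if "b \<in> Basis" for b
      using X(3)[OF that] 1 2 by auto
    have "(\<lambda>z. \<Sum>b\<in>Basis. V z (x b) * X b z F) \<in> smooth_functions C"
      by (intro M.smooth_sum M.smooth_mult sm M.vector_fieldD(2)[OF M.frame_onD(4)[OF X(1)] F])
    moreover have "\<forall>r\<in>W. V r F = (\<Sum>b\<in>Basis. V r (x b) * X b r F)"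
      by (intro ballI M.frame_onD(5)[OF X(1) _ V])
    ultimately show "\<exists>h W. h \<in> smooth_functions C \<and> open W \<and> z \<in> W \<and> (\<forall>x\<in>W. V x F = h x)"
      using M.frame_onD(2)[OF X(1)] X(2) by blast
  qed
qed

lemma tangent_split:
  assumes u: "u \<in> tangent_space C z"
  shows "u = (\<lambda>F. 1 * incl1 (snd z) (proj1 u) F + 1 * incl2 (fst z) (proj2 u) F)"
proof (rule product_tangent_eqI[OF u])
  note p = proj1_tangent[OF u] proj2_tangent[OF u]
  show "(\<lambda>F. 1 * incl1 (snd z) (proj1 u) F + 1 * incl2 (fst z) (proj2 u) F) \<in> tangent_space C z"
    using incl1_tangent[OF p(1), of "snd z"] incl2_tangent[OF p(2), of "fst z"]
    by (intro M.tangent_space_combine) auto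
  show "u (\<lambda>z. h (fst z)) = 1 * incl1 (snd z) (proj1 u) (\<lambda>z. h (fst z)) + 1 * incl2 (fst z) (proj2 u) (\<lambda>z. h (fst z))"
    if "h \<in> smooth_functions A" for h
    using that by (simp add: incl1_apply[OF p(1)] incl2_apply[OF p(2)] proj1_apply)
  show "u (\<lambda>z. h (snd z)) = 1 * incl1 (snd z) (proj1 u) (\<lambda>z. h (snd z)) + 1 * incl2 (fst z) (proj2 u) (\<lambda>z. h (snd z))"
    if "h \<in> smooth_functions B" for h
    using that by (simp add: incl1_apply[OF p(1)] incl2_apply[OF p(2)] proj2_apply)
qed

section \<open>Lifts of vector fields and 1-forms\<close>

definition hvf :: "'a vfield \<Rightarrow> ('a \<times> 'b) vfield" where
  "hvf X = (\<lambda>z. incl1 (snd z) (X (fst z)))"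

definition vvf :: "'b vfield \<Rightarrow> ('a \<times> 'b) vfield" where
  "vvf Y = (\<lambda>z. incl2 (fst z) (Y (snd z)))"

lemma hvf_apply:
  assumes X: "X \<in> vector_fields A"
  shows "h \<in> smooth_functions A \<Longrightarrow> hvf X z (\<lambda>z. h (fst z)) = X (fst z) h"
    and "k \<in> smooth_functions B \<Longrightarrow> hvf X z (\<lambda>z. k (snd z)) = 0"
  by (simp_all add: hvf_def incl1_apply[OF M1.vector_fieldD(1)[OF X]])

lemma vvf_apply:
  assumes Y: "Y \<in> vector_fields B"
  shows "h \<in> smooth_functions A \<Longrightarrow> vvf Y z (\<lambda>z. h (fst z)) = 0"
    and "k \<in> smooth_functions B \<Longrightarrow> vvf Y z (\<lambda>z. k (snd z)) = Y (snd z) k"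
  by (simp_all add: vvf_def incl2_apply[OF M2.vector_fieldD(1)[OF Y]])

lemma hvf_vf:
  assumes X: "X \<in> vector_fields A"
  shows "hvf X \<in> vector_fields C"
proof (rule product_vfI)
  show "hvf X z \<in> tangent_space C z" for z
    using incl1_tangent[OF M1.vector_fieldD(1)[OF X, of "fst z"], of "snd z"] by (simp add: hvf_def)
  show "(\<lambda>z. hvf X z (\<lambda>z. h (fst z))) \<in> smooth_functions C" if "h \<in> smooth_functions A" for h
    using smooth_fst[OF M1.vector_fieldD(2)[OF X that]] by (simp add: hvf_apply[OF X] that)
  show "(\<lambda>z. hvf X z (\<lambda>z. h (snd z))) \<in> smooth_functions C" if "h \<in> smooth_functions B" for h
    by (simp add: hvf_apply[OF X] that M.smooth_const)
qed

lemma vvf_vf: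
  assumes Y: "Y \<in> vector_fields B"
  shows "vvf Y \<in> vector_fields C"
proof (rule product_vfI)
  show "vvf Y z \<in> tangent_space C z" for z
    using incl2_tangent[OF M2.vector_fieldD(1)[OF Y, of "snd z"], of "fst z"] by (simp add: vvf_def)
  show "(\<lambda>z. vvf Y z (\<lambda>z. h (fst z))) \<in> smooth_functions C" if "h \<in> smooth_functions A" for h
    by (simp add: vvf_apply[OF Y] that M.smooth_const)
  show "(\<lambda>z. vvf Y z (\<lambda>z. h (snd z))) \<in> smooth_functions C" if "h \<in> smooth_functions B" for h
    using smooth_snd[OF M2.vector_fieldD(2)[OF Y that]] by (simp add: vvf_apply[OF Y] that)
qed

lemma hlift_apply: "u \<in> tangent_space C z \<Longrightarrow> hlift A B \<alpha> z u = \<alpha> (fst z) (proj1 u)"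
  and vlift_apply: "u \<in> tangent_space C z \<Longrightarrow> vlift A B \<beta> z u = \<beta> (snd z) (proj2 u)"
  by (simp_all add: hlift_def vlift_def pullback_def cotangent_map_def)

lemma proj_combine:
  assumes "u \<in> tangent_space C z" "v \<in> tangent_space C z"
  shows "proj1 (\<lambda>f. a * u f + b * v f) = (\<lambda>f. a * proj1 u f + b * proj1 v f)"
    "proj2 (\<lambda>f. a * u f + b * v f) = (\<lambda>f. a * proj2 u f + b * proj2 v f)"
  by (simp_all add: tangent_map_def fun_eq_iff)

lemma open_fst: "open W \<Longrightarrow> open {z. fst z \<in> W}" and open_snd: "open W' \<Longrightarrow> open {z. snd z \<in> W'}"
  using open_vimage_fst[of W] open_vimage_snd[of W'] by (simp_all add: vimage_def)

text \<open>Smoothness must be tested on fields that are not lifts. Over a frame of the factor, the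
  value on X is a sum of the smooth functions X(x_i) times lifted components of \<alpha>.\<close>

lemma hlift_form:
  assumes \<alpha>: "\<alpha> \<in> one_forms A"
  shows "hlift A B \<alpha> \<in> one_forms C"
proof (rule M.one_formI)
  show "hlift A B \<alpha> z \<in> cotangent_space C z" for z
  proof (rule M.cotangent_spaceI)
    fix u v a b assume u: "u \<in> tangent_space C z" and v: "v \<in> tangent_space C z"
    show "hlift A B \<alpha> z (\<lambda>f. a * u f + b * v f) = a * hlift A B \<alpha> z u + b * hlift A B \<alpha> z v"
      by (simp add: hlift_apply u v M.tangent_space_combine proj_combine[OF u v]
          M1.cotangent_linear[OF M1.one_formD(1)[OF \<alpha>]] proj1_tangent)
  qed (simp add: hlift_def pullback_def cotangent_map_def)
  fix X assume X: "X \<in> vector_fields C"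
  note XT = M.vector_fieldD(1)[OF X]
  show "(\<lambda>z. hlift A B \<alpha> z (X z)) \<in> smooth_functions C"
  proof (rule M.smooth_functions_local)
    fix z :: "'a \<times> 'b"
    obtain x E W where F: "frame_on A (Basis :: 'e set) x E W" "fst z \<in> W" by (rule M1.frame_at)
    have "(\<lambda>z. \<Sum>i\<in>Basis. X z (\<lambda>z. x i (fst z)) * \<alpha> (fst z) (E i (fst z))) \<in> smooth_functions C"
      using smooth_fst[OF M1.one_formD(2)[OF \<alpha> M1.frame_onD(4)[OF F(1)]]]
        M.vector_fieldD(2)[OF X smooth_fst[OF M1.frame_onD(3)[OF F(1)]]]
      by (intro M.smooth_sum M.smooth_mult) auto
    moreover have "hlift A B \<alpha> r (X r) = (\<Sum>i\<in>Basis. X r (\<lambda>z. x i (fst z)) * \<alpha> (fst r) (E i (fst r)))"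
      if "fst r \<in> W" for r
    proof -
      have "\<alpha> (fst r) (proj1 (X r)) = (\<Sum>i\<in>Basis. proj1 (X r) (x i) * \<alpha> (fst r) (E i (fst r)))"
        by (rule M1.cotangent_frame(1)[OF F(1) that M1.one_formD(1)[OF \<alpha>] proj1_tangent[OF XT]])
      then show ?thesis by (simp add: hlift_apply XT proj1_apply M1.frame_onD(3)[OF F(1)])
    qed
    ultimately show "\<exists>h W. h \<in> smooth_functions C \<and> open W \<and> z \<in> W \<and> (\<forall>x\<in>W. hlift A B \<alpha> x (X x) = h x)"
      using open_fst[OF M1.frame_onD(2)[OF F(1)]] F(2)
      by (intro exI[of _ "\<lambda>z. \<Sum>i\<in>Basis. X z (\<lambda>z. x i (fst z)) * \<alpha> (fst z) (E i (fst z))"]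
          exI[of _ "{z. fst z \<in> W}"]) simp
  qed
qed

lemma vlift_form:
  assumes \<beta>: "\<beta> \<in> one_forms B"
  shows "vlift A B \<beta> \<in> one_forms C"
proof (rule M.one_formI)
  show "vlift A B \<beta> z \<in> cotangent_space C z" for z
  proof (rule M.cotangent_spaceI)
    fix u v a b assume u: "u \<in> tangent_space C z" and v: "v \<in> tangent_space C z"
    show "vlift A B \<beta> z (\<lambda>f. a * u f + b * v f) = a * vlift A B \<beta> z u + b * vlift A B \<beta> z v"
      by (simp add: vlift_apply u v M.tangent_space_combine proj_combine[OF u v]
          M2.cotangent_linear[OF M2.one_formD(1)[OF \<beta>]] proj2_tangent)
  qed (simp add: vlift_def pullback_def cotangent_map_def)
  fix X assume X: "X \<in> vector_fields C"
  note XT = M.vector_fieldD(1)[OF X]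
  show "(\<lambda>z. vlift A B \<beta> z (X z)) \<in> smooth_functions C"
  proof (rule M.smooth_functions_local)
    fix z :: "'a \<times> 'b"
    obtain x E W where F: "frame_on B (Basis :: 'f set) x E W" "snd z \<in> W" by (rule M2.frame_at)
    have "(\<lambda>z. \<Sum>i\<in>Basis. X z (\<lambda>z. x i (snd z)) * \<beta> (snd z) (E i (snd z))) \<in> smooth_functions C"
      using smooth_snd[OF M2.one_formD(2)[OF \<beta> M2.frame_onD(4)[OF F(1)]]]
        M.vector_fieldD(2)[OF X smooth_snd[OF M2.frame_onD(3)[OF F(1)]]]
      by (intro M.smooth_sum M.smooth_mult) auto
    moreover have "vlift A B \<beta> r (X r) = (\<Sum>i\<in>Basis. X r (\<lambda>z. x i (snd z)) * \<beta> (snd r) (E i (snd r)))"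
      if "snd r \<in> W" for r
    proof -
      have "\<beta> (snd r) (proj2 (X r)) = (\<Sum>i\<in>Basis. proj2 (X r) (x i) * \<beta> (snd r) (E i (snd r)))"
        by (rule M2.cotangent_frame(1)[OF F(1) that M2.one_formD(1)[OF \<beta>] proj2_tangent[OF XT]])
      then show ?thesis by (simp add: vlift_apply XT proj2_apply M2.frame_onD(3)[OF F(1)])
    qed
    ultimately show "\<exists>h W. h \<in> smooth_functions C \<and> open W \<and> z \<in> W \<and> (\<forall>x\<in>W. vlift A B \<beta> x (X x) = h x)"
      using open_snd[OF M2.frame_onD(2)[OF F(1)]] F(2)
      by (intro exI[of _ "\<lambda>z. \<Sum>i\<in>Basis. X z (\<lambda>z. x i (snd z)) * \<beta> (snd z) (E i (snd z))"]
          exI[of _ "{z. snd z \<in> W}"]) simp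
  qed
qed

section \<open>Restrictions of covectors to the two slices\<close>

abbreviation "hres z \<equiv> cotangent_map A C (\<lambda>x. (x, snd z)) (fst z)"
abbreviation "vres z \<equiv> cotangent_map B C (\<lambda>y. (fst z, y)) (snd z)"

lemma hres_apply: "v \<in> tangent_space A (fst z) \<Longrightarrow> hres z \<xi> v = \<xi> (incl1 (snd z) v)"
  and vres_apply: "w \<in> tangent_space B (snd z) \<Longrightarrow> vres z \<xi> w = \<xi> (incl2 (fst z) w)"
  by (simp_all add: cotangent_map_def)

lemma res_combine:
  "hres z (\<lambda>u. a * \<xi> u + b * \<eta> u) = (\<lambda>v. a * hres z \<xi> v + b * hres z \<eta> v)"
  "vres z (\<lambda>u. a * \<xi> u + b * \<eta> u) = (\<lambda>v. a * vres z \<xi> v + b * vres z \<eta> v)"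
  by (simp_all add: cotangent_map_def fun_eq_iff)

lemma incl1_combine: "incl1 q (\<lambda>f. a * u f + b * v f) = (\<lambda>f. a * incl1 q u f + b * incl1 q v f)"
  and incl2_combine: "incl2 p (\<lambda>f. a * w f + b * y f) = (\<lambda>f. a * incl2 p w f + b * incl2 p y f)"
  by (simp_all add: tangent_map_def fun_eq_iff)

lemma hres_cotangent:
  assumes \<xi>: "\<xi> \<in> cotangent_space C z"
  shows "hres z \<xi> \<in> cotangent_space A (fst z)"
proof (rule M1.cotangent_spaceI)
  fix v w a b assume v: "v \<in> tangent_space A (fst z)" and w: "w \<in> tangent_space A (fst z)"
  show "hres z \<xi> (\<lambda>f. a * v f + b * w f) = a * hres z \<xi> v + b * hres z \<xi> w"
    using M.cotangent_linear[OF \<xi>, of "incl1 (snd z) v" "incl1 (snd z) w" a b]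
      incl1_tangent[OF v, of "snd z"] incl1_tangent[OF w, of "snd z"]
    by (simp add: hres_apply v w M1.tangent_space_combine incl1_combine)
qed (simp add: cotangent_map_def)

lemma vres_cotangent:
  assumes \<xi>: "\<xi> \<in> cotangent_space C z"
  shows "vres z \<xi> \<in> cotangent_space B (snd z)"
proof (rule M2.cotangent_spaceI)
  fix v w a b assume v: "v \<in> tangent_space B (snd z)" and w: "w \<in> tangent_space B (snd z)"
  show "vres z \<xi> (\<lambda>f. a * v f + b * w f) = a * vres z \<xi> v + b * vres z \<xi> w"
    using M.cotangent_linear[OF \<xi>, of "incl2 (fst z) v" "incl2 (fst z) w" a b]
      incl2_tangent[OF v, of "fst z"] incl2_tangent[OF w, of "fst z"]
    by (simp add: vres_apply v w M2.tangent_space_combine incl2_combine)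
qed (simp add: cotangent_map_def)

lemma cotangent_split:
  assumes \<xi>: "\<xi> \<in> cotangent_space C z" and u: "u \<in> tangent_space C z"
  shows "\<xi> u = hres z \<xi> (proj1 u) + vres z \<xi> (proj2 u)"
proof -
  note p = proj1_tangent[OF u] proj2_tangent[OF u]
  have "\<xi> u = \<xi> (\<lambda>F. 1 * incl1 (snd z) (proj1 u) F + 1 * incl2 (fst z) (proj2 u) F)"
    by (rule arg_cong[OF tangent_split[OF u]])
  also have "\<dots> = 1 * \<xi> (incl1 (snd z) (proj1 u)) + 1 * \<xi> (incl2 (fst z) (proj2 u))"
    using incl1_tangent[OF p(1), of "snd z"] incl2_tangent[OF p(2), of "fst z"]
    by (intro M.cotangent_linear[OF \<xi>]) auto
  finally show ?thesis by (simp add: hres_apply[OF p(1)] vres_apply[OF p(2)])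
qed

lemma res_lift:
  assumes "\<alpha> \<in> one_forms A" "\<beta> \<in> one_forms B"
  shows "hres z (hlift A B \<alpha> z) = \<alpha> (fst z)" "vres z (hlift A B \<alpha> z) = 0"
    "hres z (vlift A B \<beta> z) = 0" "vres z (vlift A B \<beta> z) = \<beta> (snd z)"
  using restrict_lift[OF M1.atlas M2.atlas assms, where p = "fst z" and q = "snd z"] by simp_all

section \<open>Warped bivector fields and cometrics as tensor fields on the product\<close>

lemma warped_eq: "warped A B \<phi> Q\<^sub>1 Q\<^sub>2 z \<xi> \<eta> =
    Q\<^sub>1 (fst z) (hres z \<xi>) (hres z \<eta>) + \<phi> (fst z) * Q\<^sub>2 (snd z) (vres z \<xi>) (vres z \<eta>)"
  by (cases z) (simp add: warped_def Let_def)

text \<open>Bilinearity is inherited from the restrictions. For smoothness the restrictions of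
  arbitrary forms are expanded in a frame of the factor: their components are the values of the
  forms on lifted frame fields, and the remaining components of the tensor are lifted
  functions.\<close>

lemma warped_tensor2:
  assumes Q1: "tensor2 A Q\<^sub>1" and Q2: "tensor2 B Q\<^sub>2" and \<phi>: "\<phi> \<in> smooth_functions A"
  shows "tensor2 C (warped A B \<phi> Q\<^sub>1 Q\<^sub>2)"
proof -
  have bil: "warped A B \<phi> Q\<^sub>1 Q\<^sub>2 z (\<lambda>v. a * \<xi> v + b * \<eta> v) \<zeta> = a * warped A B \<phi> Q\<^sub>1 Q\<^sub>2 z \<xi> \<zeta> + b * warped A B \<phi> Q\<^sub>1 Q\<^sub>2 z \<eta> \<zeta>"
    "warped A B \<phi> Q\<^sub>1 Q\<^sub>2 z \<zeta> (\<lambda>v. a * \<xi> v + b * \<eta> v) = a * warped A B \<phi> Q\<^sub>1 Q\<^sub>2 z \<zeta> \<xi> + b * warped A B \<phi> Q\<^sub>1 Q\<^sub>2 z \<zeta> \<eta>"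
    if "\<xi> \<in> cotangent_space C z" "\<eta> \<in> cotangent_space C z" "\<zeta> \<in> cotangent_space C z" for z \<xi> \<eta> \<zeta> a b
    unfolding warped_eq res_combine
    by (simp_all add: M1.tensor2D(1,2)[OF Q1] M2.tensor2D(1,2)[OF Q2] hres_cotangent vres_cotangent that algebra_simps)
  have sm1: "(\<lambda>z. Q\<^sub>1 (fst z) (hres z (\<alpha> z)) (hres z (\<beta> z))) \<in> smooth_functions C"
    if \<alpha>: "\<alpha> \<in> one_forms C" and \<beta>: "\<beta> \<in> one_forms C" for \<alpha> \<beta>
  proof (rule M.smooth_functions_local)
    fix z :: "'a \<times> 'b"
    obtain x E W where F: "frame_on A (Basis :: 'e set) x E W" "fst z \<in> W" by (rule M1.frame_at)
    note E = M1.frame_onD(4)[OF F(1)]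
    let ?h = "\<lambda>z. \<Sum>i\<in>Basis. \<Sum>j\<in>Basis. \<alpha> z (hvf (E i) z) * (\<beta> z (hvf (E j) z) *
        Q\<^sub>1 (fst z) (exterior_d A (x i) (fst z)) (exterior_d A (x j) (fst z)))"
    have "?h \<in> smooth_functions C"
      using smooth_fst[OF M1.tensor2D(3)[OF Q1 M1.exterior_d_form[OF M1.frame_onD(3)[OF F(1)]]
            M1.exterior_d_form[OF M1.frame_onD(3)[OF F(1)]]]]
        M.one_formD(2)[OF \<alpha> hvf_vf[OF E]] M.one_formD(2)[OF \<beta> hvf_vf[OF E]]
      by (intro M.smooth_sum M.smooth_mult) auto
    moreover have "Q\<^sub>1 (fst r) (hres r (\<alpha> r)) (hres r (\<beta> r)) = ?h r" if "fst r \<in> W" for r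
      unfolding M1.tensor2_expand[OF Q1 F(1) that hres_cotangent[OF M.one_formD(1)[OF \<alpha>]]
          hres_cotangent[OF M.one_formD(1)[OF \<beta>]]]
      by (intro sum.cong refl) (simp add: hres_apply M1.vector_fieldD(1)[OF E] hvf_def)
    ultimately show "\<exists>h W. h \<in> smooth_functions C \<and> open W \<and> z \<in> W \<and>
        (\<forall>x\<in>W. Q\<^sub>1 (fst x) (hres x (\<alpha> x)) (hres x (\<beta> x)) = h x)"
      using open_fst[OF M1.frame_onD(2)[OF F(1)]] F(2)
      by (intro exI[of _ ?h] exI[of _ "{z. fst z \<in> W}"]) simp
  qed
  have sm2: "(\<lambda>z. Q\<^sub>2 (snd z) (vres z (\<alpha> z)) (vres z (\<beta> z))) \<in> smooth_functions C"
    if \<alpha>: "\<alpha> \<in> one_forms C" and \<beta>: "\<beta> \<in> one_forms C" for \<alpha> \<beta>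
  proof (rule M.smooth_functions_local)
    fix z :: "'a \<times> 'b"
    obtain x E W where F: "frame_on B (Basis :: 'f set) x E W" "snd z \<in> W" by (rule M2.frame_at)
    note E = M2.frame_onD(4)[OF F(1)]
    let ?h = "\<lambda>z. \<Sum>i\<in>Basis. \<Sum>j\<in>Basis. \<alpha> z (vvf (E i) z) * (\<beta> z (vvf (E j) z) *
        Q\<^sub>2 (snd z) (exterior_d B (x i) (snd z)) (exterior_d B (x j) (snd z)))"
    have "?h \<in> smooth_functions C"
      using smooth_snd[OF M2.tensor2D(3)[OF Q2 M2.exterior_d_form[OF M2.frame_onD(3)[OF F(1)]]
            M2.exterior_d_form[OF M2.frame_onD(3)[OF F(1)]]]]
        M.one_formD(2)[OF \<alpha> vvf_vf[OF E]] M.one_formD(2)[OF \<beta> vvf_vf[OF E]]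
      by (intro M.smooth_sum M.smooth_mult) auto
    moreover have "Q\<^sub>2 (snd r) (vres r (\<alpha> r)) (vres r (\<beta> r)) = ?h r" if "snd r \<in> W" for r
      unfolding M2.tensor2_expand[OF Q2 F(1) that vres_cotangent[OF M.one_formD(1)[OF \<alpha>]]
          vres_cotangent[OF M.one_formD(1)[OF \<beta>]]]
      by (intro sum.cong refl) (simp add: vres_apply M2.vector_fieldD(1)[OF E] vvf_def)
    ultimately show "\<exists>h W. h \<in> smooth_functions C \<and> open W \<and> z \<in> W \<and>
        (\<forall>x\<in>W. Q\<^sub>2 (snd x) (vres x (\<alpha> x)) (vres x (\<beta> x)) = h x)"
      using open_snd[OF M2.frame_onD(2)[OF F(1)]] F(2)
      by (intro exI[of _ ?h] exI[of _ "{z. snd z \<in> W}"]) simp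
  qed
  have sm: "(\<lambda>z. warped A B \<phi> Q\<^sub>1 Q\<^sub>2 z (\<alpha> z) (\<beta> z)) \<in> smooth_functions C"
    if "\<alpha> \<in> one_forms C" "\<beta> \<in> one_forms C" for \<alpha> \<beta>
    unfolding warped_eq by (intro M.smooth_add M.smooth_mult smooth_fst \<phi> sm1 sm2 that)
  show ?thesis
    unfolding tensor2_def by (intro conjI ballI allI; (rule sm bil; assumption))
qed

lemma warped_bivector:
  assumes P1: "bivector_field A P\<^sub>1" and P2: "bivector_field B P\<^sub>2" and \<phi>: "\<phi> \<in> smooth_functions A"
  shows "bivector_field C (warped A B \<phi> P\<^sub>1 P\<^sub>2)"
proof -
  interpret B1: bivector_manifold A P\<^sub>1 by unfold_locales (rule P1)
  interpret B2: bivector_manifold B P\<^sub>2 by unfold_locales (rule P2)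
  note T = warped_tensor2[OF B1.P_tensor B2.P_tensor \<phi>]
  have "warped A B \<phi> P\<^sub>1 P\<^sub>2 z \<xi> \<eta> = - warped A B \<phi> P\<^sub>1 P\<^sub>2 z \<eta> \<xi>"
    if "\<xi> \<in> cotangent_space C z" "\<eta> \<in> cotangent_space C z" for z \<xi> \<eta>
    unfolding warped_eq
    using B1.skew[OF hres_cotangent[OF that(1)] hres_cotangent[OF that(2)]]
      B2.skew[OF vres_cotangent[OF that(1)] vres_cotangent[OF that(2)]] by simp
  then show ?thesis
    unfolding bivector_field_def using M.tensor2D(1,3)[OF T] by blast
qed

text \<open>The local criterion is used because frames exist only locally. Near z the fields of the
  two frames are represented by 1-forms of the factors; lifting these and weighting them with the
  components of V gives the representing form.\<close>

lemma warped_cometric: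
  assumes g1: "cometric_tensor A g\<^sub>1" and g2: "cometric_tensor B g\<^sub>2"
    and f: "f \<in> smooth_functions A" and pos: "\<And>x. f x > 0"
  shows "cometric_tensor C (warped A B f g\<^sub>1 g\<^sub>2)"
proof (rule M.cometric_tensorI)
  have T1: "tensor2 A g\<^sub>1" and T2: "tensor2 B g\<^sub>2" using g1 g2 by (simp_all add: cometric_tensor_def)
  have s1: "g\<^sub>1 p \<xi> \<eta> = g\<^sub>1 p \<eta> \<xi>" if "\<xi> \<in> cotangent_space A p" "\<eta> \<in> cotangent_space A p" for p \<xi> \<eta>
    using g1 that unfolding cometric_tensor_def by blast
  have s2: "g\<^sub>2 p \<xi> \<eta> = g\<^sub>2 p \<eta> \<xi>" if "\<xi> \<in> cotangent_space B p" "\<eta> \<in> cotangent_space B p" for p \<xi> \<eta>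
    using g2 that unfolding cometric_tensor_def by blast
  show "tensor2 C (warped A B f g\<^sub>1 g\<^sub>2)" by (rule warped_tensor2[OF T1 T2 f])
  show "warped A B f g\<^sub>1 g\<^sub>2 z \<xi> \<eta> = warped A B f g\<^sub>1 g\<^sub>2 z \<eta> \<xi>"
    if "\<xi> \<in> cotangent_space C z" "\<eta> \<in> cotangent_space C z" for z \<xi> \<eta>
    unfolding warped_eq
    using s1[OF hres_cotangent[OF that(1)] hres_cotangent[OF that(2)]]
      s2[OF vres_cotangent[OF that(1)] vres_cotangent[OF that(2)]] by simp
  fix V :: "('a \<times> 'b) vfield" and z :: "'a \<times> 'b" assume V: "V \<in> vector_fields C"
  note VT = M.vector_fieldD(1)[OF V]
  obtain x E W where F: "frame_on A (Basis :: 'e set) x E W" "fst z \<in> W" by (rule M1.frame_at)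
  obtain y E' W' where F': "frame_on B (Basis :: 'f set) y E' W'" "snd z \<in> W'" by (rule M2.frame_at)
  have "\<exists>\<omega>\<in>one_forms A. \<forall>p. \<forall>\<xi>\<in>cotangent_space A p. g\<^sub>1 p (\<omega> p) \<xi> = \<xi> (E b p)" if "b \<in> Basis" for b
    using g1 M1.frame_onD(4)[OF F(1) that] unfolding cometric_tensor_def by blast
  then have "\<forall>b\<in>Basis. \<exists>\<omega>. \<omega> \<in> one_forms A \<and> (\<forall>p. \<forall>\<xi>\<in>cotangent_space A p. g\<^sub>1 p (\<omega> p) \<xi> = \<xi> (E b p))" by blast
  from bchoice[OF this] obtain \<omega> where \<omega>: "\<And>b. b \<in> Basis \<Longrightarrow> \<omega> b \<in> one_forms A"
    "\<And>b p \<xi>. b \<in> Basis \<Longrightarrow> \<xi> \<in> cotangent_space A p \<Longrightarrow> g\<^sub>1 p (\<omega> b p) \<xi> = \<xi> (E b p)" by blast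
  have "\<exists>\<omega>\<in>one_forms B. \<forall>p. \<forall>\<xi>\<in>cotangent_space B p. g\<^sub>2 p (\<omega> p) \<xi> = \<xi> (E' b p)" if "b \<in> Basis" for b
    using g2 M2.frame_onD(4)[OF F'(1) that] unfolding cometric_tensor_def by blast
  then have "\<forall>b\<in>Basis. \<exists>\<omega>. \<omega> \<in> one_forms B \<and> (\<forall>p. \<forall>\<xi>\<in>cotangent_space B p. g\<^sub>2 p (\<omega> p) \<xi> = \<xi> (E' b p))" by blast
  from bchoice[OF this] obtain \<theta> where \<theta>: "\<And>b. b \<in> Basis \<Longrightarrow> \<theta> b \<in> one_forms B"
    "\<And>b p \<xi>. b \<in> Basis \<Longrightarrow> \<xi> \<in> cotangent_space B p \<Longrightarrow> g\<^sub>2 p (\<theta> b p) \<xi> = \<xi> (E' b p)" by blast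
  note T = warped_tensor2[OF T1 T2 f]
  let ?g = "warped A B f g\<^sub>1 g\<^sub>2"
  let ?\<eta>1 = "\<Sum>b\<in>Basis. (\<lambda>z. V z (\<lambda>z. x b (fst z))) \<cdot> hlift A B (\<omega> b)"
  \<comment> \<open>Division by \<open>f\<close> compensates the factor \<open>f\<close> of the
    vertical part of the metric; it is legitimate because \<open>f\<close> is positive.\<close>
  let ?\<eta>2 = "\<Sum>b\<in>Basis. (\<lambda>z. V z (\<lambda>z. y b (snd z)) / f (fst z)) \<cdot> vlift A B (\<theta> b)"
  have c1: "(\<lambda>z. V z (\<lambda>z. x b (fst z))) \<in> smooth_functions C" if "b \<in> Basis" for b
    by (intro M.vector_fieldD(2)[OF V] smooth_fst M1.frame_onD(3)[OF F(1)] that)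
  have c2: "(\<lambda>z. V z (\<lambda>z. y b (snd z)) / f (fst z)) \<in> smooth_functions C" if "b \<in> Basis" for b
    using pos by (intro M.smooth_divide M.vector_fieldD(2)[OF V] smooth_snd M2.frame_onD(3)[OF F'(1)] that smooth_fst f)
      (metis less_irrefl)
  have l1: "hlift A B (\<omega> b) \<in> one_forms C" if "b \<in> Basis" for b by (rule hlift_form[OF \<omega>(1)[OF that]])
  have l2: "vlift A B (\<theta> b) \<in> one_forms C" if "b \<in> Basis" for b by (rule vlift_form[OF \<theta>(1)[OF that]])
  have f1: "?\<eta>1 \<in> one_forms C" by (intro M.form_sum M.form_smult c1 l1)
  have f2: "?\<eta>2 \<in> one_forms C" by (intro M.form_sum M.form_smult c2 l2)
  have gsum: "?g r ((\<Sum>b\<in>J. c b \<cdot> \<zeta> b) r) \<xi> = (\<Sum>b\<in>J. c b r * ?g r (\<zeta> b r) \<xi>)"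
    if "\<And>b. b \<in> J \<Longrightarrow> c b \<in> smooth_functions C" "\<And>b. b \<in> J \<Longrightarrow> \<zeta> b \<in> one_forms C" "\<xi> \<in> cotangent_space C r"
    for J :: "'i set" and c \<zeta> r \<xi>
    using that(1,2)
  proof (induction J rule: infinite_finite_induct)
    case (insert b J)
    have s: "(\<Sum>b\<in>J. c b \<cdot> \<zeta> b) \<in> one_forms C"
      using insert.prems by (intro M.form_sum M.form_smult) auto
    have "?g r ((c b \<cdot> \<zeta> b + (\<lambda>_. 1) \<cdot> (\<Sum>b\<in>J. c b \<cdot> \<zeta> b)) r) \<xi> =
        c b r * ?g r (\<zeta> b r) \<xi> + 1 * ?g r ((\<Sum>b\<in>J. c b \<cdot> \<zeta> b) r) \<xi>"
      using insert.prems by (intro M.tensor2_forms(1)[OF T _ s that(3)]) auto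
    moreover have "?g r ((\<Sum>b\<in>J. c b \<cdot> \<zeta> b) r) \<xi> = (\<Sum>b\<in>J. c b r * ?g r (\<zeta> b r) \<xi>)"
      using insert.prems by (intro insert.IH) auto
    ultimately show ?case
      by (simp only: sum.insert[OF insert.hyps(1,2)] M.smult_const_1 mult_1)
  qed (simp_all add: M.tensor2_zero[OF T that(3)])
  have main: "?g r ((?\<eta>1 + ?\<eta>2) r) \<xi> = \<xi> (V r)"
    if r: "fst r \<in> W" "snd r \<in> W'" and \<xi>: "\<xi> \<in> cotangent_space C r" for r \<xi>
  proof -
    note h = hres_cotangent[OF \<xi>] and v = vres_cotangent[OF \<xi>]
    have G1: "?g r (hlift A B (\<omega> b) r) \<xi> = hres r \<xi> (E b (fst r))" if "b \<in> Basis" for b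
      unfolding warped_eq by (simp add: res_lift[OF \<omega>(1)[OF that] M2.form_zero] \<omega>(2)[OF that h] M2.tensor2_zero[OF T2 v])
    have G2: "?g r (vlift A B (\<theta> b) r) \<xi> = f (fst r) * vres r \<xi> (E' b (snd r))" if "b \<in> Basis" for b
      unfolding warped_eq by (simp add: res_lift[OF M1.form_zero \<theta>(1)[OF that]] \<theta>(2)[OF that v] M1.tensor2_zero[OF T1 h])
    have "?g r ((?\<eta>1 + ?\<eta>2) r) \<xi> = ?g r (?\<eta>1 r) \<xi> + ?g r (?\<eta>2 r) \<xi>"
      using M.tensor2_forms(1)[OF T f1 f2 \<xi>, of "\<lambda>_. 1" "\<lambda>_. 1"] by (simp only: M.smult_const_1 mult_1)
    also have "?g r (?\<eta>1 r) \<xi> = (\<Sum>b\<in>Basis. V r (\<lambda>z. x b (fst z)) * ?g r (hlift A B (\<omega> b) r) \<xi>)"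
      by (rule gsum[OF c1 l1 \<xi>])
    also have "\<dots> = (\<Sum>b\<in>Basis. proj1 (V r) (x b) * hres r \<xi> (E b (fst r)))"
      by (intro sum.cong refl) (simp add: G1 proj1_apply M1.frame_onD(3)[OF F(1)])
    also have "\<dots> = hres r \<xi> (proj1 (V r))"
      by (rule M1.cotangent_frame(1)[OF F(1) r(1) h proj1_tangent[OF VT], symmetric])
    also have "?g r (?\<eta>2 r) \<xi> = (\<Sum>b\<in>Basis. V r (\<lambda>z. y b (snd z)) / f (fst r) * ?g r (vlift A B (\<theta> b) r) \<xi>)"
      by (rule gsum[OF c2 l2 \<xi>])
    also have "\<dots> = (\<Sum>b\<in>Basis. proj2 (V r) (y b) * vres r \<xi> (E' b (snd r)))"
      using pos[of "fst r"] by (intro sum.cong refl) (simp add: G2 proj2_apply M2.frame_onD(3)[OF F'(1)])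
    also have "\<dots> = vres r \<xi> (proj2 (V r))"
      by (rule M2.cotangent_frame(1)[OF F'(1) r(2) v proj2_tangent[OF VT], symmetric])
    finally show ?thesis by (simp only: cotangent_split[OF \<xi> VT])
  qed
  show "\<exists>\<omega> W. \<omega> \<in> one_forms C \<and> open W \<and> z \<in> W \<and> (\<forall>r\<in>W. \<forall>\<xi>\<in>cotangent_space C r. ?g r (\<omega> r) \<xi> = \<xi> (V r))"
    using M.form_add[OF f1 f2] open_Int[OF open_fst[OF M1.frame_onD(2)[OF F(1)]] open_snd[OF M2.frame_onD(2)[OF F'(1)]]]
      F(2) F'(2) main
    by (intro exI[of _ "?\<eta>1 + ?\<eta>2"] exI[of _ "{z. fst z \<in> W} \<inter> {z. snd z \<in> W'}"]) blast
qed

lemma product_form_eqI: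
  assumes \<omega>: "\<omega> \<in> one_forms C" and \<eta>: "\<eta> \<in> one_forms C"
    and 1: "\<And>X z. X \<in> vector_fields A \<Longrightarrow> \<omega> z (hvf X z) = \<eta> z (hvf X z)"
    and 2: "\<And>Y z. Y \<in> vector_fields B \<Longrightarrow> \<omega> z (vvf Y z) = \<eta> z (vvf Y z)"
  shows "\<omega> = \<eta>"
proof
  fix z
  note \<omega>T = M.one_formD(1)[OF \<omega>, of z] and \<eta>T = M.one_formD(1)[OF \<eta>, of z]
  show "\<omega> z = \<eta> z"
  proof (rule M.cotangent_eqI[OF \<omega>T \<eta>T])
    fix u assume u: "u \<in> tangent_space C z"
    obtain X where X: "X \<in> vector_fields A" "X (fst z) = proj1 u"
      by (rule M1.vf_extend[OF proj1_tangent[OF u]])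
    obtain Y where Y: "Y \<in> vector_fields B" "Y (snd z) = proj2 u"
      by (rule M2.vf_extend[OF proj2_tangent[OF u]])
    show "\<omega> z u = \<eta> z u"
      using 1[OF X(1), of z] 2[OF Y(1), of z]
      by (simp add: cotangent_split[OF \<omega>T u] cotangent_split[OF \<eta>T u] hres_apply vres_apply
          proj1_tangent[OF u] proj2_tangent[OF u] hvf_def vvf_def X(2) Y(2))
  qed
qed

text \<open>Both restrictions of the covector are extended to exact forms of the factors, whose
  lifts add up to the covector by the splitting of tangent vectors.\<close>

lemma cotangent_lift:
  assumes \<xi>: "\<xi> \<in> cotangent_space C z"
  obtains \<alpha> \<beta> where "\<alpha> \<in> one_forms A" "\<beta> \<in> one_forms B" "(hlift A B \<alpha> + vlift A B \<beta>) z = \<xi>"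
proof -
  obtain a where a: "a \<in> smooth_functions A" "exterior_d A a (fst z) = hres z \<xi>"
    by (rule M1.cotangent_exact[OF hres_cotangent[OF \<xi>]])
  obtain b where b: "b \<in> smooth_functions B" "exterior_d B b (snd z) = vres z \<xi>"
    by (rule M2.cotangent_exact[OF vres_cotangent[OF \<xi>]])
  note F = M1.exterior_d_form[OF a(1)] M2.exterior_d_form[OF b(1)]
  have "(hlift A B (exterior_d A a) + vlift A B (exterior_d B b)) z = \<xi>"
  proof (rule M.cotangent_eqI[OF M.one_formD(1)[OF M.form_add[OF hlift_form[OF F(1)] vlift_form[OF F(2)]]] \<xi>])
    fix u assume u: "u \<in> tangent_space C z"
    show "(hlift A B (exterior_d A a) + vlift A B (exterior_d B b)) z u = \<xi> u"
      by (simp add: hlift_apply[OF u] vlift_apply[OF u] a(2) b(2) cotangent_split[OF \<xi> u])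
  qed
  with F show ?thesis by (rule that)
qed

end

section \<open>Warped products with Casimir warping function\<close>

text \<open>The Casimir and constancy hypotheses enter in derivative form: \<sharp>\<alpha>(f) = 0
  for every \<alpha>, and every tangent vector kills \<mu>. These are the statements that the
  computations on lifts consume.\<close>

locale warped_product = product_manifold A B + L1: levi_civita_manifold A P\<^sub>1 g\<^sub>1 D\<^sub>1 + L2: levi_civita_manifold B P\<^sub>2 g\<^sub>2 D\<^sub>2
  for A :: "('a::{t2_space,second_countable_topology}, 'e::euclidean_space) chart set"
    and B :: "('b::{t2_space,second_countable_topology}, 'f::euclidean_space) chart set"
    and P\<^sub>1 g\<^sub>1 D\<^sub>1 P\<^sub>2 g\<^sub>2 D\<^sub>2 +
  fixes f \<mu> :: "'a \<Rightarrow> real"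
  assumes f: "f \<in> smooth_functions A" and f_pos: "f p > 0" and \<mu>: "\<mu> \<in> smooth_functions A"
    and f_casimir: "\<alpha> \<in> one_forms A \<Longrightarrow> anchor A P\<^sub>1 \<alpha> p f = 0"
    and \<mu>_const: "v \<in> tangent_space A p \<Longrightarrow> v \<mu> = 0"
begin

abbreviation "P \<equiv> warped A B \<mu> P\<^sub>1 P\<^sub>2"
abbreviation "g \<equiv> warped A B f g\<^sub>1 g\<^sub>2"

sublocale N: metric_manifold C P g
  by unfold_locales
     (rule warped_bivector[OF L1.bivector L2.bivector \<mu>], rule warped_cometric[OF L1.cometric L2.cometric f f_pos])

text \<open>The power of \<open>\<mu>\<close> records how often the connection or the bracket has been applied.\<close>

definition lift :: "nat \<Rightarrow> 'a form \<Rightarrow> 'b form \<Rightarrow> ('a \<times> 'b) form" where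
  "lift k \<alpha> \<beta> = hlift A B \<alpha> + (\<lambda>z. \<mu> (fst z) ^ k) \<cdot> vlift A B \<beta>"

lemma \<mu>_power: "(\<lambda>p. \<mu> p ^ k) \<in> smooth_functions A"
  by (induction k) (simp_all add: M1.smooth_const M1.smooth_mult \<mu>)

lemma \<mu>_power_const: "v \<in> tangent_space A p \<Longrightarrow> v (\<lambda>p. \<mu> p ^ k) = 0"
  by (induction k) (simp_all add: tangent_space_const M1.tangent_mult[OF _ \<mu> \<mu>_power, of v p] \<mu>_const)

lemma \<mu>_power_fst: "(\<lambda>z. \<mu> (fst z) ^ k) \<in> smooth_functions C"
  by (rule smooth_fst[OF \<mu>_power])

text \<open>The Leibniz rule with one derivative equal to 0: a lifted function that is killed by u
  may be pulled out. It is used for powers of \<mu>, and for f times a power of \<mu> when u is an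
  anchored vector.\<close>

lemma tangent_fst_const:
  assumes u: "u \<in> tangent_space C z" and "h \<in> smooth_functions A" and "proj1 u h = 0" and F: "F \<in> smooth_functions C"
  shows "u (\<lambda>z. h (fst z) * F z) = h (fst z) * u F"
  using M.tangent_mult[OF u smooth_fst[OF assms(2)] F] assms(3) by (simp add: proj1_apply assms(2))

lemma tangent_\<mu>_power:
  assumes u: "u \<in> tangent_space C z" and F: "F \<in> smooth_functions C"
  shows "u (\<lambda>z. \<mu> (fst z) ^ k * F z) = \<mu> (fst z) ^ k * u F"
  by (rule tangent_fst_const[OF u \<mu>_power \<mu>_power_const[OF proj1_tangent[OF u]] F])

lemma lift_form:
  assumes "\<alpha> \<in> one_forms A" "\<beta> \<in> one_forms B"
  shows "lift k \<alpha> \<beta> \<in> one_forms C"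
  unfolding lift_def
  by (intro M.form_add M.form_smult hlift_form vlift_form \<mu>_power_fst assms)

lemma lift_combine: "lift k \<alpha> \<beta> z = (\<lambda>u. 1 * hlift A B \<alpha> z u + \<mu> (fst z) ^ k * vlift A B \<beta> z u)"
  by (simp add: lift_def smult_def plus_fun_def)

lemma proj_vf:
  assumes X: "X \<in> vector_fields A" and Y: "Y \<in> vector_fields B"
  shows "proj1 (hvf X z) = X (fst z)" "proj2 (hvf X z) = 0" "proj1 (vvf Y z) = 0" "proj2 (vvf Y z) = Y (snd z)"
  unfolding hvf_def vvf_def
  using tangent_map_proj_slice1[OF M1.atlas M2.atlas M1.vector_fieldD(1)[OF X]]
    tangent_map_proj_slice2[OF M1.atlas M2.atlas M2.vector_fieldD(1)[OF Y]] by simp_all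

lemma vf_zero: "(\<lambda>p F. 0) \<in> vector_fields A" "(\<lambda>p F. 0) \<in> vector_fields B"
  by (intro M1.vector_fieldI M1.tangent_space_0 M1.smooth_const M2.vector_fieldI M2.tangent_space_0 M2.smooth_const)+

lemma lift_hvf:
  assumes \<alpha>: "\<alpha> \<in> one_forms A" and \<beta>: "\<beta> \<in> one_forms B" and X: "X \<in> vector_fields A"
  shows "lift k \<alpha> \<beta> z (hvf X z) = \<alpha> (fst z) (X (fst z))"
  by (simp add: lift_combine hlift_apply[OF M.vector_fieldD(1)[OF hvf_vf[OF X]]]
      vlift_apply[OF M.vector_fieldD(1)[OF hvf_vf[OF X]]] proj_vf[OF X vf_zero(2)]
      cotangent_space_zero[OF M2.one_formD(1)[OF \<beta>]])

lemma lift_vvf: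
  assumes \<alpha>: "\<alpha> \<in> one_forms A" and \<beta>: "\<beta> \<in> one_forms B" and Y: "Y \<in> vector_fields B"
  shows "lift k \<alpha> \<beta> z (vvf Y z) = \<mu> (fst z) ^ k * \<beta> (snd z) (Y (snd z))"
  by (simp add: lift_combine hlift_apply[OF M.vector_fieldD(1)[OF vvf_vf[OF Y]]]
      vlift_apply[OF M.vector_fieldD(1)[OF vvf_vf[OF Y]]] proj_vf[OF vf_zero(1) Y]
      cotangent_space_zero[OF M1.one_formD(1)[OF \<alpha>]])

text \<open>The summand with factor 0 gives the vertical restriction the shape of a linear
  combination, so that \<open>tensor2D\<close> applies directly.\<close>

lemma res_lift_pair:
  assumes "\<alpha> \<in> one_forms A" "\<beta> \<in> one_forms B"
  shows "hres z (lift k \<alpha> \<beta> z) = \<alpha> (fst z)"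
    and "vres z (lift k \<alpha> \<beta> z) = (\<lambda>w. \<mu> (fst z) ^ k * \<beta> (snd z) w + 0 * \<beta> (snd z) w)"
  unfolding lift_combine res_combine by (simp_all add: res_lift[OF assms])

text \<open>The restrictions to the slices separate the two factors, and by bilinearity the vertical
  term collects the powers of \<mu> from both arguments.\<close>

lemma warped_lift:
  assumes a: "\<alpha>\<^sub>1 \<in> one_forms A" "\<alpha>\<^sub>2 \<in> one_forms B" and b: "\<beta>\<^sub>1 \<in> one_forms A" "\<beta>\<^sub>2 \<in> one_forms B"
    and Q2: "tensor2 B Q\<^sub>2"
  shows "warped A B \<phi> Q\<^sub>1 Q\<^sub>2 z (lift j \<alpha>\<^sub>1 \<alpha>\<^sub>2 z) (lift k \<beta>\<^sub>1 \<beta>\<^sub>2 z) =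
    Q\<^sub>1 (fst z) (\<alpha>\<^sub>1 (fst z)) (\<beta>\<^sub>1 (fst z)) + \<phi> (fst z) * \<mu> (fst z) ^ (j + k) * Q\<^sub>2 (snd z) (\<alpha>\<^sub>2 (snd z)) (\<beta>\<^sub>2 (snd z))"
proof -
  note T = M2.one_formD(1)[OF a(2)] M2.one_formD(1)[OF b(2)]
  show ?thesis
    unfolding warped_eq res_lift_pair[OF a] res_lift_pair[OF b]
      M2.tensor2D(1)[OF Q2 T(1) T(1) M2.cotangent_combine[OF T(2) T(2)]] M2.tensor2D(2)[OF Q2 T(2) T(2) T(1)]
    by (simp add: power_add)
qed

section \<open>Anchor, brackets and the Koszul formula on lifts\<close>

lemma exterior_d_fst: "h \<in> smooth_functions A \<Longrightarrow> exterior_d C (\<lambda>z. h (fst z)) z = lift 0 (exterior_d A h) 0 z"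
  and exterior_d_snd: "k \<in> smooth_functions B \<Longrightarrow> exterior_d C (\<lambda>z. k (snd z)) z = lift 0 0 (exterior_d B k) z"
proof -
  have z: "hlift A B 0 z u = 0" "vlift A B 0 z u = 0" for u
    by (simp_all add: hlift_def vlift_def pullback_def cotangent_map_def)
  have o: "hlift A B \<alpha> z u = 0" "vlift A B \<beta> z u = 0" if "u \<notin> tangent_space C z" for \<alpha> \<beta> u
    using that by (simp_all add: hlift_def vlift_def pullback_def cotangent_map_def)
  show "exterior_d C (\<lambda>z. h (fst z)) z = lift 0 (exterior_d A h) 0 z" if h: "h \<in> smooth_functions A"
  proof
    fix u show "exterior_d C (\<lambda>z. h (fst z)) z u = lift 0 (exterior_d A h) 0 z u"
      by (cases "u \<in> tangent_space C z")
         (simp_all add: lift_combine z o hlift_apply exterior_d_apply proj1_tangent proj1_apply h exterior_d_def)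
  qed
  show "exterior_d C (\<lambda>z. k (snd z)) z = lift 0 0 (exterior_d B k) z" if k: "k \<in> smooth_functions B"
  proof
    fix u show "exterior_d C (\<lambda>z. k (snd z)) z u = lift 0 0 (exterior_d B k) z u"
      by (cases "u \<in> tangent_space C z")
         (simp_all add: lift_combine z o vlift_apply exterior_d_apply proj2_tangent proj2_apply k exterior_d_def)
  qed
qed

text \<open>The exponent \<open>k + 1\<close> consists of the weight of the form and one factor
  \<mu> contributed by the warped bivector field.\<close>

lemma anchor_lift:
  assumes \<alpha>: "\<alpha> \<in> one_forms A" and \<beta>: "\<beta> \<in> one_forms B"
  shows "h \<in> smooth_functions A \<Longrightarrow> N.sh (lift k \<alpha> \<beta>) z (\<lambda>z. h (fst z)) = L1.sh \<alpha> (fst z) h"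
    and "l \<in> smooth_functions B \<Longrightarrow> N.sh (lift k \<alpha> \<beta>) z (\<lambda>z. l (snd z)) = \<mu> (fst z) ^ (k + 1) * L2.sh \<beta> (snd z) l"
proof -
  note F = lift_form[OF \<alpha> \<beta>]
  show "N.sh (lift k \<alpha> \<beta>) z (\<lambda>z. h (fst z)) = L1.sh \<alpha> (fst z) h" if h: "h \<in> smooth_functions A"
    unfolding N.anchor_apply[OF F] exterior_d_fst[OF h] L1.anchor_apply[OF \<alpha>]
      warped_lift[OF \<alpha> \<beta> M1.exterior_d_form[OF h] M2.form_zero L2.P_tensor]
    by (simp add: M2.tensor2_zero[OF L2.P_tensor M2.one_formD(1)[OF \<beta>]])
  show "N.sh (lift k \<alpha> \<beta>) z (\<lambda>z. l (snd z)) = \<mu> (fst z) ^ (k + 1) * L2.sh \<beta> (snd z) l" if l: "l \<in> smooth_functions B"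
    unfolding N.anchor_apply[OF F] exterior_d_snd[OF l] L2.anchor_apply[OF \<beta>]
      warped_lift[OF \<alpha> \<beta> M1.form_zero M2.exterior_d_form[OF l] L2.P_tensor]
    by (simp add: M1.tensor2_zero[OF L1.P_tensor M1.one_formD(1)[OF \<alpha>]])
qed

text \<open>Stated for values of the warped metric on lifts: \<open>h\<close> and \<open>l\<close>
  stand for the contributions of the two metrics, and \<open>m\<close> for f times a power of \<mu>,
  which the anchored vector treats as a constant.\<close>

lemma anchor_lift_mixed:
  assumes \<alpha>: "\<alpha> \<in> one_forms A" and \<beta>: "\<beta> \<in> one_forms B" and h: "h \<in> smooth_functions A" and l: "l \<in> smooth_functions B"
    and m: "m \<in> smooth_functions A" "\<And>p. L1.sh \<alpha> p m = 0"
  shows "N.sh (lift k \<alpha> \<beta>) z (\<lambda>z. h (fst z) + m (fst z) * l (snd z)) =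
    L1.sh \<alpha> (fst z) h + m (fst z) * \<mu> (fst z) ^ (k + 1) * L2.sh \<beta> (snd z) l"
proof -
  note U = N.anchor_tangent[OF lift_form[OF \<alpha> \<beta>], of k z]
  show ?thesis
    using tangent_fst_const[OF U m(1) _ smooth_snd[OF l]]
    by (simp add: M.tangent_add[OF U smooth_fst[OF h] M.smooth_mult[OF smooth_fst[OF m(1)] smooth_snd[OF l]]]
        anchor_lift \<alpha> \<beta> h l m proj1_apply)
qed

text \<open>Checked on lifted functions. Mixed terms vanish because a lifted field kills functions
  of the other factor and the powers of \<mu>; in the vertical bracket the weight
  \<open>k + 1\<close> of the anchor is thus an overall factor. The summand with factor 0 again
  supplies the shape of a linear combination.\<close>

lemma lie_bracket_lift:
  assumes \<alpha>: "\<alpha> \<in> one_forms A" and \<beta>: "\<beta> \<in> one_forms B"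
  shows "X \<in> vector_fields A \<Longrightarrow> lie_bracket (N.sh (lift k \<alpha> \<beta>)) (hvf X) z = hvf (lie_bracket (L1.sh \<alpha>) X) z"
    and "Y \<in> vector_fields B \<Longrightarrow> lie_bracket (N.sh (lift k \<alpha> \<beta>)) (vvf Y) z =
      (\<lambda>F. \<mu> (fst z) ^ (k + 1) * vvf (lie_bracket (L2.sh \<beta>) Y) z F + 0 * vvf (lie_bracket (L2.sh \<beta>) Y) z F)"
proof -
  note U = N.anchor_vf[OF lift_form[OF \<alpha> \<beta>], of k] and S = L1.anchor_vf[OF \<alpha>] and T = L2.anchor_vf[OF \<beta>]
  note UT = M.vector_fieldD(1)[OF U]
  show "lie_bracket (N.sh (lift k \<alpha> \<beta>)) (hvf X) z = hvf (lie_bracket (L1.sh \<alpha>) X) z" if X: "X \<in> vector_fields A"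
  proof (rule product_tangent_eqI[OF M.vector_fieldD(1)[OF M.lie_bracket_vf[OF U hvf_vf[OF X]]]
        M.vector_fieldD(1)[OF hvf_vf[OF M1.lie_bracket_vf[OF S X]]]])
    note XT = M.vector_fieldD(1)[OF hvf_vf[OF X]]
    fix h assume h: "h \<in> smooth_functions A"
    show "lie_bracket (N.sh (lift k \<alpha> \<beta>)) (hvf X) z (\<lambda>z. h (fst z)) = hvf (lie_bracket (L1.sh \<alpha>) X) z (\<lambda>z. h (fst z))"
      using anchor_lift(1)[OF \<alpha> \<beta> M1.vector_fieldD(2)[OF X h]] hvf_apply(1)[OF X M1.vector_fieldD(2)[OF S h]]
      by (simp add: lie_bracket_def hvf_apply(1)[OF X h] anchor_lift(1)[OF \<alpha> \<beta> h]
          hvf_apply(1)[OF M1.lie_bracket_vf[OF S X, unfolded lie_bracket_def] h])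
  next
    note XT = M.vector_fieldD(1)[OF hvf_vf[OF X]]
    fix h assume h: "h \<in> smooth_functions B"
    show "lie_bracket (N.sh (lift k \<alpha> \<beta>)) (hvf X) z (\<lambda>z. h (snd z)) = hvf (lie_bracket (L1.sh \<alpha>) X) z (\<lambda>z. h (snd z))"
      using tangent_\<mu>_power[OF XT smooth_snd[OF M2.vector_fieldD(2)[OF T h]], of z "k + 1"]
      by (simp add: lie_bracket_def[of _ "hvf X"] hvf_apply(2)[OF X h] anchor_lift(2)[OF \<alpha> \<beta> h]
          hvf_apply(2)[OF M1.lie_bracket_vf[OF S X] h] tangent_space_const[OF UT]
          hvf_apply(2)[OF X M2.vector_fieldD(2)[OF T h]])
  qed
  show "lie_bracket (N.sh (lift k \<alpha> \<beta>)) (vvf Y) z =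
      (\<lambda>F. \<mu> (fst z) ^ (k + 1) * vvf (lie_bracket (L2.sh \<beta>) Y) z F + 0 * vvf (lie_bracket (L2.sh \<beta>) Y) z F)"
    if Y: "Y \<in> vector_fields B"
  proof (rule product_tangent_eqI[OF M.vector_fieldD(1)[OF M.lie_bracket_vf[OF U vvf_vf[OF Y]]]
        M.tangent_space_combine[OF M.vector_fieldD(1)[OF vvf_vf[OF M2.lie_bracket_vf[OF T Y]]]
          M.vector_fieldD(1)[OF vvf_vf[OF M2.lie_bracket_vf[OF T Y]]]]])
    note YT = M.vector_fieldD(1)[OF vvf_vf[OF Y]]
    fix h assume h: "h \<in> smooth_functions A"
    show "lie_bracket (N.sh (lift k \<alpha> \<beta>)) (vvf Y) z (\<lambda>z. h (fst z)) =
      \<mu> (fst z) ^ (k + 1) * vvf (lie_bracket (L2.sh \<beta>) Y) z (\<lambda>z. h (fst z)) + 0 * vvf (lie_bracket (L2.sh \<beta>) Y) z (\<lambda>z. h (fst z))"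
      by (simp add: lie_bracket_def[of _ "vvf Y"] vvf_apply(1)[OF Y h] anchor_lift(1)[OF \<alpha> \<beta> h]
          vvf_apply(1)[OF M2.lie_bracket_vf[OF T Y] h] tangent_space_const[OF UT]
          vvf_apply(1)[OF Y M1.vector_fieldD(2)[OF S h]])
  next
    note YT = M.vector_fieldD(1)[OF vvf_vf[OF Y]]
    fix h assume h: "h \<in> smooth_functions B"
    have e: "vvf (lie_bracket (L2.sh \<beta>) Y) z (\<lambda>z. h (snd z)) =
        L2.sh \<beta> (snd z) (\<lambda>q. Y q h) - Y (snd z) (\<lambda>q. L2.sh \<beta> q h)"
      unfolding vvf_apply(2)[OF M2.lie_bracket_vf[OF T Y] h] by (simp add: lie_bracket_def)
    show "lie_bracket (N.sh (lift k \<alpha> \<beta>)) (vvf Y) z (\<lambda>z. h (snd z)) =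
      \<mu> (fst z) ^ (k + 1) * vvf (lie_bracket (L2.sh \<beta>) Y) z (\<lambda>z. h (snd z)) + 0 * vvf (lie_bracket (L2.sh \<beta>) Y) z (\<lambda>z. h (snd z))"
      using tangent_\<mu>_power[OF YT smooth_snd[OF M2.vector_fieldD(2)[OF T h]], of z "k + 1"]
      by (simp add: lie_bracket_def[of _ "vvf Y"] vvf_apply(2)[OF Y h] anchor_lift(2)[OF \<alpha> \<beta> h] anchor_lift(2)[OF \<alpha> \<beta> M2.vector_fieldD(2)[OF Y h]]
          vvf_apply(2)[OF Y M2.vector_fieldD(2)[OF T h]] e algebra_simps)
  qed
qed

text \<open>Tested on lifted fields, every vertical term of the bracket contains the weights of both
  forms and one more \<mu>, from an anchor or from the warped bivector field; there are no terms
  mixing the factors.\<close>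

lemma koszul_lift:
  assumes a: "\<alpha>\<^sub>1 \<in> one_forms A" "\<alpha>\<^sub>2 \<in> one_forms B" and b: "\<beta>\<^sub>1 \<in> one_forms A" "\<beta>\<^sub>2 \<in> one_forms B"
  shows "N.kos (lift j \<alpha>\<^sub>1 \<alpha>\<^sub>2) (lift k \<beta>\<^sub>1 \<beta>\<^sub>2) = lift (j + k + 1) (L1.kos \<alpha>\<^sub>1 \<beta>\<^sub>1) (L2.kos \<alpha>\<^sub>2 \<beta>\<^sub>2)"
proof (rule product_form_eqI)
  note F = lift_form[OF a] lift_form[OF b] and K = L1.koszul_form[OF a(1) b(1)] L2.koszul_form[OF a(2) b(2)]
  show "N.kos (lift j \<alpha>\<^sub>1 \<alpha>\<^sub>2) (lift k \<beta>\<^sub>1 \<beta>\<^sub>2) \<in> one_forms C" by (rule N.koszul_form[OF F])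
  show "lift (j + k + 1) (L1.kos \<alpha>\<^sub>1 \<beta>\<^sub>1) (L2.kos \<alpha>\<^sub>2 \<beta>\<^sub>2) \<in> one_forms C" by (rule lift_form[OF K])
  have P: "(\<lambda>q. P q (lift j \<alpha>\<^sub>1 \<alpha>\<^sub>2 q) (lift k \<beta>\<^sub>1 \<beta>\<^sub>2 q)) =
      (\<lambda>z. P\<^sub>1 (fst z) (\<alpha>\<^sub>1 (fst z)) (\<beta>\<^sub>1 (fst z)) + \<mu> (fst z) ^ (j + k + 1) * P\<^sub>2 (snd z) (\<alpha>\<^sub>2 (snd z)) (\<beta>\<^sub>2 (snd z)))"
    by (simp add: warped_lift[OF a b L2.P_tensor])
  have P1: "(\<lambda>p. P\<^sub>1 p (\<alpha>\<^sub>1 p) (\<beta>\<^sub>1 p)) \<in> smooth_functions A" by (rule M1.tensor2D(3)[OF L1.P_tensor a(1) b(1)])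
  have P2: "(\<lambda>p. P\<^sub>2 p (\<alpha>\<^sub>2 p) (\<beta>\<^sub>2 p)) \<in> smooth_functions B" by (rule M2.tensor2D(3)[OF L2.P_tensor a(2) b(2)])
  have dP: "u (\<lambda>z. P\<^sub>1 (fst z) (\<alpha>\<^sub>1 (fst z)) (\<beta>\<^sub>1 (fst z)) + \<mu> (fst z) ^ (j + k + 1) * P\<^sub>2 (snd z) (\<alpha>\<^sub>2 (snd z)) (\<beta>\<^sub>2 (snd z))) =
      u (\<lambda>z. P\<^sub>1 (fst z) (\<alpha>\<^sub>1 (fst z)) (\<beta>\<^sub>1 (fst z))) + \<mu> (fst z) ^ (j + k + 1) * u (\<lambda>z. P\<^sub>2 (snd z) (\<alpha>\<^sub>2 (snd z)) (\<beta>\<^sub>2 (snd z)))"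
    if u: "u \<in> tangent_space C z" for u z
    by (simp only: M.tangent_add[OF u smooth_fst[OF P1] M.smooth_mult[OF \<mu>_power_fst smooth_snd[OF P2]]]
        tangent_\<mu>_power[OF u smooth_snd[OF P2]])
  {
    fix X z assume X: "X \<in> vector_fields A"
    note h = M1.one_formD(2)[OF a(1) X] M1.one_formD(2)[OF b(1) X]
    show "N.kos (lift j \<alpha>\<^sub>1 \<alpha>\<^sub>2) (lift k \<beta>\<^sub>1 \<beta>\<^sub>2) z (hvf X z) = lift (j + k + 1) (L1.kos \<alpha>\<^sub>1 \<beta>\<^sub>1) (L2.kos \<alpha>\<^sub>2 \<beta>\<^sub>2) z (hvf X z)"
      unfolding N.koszul_apply[OF F hvf_vf[OF X]] lift_hvf[OF K X] L1.koszul_apply[OF a(1) b(1) X] P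
        dP[OF M.vector_fieldD(1)[OF hvf_vf[OF X]]]
        hvf_apply(1)[OF X P1] hvf_apply(2)[OF X P2]
        lie_bracket_lift(1)[OF a X] lie_bracket_lift(1)[OF b X]
        lift_hvf[OF a X] lift_hvf[OF b X] lift_hvf[OF b M1.lie_bracket_vf[OF L1.anchor_vf[OF a(1)] X]]
        lift_hvf[OF a M1.lie_bracket_vf[OF L1.anchor_vf[OF b(1)] X]]
        anchor_lift(1)[OF a h(2)] anchor_lift(1)[OF b h(1)]
      by simp
  next
    fix Y z assume Y: "Y \<in> vector_fields B"
    note h = M2.one_formD(2)[OF a(2) Y] M2.one_formD(2)[OF b(2) Y]
    note Fz = M.one_formD(1)[OF F(1)] M.one_formD(1)[OF F(2)]
    have VT: "vvf (lie_bracket (L2.sh \<gamma>) Y) z \<in> tangent_space C z" if "\<gamma> \<in> one_forms B" for \<gamma>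
      by (rule M.vector_fieldD(1)[OF vvf_vf[OF M2.lie_bracket_vf[OF L2.anchor_vf[OF that] Y]]])
    show "N.kos (lift j \<alpha>\<^sub>1 \<alpha>\<^sub>2) (lift k \<beta>\<^sub>1 \<beta>\<^sub>2) z (vvf Y z) = lift (j + k + 1) (L1.kos \<alpha>\<^sub>1 \<beta>\<^sub>1) (L2.kos \<alpha>\<^sub>2 \<beta>\<^sub>2) z (vvf Y z)"
      unfolding N.koszul_apply[OF F vvf_vf[OF Y]] lift_vvf[OF K Y] L2.koszul_apply[OF a(2) b(2) Y] P
        dP[OF M.vector_fieldD(1)[OF vvf_vf[OF Y]]]
        vvf_apply(1)[OF Y P1] vvf_apply(2)[OF Y P2]
        lie_bracket_lift(2)[OF a Y] lie_bracket_lift(2)[OF b Y]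
        M.cotangent_linear[OF Fz(1) VT[OF b(2)] VT[OF b(2)]] M.cotangent_linear[OF Fz(2) VT[OF a(2)] VT[OF a(2)]]
        lift_vvf[OF a Y] lift_vvf[OF b Y] lift_vvf[OF b M2.lie_bracket_vf[OF L2.anchor_vf[OF a(2)] Y]]
        lift_vvf[OF a M2.lie_bracket_vf[OF L2.anchor_vf[OF b(2)] Y]]
        tangent_\<mu>_power[OF N.anchor_tangent[OF F(1)] smooth_snd[OF h(2)]]
        tangent_\<mu>_power[OF N.anchor_tangent[OF F(2)] smooth_snd[OF h(1)]]
        anchor_lift(2)[OF a h(2)] anchor_lift(2)[OF b h(1)]
      by (simp add: power_add algebra_simps)
  }
qed

text \<open>Here the Casimir property is used: f times a power of \<mu> is constant along the
  horizontal anchor. The exponent consists of j + k from the forms inside the metric and i + 1 from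
  the anchor.\<close>

lemma anchor_g_lift:
  assumes a: "\<alpha>\<^sub>1 \<in> one_forms A" "\<alpha>\<^sub>2 \<in> one_forms B" and b: "\<beta>\<^sub>1 \<in> one_forms A" "\<beta>\<^sub>2 \<in> one_forms B"
    and c: "\<gamma>\<^sub>1 \<in> one_forms A" "\<gamma>\<^sub>2 \<in> one_forms B"
  shows "N.sh (lift i \<gamma>\<^sub>1 \<gamma>\<^sub>2) z (\<lambda>z. g z (lift j \<alpha>\<^sub>1 \<alpha>\<^sub>2 z) (lift k \<beta>\<^sub>1 \<beta>\<^sub>2 z)) =
    L1.sh \<gamma>\<^sub>1 (fst z) (\<lambda>p. g\<^sub>1 p (\<alpha>\<^sub>1 p) (\<beta>\<^sub>1 p)) +
    f (fst z) * \<mu> (fst z) ^ (i + j + k + 1) * L2.sh \<gamma>\<^sub>2 (snd z) (\<lambda>q. g\<^sub>2 q (\<alpha>\<^sub>2 q) (\<beta>\<^sub>2 q))"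
proof -
  have m: "(\<lambda>p. f p * \<mu> p ^ (j + k)) \<in> smooth_functions A" by (rule M1.smooth_mult[OF f \<mu>_power])
  have mz: "L1.sh \<gamma>\<^sub>1 p (\<lambda>p. f p * \<mu> p ^ (j + k)) = 0" for p
    by (simp add: M1.tangent_mult[OF L1.anchor_tangent[OF c(1)] f \<mu>_power] f_casimir c
        \<mu>_power_const[OF L1.anchor_tangent[OF c(1)]])
  have "(\<lambda>z. g z (lift j \<alpha>\<^sub>1 \<alpha>\<^sub>2 z) (lift k \<beta>\<^sub>1 \<beta>\<^sub>2 z)) =
      (\<lambda>z. g\<^sub>1 (fst z) (\<alpha>\<^sub>1 (fst z)) (\<beta>\<^sub>1 (fst z)) + f (fst z) * \<mu> (fst z) ^ (j + k) * g\<^sub>2 (snd z) (\<alpha>\<^sub>2 (snd z)) (\<beta>\<^sub>2 (snd z)))"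
    by (simp add: warped_lift[OF a b L2.g_tensor])
  then show ?thesis
    using anchor_lift_mixed[OF c L1.g_smooth[OF a(1) b(1)] L2.g_smooth[OF a(2) b(2)] m mz, of i z]
    by (simp add: power_add mult_ac)
qed

text \<open>All six terms have the common vertical factor f times \<mu> to the power i + j + k + 1,
  whether they come from an anchored derivative of the metric or from a bracket paired with a
  form.\<close>

lemma koszul_formula_lift:
  assumes a: "\<alpha>\<^sub>1 \<in> one_forms A" "\<alpha>\<^sub>2 \<in> one_forms B" and b: "\<beta>\<^sub>1 \<in> one_forms A" "\<beta>\<^sub>2 \<in> one_forms B"
    and c: "\<gamma>\<^sub>1 \<in> one_forms A" "\<gamma>\<^sub>2 \<in> one_forms B"
  shows "N.koszul_formula (lift i \<alpha>\<^sub>1 \<alpha>\<^sub>2) (lift j \<beta>\<^sub>1 \<beta>\<^sub>2) (lift k \<gamma>\<^sub>1 \<gamma>\<^sub>2) z =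
    L1.koszul_formula \<alpha>\<^sub>1 \<beta>\<^sub>1 \<gamma>\<^sub>1 (fst z) + f (fst z) * \<mu> (fst z) ^ (i + j + k + 1) * L2.koszul_formula \<alpha>\<^sub>2 \<beta>\<^sub>2 \<gamma>\<^sub>2 (snd z)"
  unfolding N.koszul_formula_def L1.koszul_formula_def L2.koszul_formula_def
    anchor_g_lift[OF b c a] anchor_g_lift[OF a c b] anchor_g_lift[OF a b c]
    koszul_lift[OF a b] koszul_lift[OF c a] koszul_lift[OF c b]
    warped_lift[OF L1.koszul_form[OF a(1) b(1)] L2.koszul_form[OF a(2) b(2)] c L2.g_tensor]
    warped_lift[OF L1.koszul_form[OF c(1) a(1)] L2.koszul_form[OF c(2) a(2)] b L2.g_tensor]
    warped_lift[OF L1.koszul_form[OF c(1) b(1)] L2.koszul_form[OF c(2) b(2)] a L2.g_tensor]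
  by (simp add: power_add algebra_simps)

lemma cotangent_lift_pair:
  assumes \<xi>: "\<xi> \<in> cotangent_space C z"
  obtains \<alpha> \<beta> where "\<alpha> \<in> one_forms A" "\<beta> \<in> one_forms B" "lift 0 \<alpha> \<beta> z = \<xi>"
proof -
  obtain \<alpha> \<beta> where F: "\<alpha> \<in> one_forms A" "\<beta> \<in> one_forms B" "(hlift A B \<alpha> + vlift A B \<beta>) z = \<xi>"
    by (rule cotangent_lift[OF \<xi>])
  have "lift 0 \<alpha> \<beta> = hlift A B \<alpha> + vlift A B \<beta>" by (simp add: lift_def M.smult_const_1)
  with F show ?thesis using that by simp
qed

end

section \<open>The Levi-Civita connection and the curvature of the warped product\<close>

locale warped_levi_civita = warped_product A B P\<^sub>1 g\<^sub>1 D\<^sub>1 P\<^sub>2 g\<^sub>2 D\<^sub>2 f \<mu> +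
  L: levi_civita_manifold "prod_atlas A B" "warped A B \<mu> P\<^sub>1 P\<^sub>2" "warped A B f g\<^sub>1 g\<^sub>2" D
  for A :: "('a::{t2_space,second_countable_topology}, 'e::euclidean_space) chart set"
    and B :: "('b::{t2_space,second_countable_topology}, 'f::euclidean_space) chart set"
    and P\<^sub>1 g\<^sub>1 D\<^sub>1 P\<^sub>2 g\<^sub>2 D\<^sub>2 f \<mu> D
begin

text \<open>By nondegeneracy both sides are compared under the metric at a single point, where any
  test form may be replaced by a lift of weight 0. The Koszul formula on the left and the metric on
  the right then carry the same vertical factor f times \<mu> to the power j + k + 1.\<close>

lemma D_lift:
  assumes a: "\<alpha>\<^sub>1 \<in> one_forms A" "\<alpha>\<^sub>2 \<in> one_forms B" and b: "\<beta>\<^sub>1 \<in> one_forms A" "\<beta>\<^sub>2 \<in> one_forms B"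
  shows "D (lift j \<alpha>\<^sub>1 \<alpha>\<^sub>2) (lift k \<beta>\<^sub>1 \<beta>\<^sub>2) = lift (j + k + 1) (D\<^sub>1 \<alpha>\<^sub>1 \<beta>\<^sub>1) (D\<^sub>2 \<alpha>\<^sub>2 \<beta>\<^sub>2)"
proof (rule N.form_nondegenerate)
  note F = lift_form[OF a] lift_form[OF b] and K = L1.D_form[OF a(1) b(1)] L2.D_form[OF a(2) b(2)]
  show "D (lift j \<alpha>\<^sub>1 \<alpha>\<^sub>2) (lift k \<beta>\<^sub>1 \<beta>\<^sub>2) \<in> one_forms C" by (rule L.D_form[OF F])
  show "lift (j + k + 1) (D\<^sub>1 \<alpha>\<^sub>1 \<beta>\<^sub>1) (D\<^sub>2 \<alpha>\<^sub>2 \<beta>\<^sub>2) \<in> one_forms C" by (rule lift_form[OF K])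
  fix \<gamma> z assume \<gamma>: "\<gamma> \<in> one_forms C"
  obtain \<gamma>\<^sub>1 \<gamma>\<^sub>2 where c: "\<gamma>\<^sub>1 \<in> one_forms A" "\<gamma>\<^sub>2 \<in> one_forms B" "lift 0 \<gamma>\<^sub>1 \<gamma>\<^sub>2 z = \<gamma> z"
    by (rule cotangent_lift_pair[OF M.one_formD(1)[OF \<gamma>]])
  have "2 * g z (D (lift j \<alpha>\<^sub>1 \<alpha>\<^sub>2) (lift k \<beta>\<^sub>1 \<beta>\<^sub>2) z) (lift 0 \<gamma>\<^sub>1 \<gamma>\<^sub>2 z) =
      2 * g z (lift (j + k + 1) (D\<^sub>1 \<alpha>\<^sub>1 \<beta>\<^sub>1) (D\<^sub>2 \<alpha>\<^sub>2 \<beta>\<^sub>2) z) (lift 0 \<gamma>\<^sub>1 \<gamma>\<^sub>2 z)"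
    unfolding N.levi_civita_koszul[OF L.levi_civita F lift_form[OF c(1,2)]] koszul_formula_lift[OF a b c(1,2)]
      L1.levi_civita_koszul[OF L1.levi_civita a(1) b(1) c(1), symmetric]
      L2.levi_civita_koszul[OF L2.levi_civita a(2) b(2) c(2), symmetric]
      warped_lift[OF K c(1,2) L2.g_tensor]
    by (simp add: algebra_simps)
  then show "g z (D (lift j \<alpha>\<^sub>1 \<alpha>\<^sub>2) (lift k \<beta>\<^sub>1 \<beta>\<^sub>2) z) (\<gamma> z) =
      g z (lift (j + k + 1) (D\<^sub>1 \<alpha>\<^sub>1 \<beta>\<^sub>1) (D\<^sub>2 \<alpha>\<^sub>2 \<beta>\<^sub>2) z) (\<gamma> z)"
    by (simp add: c(3))
qed

lemma lift_diff:
  assumes "\<alpha>\<^sub>1 \<in> one_forms A" "\<alpha>\<^sub>2 \<in> one_forms B" "\<beta>\<^sub>1 \<in> one_forms A" "\<beta>\<^sub>2 \<in> one_forms B"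
  shows "lift k \<alpha>\<^sub>1 \<alpha>\<^sub>2 - lift k \<beta>\<^sub>1 \<beta>\<^sub>2 = lift k (\<alpha>\<^sub>1 - \<beta>\<^sub>1) (\<alpha>\<^sub>2 - \<beta>\<^sub>2)"
proof (intro ext)
  fix z u
  show "(lift k \<alpha>\<^sub>1 \<alpha>\<^sub>2 - lift k \<beta>\<^sub>1 \<beta>\<^sub>2) z u = lift k (\<alpha>\<^sub>1 - \<beta>\<^sub>1) (\<alpha>\<^sub>2 - \<beta>\<^sub>2) z u"
    by (simp add: lift_combine hlift_def vlift_def pullback_def cotangent_map_def algebra_simps)
qed

lemma R_lift:
  assumes a: "\<alpha>\<^sub>1 \<in> one_forms A" "\<alpha>\<^sub>2 \<in> one_forms B" and b: "\<beta>\<^sub>1 \<in> one_forms A" "\<beta>\<^sub>2 \<in> one_forms B"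
    and c: "\<gamma>\<^sub>1 \<in> one_forms A" "\<gamma>\<^sub>2 \<in> one_forms B"
  shows "L.R (lift i \<alpha>\<^sub>1 \<alpha>\<^sub>2) (lift j \<beta>\<^sub>1 \<beta>\<^sub>2) (lift k \<gamma>\<^sub>1 \<gamma>\<^sub>2) = lift (i + j + k + 2) (L1.R \<alpha>\<^sub>1 \<beta>\<^sub>1 \<gamma>\<^sub>1) (L2.R \<alpha>\<^sub>2 \<beta>\<^sub>2 \<gamma>\<^sub>2)"
  unfolding curvature_def
  by (simp add: D_lift koszul_lift lift_diff L1.D_form L2.D_form L1.koszul_form L2.koszul_form
      M1.form_diff M2.form_diff a b c add_ac)

text \<open>Every application of D adds one power of \<mu>: two come from the curvature and one from
  the outer derivative, in each of the four terms alike.\<close>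

lemma DR_lift:
  assumes a: "\<alpha>\<^sub>1 \<in> one_forms A" "\<alpha>\<^sub>2 \<in> one_forms B" and b: "\<beta>\<^sub>1 \<in> one_forms A" "\<beta>\<^sub>2 \<in> one_forms B"
    and c: "\<gamma>\<^sub>1 \<in> one_forms A" "\<gamma>\<^sub>2 \<in> one_forms B" and d: "\<delta>\<^sub>1 \<in> one_forms A" "\<delta>\<^sub>2 \<in> one_forms B"
  shows "L.DR (lift 0 \<alpha>\<^sub>1 \<alpha>\<^sub>2) (lift 0 \<beta>\<^sub>1 \<beta>\<^sub>2) (lift 0 \<gamma>\<^sub>1 \<gamma>\<^sub>2) (lift 0 \<delta>\<^sub>1 \<delta>\<^sub>2) =
    lift 3 (L1.DR \<alpha>\<^sub>1 \<beta>\<^sub>1 \<gamma>\<^sub>1 \<delta>\<^sub>1) (L2.DR \<alpha>\<^sub>2 \<beta>\<^sub>2 \<gamma>\<^sub>2 \<delta>\<^sub>2)"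
  unfolding L.DR_def L1.DR_def L2.DR_def
  by (simp add: D_lift R_lift lift_diff L1.D_form L2.D_form L1.R_form L2.R_form
      M1.form_diff M2.form_diff a b c d eval_nat_numeral)

text \<open>As the defect is tensorial in the two forms, these may be taken to be lifts at the given
  point. The equality of [\<sharp>\<beta>, \<sharp>\<gamma>] and \<sharp>[\<beta>, \<gamma>] is then
  an equality of tangent vectors, so it can be tested on lifted functions instead of h.\<close>

lemma jacobi_defect_lift:
  assumes J1: "\<And>\<beta> \<gamma> f. \<beta> \<in> one_forms A \<Longrightarrow> \<gamma> \<in> one_forms A \<Longrightarrow> f \<in> smooth_functions A \<Longrightarrow> L1.jacobi_defect \<beta> \<gamma> f = (\<lambda>p. 0)"
    and J2: "\<And>\<beta> \<gamma> f. \<beta> \<in> one_forms B \<Longrightarrow> \<gamma> \<in> one_forms B \<Longrightarrow> f \<in> smooth_functions B \<Longrightarrow> L2.jacobi_defect \<beta> \<gamma> f = (\<lambda>p. 0)"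
    and \<beta>: "\<beta> \<in> one_forms C" and \<gamma>: "\<gamma> \<in> one_forms C" and h: "h \<in> smooth_functions C"
  shows "L.jacobi_defect \<beta> \<gamma> h = (\<lambda>z. 0)"
proof
  fix z
  have lifts: "L.jacobi_defect (lift 0 \<beta>\<^sub>1 \<beta>\<^sub>2) (lift 0 \<gamma>\<^sub>1 \<gamma>\<^sub>2) h z = 0"
    if b: "\<beta>\<^sub>1 \<in> one_forms A" "\<beta>\<^sub>2 \<in> one_forms B" and c: "\<gamma>\<^sub>1 \<in> one_forms A" "\<gamma>\<^sub>2 \<in> one_forms B" for \<beta>\<^sub>1 \<beta>\<^sub>2 \<gamma>\<^sub>1 \<gamma>\<^sub>2
  proof -
    note F = lift_form[OF b, of 0] lift_form[OF c, of 0] and K = L1.koszul_form[OF b(1) c(1)] L2.koszul_form[OF b(2) c(2)]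
    have "lie_bracket (N.sh (lift 0 \<beta>\<^sub>1 \<beta>\<^sub>2)) (N.sh (lift 0 \<gamma>\<^sub>1 \<gamma>\<^sub>2)) z = N.sh (N.kos (lift 0 \<beta>\<^sub>1 \<beta>\<^sub>2) (lift 0 \<gamma>\<^sub>1 \<gamma>\<^sub>2)) z"
    proof (rule product_tangent_eqI[OF M.vector_fieldD(1)[OF M.lie_bracket_vf[OF N.anchor_vf[OF F(1)] N.anchor_vf[OF F(2)]]]
          N.anchor_tangent[OF N.koszul_form[OF F]]])
      fix l assume l: "l \<in> smooth_functions A"
      show "lie_bracket (N.sh (lift 0 \<beta>\<^sub>1 \<beta>\<^sub>2)) (N.sh (lift 0 \<gamma>\<^sub>1 \<gamma>\<^sub>2)) z (\<lambda>z. l (fst z)) =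
          N.sh (N.kos (lift 0 \<beta>\<^sub>1 \<beta>\<^sub>2) (lift 0 \<gamma>\<^sub>1 \<gamma>\<^sub>2)) z (\<lambda>z. l (fst z))"
        unfolding lie_bracket_def koszul_lift[OF b c] anchor_lift(1)[OF b l] anchor_lift(1)[OF c l] anchor_lift(1)[OF K l]
          anchor_lift(1)[OF b L1.anchor_smooth[OF c(1) l]] anchor_lift(1)[OF c L1.anchor_smooth[OF b(1) l]]
        using fun_cong[OF J1[OF b(1) c(1) l], of "fst z"] by (simp add: L1.jacobi_defect_def)
    next
      fix l assume l: "l \<in> smooth_functions B"
      note b' = L2.anchor_smooth[OF b(2) l] and c' = L2.anchor_smooth[OF c(2) l]
      \<comment> \<open>The factor \<mu> squared appears on both sides: one \<mu> from each of two
        anchors on the left, and on the right one from the weight of the Koszul bracket and one from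
        its anchor.\<close>
      have "\<mu> (fst z) * \<mu> (fst z) * (L2.sh \<beta>\<^sub>2 (snd z) (\<lambda>q. L2.sh \<gamma>\<^sub>2 q l) - L2.sh \<gamma>\<^sub>2 (snd z) (\<lambda>q. L2.sh \<beta>\<^sub>2 q l)) =
          \<mu> (fst z) * \<mu> (fst z) * L2.sh (L2.kos \<beta>\<^sub>2 \<gamma>\<^sub>2) (snd z) l"
        using fun_cong[OF J2[OF b(2) c(2) l], of "snd z"] by (simp add: L2.jacobi_defect_def)
      then show "lie_bracket (N.sh (lift 0 \<beta>\<^sub>1 \<beta>\<^sub>2)) (N.sh (lift 0 \<gamma>\<^sub>1 \<gamma>\<^sub>2)) z (\<lambda>z. l (snd z)) =
          N.sh (N.kos (lift 0 \<beta>\<^sub>1 \<beta>\<^sub>2) (lift 0 \<gamma>\<^sub>1 \<gamma>\<^sub>2)) z (\<lambda>z. l (snd z))"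
        unfolding lie_bracket_def koszul_lift[OF b c] anchor_lift(2)[OF b l] anchor_lift(2)[OF c l] anchor_lift(2)[OF K l]
          tangent_\<mu>_power[OF N.anchor_tangent[OF F(1)] smooth_snd[OF c']]
          tangent_\<mu>_power[OF N.anchor_tangent[OF F(2)] smooth_snd[OF b']]
          anchor_lift(2)[OF b c'] anchor_lift(2)[OF c b']
        by (simp add: algebra_simps)
    qed
    from fun_cong[OF this, of h] show ?thesis
      by (simp add: L.jacobi_defect_def lie_bracket_def)
  qed
  obtain \<beta>\<^sub>1 \<beta>\<^sub>2 where b: "\<beta>\<^sub>1 \<in> one_forms A" "\<beta>\<^sub>2 \<in> one_forms B" "lift 0 \<beta>\<^sub>1 \<beta>\<^sub>2 z = \<beta> z"
    by (rule cotangent_lift_pair[OF M.one_formD(1)[OF \<beta>]])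
  obtain \<gamma>\<^sub>1 \<gamma>\<^sub>2 where c: "\<gamma>\<^sub>1 \<in> one_forms A" "\<gamma>\<^sub>2 \<in> one_forms B" "lift 0 \<gamma>\<^sub>1 \<gamma>\<^sub>2 z = \<gamma> z"
    by (rule cotangent_lift_pair[OF M.one_formD(1)[OF \<gamma>]])
  show "L.jacobi_defect \<beta> \<gamma> h z = 0"
    using L.jacobi_defect_cong[OF \<beta> lift_form[OF b(1,2)] \<gamma> lift_form[OF c(1,2)] h b(3)[symmetric] c(3)[symmetric]]
      lifts[OF b(1,2) c(1,2)] by simp
qed

lemma DR_zero_iff:
  assumes "\<exists>p. \<mu> p \<noteq> 0"
  shows "(\<forall>\<alpha>\<in>one_forms C. \<forall>\<beta>\<in>one_forms C. \<forall>\<gamma>\<in>one_forms C. \<forall>\<delta>\<in>one_forms C. L.DR \<alpha> \<beta> \<gamma> \<delta> = 0) \<longleftrightarrow>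
    (\<forall>\<alpha>\<in>one_forms A. \<forall>\<beta>\<in>one_forms A. \<forall>\<gamma>\<in>one_forms A. \<forall>\<delta>\<in>one_forms A. L1.DR \<alpha> \<beta> \<gamma> \<delta> = 0) \<and>
    (\<forall>\<alpha>\<in>one_forms B. \<forall>\<beta>\<in>one_forms B. \<forall>\<gamma>\<in>one_forms B. \<forall>\<delta>\<in>one_forms B. L2.DR \<alpha> \<beta> \<gamma> \<delta> = 0)"
    (is "?C \<longleftrightarrow> ?A \<and> ?B")
proof (intro iffI conjI ballI)
  assume C: ?C
  {
    fix \<alpha> \<beta> \<gamma> \<delta> assume F: "\<alpha> \<in> one_forms A" "\<beta> \<in> one_forms A" "\<gamma> \<in> one_forms A" "\<delta> \<in> one_forms A"
    note Z = M2.form_zero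
    \<comment> \<open>Zero forms of the second factor complete the arguments to lifts; evaluation on
      horizontal fields then extracts the first component.\<close>
    have 0: "lift 3 (L1.DR \<alpha> \<beta> \<gamma> \<delta>) (L2.DR 0 0 0 0) = 0"
      unfolding DR_lift[OF F(1) Z F(2) Z F(3) Z F(4) Z, symmetric] using C lift_form[OF _ Z] F by blast
    show "L1.DR \<alpha> \<beta> \<gamma> \<delta> = 0"
    proof (rule M1.form_eqI[OF L1.DR_form[OF F] M1.form_zero])
      fix p X assume X: "X \<in> vector_fields A"
      show "L1.DR \<alpha> \<beta> \<gamma> \<delta> p (X p) = 0 p (X p)"
        \<comment> \<open>The horizontal component does not vary with the second coordinate, so
          \<open>undefined\<close> serves as some point of the second factor.\<close>
        using lift_hvf[OF L1.DR_form[OF F] L2.DR_form[OF Z Z Z Z] X, of 3 "(p, undefined)"] unfolding 0 by simp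
    qed
  next
    fix \<alpha> \<beta> \<gamma> \<delta> assume F: "\<alpha> \<in> one_forms B" "\<beta> \<in> one_forms B" "\<gamma> \<in> one_forms B" "\<delta> \<in> one_forms B"
    note Z = M1.form_zero
    obtain p where p: "\<mu> p \<noteq> 0" using assms by blast
    have 0: "lift 3 (L1.DR 0 0 0 0) (L2.DR \<alpha> \<beta> \<gamma> \<delta>) = 0"
      unfolding DR_lift[OF Z F(1) Z F(2) Z F(3) Z F(4), symmetric] using C lift_form[OF Z] F by blast
    show "L2.DR \<alpha> \<beta> \<gamma> \<delta> = 0"
    proof (rule M2.form_eqI[OF L2.DR_form[OF F] M2.form_zero])
      fix q Y assume Y: "Y \<in> vector_fields B"
      show "L2.DR \<alpha> \<beta> \<gamma> \<delta> q (Y q) = 0 q (Y q)"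
        \<comment> \<open>On vertical fields the lift gives the cube of \<mu>(p) times the wanted
          value; p was chosen so that this factor can be cancelled.\<close>
        using lift_vvf[OF L1.DR_form[OF Z Z Z Z] L2.DR_form[OF F] Y, of 3 "(p, q)"] p unfolding 0 by simp
    qed
  }
next
  assume AB: "?A \<and> ?B"
  have J1: "L1.jacobi_defect \<beta> \<gamma> h = (\<lambda>p. 0)" if "\<beta> \<in> one_forms A" "\<gamma> \<in> one_forms A" "h \<in> smooth_functions A" for \<beta> \<gamma> h
    using that AB by (intro L1.locally_symmetric_jacobi) auto
  have J2: "L2.jacobi_defect \<beta> \<gamma> h = (\<lambda>p. 0)" if "\<beta> \<in> one_forms B" "\<gamma> \<in> one_forms B" "h \<in> smooth_functions B" for \<beta> \<gamma> h
    using that AB by (intro L2.locally_symmetric_jacobi) auto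
  have J: "L.jacobi_defect \<beta> \<gamma> h = (\<lambda>z. 0)" if "\<beta> \<in> one_forms C" "\<gamma> \<in> one_forms C" "h \<in> smooth_functions C" for \<beta> \<gamma> h
    by (rule jacobi_defect_lift[OF J1 J2 that])
  fix \<alpha> \<beta> \<gamma> \<delta> assume F: "\<alpha> \<in> one_forms C" "\<beta> \<in> one_forms C" "\<gamma> \<in> one_forms C" "\<delta> \<in> one_forms C"
  show "L.DR \<alpha> \<beta> \<gamma> \<delta> = 0"
  proof (intro ext)
    fix z u
    obtain \<alpha>\<^sub>1 \<alpha>\<^sub>2 where a: "\<alpha>\<^sub>1 \<in> one_forms A" "\<alpha>\<^sub>2 \<in> one_forms B" "lift 0 \<alpha>\<^sub>1 \<alpha>\<^sub>2 z = \<alpha> z"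
      by (rule cotangent_lift_pair[OF M.one_formD(1)[OF F(1)]])
    obtain \<beta>\<^sub>1 \<beta>\<^sub>2 where b: "\<beta>\<^sub>1 \<in> one_forms A" "\<beta>\<^sub>2 \<in> one_forms B" "lift 0 \<beta>\<^sub>1 \<beta>\<^sub>2 z = \<beta> z"
      by (rule cotangent_lift_pair[OF M.one_formD(1)[OF F(2)]])
    obtain \<gamma>\<^sub>1 \<gamma>\<^sub>2 where c: "\<gamma>\<^sub>1 \<in> one_forms A" "\<gamma>\<^sub>2 \<in> one_forms B" "lift 0 \<gamma>\<^sub>1 \<gamma>\<^sub>2 z = \<gamma> z"
      by (rule cotangent_lift_pair[OF M.one_formD(1)[OF F(3)]])
    obtain \<delta>\<^sub>1 \<delta>\<^sub>2 where d: "\<delta>\<^sub>1 \<in> one_forms A" "\<delta>\<^sub>2 \<in> one_forms B" "lift 0 \<delta>\<^sub>1 \<delta>\<^sub>2 z = \<delta> z"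
      by (rule cotangent_lift_pair[OF M.one_formD(1)[OF F(4)]])
    have "L.DR \<alpha> \<beta> \<gamma> \<delta> z u = L.DR (lift 0 \<alpha>\<^sub>1 \<alpha>\<^sub>2) (lift 0 \<beta>\<^sub>1 \<beta>\<^sub>2) (lift 0 \<gamma>\<^sub>1 \<gamma>\<^sub>2) (lift 0 \<delta>\<^sub>1 \<delta>\<^sub>2) z u"
      by (rule L.DR_cong[OF J F]) (simp_all add: a b c d lift_form)
    also have "\<dots> = lift 3 0 0 z u"
      using AB by (simp add: DR_lift a b c d)
    also have "\<dots> = 0"
      by (simp add: lift_combine hlift_def vlift_def pullback_def cotangent_map_def)
    finally show "L.DR \<alpha> \<beta> \<gamma> \<delta> z u = 0 z u" by simp
  qed
qed

end

text \<open>The preimage of a coordinate ball is a connected neighbourhood of p, being a continuous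
  image of a convex set. There \<mu> is constant, and a tangent vector sees only the germ of a
  function.\<close>

lemma (in manifold) essentially_constant_tangent:
  assumes \<mu>: "\<mu> \<in> smooth_functions A" "essentially_constant \<mu>" and v: "v \<in> tangent_space A p"
  shows "v \<mu> = 0"
proof -
  obtain U \<phi> where U: "(U, \<phi>) \<in> A" "p \<in> U" by (rule chart_at)
  obtain r where r: "r > 0" "cball (\<phi> p) r \<subseteq> \<phi> ` U"
    by (rule chart_ball[OF U(1,2) chart(1)[OF U(1)] order_refl])
  define N where "N = {x \<in> U. \<phi> x \<in> ball (\<phi> p) r}"
  have N: "open N" "p \<in> N"
    using chart_open_preimage[OF U(1) open_ball] U(2) r(1) by (auto simp: N_def)
  have b: "ball (\<phi> p) r \<subseteq> \<phi> ` U" using r(2) ball_subset_cball by blast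
  have "continuous_on (\<phi> ` U) (inv_into U \<phi>)"
    using chart(3)[OF U(1)] by (simp add: homeomorphism_def)
  then have "connected (inv_into U \<phi> ` ball (\<phi> p) r)"
    by (intro connected_continuous_image[OF continuous_on_subset[OF _ b]] convex_connected convex_ball)
  moreover have "inv_into U \<phi> ` ball (\<phi> p) r = N"
  proof (intro equalityI subsetI)
    fix x assume "x \<in> inv_into U \<phi> ` ball (\<phi> p) r"
    then obtain y where y: "y \<in> ball (\<phi> p) r" "x = inv_into U \<phi> y" by auto
    then obtain x' where "x' \<in> U" "y = \<phi> x'" using b by blast
    then show "x \<in> N" using y chart_inv[OF U(1)] by (simp add: N_def)
  next
    fix x assume "x \<in> N"
    then show "x \<in> inv_into U \<phi> ` ball (\<phi> p) r"
      using chart_inv[OF U(1)] by (force simp: N_def)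
  qed
  ultimately have cN: "connected N" by simp
  have "\<mu> x = \<mu> p" if "x \<in> N" for x
  proof -
    have "connected_component UNIV x p"
      unfolding connected_component_def using cN that N(2) by blast
    then show ?thesis using \<mu>(2) unfolding essentially_constant_def by blast
  qed
  then have "v \<mu> = v (\<lambda>_. \<mu> p)"
    by (rule tangent_local[OF v \<mu>(1) smooth_const N])
  then show ?thesis by (simp add: tangent_space_const[OF v])
qed

text \<open>Skew symmetry moves the differential of f into the first slot: \<sharp>\<alpha>(f) =
  P(\<alpha>, df) = - P(df, \<alpha>) = - \<alpha>(\<sharp>df), and \<sharp>df = 0.\<close>

lemma (in bivector_manifold) casimir_anchor:
  assumes f: "casimir A P f" and \<alpha>: "\<alpha> \<in> one_forms A"
  shows "sh \<alpha> p f = 0"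
proof -
  have F: "f \<in> smooth_functions A" "sh (exterior_d A f) = 0" using f by (simp_all add: casimir_def)
  note df = exterior_d_form[OF F(1)]
  have "P p (exterior_d A f p) (\<alpha> p) = 0"
    using anchor_form[OF df \<alpha>, of p] cotangent_space_zero[OF one_formD(1)[OF \<alpha>]] by (simp add: F(2))
  then show ?thesis
    using skew[OF one_formD(1)[OF df, of p] one_formD(1)[OF \<alpha>]] by (simp add: anchor_apply[OF \<alpha>])
qed

theorem theorem5p3:
  fixes A\<^sub>1 :: "('a::{t2_space,second_countable_topology}, 'e::euclidean_space) chart set"
    and A\<^sub>2 :: "('b::{t2_space,second_countable_topology}, 'f::euclidean_space) chart set"
    and G\<^sub>1 :: "'a metric" and G\<^sub>2 :: "'b metric"
    and g\<^sub>1 P\<^sub>1 :: "'a contra2" and g\<^sub>2 P\<^sub>2 :: "'b contra2"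
    and f \<mu> :: "'a \<Rightarrow> real"
  assumes "smooth_atlas A\<^sub>1" and "smooth_atlas A\<^sub>2"
    and "pseudo_riemannian_metric A\<^sub>1 G\<^sub>1" and "pseudo_riemannian_metric A\<^sub>2 G\<^sub>2"
    and "g\<^sub>1 = cometric A\<^sub>1 G\<^sub>1" and "g\<^sub>2 = cometric A\<^sub>2 G\<^sub>2"
    and "bivector_field A\<^sub>1 P\<^sub>1" and "bivector_field A\<^sub>2 P\<^sub>2"
    and "f \<in> smooth_functions A\<^sub>1" and "\<forall>x. f x > 0"
    and "\<mu> \<in> smooth_functions A\<^sub>1"
    and "casimir A\<^sub>1 P\<^sub>1 f"
    and "essentially_constant \<mu>" and "\<exists>x. \<mu> x \<noteq> 0"
  shows "locally_symmetric (prod_atlas A\<^sub>1 A\<^sub>2)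
           (warped A\<^sub>1 A\<^sub>2 f g\<^sub>1 g\<^sub>2) (warped A\<^sub>1 A\<^sub>2 \<mu> P\<^sub>1 P\<^sub>2) \<longleftrightarrow>
         locally_symmetric A\<^sub>1 g\<^sub>1 P\<^sub>1 \<and> locally_symmetric A\<^sub>2 g\<^sub>2 P\<^sub>2"
proof -
  interpret M1: manifold A\<^sub>1 by unfold_locales fact
  interpret M2: manifold A\<^sub>2 by unfold_locales fact
  interpret M1: metric_manifold A\<^sub>1 P\<^sub>1 g\<^sub>1
    by unfold_locales (fact, simp add: assms M1.cometric_tensor_cometric)
  interpret M2: metric_manifold A\<^sub>2 P\<^sub>2 g\<^sub>2
    by unfold_locales (fact, simp add: assms M2.cometric_tensor_cometric)
  have W: "warped_product A\<^sub>1 A\<^sub>2 P\<^sub>1 g\<^sub>1 D\<^sub>1 P\<^sub>2 g\<^sub>2 D\<^sub>2 f \<mu>"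
    if D: "levi_civita A\<^sub>1 g\<^sub>1 P\<^sub>1 D\<^sub>1" "levi_civita A\<^sub>2 g\<^sub>2 P\<^sub>2 D\<^sub>2" for D\<^sub>1 D\<^sub>2
    by unfold_locales (use D assms M1.casimir_anchor M1.essentially_constant_tangent in auto)
  show ?thesis
  proof (intro iffI conjI; (elim conjE)?)
    assume sym: "locally_symmetric (prod_atlas A\<^sub>1 A\<^sub>2) (warped A\<^sub>1 A\<^sub>2 f g\<^sub>1 g\<^sub>2) (warped A\<^sub>1 A\<^sub>2 \<mu> P\<^sub>1 P\<^sub>2)"
    \<comment> \<open>The hypothesis supplies a connection on the product only; those of the
      factors, demanded by the conclusion, come from the existence theorem.\<close>
    obtain D\<^sub>1 where D1: "levi_civita A\<^sub>1 g\<^sub>1 P\<^sub>1 D\<^sub>1" by (rule M1.levi_civita_exists)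
    obtain D\<^sub>2 where D2: "levi_civita A\<^sub>2 g\<^sub>2 P\<^sub>2 D\<^sub>2" by (rule M2.levi_civita_exists)
    interpret W: warped_product A\<^sub>1 A\<^sub>2 P\<^sub>1 g\<^sub>1 D\<^sub>1 P\<^sub>2 g\<^sub>2 D\<^sub>2 f \<mu> by (rule W[OF D1 D2])
    obtain D where D: "levi_civita_manifold (prod_atlas A\<^sub>1 A\<^sub>2) (warped A\<^sub>1 A\<^sub>2 \<mu> P\<^sub>1 P\<^sub>2) (warped A\<^sub>1 A\<^sub>2 f g\<^sub>1 g\<^sub>2) D"
      and DR: "\<And>\<alpha> \<beta> \<gamma> \<delta>. \<alpha> \<in> one_forms (prod_atlas A\<^sub>1 A\<^sub>2) \<Longrightarrow> \<beta> \<in> one_forms (prod_atlas A\<^sub>1 A\<^sub>2) \<Longrightarrow>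
        \<gamma> \<in> one_forms (prod_atlas A\<^sub>1 A\<^sub>2) \<Longrightarrow> \<delta> \<in> one_forms (prod_atlas A\<^sub>1 A\<^sub>2) \<Longrightarrow>
        levi_civita_manifold.DR (prod_atlas A\<^sub>1 A\<^sub>2) (warped A\<^sub>1 A\<^sub>2 \<mu> P\<^sub>1 P\<^sub>2) D \<alpha> \<beta> \<gamma> \<delta> = 0"
      by (rule W.N.locally_symmetricE[OF sym]) (rule that)
    interpret L: levi_civita_manifold "prod_atlas A\<^sub>1 A\<^sub>2" "warped A\<^sub>1 A\<^sub>2 \<mu> P\<^sub>1 P\<^sub>2" "warped A\<^sub>1 A\<^sub>2 f g\<^sub>1 g\<^sub>2" D
      by (rule D)
    interpret LC: warped_levi_civita A\<^sub>1 A\<^sub>2 P\<^sub>1 g\<^sub>1 D\<^sub>1 P\<^sub>2 g\<^sub>2 D\<^sub>2 f \<mu> D by unfold_locales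
    have "(\<forall>\<alpha>\<in>one_forms A\<^sub>1. \<forall>\<beta>\<in>one_forms A\<^sub>1. \<forall>\<gamma>\<in>one_forms A\<^sub>1. \<forall>\<delta>\<in>one_forms A\<^sub>1. W.L1.DR \<alpha> \<beta> \<gamma> \<delta> = 0) \<and>
        (\<forall>\<alpha>\<in>one_forms A\<^sub>2. \<forall>\<beta>\<in>one_forms A\<^sub>2. \<forall>\<gamma>\<in>one_forms A\<^sub>2. \<forall>\<delta>\<in>one_forms A\<^sub>2. W.L2.DR \<alpha> \<beta> \<gamma> \<delta> = 0)"
      using DR by (intro LC.DR_zero_iff[OF assms(14), THEN iffD1] ballI)
    then show "locally_symmetric A\<^sub>1 g\<^sub>1 P\<^sub>1" "locally_symmetric A\<^sub>2 g\<^sub>2 P\<^sub>2"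
      by (auto intro!: W.L1.locally_symmetricI W.L2.locally_symmetricI)
  next
    assume sym: "locally_symmetric A\<^sub>1 g\<^sub>1 P\<^sub>1" "locally_symmetric A\<^sub>2 g\<^sub>2 P\<^sub>2"
    obtain D\<^sub>1 where D1: "levi_civita_manifold A\<^sub>1 P\<^sub>1 g\<^sub>1 D\<^sub>1"
      and DR1: "\<And>\<alpha> \<beta> \<gamma> \<delta>. \<alpha> \<in> one_forms A\<^sub>1 \<Longrightarrow> \<beta> \<in> one_forms A\<^sub>1 \<Longrightarrow> \<gamma> \<in> one_forms A\<^sub>1 \<Longrightarrow> \<delta> \<in> one_forms A\<^sub>1 \<Longrightarrow>
        levi_civita_manifold.DR A\<^sub>1 P\<^sub>1 D\<^sub>1 \<alpha> \<beta> \<gamma> \<delta> = 0"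
      by (rule M1.locally_symmetricE[OF sym(1)]) (rule that)
    obtain D\<^sub>2 where D2: "levi_civita_manifold A\<^sub>2 P\<^sub>2 g\<^sub>2 D\<^sub>2"
      and DR2: "\<And>\<alpha> \<beta> \<gamma> \<delta>. \<alpha> \<in> one_forms A\<^sub>2 \<Longrightarrow> \<beta> \<in> one_forms A\<^sub>2 \<Longrightarrow> \<gamma> \<in> one_forms A\<^sub>2 \<Longrightarrow> \<delta> \<in> one_forms A\<^sub>2 \<Longrightarrow>
        levi_civita_manifold.DR A\<^sub>2 P\<^sub>2 D\<^sub>2 \<alpha> \<beta> \<gamma> \<delta> = 0"
      by (rule M2.locally_symmetricE[OF sym(2)]) (rule that)
    interpret W: warped_product A\<^sub>1 A\<^sub>2 P\<^sub>1 g\<^sub>1 D\<^sub>1 P\<^sub>2 g\<^sub>2 D\<^sub>2 f \<mu>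
      by (rule W[OF levi_civita_manifold.levi_civita[OF D1] levi_civita_manifold.levi_civita[OF D2]])
    \<comment> \<open>Here the roles are reversed: the factors bring their connections, and the
      product needs one constructed for its warped tensors.\<close>
    obtain D where D: "levi_civita (prod_atlas A\<^sub>1 A\<^sub>2) (warped A\<^sub>1 A\<^sub>2 f g\<^sub>1 g\<^sub>2) (warped A\<^sub>1 A\<^sub>2 \<mu> P\<^sub>1 P\<^sub>2) D"
      by (rule W.N.levi_civita_exists)
    interpret LC: warped_levi_civita A\<^sub>1 A\<^sub>2 P\<^sub>1 g\<^sub>1 D\<^sub>1 P\<^sub>2 g\<^sub>2 D\<^sub>2 f \<mu> D by unfold_locales (rule D)
    have "\<forall>\<alpha>\<in>one_forms (prod_atlas A\<^sub>1 A\<^sub>2). \<forall>\<beta>\<in>one_forms (prod_atlas A\<^sub>1 A\<^sub>2). \<forall>\<gamma>\<in>one_forms (prod_atlas A\<^sub>1 A\<^sub>2).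
        \<forall>\<delta>\<in>one_forms (prod_atlas A\<^sub>1 A\<^sub>2). LC.L.DR \<alpha> \<beta> \<gamma> \<delta> = 0"
      using DR1 DR2 by (intro LC.DR_zero_iff[OF assms(14), THEN iffD2] conjI ballI)
    then show "locally_symmetric (prod_atlas A\<^sub>1 A\<^sub>2) (warped A\<^sub>1 A\<^sub>2 f g\<^sub>1 g\<^sub>2) (warped A\<^sub>1 A\<^sub>2 \<mu> P\<^sub>1 P\<^sub>2)"
      by (intro LC.L.locally_symmetricI) auto
  qed
qed

end
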